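(* Let $\Lambda$ be an associative ring with identity. The following conditions are equivalent: (i) $\Lambda$ is left hereditary, left perfect and right coherent; (ii) $\Lambda$ is left hereditary and the direct product of an arbitrary family of projective modules is projective; (iii) the quotient functor $Q:\Lambda\text{-}Mod\to\underline{\Lambda\text{-}Mod}$ preserves limits; (iv) the functor $Q$ has a left adjoint; (v) the full subcategory of projective modules is epireflective in $\Lambda\text{-}Mod$ (i.e. reflective with all components of the reflection unit being epimorphisms); (vi) $\Lambda$ is left hereditary and the full subcategory of projective modules is reflective in $\Lambda\text{-}Mod$; (vii) $\Lambda$ is left hereditary and for any module $M$ there is a representation $M=K\oplus P$ with submodules $K$ and $P$ such that $P$ is projective and, if $M=K'\oplus P'$ for submodules $K'$ and $P'$ of $M$ with $P'$ projective, then $K\subseteq K'$ and there is a projective submodule $P''$ of $P$ such that $P=P'\oplus P''$ and $K'=K\oplus P''$; (viii) $\Lambda$ is left hereditary and for any module $M$ there is a representation $M=K\oplus P$ with submodules $K$ and $P$ such that $P$ is projective and, if $M=K'\oplus P'$ for submodules $K'$ and $P'$ of $M$ with $P'$ projective, then $K\subseteq K'$; (ix) $\Lambda$ is left hereditary and any module is isomorphic, in the stable category $\underline{\Lambda\text{-}Mod}$, to some stable module; (x) $\Lambda$ is left hereditary and the functors $R_{St}$ and $Q_{St}$ are equivalences of categories; (xi) $\Lambda$ is left hereditary and for any module $M$ the morphism $\underline{\varepsilon_M}:R(M)\rightarrowtail M$ of the stable category is an isomorphism; (xii) $\Lambda$ is left hereditary and for any module $M$ there exists a representation $M=N\oplus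 P$ such that $P$ is projective and $N$ is a submodule of $R(M)$; (xiii) $\Lambda$ is left hereditary and for any module $M$ there are projective modules $P$ and $P'$ and an isomorphism $\delta:R(M)\oplus P\to M\oplus P'$ such that $\varepsilon_M=\pi'\delta i$, where $i:R(M)\to R(M)\oplus P$ is the canonical embedding and $\pi':M\oplus P'\to M$ is the canonical projection.
   Context: "Module" means left $\Lambda$-module, and $\Lambda\text{-}Mod$ is the category of left $\Lambda$-modules. A module is called stable if it has no non-zero projective direct summands; $\Lambda\text{-}Mod_{St}$ denotes the full subcategory of $\Lambda\text{-}Mod$ on the stable modules. The stable category $\underline{\Lambda\text{-}Mod}$ has modules as objects; morphisms $M\to N$ are equivalence classes of $Hom(M,N)$ under the relation $f\sim g$ iff $f-g$ factors through a projective module. The class of $f$ is denoted $\underline{f}$. $Q:\Lambda\text{-}Mod\to\underline{\Lambda\text{-}Mod}$ is the quotient functor (identity on objects, $f\mapsto\underline{f}$). When $\Lambda$ is left hereditary: for a module $M$, $R(M)$ is the sum of all stable submodules of $M$ (it is itself stable), and $\varepsilon_M:R(M)\rightarrowtail M$ is the inclusion; $R:\Lambda\text{-}Mod\to\Lambda\text{-}Mod_{St}$ is the resulting functor (acting on homomorphisms by restriction). $Q_{St}:\Lambda\text{-}Mod_{St}\to\underline{\Lambda\text{-}Mod}$ is the restriction of $Q$ to stable modules. $R_{St}:\underline{\Lambda\text{-}Mod}\to\Lambda\text{-}Mod_{St}$ is the functor with $R_{St}Q=R$, i.e. $R_{St}(M)=R(M)$ and $R_{St}(\underline{f})=R(f)$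 (well defined since equivalent homomorphisms with the same domain $M$ agree on $R(M)$).
   Formalization: In (vii), "P = P' ⊕ P''" is read as P = P1 ⊕ P'' for a submodule P1 of P isomorphic to P'; literal equality fails, e.g. for upper triangular 2×2 matrices over a field. Modules, index sets and limit shapes are those small in a fixed Grothendieck universe. *)

theory Defs
  imports "HOL-Algebra.Module" "HOL-Algebra.AbelCoset" "HOL-Library.Equipollence"
begin

section \<open>Categories and functors\<close>

text \<open>Hom-sets are indexed by objects and need not be disjoint, so composition takes the three
  objects involved: \<open>Comp C a b c g f\<close> is the composite of \<open>f : a \<rightarrow> b\<close> followed by \<open>g : b \<rightarrow> c\<close>.
  Likewise the arrow part of a functor takes the source and the target of the arrow.\<close>

record ('o, 'm) category =
  Obj :: "'o set"
  Hom :: "'o \<Rightarrow> 'o \<Rightarrow> 'm set"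
  Id :: "'o \<Rightarrow> 'm"
  Comp :: "'o \<Rightarrow> 'o \<Rightarrow> 'o \<Rightarrow> 'm \<Rightarrow> 'm \<Rightarrow> 'm"

locale category =
  fixes C :: "('o, 'm) category"
  assumes Id_in_Hom: "a \<in> Obj C \<Longrightarrow> Id C a \<in> Hom C a a"
    and Comp_in_Hom:
      "\<lbrakk>a \<in> Obj C; b \<in> Obj C; c \<in> Obj C; f \<in> Hom C a b; g \<in> Hom C b c\<rbrakk>
        \<Longrightarrow> Comp C a b c g f \<in> Hom C a c"
    and Comp_Id_right:
      "\<lbrakk>a \<in> Obj C; b \<in> Obj C; f \<in> Hom C a b\<rbrakk> \<Longrightarrow> Comp C a a b f (Id C a) = f"
    and Comp_Id_left:
      "\<lbrakk>a \<in> Obj C; b \<in> Obj C; f \<in> Hom C a b\<rbrakk> \<Longrightarrow> Comp C a b b (Id C b) f = f"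
    and Comp_assoc:
      "\<lbrakk>a \<in> Obj C; b \<in> Obj C; c \<in> Obj C; d \<in> Obj C;
        f \<in> Hom C a b; g \<in> Hom C b c; h \<in> Hom C c d\<rbrakk>
        \<Longrightarrow> Comp C a c d h (Comp C a b c g f) = Comp C a b d (Comp C b c d h g) f"

definition iso_arrow :: "('o, 'm) category \<Rightarrow> 'o \<Rightarrow> 'o \<Rightarrow> 'm \<Rightarrow> bool" where
  "iso_arrow C a b f \<longleftrightarrow> f \<in> Hom C a b \<and>
     (\<exists>g \<in> Hom C b a. Comp C a b a g f = Id C a \<and> Comp C b a b f g = Id C b)"

definition isomorphic_objects :: "('o, 'm) category \<Rightarrow> 'o \<Rightarrow> 'o \<Rightarrow> bool" where
  "isomorphic_objects C a b \<longleftrightarrow> (\<exists>f. iso_arrow C a b f)"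

definition epi_arrow :: "('o, 'm) category \<Rightarrow> 'o \<Rightarrow> 'o \<Rightarrow> 'm \<Rightarrow> bool" where
  "epi_arrow C a b f \<longleftrightarrow> f \<in> Hom C a b \<and>
     (\<forall>c \<in> Obj C. \<forall>g \<in> Hom C b c. \<forall>h \<in> Hom C b c.
        Comp C a b c g f = Comp C a b c h f \<longrightarrow> g = h)"

definition full_subcategory :: "('o, 'm) category \<Rightarrow> 'o set \<Rightarrow> ('o, 'm) category" where
  "full_subcategory C S = C\<lparr>Obj := Obj C \<inter> S\<rparr>"

record ('o, 'm, 'p, 'n) functor_data =
  on_obj :: "'o \<Rightarrow> 'p"
  on_arr :: "'o \<Rightarrow> 'o \<Rightarrow> 'm \<Rightarrow> 'n"

definition is_functor ::
    "('o, 'm) category \<Rightarrow> ('p, 'n) category \<Rightarrow> ('o, 'm, 'p, 'n) functor_data \<Rightarrow> bool" where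
  "is_functor C D F \<longleftrightarrow> category C \<and> category D \<and>
     (\<forall>a \<in> Obj C. on_obj F a \<in> Obj D) \<and>
     (\<forall>a \<in> Obj C. \<forall>b \<in> Obj C. \<forall>f \<in> Hom C a b.
        on_arr F a b f \<in> Hom D (on_obj F a) (on_obj F b)) \<and>
     (\<forall>a \<in> Obj C. on_arr F a a (Id C a) = Id D (on_obj F a)) \<and>
     (\<forall>a \<in> Obj C. \<forall>b \<in> Obj C. \<forall>c \<in> Obj C. \<forall>f \<in> Hom C a b. \<forall>g \<in> Hom C b c.
        on_arr F a c (Comp C a b c g f) =
          Comp D (on_obj F a) (on_obj F b) (on_obj F c) (on_arr F b c g) (on_arr F a b f))"

definition id_functor :: "('o, 'm, 'o, 'm) functor_data" where
  "id_functor = \<lparr>on_obj = (\<lambda>a. a), on_arr = (\<lambda>a b f. f)\<rparr>"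

definition comp_functor ::
    "('p, 'n, 'q, 'k) functor_data \<Rightarrow> ('o, 'm, 'p, 'n) functor_data
      \<Rightarrow> ('o, 'm, 'q, 'k) functor_data" where
  "comp_functor G F =
     \<lparr>on_obj = (\<lambda>a. on_obj G (on_obj F a)),
      on_arr = (\<lambda>a b f. on_arr G (on_obj F a) (on_obj F b) (on_arr F a b f))\<rparr>"

definition natural_transformation ::
    "('o, 'm) category \<Rightarrow> ('p, 'n) category \<Rightarrow> ('o, 'm, 'p, 'n) functor_data
      \<Rightarrow> ('o, 'm, 'p, 'n) functor_data \<Rightarrow> ('o \<Rightarrow> 'n) \<Rightarrow> bool" where
  "natural_transformation C D F G \<tau> \<longleftrightarrow> is_functor C D F \<and> is_functor C D G \<and>
     (\<forall>a \<in> Obj C. \<tau> a \<in> Hom D (on_obj F a) (on_obj G a)) \<and>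
     (\<forall>a \<in> Obj C. \<forall>b \<in> Obj C. \<forall>f \<in> Hom C a b.
        Comp D (on_obj F a) (on_obj F b) (on_obj G b) (\<tau> b) (on_arr F a b f) =
        Comp D (on_obj F a) (on_obj G a) (on_obj G b) (on_arr G a b f) (\<tau> a))"

definition natural_isomorphism ::
    "('o, 'm) category \<Rightarrow> ('p, 'n) category \<Rightarrow> ('o, 'm, 'p, 'n) functor_data
      \<Rightarrow> ('o, 'm, 'p, 'n) functor_data \<Rightarrow> ('o \<Rightarrow> 'n) \<Rightarrow> bool" where
  "natural_isomorphism C D F G \<tau> \<longleftrightarrow> natural_transformation C D F G \<tau> \<and>
     (\<forall>a \<in> Obj C. iso_arrow D (on_obj F a) (on_obj G a) (\<tau> a))"

definition equivalence_of_categories ::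
    "('o, 'm) category \<Rightarrow> ('p, 'n) category \<Rightarrow> ('o, 'm, 'p, 'n) functor_data \<Rightarrow> bool" where
  "equivalence_of_categories C D F \<longleftrightarrow> is_functor C D F \<and>
     (\<exists>G. is_functor D C G \<and>
        (\<exists>\<eta>. natural_isomorphism C C id_functor (comp_functor G F) \<eta>) \<and>
        (\<exists>\<epsilon>. natural_isomorphism D D (comp_functor F G) id_functor \<epsilon>))"

definition adjunction ::
    "('o, 'm) category \<Rightarrow> ('p, 'n) category \<Rightarrow> ('o, 'm, 'p, 'n) functor_data
      \<Rightarrow> ('p, 'n, 'o, 'm) functor_data \<Rightarrow> ('o \<Rightarrow> 'm) \<Rightarrow> ('p \<Rightarrow> 'n) \<Rightarrow> bool" where
  \<comment> \<open>\<open>F : C \<rightarrow> D\<close> is left adjoint to \<open>G : D \<rightarrow> C\<close> with unit \<open>\<eta>\<close> and counit \<open>\<epsilon>\<close>\<close>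
  "adjunction C D F G \<eta> \<epsilon> \<longleftrightarrow> is_functor C D F \<and> is_functor D C G \<and>
     natural_transformation C C id_functor (comp_functor G F) \<eta> \<and>
     natural_transformation D D (comp_functor F G) id_functor \<epsilon> \<and>
     (\<forall>a \<in> Obj C.
        Comp D (on_obj F a) (on_obj F (on_obj G (on_obj F a))) (on_obj F a)
          (\<epsilon> (on_obj F a)) (on_arr F a (on_obj G (on_obj F a)) (\<eta> a)) = Id D (on_obj F a)) \<and>
     (\<forall>d \<in> Obj D.
        Comp C (on_obj G d) (on_obj G (on_obj F (on_obj G d))) (on_obj G d)
          (on_arr G (on_obj F (on_obj G d)) d (\<epsilon> d)) (\<eta> (on_obj G d)) = Id C (on_obj G d))"

definition has_left_adjoint ::
    "('p, 'n) category \<Rightarrow> ('o, 'm) category \<Rightarrow> ('p, 'n, 'o, 'm) functor_data \<Rightarrow> bool" where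
  "has_left_adjoint D C G \<longleftrightarrow> (\<exists>F \<eta> \<epsilon>. adjunction C D F G \<eta> \<epsilon>)"

text \<open>The inclusion functor of a full subcategory is \<^term>\<open>id_functor\<close>, considered as a functor
  from the subcategory to the ambient category.\<close>

definition reflective :: "('o, 'm) category \<Rightarrow> 'o set \<Rightarrow> bool" where
  "reflective C S \<longleftrightarrow> has_left_adjoint (full_subcategory C S) C id_functor"

definition epireflective :: "('o, 'm) category \<Rightarrow> 'o set \<Rightarrow> bool" where
  "epireflective C S \<longleftrightarrow>
     (\<exists>F \<eta> \<epsilon>. adjunction C (full_subcategory C S) F id_functor \<eta> \<epsilon> \<and>
        (\<forall>a \<in> Obj C. epi_arrow C a (on_obj F a) (\<eta> a)))"

definition is_cone ::
    "('i, 'u) category \<Rightarrow> ('o, 'm) category \<Rightarrow> ('i, 'u, 'o, 'm) functor_data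
      \<Rightarrow> 'o \<Rightarrow> ('i \<Rightarrow> 'm) \<Rightarrow> bool" where
  "is_cone J C T x p \<longleftrightarrow> x \<in> Obj C \<and>
     (\<forall>i \<in> Obj J. p i \<in> Hom C x (on_obj T i)) \<and>
     (\<forall>i \<in> Obj J. \<forall>j \<in> Obj J. \<forall>u \<in> Hom J i j.
        Comp C x (on_obj T i) (on_obj T j) (on_arr T i j u) (p i) = p j)"

definition is_limit ::
    "('i, 'u) category \<Rightarrow> ('o, 'm) category \<Rightarrow> ('i, 'u, 'o, 'm) functor_data
      \<Rightarrow> 'o \<Rightarrow> ('i \<Rightarrow> 'm) \<Rightarrow> bool" where
  "is_limit J C T x p \<longleftrightarrow> is_cone J C T x p \<and>
     (\<forall>y q. is_cone J C T y q \<longrightarrow>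
        (\<exists>!h. h \<in> Hom C y x \<and> (\<forall>i \<in> Obj J. Comp C y x (on_obj T i) (p i) h = q i)))"

definition preserves_limits_of_shape ::
    "('i, 'u) category \<Rightarrow> ('o, 'm) category \<Rightarrow> ('p, 'n) category
      \<Rightarrow> ('o, 'm, 'p, 'n) functor_data \<Rightarrow> bool" where
  "preserves_limits_of_shape J C D F \<longleftrightarrow>
     (\<forall>T x p. is_functor J C T \<and> is_limit J C T x p \<longrightarrow>
        is_limit J D (comp_functor F T) (on_obj F x)
          (\<lambda>i. on_arr F x (on_obj T i) (p i)))"


section \<open>Size\<close>

text \<open>There is no type of all sets, so sets, rings and modules live in a type \<open>'v\<close> playing the role
  of a Grothendieck universe: its cardinality is assumed strongly inaccessible, and the small sets
  are those of cardinality below that of \<open>'v\<close>.\<close>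

definition small :: "'v set \<Rightarrow> bool" where
  "small A \<longleftrightarrow> A \<prec> (UNIV :: 'v set)"

definition strongly_inaccessible :: "'v itself \<Rightarrow> bool" where
  "strongly_inaccessible (_ :: 'v itself) \<longleftrightarrow>
     (UNIV :: nat set) \<prec> (UNIV :: 'v set) \<and>
     (\<forall>A :: 'v set. small A \<longrightarrow> Pow A \<prec> (UNIV :: 'v set)) \<and>
     (\<forall>(I :: 'v set) (A :: 'v \<Rightarrow> 'v set). small I \<and> (\<forall>i \<in> I. small (A i)) \<longrightarrow> small (\<Union>i \<in> I. A i))"

definition small_category :: "('v, 'v) category \<Rightarrow> bool" where
  "small_category J \<longleftrightarrow> category J \<and> small (Obj J) \<and>
     (\<forall>i \<in> Obj J. \<forall>j \<in> Obj J. small (Hom J i j))"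


section \<open>Left modules over an associative ring with identity\<close>

text \<open>The library locale for modules asks for a commutative ring. Its record type is used here; the
  fields \<^const>\<open>monoid.mult\<close> and \<^const>\<open>monoid.one\<close>, which that type inherits from rings, carry no
  meaning for a module.\<close>

locale left_module = R?: ring R + M?: abelian_group M
  for R :: "('r, 'x) ring_scheme" (structure) and M :: "('r, 'a) module" (structure) +
  assumes smult_closed [simp, intro]:
      "\<lbrakk>r \<in> carrier R; x \<in> carrier M\<rbrakk> \<Longrightarrow> r \<odot>\<^bsub>M\<^esub> x \<in> carrier M"
    and smult_l_distr:
      "\<lbrakk>r \<in> carrier R; s \<in> carrier R; x \<in> carrier M\<rbrakk>
        \<Longrightarrow> (r \<oplus>\<^bsub>R\<^esub> s) \<odot>\<^bsub>M\<^esub> x = r \<odot>\<^bsub>M\<^esub> x \<oplus>\<^bsub>M\<^esub> s \<odot>\<^bsub>M\<^esub> x"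
    and smult_r_distr:
      "\<lbrakk>r \<in> carrier R; x \<in> carrier M; y \<in> carrier M\<rbrakk>
        \<Longrightarrow> r \<odot>\<^bsub>M\<^esub> (x \<oplus>\<^bsub>M\<^esub> y) = r \<odot>\<^bsub>M\<^esub> x \<oplus>\<^bsub>M\<^esub> r \<odot>\<^bsub>M\<^esub> y"
    and smult_assoc1:
      "\<lbrakk>r \<in> carrier R; s \<in> carrier R; x \<in> carrier M\<rbrakk>
        \<Longrightarrow> (r \<otimes>\<^bsub>R\<^esub> s) \<odot>\<^bsub>M\<^esub> x = r \<odot>\<^bsub>M\<^esub> (s \<odot>\<^bsub>M\<^esub> x)"
    and smult_one [simp]: "x \<in> carrier M \<Longrightarrow> \<one>\<^bsub>R\<^esub> \<odot>\<^bsub>M\<^esub> x = x"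

definition modules :: "('v, 'x) ring_scheme \<Rightarrow> ('v, 'v) module set" where
  "modules R = {M. left_module R M \<and> small (carrier M)}"

definition mod_hom ::
    "('r, 'x) ring_scheme \<Rightarrow> ('r, 'a) module \<Rightarrow> ('r, 'b) module \<Rightarrow> ('a \<Rightarrow> 'b) set" where
  "mod_hom R M N = {f \<in> carrier M \<rightarrow>\<^sub>E carrier N.
     (\<forall>x \<in> carrier M. \<forall>y \<in> carrier M. f (x \<oplus>\<^bsub>M\<^esub> y) = f x \<oplus>\<^bsub>N\<^esub> f y) \<and>
     (\<forall>r \<in> carrier R. \<forall>x \<in> carrier M. f (r \<odot>\<^bsub>M\<^esub> x) = r \<odot>\<^bsub>N\<^esub> f x)}"

definition mod_iso ::
    "('r, 'x) ring_scheme \<Rightarrow> ('r, 'a) module \<Rightarrow> ('r, 'b) module \<Rightarrow> ('a \<Rightarrow> 'b) set" where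
  "mod_iso R M N = {f \<in> mod_hom R M N. bij_betw f (carrier M) (carrier N)}"

definition LMod :: "('v, 'x) ring_scheme \<Rightarrow> (('v, 'v) module, 'v \<Rightarrow> 'v) category" where
  "LMod R = \<lparr>Obj = modules R, Hom = mod_hom R, Id = (\<lambda>M. \<lambda>x \<in> carrier M. x),
            Comp = (\<lambda>L M N g f. compose (carrier L) g f)\<rparr>"

text \<open>A submodule \<open>S\<close> of \<open>M\<close>, regarded as a module, is \<open>M\<lparr>carrier := S\<rparr>\<close>.\<close>

definition submodule_span ::
    "('r, 'x) ring_scheme \<Rightarrow> ('r, 'a) module \<Rightarrow> 'a set \<Rightarrow> 'a set" where
  "submodule_span R M X = \<Inter>{S. submodule S R M \<and> X \<subseteq> S}"

definition internal_direct_sum ::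
    "('r, 'x) ring_scheme \<Rightarrow> ('r, 'a) module \<Rightarrow> 'a set \<Rightarrow> 'a set \<Rightarrow> bool" where
  "internal_direct_sum R M K P \<longleftrightarrow> submodule K R M \<and> submodule P R M \<and>
     carrier M = K <+>\<^bsub>M\<^esub> P \<and> K \<inter> P = {\<zero>\<^bsub>M\<^esub>}"

definition direct_sum ::
    "('r, 'a) module \<Rightarrow> ('r, 'b) module \<Rightarrow> ('r, 'a \<times> 'b) module" where
  "direct_sum M N =
     \<lparr>carrier = carrier M \<times> carrier N, mult = undefined, one = undefined,
      zero = (\<zero>\<^bsub>M\<^esub>, \<zero>\<^bsub>N\<^esub>),
      add = (\<lambda>(x, y) (x', y'). (x \<oplus>\<^bsub>M\<^esub> x', y \<oplus>\<^bsub>N\<^esub> y')),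
      smult = (\<lambda>r (x, y). (r \<odot>\<^bsub>M\<^esub> x, r \<odot>\<^bsub>N\<^esub> y))\<rparr>"

definition direct_product ::
    "'i set \<Rightarrow> ('i \<Rightarrow> ('r, 'a) module) \<Rightarrow> ('r, 'i \<Rightarrow> 'a) module" where
  "direct_product I M =
     \<lparr>carrier = (\<Pi>\<^sub>E i \<in> I. carrier (M i)), mult = undefined, one = undefined,
      zero = (\<lambda>i \<in> I. \<zero>\<^bsub>M i\<^esub>),
      add = (\<lambda>x y. \<lambda>i \<in> I. x i \<oplus>\<^bsub>M i\<^esub> y i),
      smult = (\<lambda>r x. \<lambda>i \<in> I. r \<odot>\<^bsub>M i\<^esub> x i)\<rparr>"

definition regular_module :: "('r, 'x) ring_scheme \<Rightarrow> ('r, 'r) module" where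
  "regular_module R =
     \<lparr>carrier = carrier R, mult = mult R, one = one R, zero = zero R, add = add R,
      smult = mult R\<rparr>"

text \<open>The elements of \<open>M\<close> may have any type (the direct product of a family of modules over
  \<open>'v\<close> has elements of type \<open>'v \<Rightarrow> 'v\<close>), whereas the lifting property refers to the epimorphisms
  of \<^term>\<open>LMod R\<close>.\<close>

definition projective :: "('v, 'x) ring_scheme \<Rightarrow> ('v, 'a) module \<Rightarrow> bool" where
  "projective R M \<longleftrightarrow> left_module R M \<and>
     (\<forall>N \<in> modules R. \<forall>L \<in> modules R. \<forall>g \<in> mod_hom R N L. \<forall>f \<in> mod_hom R M L.
        g ` carrier N = carrier L \<longrightarrow> (\<exists>h \<in> mod_hom R M N. compose (carrier M) g h = f))"

definition projectives :: "('v, 'x) ring_scheme \<Rightarrow> ('v, 'v) module set" where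
  "projectives R = {P \<in> modules R. projective R P}"


section \<open>Hereditary, perfect and coherent rings\<close>

definition left_hereditary :: "('v, 'x) ring_scheme \<Rightarrow> bool" where
  \<comment> \<open>every left ideal is projective\<close>
  "left_hereditary R \<longleftrightarrow>
     (\<forall>I. submodule I R (regular_module R) \<longrightarrow> projective R ((regular_module R)\<lparr>carrier := I\<rparr>))"

definition superfluous ::
    "('r, 'x) ring_scheme \<Rightarrow> ('r, 'a) module \<Rightarrow> 'a set \<Rightarrow> bool" where
  "superfluous R M K \<longleftrightarrow> submodule K R M \<and>
     (\<forall>L. submodule L R M \<and> K <+>\<^bsub>M\<^esub> L = carrier M \<longrightarrow> L = carrier M)"

definition mod_kernel :: "('r, 'a) module \<Rightarrow> ('r, 'b) module \<Rightarrow> ('a \<Rightarrow> 'b) \<Rightarrow> 'a set" where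
  "mod_kernel M N f = {x \<in> carrier M. f x = \<zero>\<^bsub>N\<^esub>}"

definition projective_cover ::
    "('v, 'x) ring_scheme \<Rightarrow> ('v, 'v) module \<Rightarrow> ('v, 'v) module \<Rightarrow> ('v \<Rightarrow> 'v) \<Rightarrow> bool" where
  "projective_cover R M P p \<longleftrightarrow> P \<in> projectives R \<and> p \<in> mod_hom R P M \<and>
     p ` carrier P = carrier M \<and> superfluous R P (mod_kernel P M p)"

definition left_perfect :: "('v, 'x) ring_scheme \<Rightarrow> bool" where
  "left_perfect R \<longleftrightarrow> (\<forall>M \<in> modules R. \<exists>P p. projective_cover R M P p)"

definition finitely_generated :: "('r, 'x) ring_scheme \<Rightarrow> ('r, 'a) module \<Rightarrow> bool" where
  "finitely_generated R M \<longleftrightarrow>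
     (\<exists>X. finite X \<and> X \<subseteq> carrier M \<and> submodule_span R M X = carrier M)"

definition finitely_presented :: "('r, 'x) ring_scheme \<Rightarrow> ('r, 'a) module \<Rightarrow> bool" where
  "finitely_presented R M \<longleftrightarrow>
     (\<exists>n :: nat. let F = direct_product {..<n} (\<lambda>_. regular_module R) in
        \<exists>f \<in> mod_hom R F M. f ` carrier F = carrier M \<and>
          finitely_generated R (F\<lparr>carrier := mod_kernel F M f\<rparr>))"

definition left_coherent :: "('r, 'x) ring_scheme \<Rightarrow> bool" where
  \<comment> \<open>every finitely generated left ideal is finitely presented\<close>
  "left_coherent R \<longleftrightarrow>
     (\<forall>I. submodule I R (regular_module R) \<and>
          finitely_generated R ((regular_module R)\<lparr>carrier := I\<rparr>) \<longrightarrow>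
          finitely_presented R ((regular_module R)\<lparr>carrier := I\<rparr>))"

text \<open>Right modules over \<open>R\<close> are left modules over the opposite ring.\<close>

definition opposite_ring :: "('r, 'x) ring_scheme \<Rightarrow> ('r, 'x) ring_scheme" where
  "opposite_ring R = R\<lparr>mult := (\<lambda>x y. y \<otimes>\<^bsub>R\<^esub> x)\<rparr>"

definition right_coherent :: "('r, 'x) ring_scheme \<Rightarrow> bool" where
  "right_coherent R \<longleftrightarrow> left_coherent (opposite_ring R)"


section \<open>Stable modules and the stable category\<close>

definition stable :: "('v, 'x) ring_scheme \<Rightarrow> ('v, 'a) module \<Rightarrow> bool" where
  "stable R M \<longleftrightarrow>
     (\<forall>K P. internal_direct_sum R M K P \<and> projective R (M\<lparr>carrier := P\<rparr>) \<longrightarrow> P = {\<zero>\<^bsub>M\<^esub>})"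

definition stable_modules :: "('v, 'x) ring_scheme \<Rightarrow> ('v, 'v) module set" where
  "stable_modules R = {M \<in> modules R. stable R M}"

definition LMod_St :: "('v, 'x) ring_scheme \<Rightarrow> (('v, 'v) module, 'v \<Rightarrow> 'v) category" where
  "LMod_St R = full_subcategory (LMod R) (stable_modules R)"

definition factors_through_projective ::
    "('v, 'x) ring_scheme \<Rightarrow> ('v, 'v) module \<Rightarrow> ('v, 'v) module \<Rightarrow> ('v \<Rightarrow> 'v) \<Rightarrow> bool" where
  "factors_through_projective R M N h \<longleftrightarrow>
     (\<exists>P \<in> projectives R. \<exists>u \<in> mod_hom R M P. \<exists>v \<in> mod_hom R P N. h = compose (carrier M) v u)"

definition stable_rel ::
    "('v, 'x) ring_scheme \<Rightarrow> ('v, 'v) module \<Rightarrow> ('v, 'v) module \<Rightarrow> (('v \<Rightarrow> 'v) \<times> ('v \<Rightarrow> 'v)) set" where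
  "stable_rel R M N = {(f, g). f \<in> mod_hom R M N \<and> g \<in> mod_hom R M N \<and>
     factors_through_projective R M N (\<lambda>x \<in> carrier M. f x \<ominus>\<^bsub>N\<^esub> g x)}"

definition stable_class ::
    "('v, 'x) ring_scheme \<Rightarrow> ('v, 'v) module \<Rightarrow> ('v, 'v) module \<Rightarrow> ('v \<Rightarrow> 'v) \<Rightarrow> ('v \<Rightarrow> 'v) set" where
  "stable_class R M N f = stable_rel R M N `` {f}"

definition LMod_stable :: "('v, 'x) ring_scheme \<Rightarrow> (('v, 'v) module, ('v \<Rightarrow> 'v) set) category" where
  "LMod_stable R =
     \<lparr>Obj = modules R,
      Hom = (\<lambda>M N. mod_hom R M N // stable_rel R M N),
      Id = (\<lambda>M. stable_class R M M (\<lambda>x \<in> carrier M. x)),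
      Comp = (\<lambda>L M N v u. \<Union>g \<in> v. \<Union>f \<in> u. stable_class R L N (compose (carrier L) g f))\<rparr>"

definition Q_functor ::
    "('v, 'x) ring_scheme
      \<Rightarrow> (('v, 'v) module, 'v \<Rightarrow> 'v, ('v, 'v) module, ('v \<Rightarrow> 'v) set) functor_data" where
  \<comment> \<open>as a functor on \<^term>\<open>LMod_St R\<close> it is the restriction of \<open>Q\<close> to stable modules\<close>
  "Q_functor R = \<lparr>on_obj = (\<lambda>M. M), on_arr = stable_class R\<rparr>"

definition R_part :: "('v, 'x) ring_scheme \<Rightarrow> ('v, 'v) module \<Rightarrow> ('v, 'v) module" where
  \<comment> \<open>the sum of a set of submodules is the submodule generated by their union\<close>
  "R_part R M = M\<lparr>carrier :=
     submodule_span R M (\<Union>{S. submodule S R M \<and> stable R (M\<lparr>carrier := S\<rparr>)})\<rparr>"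

definition R_incl :: "('v, 'x) ring_scheme \<Rightarrow> ('v, 'v) module \<Rightarrow> 'v \<Rightarrow> 'v" where
  "R_incl R M = (\<lambda>x \<in> carrier (R_part R M). x)"

definition R_functor ::
    "('v, 'x) ring_scheme
      \<Rightarrow> (('v, 'v) module, 'v \<Rightarrow> 'v, ('v, 'v) module, 'v \<Rightarrow> 'v) functor_data" where
  "R_functor R =
     \<lparr>on_obj = R_part R, on_arr = (\<lambda>M N f. restrict f (carrier (R_part R M)))\<rparr>"

definition R_St ::
    "('v, 'x) ring_scheme
      \<Rightarrow> (('v, 'v) module, ('v \<Rightarrow> 'v) set, ('v, 'v) module, 'v \<Rightarrow> 'v) functor_data" where
  \<comment> \<open>over a left hereditary ring all members of a class have the same restriction\<close>
  "R_St R =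
     \<lparr>on_obj = R_part R, on_arr = (\<lambda>M N u. the_elem (on_arr (R_functor R) M N ` u))\<rparr>"


definition all_equivalent :: "bool list \<Rightarrow> bool" where
  "all_equivalent ps \<longleftrightarrow> (\<forall>p \<in> set ps. \<forall>q \<in> set ps. p \<longleftrightarrow> q)"

end

theory Submission
  imports Defs
begin

text \<open>Over a left hereditary ring submodules of projective modules are projective, so the image of a
  map from \<open>M\<close> to a projective module splits off, and \<open>R(M)\<close> is the common kernel of all
  homomorphisms from \<open>M\<close> to the ring. Most of the conditions amount to saying that \<open>R(M)\<close> always
  has a projective complement. If products of projective modules are projective, the image of \<open>M\<close>
  in a suitable power of the ring is such a complement. Conversely, a projective complement of
  \<open>R(M)\<close> is the reflection of \<open>M\<close> in the projective modules, and \<open>R\<close> is left adjoint to \<open>Q\<close>, which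
  therefore preserves limits. If the projections of a limit preserved by \<open>Q\<close> vanish in the stable
  category, then so does the limit, that is, it is projective; products of projective modules, and
  left ideals as equalizers, yield condition (ii) again.

  Condition (i) enters through (ii). If products are projective, then the relations
  between finitely many elements of the opposite ring are finitely generated, and Chase's argument
  gives the descending chain condition on principal right ideals. Together with heredity the chain
  condition yields a decomposition of the identity into local idempotents, and projective covers are
  then built from maximal independent sets of local elements. Conversely, over a right coherent
  ring the equational criterion for flatness holds in a product of projective modules, and it makes
  the kernel of a projective cover of the product vanish.\<close>

section \<open>Small sets\<close>

text \<open>The conditions quantify over modules with elements in \<open>'v\<close>, and
  \<open>projective\<close> tests lifting against these only, whereas powers of the ring and free
  modules consist of functions. Dual bases bridge the gap: a projective module with small carrier
  has one, and a dual basis lifts against epimorphisms between modules of any type. In the step from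
  (ii) to the chain condition the obstacle is size. The diagonal argument leaves finitely many
  coordinates uncontrolled, so the product needs so many factors that two unit vectors of one row
  agree in them; a power set, small by inaccessibility, supplies the factors. Heredity is used for
  more than submodules of projectives: for a primitive idempotent \<open>e\<close>, right
  multiplication by a nonzero element of \<open>eR\<close> is injective on \<open>Re\<close>. With
  the chain condition this makes \<open>eRe\<close> a division ring, and it makes the relation
  \<open>fJe \<noteq> 0\<close> between primitive idempotents transitive, hence a strict order on a
  finite set. That order does the work of nilpotency of the radical. The way back from preservation
  of limits needs two diagram shapes, discrete ones and the parallel pair.\<close>

locale universe =
  fixes U :: "'v itself"
  assumes inaccessible: "strongly_inaccessible TYPE('v)"
begin

lemma infinite_universe: "infinite (UNIV :: 'v set)"
  using inaccessible by (auto simp: strongly_inaccessible_def lesspoll_def infinite_le_lepoll)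

lemma finite_small: "finite A \<Longrightarrow> A \<prec> (UNIV :: 'v set)"
  using infinite_universe by (simp add: finite_lesspoll_infinite)

lemma nat_small: "(UNIV :: nat set) \<prec> (UNIV :: 'v set)"
  using inaccessible by (auto simp: strongly_inaccessible_def)

lemma subset_small: "\<lbrakk>A \<prec> (UNIV :: 'v set); B \<subseteq> A\<rbrakk> \<Longrightarrow> B \<prec> (UNIV :: 'v set)"
  by (meson lesspoll_trans1 subset_imp_lepoll)

lemma image_small: "A \<prec> (UNIV :: 'v set) \<Longrightarrow> f ` A \<prec> (UNIV :: 'v set)"
  by (meson lesspoll_trans1 image_lepoll)

lemma inj_on_small:
  assumes "inj_on f A" "f ` A \<subseteq> B" "B \<prec> (UNIV :: 'v set)"
  shows "A \<prec> (UNIV :: 'v set)"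
  using assms by (meson lesspoll_trans1 lepoll_def)

text \<open>Inaccessibility is stated for sets with elements in \<open>'v\<close>. Sets of functions
  and pairs must count as small too, hence the formulation with \<open>\<prec>\<close>; the
  embedding is the way back into \<open>'v\<close>.\<close>

lemma small_embedding:
  assumes "A \<prec> (UNIV :: 'v set)"
  obtains e :: "'a \<Rightarrow> 'v" where "inj_on e A" "small (e ` A)"
proof -
  obtain e :: "'a \<Rightarrow> 'v" where e: "inj_on e A"
    using assms by (auto simp: lesspoll_def lepoll_def)
  moreover have "small (e ` A)"
    unfolding small_def using image_small[OF assms] .
  ultimately show ?thesis using that by blast
qed

text \<open>An infinite cardinal equals its square. The pairing tags elements with their index and
  so makes the members of a family disjoint inside \<open>'v\<close>.\<close>

lemma pairing: obtains pr :: "'v \<times> 'v \<Rightarrow> 'v" where "inj pr"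
proof -
  have "(UNIV :: ('v \<times> 'v) set) \<approx> (UNIV :: 'v set)"
    using card_of_Times_same_infinite[OF infinite_universe]
    by (simp add: eqpoll_iff_card_of_ordIso)
  then show ?thesis using that by (auto simp: eqpoll_def bij_betw_def)
qed

text \<open>Smallness of unions is given for families of subsets of \<open>'v\<close> indexed by
  elements of \<open>'v\<close>. Index set and fibres are therefore copied into \<open>'v\<close>,
  the fibres tagged with their index, and the sum embeds into the resulting union.\<close>

lemma Sigma_small:
  assumes "I \<prec> (UNIV :: 'v set)" "\<And>i. i \<in> I \<Longrightarrow> A i \<prec> (UNIV :: 'v set)"
  shows "Sigma I A \<prec> (UNIV :: 'v set)"
proof -
  obtain pr :: "'v \<times> 'v \<Rightarrow> 'v" where pr: "inj pr" by (rule pairing)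
  obtain e :: "'a \<Rightarrow> 'v" where e: "inj_on e I" "small (e ` I)"
    by (rule small_embedding[OF assms(1)])
  have "\<exists>d :: 'b \<Rightarrow> 'v. inj_on d (A i) \<and> small (d ` A i)" if "i \<in> I" for i
    using small_embedding[OF assms(2)[OF that]] by metis
  then obtain d :: "'a \<Rightarrow> 'b \<Rightarrow> 'v"
    where d: "\<And>i. i \<in> I \<Longrightarrow> inj_on (d i) (A i)" "\<And>i. i \<in> I \<Longrightarrow> small (d i ` A i)" by metis
  define B where "B v = (let i = inv_into I e v in (\<lambda>x. pr (v, x)) ` d i ` A i)" for v
  have "small (\<Union>v \<in> e ` I. B v)"
  proof -
    have "small (B v)" if "v \<in> e ` I" for v
      unfolding B_def Let_def small_def
      by (rule image_small) (use that d(2) e(1) in \<open>auto simp: small_def\<close>)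
    then show ?thesis
      using inaccessible e(2) unfolding strongly_inaccessible_def by blast
  qed
  moreover have "inj_on (\<lambda>(i, a). pr (e i, d i a)) (Sigma I A)"
  proof (rule inj_onI, clarify)
    fix i a j b assume *: "i \<in> I" "a \<in> A i" "j \<in> I" "b \<in> A j" "pr (e i, d i a) = pr (e j, d j b)"
    then have "e i = e j" "d i a = d j b" using injD[OF pr *(5)] by auto
    then show "i = j \<and> a = b" using * e(1) d(1) by (metis inj_onD)
  qed
  moreover have "(\<lambda>(i, a). pr (e i, d i a)) ` Sigma I A \<subseteq> (\<Union>v \<in> e ` I. B v)"
    using e(1) by (auto simp: B_def Let_def)
  ultimately show ?thesis
    unfolding small_def by (meson inj_on_small)
qed

lemma UN_small:
  assumes "I \<prec> (UNIV :: 'v set)" "\<And>i. i \<in> I \<Longrightarrow> A i \<prec> (UNIV :: 'v set)"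
  shows "(\<Union>i \<in> I. A i) \<prec> (UNIV :: 'v set)"
proof -
  have "(\<Union>i \<in> I. A i) = snd ` Sigma I A" by force
  then show ?thesis by (simp only:) (rule image_small[OF Sigma_small[OF assms]])
qed

lemma Pow_small:
  assumes "A \<prec> (UNIV :: 'v set)"
  shows "Pow A \<prec> (UNIV :: 'v set)"
proof -
  obtain e :: "'a \<Rightarrow> 'v" where e: "inj_on e A" "small (e ` A)"
    by (rule small_embedding[OF assms])
  have "Pow (e ` A) \<prec> (UNIV :: 'v set)"
    using inaccessible e(2) by (auto simp: strongly_inaccessible_def)
  moreover have "inj_on ((`) e) (Pow A)"
    using e(1) by (rule inj_on_image_Pow)
  moreover have "(`) e ` Pow A \<subseteq> Pow (e ` A)" by auto
  ultimately show ?thesis by (meson inj_on_small)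
qed

text \<open>A function is determined by its graph, so the product injects into the power set of
  \<open>Sigma I A\<close>.\<close>

lemma PiE_small:
  assumes "I \<prec> (UNIV :: 'v set)" "\<And>i. i \<in> I \<Longrightarrow> A i \<prec> (UNIV :: 'v set)"
  shows "(\<Pi>\<^sub>E i \<in> I. A i) \<prec> (UNIV :: 'v set)"
proof (rule inj_on_small)
  show "Pow (Sigma I A) \<prec> (UNIV :: 'v set)"
    by (rule Pow_small[OF Sigma_small[OF assms]])
  show "(\<lambda>f. (\<lambda>i. (i, f i)) ` I) ` (\<Pi>\<^sub>E i \<in> I. A i) \<subseteq> Pow (Sigma I A)" by auto
  show "inj_on (\<lambda>f. (\<lambda>i. (i, f i)) ` I) (\<Pi>\<^sub>E i \<in> I. A i)"
  proof (rule inj_onI)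
    fix f g assume *: "f \<in> (\<Pi>\<^sub>E i \<in> I. A i)" "g \<in> (\<Pi>\<^sub>E i \<in> I. A i)"
      "(\<lambda>i. (i, f i)) ` I = (\<lambda>i. (i, g i)) ` I"
    show "f = g"
    proof (rule PiE_ext[OF *(1,2)])
      fix i assume "i \<in> I"
      then have "(i, f i) \<in> (\<lambda>i. (i, g i)) ` I" using *(3) by auto
      then show "f i = g i" by auto
    qed
  qed
qed

lemma Times_small:
  "\<lbrakk>A \<prec> (UNIV :: 'v set); B \<prec> (UNIV :: 'v set)\<rbrakk> \<Longrightarrow> A \<times> B \<prec> (UNIV :: 'v set)"
  by (rule Sigma_small)

end

section \<open>Modules and homomorphisms\<close>

lemma left_moduleI:
  fixes R (structure) and M (structure)
  assumes "ring R"
    and "\<And>x y. \<lbrakk>x \<in> carrier M; y \<in> carrier M\<rbrakk> \<Longrightarrow> x \<oplus>\<^bsub>M\<^esub> y \<in> carrier M"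
    and "\<zero>\<^bsub>M\<^esub> \<in> carrier M"
    and "\<And>x y z. \<lbrakk>x \<in> carrier M; y \<in> carrier M; z \<in> carrier M\<rbrakk>
      \<Longrightarrow> (x \<oplus>\<^bsub>M\<^esub> y) \<oplus>\<^bsub>M\<^esub> z = x \<oplus>\<^bsub>M\<^esub> (y \<oplus>\<^bsub>M\<^esub> z)"
    and "\<And>x y. \<lbrakk>x \<in> carrier M; y \<in> carrier M\<rbrakk> \<Longrightarrow> x \<oplus>\<^bsub>M\<^esub> y = y \<oplus>\<^bsub>M\<^esub> x"
    and "\<And>x. x \<in> carrier M \<Longrightarrow> \<zero>\<^bsub>M\<^esub> \<oplus>\<^bsub>M\<^esub> x = x"
    and "\<And>x. x \<in> carrier M \<Longrightarrow> \<exists>y \<in> carrier M. y \<oplus>\<^bsub>M\<^esub> x = \<zero>\<^bsub>M\<^esub>"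
    and "\<And>r x. \<lbrakk>r \<in> carrier R; x \<in> carrier M\<rbrakk> \<Longrightarrow> r \<odot>\<^bsub>M\<^esub> x \<in> carrier M"
    and "\<And>r s x. \<lbrakk>r \<in> carrier R; s \<in> carrier R; x \<in> carrier M\<rbrakk>
      \<Longrightarrow> (r \<oplus>\<^bsub>R\<^esub> s) \<odot>\<^bsub>M\<^esub> x = r \<odot>\<^bsub>M\<^esub> x \<oplus>\<^bsub>M\<^esub> s \<odot>\<^bsub>M\<^esub> x"
    and "\<And>r x y. \<lbrakk>r \<in> carrier R; x \<in> carrier M; y \<in> carrier M\<rbrakk>
      \<Longrightarrow> r \<odot>\<^bsub>M\<^esub> (x \<oplus>\<^bsub>M\<^esub> y) = r \<odot>\<^bsub>M\<^esub> x \<oplus>\<^bsub>M\<^esub> r \<odot>\<^bsub>M\<^esub> y"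
    and "\<And>r s x. \<lbrakk>r \<in> carrier R; s \<in> carrier R; x \<in> carrier M\<rbrakk>
      \<Longrightarrow> (r \<otimes>\<^bsub>R\<^esub> s) \<odot>\<^bsub>M\<^esub> x = r \<odot>\<^bsub>M\<^esub> (s \<odot>\<^bsub>M\<^esub> x)"
    and "\<And>x. x \<in> carrier M \<Longrightarrow> \<one>\<^bsub>R\<^esub> \<odot>\<^bsub>M\<^esub> x = x"
  shows "left_module R M"
proof (intro left_module.intro left_module_axioms.intro)
  show "abelian_group M" by (rule abelian_groupI) (use assms in auto)
qed (use assms in auto)

section \<open>Arithmetic, submodules and spans in a left module\<close>

context left_module
begin

lemma smult_l_null [simp]: "x \<in> carrier M \<Longrightarrow> \<zero> \<odot>\<^bsub>M\<^esub> x = \<zero>\<^bsub>M\<^esub>"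
  by (metis M.add.r_cancel_one' R.l_zero R.zero_closed smult_closed smult_l_distr)

lemma smult_r_null [simp]: "r \<in> carrier R \<Longrightarrow> r \<odot>\<^bsub>M\<^esub> \<zero>\<^bsub>M\<^esub> = \<zero>\<^bsub>M\<^esub>"
  by (metis M.add.r_cancel_one' M.l_zero M.zero_closed smult_closed smult_r_distr)

lemma smult_l_minus:
  "\<lbrakk>r \<in> carrier R; x \<in> carrier M\<rbrakk> \<Longrightarrow> (\<ominus> r) \<odot>\<^bsub>M\<^esub> x = \<ominus>\<^bsub>M\<^esub> (r \<odot>\<^bsub>M\<^esub> x)"
  by (metis M.minus_equality R.a_inv_closed R.l_neg smult_closed smult_l_distr smult_l_null)

lemma smult_r_minus:
  "\<lbrakk>r \<in> carrier R; x \<in> carrier M\<rbrakk> \<Longrightarrow> r \<odot>\<^bsub>M\<^esub> (\<ominus>\<^bsub>M\<^esub> x) = \<ominus>\<^bsub>M\<^esub> (r \<odot>\<^bsub>M\<^esub> x)"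
  by (metis M.minus_equality M.a_inv_closed M.l_neg smult_closed smult_r_distr smult_r_null)

lemma neg_one_smult: "x \<in> carrier M \<Longrightarrow> (\<ominus> \<one>) \<odot>\<^bsub>M\<^esub> x = \<ominus>\<^bsub>M\<^esub> x"
  by (simp add: smult_l_minus)

lemma smult_r_sub:
  "\<lbrakk>r \<in> carrier R; x \<in> carrier M; y \<in> carrier M\<rbrakk>
    \<Longrightarrow> r \<odot>\<^bsub>M\<^esub> (x \<ominus>\<^bsub>M\<^esub> y) = r \<odot>\<^bsub>M\<^esub> x \<ominus>\<^bsub>M\<^esub> r \<odot>\<^bsub>M\<^esub> y"
  by (simp add: a_minus_def smult_r_distr smult_r_minus)

lemma diff_add_cancel: "\<lbrakk>x \<in> carrier M; y \<in> carrier M\<rbrakk> \<Longrightarrow> (x \<ominus>\<^bsub>M\<^esub> y) \<oplus>\<^bsub>M\<^esub> y = x"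
  by (simp add: a_minus_def M.a_assoc M.l_neg)

lemma diff_eq_zero_iff:
  "\<lbrakk>x \<in> carrier M; y \<in> carrier M\<rbrakk> \<Longrightarrow> x \<ominus>\<^bsub>M\<^esub> y = \<zero>\<^bsub>M\<^esub> \<longleftrightarrow> x = y"
  by (metis M.l_zero M.r_neg a_minus_def diff_add_cancel)

lemma diff_eq_iff:
  "\<lbrakk>x \<in> carrier M; y \<in> carrier M; z \<in> carrier M\<rbrakk> \<Longrightarrow> x \<ominus>\<^bsub>M\<^esub> y = z \<longleftrightarrow> x = y \<oplus>\<^bsub>M\<^esub> z"
  by (metis M.a_comm M.add.inv_solve_right M.minus_closed a_minus_def)

lemma finsum_smult:
  "\<lbrakk>finite S; r \<in> carrier R; f \<in> S \<rightarrow> carrier M\<rbrakk>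
    \<Longrightarrow> r \<odot>\<^bsub>M\<^esub> (\<Oplus>\<^bsub>M\<^esub> i \<in> S. f i) = (\<Oplus>\<^bsub>M\<^esub> i \<in> S. r \<odot>\<^bsub>M\<^esub> f i)"
proof (induction S rule: finite_induct)
  case (insert i S)
  then have *: "f i \<in> carrier M" "f \<in> S \<rightarrow> carrier M" by auto
  then have "(\<lambda>i. r \<odot>\<^bsub>M\<^esub> f i) \<in> S \<rightarrow> carrier M" using insert.prems by auto
  then show ?case using insert * by (simp add: M.finsum_insert smult_r_distr M.finsum_closed)
qed auto

lemma finsum_zero_outside:
  assumes "finite S" "T \<subseteq> S" "f \<in> T \<rightarrow> carrier M" "\<And>i. i \<in> S - T \<Longrightarrow> f i = \<zero>\<^bsub>M\<^esub>"
  shows "(\<Oplus>\<^bsub>M\<^esub> i \<in> S. f i) = (\<Oplus>\<^bsub>M\<^esub> i \<in> T. f i)"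
  using assms by (intro M.add.finprod_mono_neutral_cong_right) auto

text \<open>Closure under negatives comes from multiplication by minus one.\<close>

lemma submoduleI:
  assumes "S \<subseteq> carrier M" "\<zero>\<^bsub>M\<^esub> \<in> S"
    and "\<And>x y. \<lbrakk>x \<in> S; y \<in> S\<rbrakk> \<Longrightarrow> x \<oplus>\<^bsub>M\<^esub> y \<in> S"
    and "\<And>r x. \<lbrakk>r \<in> carrier R; x \<in> S\<rbrakk> \<Longrightarrow> r \<odot>\<^bsub>M\<^esub> x \<in> S"
  shows "submodule S R M"
proof (intro submodule.intro subgroup.intro submodule_axioms.intro)
  fix x assume "x \<in> S"
  then have "(\<ominus> \<one>) \<odot>\<^bsub>M\<^esub> x \<in> S" using assms(4) by auto
  then have "\<ominus>\<^bsub>M\<^esub> x \<in> S" using neg_one_smult \<open>x \<in> S\<close> assms(1) by auto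
  then show "inv\<^bsub>add_monoid M\<^esub> x \<in> S" by (simp add: a_inv_def)
qed (use assms in auto)

lemma submoduleD:
  assumes "submodule S R M"
  shows "S \<subseteq> carrier M" "\<zero>\<^bsub>M\<^esub> \<in> S"
    and "\<And>x y. \<lbrakk>x \<in> S; y \<in> S\<rbrakk> \<Longrightarrow> x \<oplus>\<^bsub>M\<^esub> y \<in> S"
    and "\<And>r x. \<lbrakk>r \<in> carrier R; x \<in> S\<rbrakk> \<Longrightarrow> r \<odot>\<^bsub>M\<^esub> x \<in> S"
    and "\<And>x. x \<in> S \<Longrightarrow> \<ominus>\<^bsub>M\<^esub> x \<in> S"
    and "\<And>x y. \<lbrakk>x \<in> S; y \<in> S\<rbrakk> \<Longrightarrow> x \<ominus>\<^bsub>M\<^esub> y \<in> S"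
proof -
  interpret submodule S R M by fact
  show "S \<subseteq> carrier M" "\<zero>\<^bsub>M\<^esub> \<in> S" using subset one_closed by auto
  show 1: "\<And>x y. \<lbrakk>x \<in> S; y \<in> S\<rbrakk> \<Longrightarrow> x \<oplus>\<^bsub>M\<^esub> y \<in> S" using m_closed by auto
  show "\<And>r x. \<lbrakk>r \<in> carrier R; x \<in> S\<rbrakk> \<Longrightarrow> r \<odot>\<^bsub>M\<^esub> x \<in> S" by auto
  show 2: "\<And>x. x \<in> S \<Longrightarrow> \<ominus>\<^bsub>M\<^esub> x \<in> S" using m_inv_closed by (auto simp: a_inv_def)
  show "\<And>x y. \<lbrakk>x \<in> S; y \<in> S\<rbrakk> \<Longrightarrow> x \<ominus>\<^bsub>M\<^esub> y \<in> S" using 1 2 by (auto simp: a_minus_def)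
qed

lemma submodule_finsum:
  assumes "submodule S R M" "f \<in> I \<rightarrow> S"
  shows "(\<Oplus>\<^bsub>M\<^esub> i \<in> I. f i) \<in> S"
proof (cases "finite I")
  case True
  then show ?thesis using assms(2)
  proof (induction I rule: finite_induct)
    case (insert i I)
    then show ?case using submoduleD[OF assms(1)] by (subst M.finsum_insert) auto
  qed (use submoduleD(2)[OF assms(1)] in auto)
next
  case False
  then show ?thesis using submoduleD(2)[OF assms(1)] by (simp add: M.finsum_infinite)
qed

lemma carrier_submodule: "submodule (carrier M) R M"
  by (rule submoduleI) auto

lemma zero_submodule: "submodule {\<zero>\<^bsub>M\<^esub>} R M"
  by (rule submoduleI) auto

lemma submodule_Int: "\<lbrakk>submodule S R M; submodule T R M\<rbrakk> \<Longrightarrow> submodule (S \<inter> T) R M"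
  using submoduleD[of S] submoduleD[of T] by (intro submoduleI) auto

lemma set_add_iff: "z \<in> S <+>\<^bsub>M\<^esub> T \<longleftrightarrow> (\<exists>x \<in> S. \<exists>y \<in> T. z = x \<oplus>\<^bsub>M\<^esub> y)"
  by (auto simp: set_add_def set_mult_def)

lemma submodule_module:
  assumes "submodule S R M"
  shows "left_module R (M\<lparr>carrier := S\<rparr>)"
proof (rule left_moduleI)
  show "ring R" by (rule R.ring_axioms)
  fix x assume x: "x \<in> carrier (M\<lparr>carrier := S\<rparr>)"
  then have "\<ominus>\<^bsub>M\<^esub> x \<in> S" "\<ominus>\<^bsub>M\<^esub> x \<oplus>\<^bsub>M\<^esub> x = \<zero>\<^bsub>M\<^esub>"
    using submoduleD[OF assms] by (auto simp: M.l_neg subset_iff)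
  then show "\<exists>y \<in> carrier (M\<lparr>carrier := S\<rparr>). y \<oplus>\<^bsub>M\<lparr>carrier := S\<rparr>\<^esub> x = \<zero>\<^bsub>M\<lparr>carrier := S\<rparr>\<^esub>"
    by auto
qed (use submoduleD[OF assms] in \<open>auto simp: subset_iff smult_l_distr smult_r_distr smult_assoc1
  M.add.m_ac\<close>)

lemma submodule_of_submodule_iff:
  assumes "submodule S R M"
  shows "submodule T R (M\<lparr>carrier := S\<rparr>) \<longleftrightarrow> submodule T R M \<and> T \<subseteq> S"
proof -
  interpret S: left_module R "M\<lparr>carrier := S\<rparr>" by (rule submodule_module[OF assms])
  show ?thesis
  proof
    assume "submodule T R (M\<lparr>carrier := S\<rparr>)"
    from S.submoduleD(1-4)[OF this] submoduleD(1)[OF assms]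
    show "submodule T R M \<and> T \<subseteq> S" by (auto intro!: submoduleI)
  next
    assume "submodule T R M \<and> T \<subseteq> S"
    with submoduleD(1-4)[of T] show "submodule T R (M\<lparr>carrier := S\<rparr>)"
      by (intro S.submoduleI) auto
  qed
qed

lemma span_submodule:
  assumes "X \<subseteq> carrier M"
  shows "submodule (submodule_span R M X) R M"
proof (rule submoduleI)
  show "submodule_span R M X \<subseteq> carrier M"
    unfolding submodule_span_def using carrier_submodule assms by auto
qed (auto simp: submodule_span_def submoduleD)

lemma span_superset: "X \<subseteq> submodule_span R M X"
  by (auto simp: submodule_span_def)

lemma span_subset: "\<lbrakk>submodule S R M; X \<subseteq> S\<rbrakk> \<Longrightarrow> submodule_span R M X \<subseteq> S"
  by (auto simp: submodule_span_def)

end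

section \<open>Homomorphisms, kernels and isomorphisms\<close>

lemma mod_homI:
  assumes "\<And>x. x \<in> carrier M \<Longrightarrow> f x \<in> carrier N"
    and "\<And>x. x \<notin> carrier M \<Longrightarrow> f x = undefined"
    and "\<And>x y. \<lbrakk>x \<in> carrier M; y \<in> carrier M\<rbrakk> \<Longrightarrow> f (x \<oplus>\<^bsub>M\<^esub> y) = f x \<oplus>\<^bsub>N\<^esub> f y"
    and "\<And>r x. \<lbrakk>r \<in> carrier R; x \<in> carrier M\<rbrakk> \<Longrightarrow> f (r \<odot>\<^bsub>M\<^esub> x) = r \<odot>\<^bsub>N\<^esub> f x"
  shows "f \<in> mod_hom R M N"
  using assms by (auto simp: mod_hom_def PiE_def extensional_def)

lemma restrict_mod_homI:
  assumes "left_module R M"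
    and "\<And>x. x \<in> carrier M \<Longrightarrow> f x \<in> carrier N"
    and "\<And>x y. \<lbrakk>x \<in> carrier M; y \<in> carrier M\<rbrakk> \<Longrightarrow> f (x \<oplus>\<^bsub>M\<^esub> y) = f x \<oplus>\<^bsub>N\<^esub> f y"
    and "\<And>r x. \<lbrakk>r \<in> carrier R; x \<in> carrier M\<rbrakk> \<Longrightarrow> f (r \<odot>\<^bsub>M\<^esub> x) = r \<odot>\<^bsub>N\<^esub> f x"
  shows "restrict f (carrier M) \<in> mod_hom R M N"
proof -
  interpret left_module R M by fact
  show ?thesis by (rule mod_homI) (use assms in auto)
qed

lemma mod_homD:
  assumes "f \<in> mod_hom R M N"
  shows "\<And>x. x \<in> carrier M \<Longrightarrow> f x \<in> carrier N"
    and "\<And>x. x \<notin> carrier M \<Longrightarrow> f x = undefined"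
    and "\<And>x y. \<lbrakk>x \<in> carrier M; y \<in> carrier M\<rbrakk> \<Longrightarrow> f (x \<oplus>\<^bsub>M\<^esub> y) = f x \<oplus>\<^bsub>N\<^esub> f y"
    and "\<And>r x. \<lbrakk>r \<in> carrier R; x \<in> carrier M\<rbrakk> \<Longrightarrow> f (r \<odot>\<^bsub>M\<^esub> x) = r \<odot>\<^bsub>N\<^esub> f x"
  using assms by (auto simp: mod_hom_def PiE_def extensional_def)

text \<open>Homomorphisms take the value \<open>undefined\<close> off the carrier, so agreement on
  the carrier is equality. The codomains may differ, as with a submodule and its ambient
  module.\<close>

lemma mod_hom_ext:
  assumes "f \<in> mod_hom R M N" "g \<in> mod_hom R M L" "\<And>x. x \<in> carrier M \<Longrightarrow> f x = g x"
  shows "f = g"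
proof
  fix x show "f x = g x"
    using assms mod_homD(2)[OF assms(1)] mod_homD(2)[OF assms(2)] by (cases "x \<in> carrier M") auto
qed

lemma mod_hom_cong_target:
  "carrier N \<subseteq> carrier N' \<Longrightarrow> add N = add N' \<Longrightarrow> smult N = smult N' \<Longrightarrow>
    f \<in> mod_hom R M N \<Longrightarrow> f \<in> mod_hom R M N'"
  by (auto simp: mod_hom_def PiE_def)

lemma mod_hom_into_submodule:
  "\<lbrakk>f \<in> mod_hom R M N; \<And>x. x \<in> carrier M \<Longrightarrow> f x \<in> S\<rbrakk> \<Longrightarrow> f \<in> mod_hom R M (N\<lparr>carrier := S\<rparr>)"
  by (auto simp: mod_hom_def PiE_def)

locale mod_homs =
  M?: left_module R M + N?: left_module R N
  for R :: "('r, 'x) ring_scheme" and M :: "('r, 'a) module" and N :: "('r, 'b) module" +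
  fixes f
  assumes f: "f \<in> mod_hom R M N"
begin

lemmas f_closed [simp, intro] = mod_homD(1)[OF f]
lemmas f_add = mod_homD(3)[OF f]
lemmas f_smult = mod_homD(4)[OF f]

lemma f_zero [simp]: "f \<zero>\<^bsub>M\<^esub> = \<zero>\<^bsub>N\<^esub>"
  by (metis N.M.add.r_cancel_one' M.M.l_zero M.M.zero_closed f_add f_closed)

lemma f_minus: "x \<in> carrier M \<Longrightarrow> f (\<ominus>\<^bsub>M\<^esub> x) = \<ominus>\<^bsub>N\<^esub> f x"
  by (metis N.M.minus_equality M.M.a_inv_closed M.M.l_neg f_closed f_add f_zero)

lemma f_diff: "\<lbrakk>x \<in> carrier M; y \<in> carrier M\<rbrakk> \<Longrightarrow> f (x \<ominus>\<^bsub>M\<^esub> y) = f x \<ominus>\<^bsub>N\<^esub> f y"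
  by (simp add: a_minus_def f_add f_minus)

lemma f_finsum:
  "\<lbrakk>finite S; g \<in> S \<rightarrow> carrier M\<rbrakk> \<Longrightarrow> f (\<Oplus>\<^bsub>M\<^esub> i \<in> S. g i) = (\<Oplus>\<^bsub>N\<^esub> i \<in> S. f (g i))"
proof (induction S rule: finite_induct)
  case (insert i S)
  then have *: "g i \<in> carrier M" "g \<in> S \<rightarrow> carrier M" by auto
  then have "(\<lambda>i. f (g i)) \<in> S \<rightarrow> carrier N" by auto
  then show ?case using insert * by (simp add: M.M.finsum_insert N.M.finsum_insert f_add M.M.finsum_closed)
qed auto

lemma image_submodule:
  assumes "submodule S R M"
  shows "submodule (f ` S) R N"
proof (rule N.submoduleI)
  note S = M.submoduleD[OF assms]
  show "f ` S \<subseteq> carrier N" using S by auto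
  show "\<zero>\<^bsub>N\<^esub> \<in> f ` S" using S by (metis f_zero imageI)
  show "\<And>x y. x \<in> f ` S \<Longrightarrow> y \<in> f ` S \<Longrightarrow> x \<oplus>\<^bsub>N\<^esub> y \<in> f ` S"
    using S(1,3) by (auto simp: f_add[symmetric] subset_iff)
  show "\<And>r x. r \<in> carrier R \<Longrightarrow> x \<in> f ` S \<Longrightarrow> r \<odot>\<^bsub>N\<^esub> x \<in> f ` S"
    using S(1,4) by (auto simp: f_smult[symmetric] subset_iff)
qed

lemma vimage_submodule:
  assumes "submodule S R N"
  shows "submodule {x \<in> carrier M. f x \<in> S} R M"
  using N.submoduleD[OF assms] by (intro M.submoduleI) (auto simp: f_add f_smult)

lemma kernel_submodule: "submodule (mod_kernel M N f) R M"
  using vimage_submodule[OF N.zero_submodule] by (simp add: mod_kernel_def)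

lemma inj_on_iff_kernel: "inj_on f (carrier M) \<longleftrightarrow> mod_kernel M N f = {\<zero>\<^bsub>M\<^esub>}"
proof
  assume "inj_on f (carrier M)"
  then show "mod_kernel M N f = {\<zero>\<^bsub>M\<^esub>}"
    unfolding mod_kernel_def inj_on_def by (auto simp: f_zero[symmetric] simp del: f_zero)
next
  assume *: "mod_kernel M N f = {\<zero>\<^bsub>M\<^esub>}"
  show "inj_on f (carrier M)"
  proof (rule inj_onI)
    fix x y assume xy: "x \<in> carrier M" "y \<in> carrier M" "f x = f y"
    then have "f (x \<ominus>\<^bsub>M\<^esub> y) = \<zero>\<^bsub>N\<^esub>" by (simp add: f_diff N.diff_eq_zero_iff)
    then have "x \<ominus>\<^bsub>M\<^esub> y = \<zero>\<^bsub>M\<^esub>" using * xy by (auto simp: mod_kernel_def)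
    then show "x = y" using xy by (simp add: M.diff_eq_zero_iff)
  qed
qed

lemma restrict_mod_hom:
  assumes "submodule S R M"
  shows "restrict f S \<in> mod_hom R (M\<lparr>carrier := S\<rparr>) N"
  by (rule mod_homI) (use M.submoduleD[OF assms] f_add f_smult in \<open>auto simp: subset_iff\<close>)

end

lemma mod_homsI: "\<lbrakk>left_module R M; left_module R N; f \<in> mod_hom R M N\<rbrakk> \<Longrightarrow> mod_homs R M N f"
  by (simp add: mod_homs_def mod_homs_axioms_def)

lemma id_mod_hom: "left_module R M \<Longrightarrow> (\<lambda>x \<in> carrier M. x) \<in> mod_hom R M M"
  by (rule restrict_mod_homI) auto

lemma incl_mod_hom:
  assumes "left_module R M" "submodule S R M"
  shows "(\<lambda>x \<in> S. x) \<in> mod_hom R (M\<lparr>carrier := S\<rparr>) M"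
proof -
  interpret left_module R M by fact
  show ?thesis by (rule mod_homI) (use submoduleD[OF assms(2)] in auto)
qed

lemma compose_mod_hom:
  assumes "left_module R L" "f \<in> mod_hom R L M" "g \<in> mod_hom R M N"
  shows "compose (carrier L) g f \<in> mod_hom R L N"
  unfolding compose_def
  by (rule restrict_mod_homI) (use assms mod_homD[OF assms(2)] mod_homD[OF assms(3)] in auto)

lemma zero_mod_hom:
  assumes "left_module R M" "left_module R N"
  shows "(\<lambda>x \<in> carrier M. \<zero>\<^bsub>N\<^esub>) \<in> mod_hom R M N"
proof -
  interpret N: left_module R N by fact
  show ?thesis by (rule restrict_mod_homI) (use assms in auto)
qed

lemma diff_mod_hom:
  assumes "left_module R M" "left_module R N" "f \<in> mod_hom R M N" "g \<in> mod_hom R M N"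
  shows "(\<lambda>x \<in> carrier M. f x \<ominus>\<^bsub>N\<^esub> g x) \<in> mod_hom R M N"
proof -
  interpret N: left_module R N by fact
  show ?thesis
    by (rule restrict_mod_homI)
      (use assms mod_homD[OF assms(3)] mod_homD[OF assms(4)] in
        \<open>auto simp: N.smult_r_sub N.M.add.m_ac a_minus_def N.M.minus_add N.smult_r_distr N.smult_r_minus\<close>)
qed

lemma mod_isoD:
  assumes "f \<in> mod_iso R M N"
  shows "f \<in> mod_hom R M N" "bij_betw f (carrier M) (carrier N)"
  using assms by (auto simp: mod_iso_def)

lemma mod_iso_inverse:
  assumes "left_module R M" "left_module R N" "f \<in> mod_iso R M N"
  obtains g where "g \<in> mod_iso R N M" "\<And>x. x \<in> carrier M \<Longrightarrow> g (f x) = x"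
    "\<And>y. y \<in> carrier N \<Longrightarrow> f (g y) = y"
proof -
  interpret mod_homs R M N f by (rule mod_homsI) (use assms mod_isoD in auto)
  have b: "bij_betw f (carrier M) (carrier N)" using mod_isoD[OF assms(3)] by auto
  define g where "g = restrict (inv_into (carrier M) f) (carrier N)"
  have gf: "g (f x) = x" if "x \<in> carrier M" for x
    using that b by (simp add: g_def bij_betw_def)
  have fg: "f (g y) = y" "g y \<in> carrier M" if "y \<in> carrier N" for y
    using that b by (auto simp: g_def bij_betw_def f_inv_into_f inv_into_into)
  have "g \<in> mod_hom R N M"
  proof (rule mod_homI)
    show "g x = undefined" if "x \<notin> carrier N" for x using that by (simp add: g_def)
    show "g (x \<oplus>\<^bsub>N\<^esub> y) = g x \<oplus>\<^bsub>M\<^esub> g y" if "x \<in> carrier N" "y \<in> carrier N" for x y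
    proof -
      have "x \<oplus>\<^bsub>N\<^esub> y = f (g x \<oplus>\<^bsub>M\<^esub> g y)" using that fg by (simp add: f_add)
      then show ?thesis using that fg gf by simp
    qed
    show "g (r \<odot>\<^bsub>N\<^esub> x) = r \<odot>\<^bsub>M\<^esub> g x" if "r \<in> carrier R" "x \<in> carrier N" for r x
    proof -
      have "r \<odot>\<^bsub>N\<^esub> x = f (r \<odot>\<^bsub>M\<^esub> g x)" using that fg by (simp add: f_smult)
      then show ?thesis using that fg gf by simp
    qed
  qed (use fg in auto)
  moreover have "bij_betw g (carrier N) (carrier M)"
    by (rule bij_betw_byWitness[where f' = f]) (use gf fg in auto)
  ultimately show ?thesis using that gf fg by (simp add: mod_iso_def)
qed

lemma regular_left_module: "ring R \<Longrightarrow> left_module R (regular_module R)"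
proof -
  assume "ring R"
  then interpret ring R .
  show ?thesis
  proof (rule left_moduleI)
    fix x assume "x \<in> carrier (regular_module R)"
    then show "\<exists>y \<in> carrier (regular_module R). y \<oplus>\<^bsub>regular_module R\<^esub> x = \<zero>\<^bsub>regular_module R\<^esub>"
      by (auto simp: regular_module_def intro!: bexI[of _ "\<ominus>\<^bsub>R\<^esub> x"] l_neg)
  qed (auto simp: regular_module_def ring_axioms m_assoc l_distr r_distr a_assoc intro: a_comm)
qed

lemma regular_module_simps [simp]:
  "carrier (regular_module R) = carrier R" "\<zero>\<^bsub>regular_module R\<^esub> = \<zero>\<^bsub>R\<^esub>"
  "add (regular_module R) = add R" "smult (regular_module R) = mult R"
  by (auto simp: regular_module_def)

text \<open>Objects of \<open>LMod R\<close> have elements in \<open>'v\<close>, while powers of the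
  ring, free modules and products consist of functions. Transport of structure along an injection of
  the small carrier turns such modules into objects.\<close>

lemma (in universe) module_copy:
  fixes M :: "('v, 'a) module"
  assumes "left_module R M" "carrier M \<prec> (UNIV :: 'v set)"
  obtains M' :: "('v, 'v) module" and \<phi> where "M' \<in> modules R" "\<phi> \<in> mod_iso R M M'"
proof -
  interpret M: left_module R M by fact
  obtain e :: "'a \<Rightarrow> 'v" where e: "inj_on e (carrier M)" "small (e ` carrier M)"
    by (rule small_embedding[OF assms(2)])
  define d where "d = inv_into (carrier M) e"
  have de: "d (e x) = x" if "x \<in> carrier M" for x using that e by (simp add: d_def)
  define M' :: "('v, 'v) module" where "M' = \<lparr>carrier = e ` carrier M, mult = undefined,
    one = undefined, zero = e \<zero>\<^bsub>M\<^esub>, add = (\<lambda>x y. e (d x \<oplus>\<^bsub>M\<^esub> d y)),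
    smult = (\<lambda>r x. e (r \<odot>\<^bsub>M\<^esub> d x))\<rparr>"
  have "left_module R M'"
  proof (rule left_moduleI)
    fix x assume "x \<in> carrier M'"
    then obtain y where y: "y \<in> carrier M" "x = e y" by (auto simp: M'_def)
    then have "e (\<ominus>\<^bsub>M\<^esub> y) \<oplus>\<^bsub>M'\<^esub> x = \<zero>\<^bsub>M'\<^esub>" by (simp add: M'_def de M.M.l_neg)
    with y show "\<exists>y \<in> carrier M'. y \<oplus>\<^bsub>M'\<^esub> x = \<zero>\<^bsub>M'\<^esub>"
      by (auto simp: M'_def intro!: bexI[of _ "\<ominus>\<^bsub>M\<^esub> y"])
  next
    show "ring R" by (rule M.R.ring_axioms)
  qed (auto simp: M'_def de M.M.add.m_ac M.smult_l_distr M.smult_r_distr M.smult_assoc1)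
  moreover have "small (carrier M')" using e by (simp add: M'_def)
  moreover have "restrict e (carrier M) \<in> mod_iso R M M'"
    unfolding mod_iso_def using restrict_mod_homI[OF assms(1), of e M'] e(1)
    by (auto simp: M'_def de bij_betw_def inj_on_def)
  ultimately show ?thesis using that by (auto simp: modules_def)
qed

section \<open>Projective modules and dual bases\<close>

text \<open>The sum runs over the support, so that \<open>X\<close> may be infinite:
  \<open>finsum\<close> over an infinite set is zero by convention and would lose the value.\<close>

definition lincomb ::
    "('r, 'x) ring_scheme \<Rightarrow> ('r, 'a) module \<Rightarrow> 'i set \<Rightarrow> ('i \<Rightarrow> 'r) \<Rightarrow> ('i \<Rightarrow> 'a) \<Rightarrow> 'a" where
  "lincomb R M X u b = (\<Oplus>\<^bsub>M\<^esub> i \<in> {i \<in> X. u i \<noteq> \<zero>\<^bsub>R\<^esub>}. u i \<odot>\<^bsub>M\<^esub> b i)"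

definition finsupp :: "('r, 'x) ring_scheme \<Rightarrow> 'i set \<Rightarrow> ('i \<Rightarrow> 'r) \<Rightarrow> bool" where
  "finsupp R X u \<longleftrightarrow> u \<in> X \<rightarrow> carrier R \<and> finite {i \<in> X. u i \<noteq> \<zero>\<^bsub>R\<^esub>}"

context left_module
begin

lemma lincomb_eq:
  assumes "finite S" "S \<subseteq> X" "{i \<in> X. u i \<noteq> \<zero>} \<subseteq> S" "u \<in> X \<rightarrow> carrier R" "b \<in> X \<rightarrow> carrier M"
  shows "lincomb R M X u b = (\<Oplus>\<^bsub>M\<^esub> i \<in> S. u i \<odot>\<^bsub>M\<^esub> b i)"
  unfolding lincomb_def
  by (rule finsum_zero_outside[symmetric]) (use assms in \<open>auto simp: subset_iff Pi_iff\<close>)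

lemma lincomb_closed [intro]:
  "\<lbrakk>u \<in> X \<rightarrow> carrier R; b \<in> X \<rightarrow> carrier M\<rbrakk> \<Longrightarrow> lincomb R M X u b \<in> carrier M"
  unfolding lincomb_def by (rule M.finsum_closed) auto

lemma lincomb_cong:
  assumes "\<And>i. i \<in> X \<Longrightarrow> u i = v i" "\<And>i. i \<in> X \<Longrightarrow> b i = d i"
    "v \<in> X \<rightarrow> carrier R" "d \<in> X \<rightarrow> carrier M"
  shows "lincomb R M X u b = lincomb R M X v d"
proof -
  have "{i \<in> X. u i \<noteq> \<zero>} = {i \<in> X. v i \<noteq> \<zero>}" using assms by auto
  then show ?thesis unfolding lincomb_def
    by (rule M.add.finprod_cong') (use assms in auto)
qed

lemma lincomb_add:
  assumes u: "finsupp R X u" and v: "finsupp R X v" and b: "b \<in> X \<rightarrow> carrier M"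
  shows "lincomb R M X (\<lambda>i. u i \<oplus> v i) b = lincomb R M X u b \<oplus>\<^bsub>M\<^esub> lincomb R M X v b"
proof -
  define S where "S = {i \<in> X. u i \<noteq> \<zero>} \<union> {i \<in> X. v i \<noteq> \<zero>}"
  have S: "finite S" "S \<subseteq> X" using u v by (auto simp: S_def finsupp_def)
  have uc: "u \<in> X \<rightarrow> carrier R" and vc: "v \<in> X \<rightarrow> carrier R" using u v by (auto simp: finsupp_def)
  have "lincomb R M X (\<lambda>i. u i \<oplus> v i) b = (\<Oplus>\<^bsub>M\<^esub> i \<in> S. (u i \<oplus> v i) \<odot>\<^bsub>M\<^esub> b i)"
    using uc vc by (intro lincomb_eq[OF S _ _ b]) (auto simp: S_def)
  also have "\<dots> = (\<Oplus>\<^bsub>M\<^esub> i \<in> S. u i \<odot>\<^bsub>M\<^esub> b i \<oplus>\<^bsub>M\<^esub> v i \<odot>\<^bsub>M\<^esub> b i)"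
    by (rule M.add.finprod_cong') (use uc vc b S(2) in \<open>auto simp: smult_l_distr Pi_iff subset_iff\<close>)
  also have "\<dots> = (\<Oplus>\<^bsub>M\<^esub> i \<in> S. u i \<odot>\<^bsub>M\<^esub> b i) \<oplus>\<^bsub>M\<^esub> (\<Oplus>\<^bsub>M\<^esub> i \<in> S. v i \<odot>\<^bsub>M\<^esub> b i)"
    by (rule M.finsum_addf) (use uc vc b S(2) in \<open>auto simp: Pi_iff subset_iff\<close>)
  also have "(\<Oplus>\<^bsub>M\<^esub> i \<in> S. u i \<odot>\<^bsub>M\<^esub> b i) = lincomb R M X u b"
    by (rule lincomb_eq[OF S _ uc b, symmetric]) (auto simp: S_def)
  also have "(\<Oplus>\<^bsub>M\<^esub> i \<in> S. v i \<odot>\<^bsub>M\<^esub> b i) = lincomb R M X v b"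
    by (rule lincomb_eq[OF S _ vc b, symmetric]) (auto simp: S_def)
  finally show ?thesis .
qed

lemma lincomb_smult:
  assumes r: "r \<in> carrier R" and u: "finsupp R X u" and b: "b \<in> X \<rightarrow> carrier M"
  shows "lincomb R M X (\<lambda>i. r \<otimes> u i) b = r \<odot>\<^bsub>M\<^esub> lincomb R M X u b"
proof -
  define S where "S = {i \<in> X. u i \<noteq> \<zero>}"
  have S: "finite S" "S \<subseteq> X" using u by (auto simp: S_def finsupp_def)
  have uc: "u \<in> X \<rightarrow> carrier R" using u by (auto simp: finsupp_def)
  have "lincomb R M X (\<lambda>i. r \<otimes> u i) b = (\<Oplus>\<^bsub>M\<^esub> i \<in> S. (r \<otimes> u i) \<odot>\<^bsub>M\<^esub> b i)"
    using uc r by (intro lincomb_eq[OF S _ _ b]) (auto simp: S_def)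
  also have "\<dots> = (\<Oplus>\<^bsub>M\<^esub> i \<in> S. r \<odot>\<^bsub>M\<^esub> (u i \<odot>\<^bsub>M\<^esub> b i))"
    by (rule M.add.finprod_cong') (use r uc b S(2) in \<open>auto simp: smult_assoc1 Pi_iff subset_iff\<close>)
  also have "\<dots> = r \<odot>\<^bsub>M\<^esub> lincomb R M X u b"
    unfolding lincomb_def S_def[symmetric]
    by (rule finsum_smult[symmetric]) (use r uc b S in \<open>auto simp: Pi_iff subset_iff\<close>)
  finally show ?thesis .
qed

lemma lincomb_delta:
  assumes "x \<in> X" "b \<in> X \<rightarrow> carrier M" "r \<in> carrier R"
  shows "lincomb R M X (\<lambda>i. if i = x then r else \<zero>) b = r \<odot>\<^bsub>M\<^esub> b x"
proof -
  have "lincomb R M X (\<lambda>i. if i = x then r else \<zero>) b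
    = (\<Oplus>\<^bsub>M\<^esub> i \<in> {x}. (if i = x then r else \<zero>) \<odot>\<^bsub>M\<^esub> b i)"
    by (rule lincomb_eq) (use assms in auto)
  also have "\<dots> = r \<odot>\<^bsub>M\<^esub> b x"
    using assms by (subst M.finsum_insert) (auto simp: Pi_iff)
  finally show ?thesis .
qed

lemma submodule_lincomb:
  assumes "submodule S R M" "u \<in> X \<rightarrow> carrier R" "b \<in> X \<rightarrow> S"
  shows "lincomb R M X u b \<in> S"
  unfolding lincomb_def
  by (rule submodule_finsum[OF assms(1)]) (use assms submoduleD(4)[OF assms(1)] in auto)

end

lemma (in mod_homs) f_lincomb:
  assumes "finsupp R X u" "b \<in> X \<rightarrow> carrier M"
  shows "f (lincomb R M X u b) = lincomb R N X u (\<lambda>i. f (b i))"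
  unfolding lincomb_def
proof (subst f_finsum)
  show "(\<Oplus>\<^bsub>N\<^esub> i \<in> {i \<in> X. u i \<noteq> \<zero>\<^bsub>R\<^esub>}. f (u i \<odot>\<^bsub>M\<^esub> b i)) =
    (\<Oplus>\<^bsub>N\<^esub> i \<in> {i \<in> X. u i \<noteq> \<zero>\<^bsub>R\<^esub>}. u i \<odot>\<^bsub>N\<^esub> f (b i))"
    by (rule N.M.add.finprod_cong') (use assms in \<open>auto simp: finsupp_def Pi_iff f_smult\<close>)
qed (use assms in \<open>auto simp: finsupp_def Pi_iff\<close>)

text \<open>The functional half of a dual basis. It is kept apart because it alone turns any family
  \<open>n i\<close> in any module into a homomorphism, sending \<open>y\<close> to the sum of the
  \<open>c i y\<close> times \<open>n i\<close>.\<close>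

definition coordinates ::
    "('r, 'x) ring_scheme \<Rightarrow> ('r, 'a) module \<Rightarrow> 'i set \<Rightarrow> ('i \<Rightarrow> 'a \<Rightarrow> 'r) \<Rightarrow> bool" where
  "coordinates R P X c \<longleftrightarrow> (\<forall>i \<in> X. c i \<in> mod_hom R P (regular_module R)) \<and>
     (\<forall>y \<in> carrier P. finsupp R X (\<lambda>i. c i y))"

text \<open>The criterion of the dual basis lemma. For a given projective module the index set will
  be its whole carrier with \<open>b\<close> the identity, which spares a choice of
  generators.\<close>

definition dual_basis ::
    "('r, 'x) ring_scheme \<Rightarrow> ('r, 'a) module \<Rightarrow> 'i set \<Rightarrow> ('i \<Rightarrow> 'a) \<Rightarrow> ('i \<Rightarrow> 'a \<Rightarrow> 'r) \<Rightarrow> bool" where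
  "dual_basis R P X b c \<longleftrightarrow> coordinates R P X c \<and> b \<in> X \<rightarrow> carrier P \<and>
     (\<forall>y \<in> carrier P. lincomb R P X (\<lambda>i. c i y) b = y)"

lemma coordinatesD:
  assumes "coordinates R P X c"
  shows "\<And>i y. \<lbrakk>i \<in> X; y \<in> carrier P\<rbrakk> \<Longrightarrow> c i y \<in> carrier R"
    and "\<And>i x y. \<lbrakk>i \<in> X; x \<in> carrier P; y \<in> carrier P\<rbrakk> \<Longrightarrow> c i (x \<oplus>\<^bsub>P\<^esub> y) = c i x \<oplus>\<^bsub>R\<^esub> c i y"
    and "\<And>i r y. \<lbrakk>i \<in> X; r \<in> carrier R; y \<in> carrier P\<rbrakk> \<Longrightarrow> c i (r \<odot>\<^bsub>P\<^esub> y) = r \<otimes>\<^bsub>R\<^esub> c i y"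
    and "\<And>y. y \<in> carrier P \<Longrightarrow> finsupp R X (\<lambda>i. c i y)"
    and "\<And>y. y \<in> carrier P \<Longrightarrow> (\<lambda>i. c i y) \<in> X \<rightarrow> carrier R"
    and "\<And>y. y \<in> carrier P \<Longrightarrow> finite {i \<in> X. c i y \<noteq> \<zero>\<^bsub>R\<^esub>}"
  using assms by (auto simp: coordinates_def mod_hom_def finsupp_def PiE_def Pi_iff)

lemma lincomb_mod_hom:
  assumes "left_module R P" "left_module R N" "coordinates R P X c" "n \<in> X \<rightarrow> carrier N"
  shows "(\<lambda>y \<in> carrier P. lincomb R N X (\<lambda>i. c i y) n) \<in> mod_hom R P N"
proof -
  interpret P: left_module R P by fact
  interpret N: left_module R N by fact
  note c = coordinatesD[OF assms(3)]
  show ?thesis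
  proof (rule restrict_mod_homI[OF assms(1)])
    fix y assume y: "y \<in> carrier P"
    show "lincomb R N X (\<lambda>i. c i y) n \<in> carrier N"
      using c(5)[OF y] assms(4) by auto
    fix x assume x: "x \<in> carrier P"
    have "lincomb R N X (\<lambda>i. c i (x \<oplus>\<^bsub>P\<^esub> y)) n = lincomb R N X (\<lambda>i. c i x \<oplus>\<^bsub>R\<^esub> c i y) n"
      using c(1,2) x y assms(4) by (intro N.lincomb_cong) auto
    then show "lincomb R N X (\<lambda>i. c i (x \<oplus>\<^bsub>P\<^esub> y)) n =
      lincomb R N X (\<lambda>i. c i x) n \<oplus>\<^bsub>N\<^esub> lincomb R N X (\<lambda>i. c i y) n"
      using N.lincomb_add[OF c(4)[OF x] c(4)[OF y] assms(4)] by simp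
  next
    fix r y assume *: "r \<in> carrier R" "y \<in> carrier P"
    have "lincomb R N X (\<lambda>i. c i (r \<odot>\<^bsub>P\<^esub> y)) n = lincomb R N X (\<lambda>i. r \<otimes>\<^bsub>R\<^esub> c i y) n"
      using c(1,3) * assms(4) by (intro N.lincomb_cong) auto
    then show "lincomb R N X (\<lambda>i. c i (r \<odot>\<^bsub>P\<^esub> y)) n = r \<odot>\<^bsub>N\<^esub> lincomb R N X (\<lambda>i. c i y) n"
      using N.lincomb_smult[OF *(1) c(4)[OF *(2)] assms(4)] by simp
  qed
qed

text \<open>Preimages \<open>n i\<close> of the \<open>f (b i)\<close> are chosen freely, and the
  homomorphism built from \<open>c\<close> and \<open>n\<close> is the lift, because
  \<open>g\<close> turns its value at \<open>y\<close> into \<open>f\<close> of the expansion of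
  \<open>y\<close>. \<open>N\<close> and \<open>L\<close> may have elements of any type.\<close>

lemma dual_basis_lift:
  assumes "left_module R P" "dual_basis R P X b c" "left_module R N" "left_module R L"
    and g: "g \<in> mod_hom R N L" "g ` carrier N = carrier L" and f: "f \<in> mod_hom R P L"
  obtains h where "h \<in> mod_hom R P N" "\<And>x. x \<in> carrier P \<Longrightarrow> g (h x) = f x"
proof -
  interpret P: left_module R P by fact
  interpret g: mod_homs R N L g by (rule mod_homsI) (use assms in auto)
  interpret f: mod_homs R P L f by (rule mod_homsI) (use assms in auto)
  have b: "b \<in> X \<rightarrow> carrier P" and c: "coordinates R P X c"
    and bc: "\<And>y. y \<in> carrier P \<Longrightarrow> lincomb R P X (\<lambda>i. c i y) b = y"
    using assms(2) by (auto simp: dual_basis_def)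
  have "\<exists>n. n \<in> carrier N \<and> g n = f (b i)" if "i \<in> X" for i
  proof -
    have "f (b i) \<in> g ` carrier N" using that b g(2) by auto
    then show ?thesis by auto
  qed
  then obtain n where n: "\<And>i. i \<in> X \<Longrightarrow> n i \<in> carrier N" "\<And>i. i \<in> X \<Longrightarrow> g (n i) = f (b i)" by metis
  define h where "h = (\<lambda>y \<in> carrier P. lincomb R N X (\<lambda>i. c i y) n)"
  have "g (h y) = f y" if y: "y \<in> carrier P" for y
  proof -
    have "g (h y) = lincomb R L X (\<lambda>i. c i y) (\<lambda>i. g (n i))"
      using y g.f_lincomb[OF coordinatesD(4)[OF c y], of n] n by (auto simp: h_def)
    also have "\<dots> = lincomb R L X (\<lambda>i. c i y) (\<lambda>i. f (b i))"
      using n b coordinatesD(5)[OF c y] by (intro g.N.lincomb_cong) auto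
    also have "\<dots> = f y"
      using f.f_lincomb[OF coordinatesD(4)[OF c y] b] bc[OF y] by simp
    finally show ?thesis .
  qed
  moreover have "h \<in> mod_hom R P N" unfolding h_def
    by (rule lincomb_mod_hom[OF assms(1,3) c]) (use n in auto)
  ultimately show ?thesis using that by blast
qed

lemma dual_basis_projective:
  fixes P :: "('v, 'a) module"
  assumes "left_module R P" "dual_basis R P X b c"
  shows "projective R P"
  unfolding projective_def
proof (intro conjI ballI impI)
  fix N L :: "('v, 'v) module" and g f
  assume *: "N \<in> modules R" "L \<in> modules R" "g \<in> mod_hom R N L" "f \<in> mod_hom R P L"
    "g ` carrier N = carrier L"
  then have NL: "left_module R N" "left_module R L" by (auto simp: modules_def)
  obtain h where h: "h \<in> mod_hom R P N" "\<And>x. x \<in> carrier P \<Longrightarrow> g (h x) = f x"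
    by (rule dual_basis_lift[OF assms NL *(3,5,4)]) blast
  have "compose (carrier P) g h \<in> mod_hom R P L"
    by (rule compose_mod_hom[OF assms(1) h(1) *(3)])
  then have "compose (carrier P) g h = f"
    by (rule mod_hom_ext[OF _ *(4)]) (use h in \<open>auto simp: compose_def\<close>)
  then show "\<exists>h \<in> mod_hom R P N. compose (carrier P) g h = f" using h(1) by blast
qed (rule assms(1))

text \<open>The composite of \<open>f\<close> and \<open>r\<close> lifts over \<open>P\<close>; this
  lift after \<open>i\<close> is a lift of \<open>f\<close>.\<close>

lemma projective_retract:
  fixes P :: "('v, 'a) module" and Q :: "('v, 'b) module"
  assumes "projective R P" "left_module R Q" "i \<in> mod_hom R Q P" "r \<in> mod_hom R P Q"
    and ri: "\<And>x. x \<in> carrier Q \<Longrightarrow> r (i x) = x"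
  shows "projective R Q"
  unfolding projective_def
proof (intro conjI ballI impI)
  have P: "left_module R P" using assms by (simp add: projective_def)
  fix N L :: "('v, 'v) module" and g f
  assume *: "N \<in> modules R" "L \<in> modules R" "g \<in> mod_hom R N L" "f \<in> mod_hom R Q L"
    "g ` carrier N = carrier L"
  have "compose (carrier P) f r \<in> mod_hom R P L" by (rule compose_mod_hom[OF P assms(4) *(4)])
  then obtain h where h: "h \<in> mod_hom R P N" "compose (carrier P) g h = compose (carrier P) f r"
    using assms(1) * unfolding projective_def by metis
  have "compose (carrier Q) g (compose (carrier Q) h i) = f"
  proof (rule mod_hom_ext[OF _ *(4)])
    show "compose (carrier Q) g (compose (carrier Q) h i) \<in> mod_hom R Q L"
      by (rule compose_mod_hom[OF assms(2) compose_mod_hom[OF assms(2,3) h(1)] *(3)])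
    fix x assume x: "x \<in> carrier Q"
    then have ix: "i x \<in> carrier P" using mod_homD(1)[OF assms(3)] by simp
    have "g (h (i x)) = f (r (i x))" using fun_cong[OF h(2), of "i x"] ix by (simp add: compose_def)
    then show "compose (carrier Q) g (compose (carrier Q) h i) x = f x"
      using x ri by (simp add: compose_def)
  qed
  then show "\<exists>h \<in> mod_hom R Q N. compose (carrier Q) g h = f"
    using compose_mod_hom[OF assms(2,3) h(1)] by blast
qed (rule assms(2))

lemma projective_iso:
  assumes "projective R P" "left_module R Q" "f \<in> mod_iso R P Q"
  shows "projective R Q"
proof -
  have P: "left_module R P" using assms by (simp add: projective_def)
  obtain g where g: "g \<in> mod_iso R Q P" "\<And>y. y \<in> carrier Q \<Longrightarrow> f (g y) = y"
    by (rule mod_iso_inverse[OF P assms(2,3)]) blast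
  show ?thesis
    by (rule projective_retract[OF assms(1,2) mod_isoD(1)[OF g(1)] mod_isoD(1)[OF assms(3)] g(2)])
qed

section \<open>Direct products and direct sums of left ideals\<close>

lemma direct_product_simps [simp]:
  "carrier (direct_product I M) = (\<Pi>\<^sub>E i \<in> I. carrier (M i))"
  "\<zero>\<^bsub>direct_product I M\<^esub> = (\<lambda>i \<in> I. \<zero>\<^bsub>M i\<^esub>)"
  "x \<oplus>\<^bsub>direct_product I M\<^esub> y = (\<lambda>i \<in> I. x i \<oplus>\<^bsub>M i\<^esub> y i)"
  "r \<odot>\<^bsub>direct_product I M\<^esub> x = (\<lambda>i \<in> I. r \<odot>\<^bsub>M i\<^esub> x i)"
  by (auto simp: direct_product_def)

lemma direct_product_module:
  assumes "ring R" "\<And>i. i \<in> I \<Longrightarrow> left_module R (M i)"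
  shows "left_module R (direct_product I M)"
proof (rule left_moduleI)
  have M: "abelian_group (M i)" if "i \<in> I" for i
    using assms(2)[OF that] by (simp add: left_module_def)
  note ag = abelian_group.axioms(1)[OF M]
  note abelian_monoid.a_closed[OF ag, simp] abelian_monoid.zero_closed[OF ag, simp]
    left_module.smult_closed[OF assms(2), simp]
  show "\<zero>\<^bsub>direct_product I M\<^esub> \<in> carrier (direct_product I M)" by auto
  fix x y z assume x: "x \<in> carrier (direct_product I M)" and y: "y \<in> carrier (direct_product I M)"
    and z: "z \<in> carrier (direct_product I M)"
  show "(x \<oplus>\<^bsub>direct_product I M\<^esub> y) \<oplus>\<^bsub>direct_product I M\<^esub> z =
    x \<oplus>\<^bsub>direct_product I M\<^esub> (y \<oplus>\<^bsub>direct_product I M\<^esub> z)"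
    using x y z abelian_monoid.a_assoc[OF ag] by (auto intro!: restrict_ext simp: PiE_iff)
  show "x \<oplus>\<^bsub>direct_product I M\<^esub> y = y \<oplus>\<^bsub>direct_product I M\<^esub> x"
    using x y abelian_monoid.a_comm[OF ag] by (auto intro!: restrict_ext simp: PiE_iff)
  show "\<zero>\<^bsub>direct_product I M\<^esub> \<oplus>\<^bsub>direct_product I M\<^esub> x = x"
    using x abelian_monoid.l_zero[OF ag] by (auto intro!: ext simp: PiE_iff extensional_def)
  have "(\<lambda>i \<in> I. \<ominus>\<^bsub>M i\<^esub> x i) \<in> carrier (direct_product I M)"
    using x abelian_group.a_inv_closed[OF M] by (auto simp: PiE_iff)
  moreover have "(\<lambda>i \<in> I. \<ominus>\<^bsub>M i\<^esub> x i) \<oplus>\<^bsub>direct_product I M\<^esub> x = \<zero>\<^bsub>direct_product I M\<^esub>"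
    using x abelian_group.l_neg[OF M] by (auto intro!: restrict_ext simp: PiE_iff)
  ultimately show "\<exists>y \<in> carrier (direct_product I M). y \<oplus>\<^bsub>direct_product I M\<^esub> x = \<zero>\<^bsub>direct_product I M\<^esub>"
    by blast
  show "x \<oplus>\<^bsub>direct_product I M\<^esub> y \<in> carrier (direct_product I M)"
    using x y by (auto simp: PiE_iff)
  show "\<one>\<^bsub>R\<^esub> \<odot>\<^bsub>direct_product I M\<^esub> x = x"
    using x left_module.smult_one[OF assms(2)] by (auto intro!: ext simp: PiE_iff extensional_def)
  fix r assume r: "r \<in> carrier R"
  show "r \<odot>\<^bsub>direct_product I M\<^esub> x \<in> carrier (direct_product I M)"
    using x r by (auto simp: PiE_iff)
  show "r \<odot>\<^bsub>direct_product I M\<^esub> (x \<oplus>\<^bsub>direct_product I M\<^esub> y) =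
    r \<odot>\<^bsub>direct_product I M\<^esub> x \<oplus>\<^bsub>direct_product I M\<^esub> r \<odot>\<^bsub>direct_product I M\<^esub> y"
    using x y r left_module.smult_r_distr[OF assms(2)] by (auto intro!: restrict_ext simp: PiE_iff)
  fix s assume s: "s \<in> carrier R"
  show "(r \<oplus>\<^bsub>R\<^esub> s) \<odot>\<^bsub>direct_product I M\<^esub> x =
    r \<odot>\<^bsub>direct_product I M\<^esub> x \<oplus>\<^bsub>direct_product I M\<^esub> s \<odot>\<^bsub>direct_product I M\<^esub> x"
    using x r s left_module.smult_l_distr[OF assms(2)] by (auto intro!: restrict_ext simp: PiE_iff)
  show "(r \<otimes>\<^bsub>R\<^esub> s) \<odot>\<^bsub>direct_product I M\<^esub> x =
    r \<odot>\<^bsub>direct_product I M\<^esub> (s \<odot>\<^bsub>direct_product I M\<^esub> x)"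
    using x r s left_module.smult_assoc1[OF assms(2)] by (auto intro!: restrict_ext simp: PiE_iff)
qed (rule assms(1))

text \<open>\<open>finsupp_module R Y L\<close> is the direct sum of the left ideals \<open>L y\<close>, inside \<open>R\<^sup>Y\<close>.\<close>

definition finsupp_module ::
    "('r, 'x) ring_scheme \<Rightarrow> 'i set \<Rightarrow> ('i \<Rightarrow> 'r set) \<Rightarrow> ('r, 'i \<Rightarrow> 'r) module" where
  "finsupp_module R Y L = (direct_product Y (\<lambda>_. regular_module R))
     \<lparr>carrier := {u \<in> \<Pi>\<^sub>E y \<in> Y. L y. finite {y \<in> Y. u y \<noteq> \<zero>\<^bsub>R\<^esub>}}\<rparr>"

lemma finsupp_module_simps [simp]:
  "carrier (finsupp_module R Y L) = {u \<in> \<Pi>\<^sub>E y \<in> Y. L y. finite {y \<in> Y. u y \<noteq> \<zero>\<^bsub>R\<^esub>}}"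
  "\<zero>\<^bsub>finsupp_module R Y L\<^esub> = (\<lambda>y \<in> Y. \<zero>\<^bsub>R\<^esub>)"
  "u \<oplus>\<^bsub>finsupp_module R Y L\<^esub> v = (\<lambda>y \<in> Y. u y \<oplus>\<^bsub>R\<^esub> v y)"
  "r \<odot>\<^bsub>finsupp_module R Y L\<^esub> u = (\<lambda>y \<in> Y. r \<otimes>\<^bsub>R\<^esub> u y)"
  by (auto simp: finsupp_module_def)

lemma finsupp_module_module:
  assumes "ring R" "\<And>y. y \<in> Y \<Longrightarrow> submodule (L y) R (regular_module R)"
  shows "left_module R (finsupp_module R Y L)"
proof -
  interpret D: left_module R "direct_product Y (\<lambda>_. regular_module R)"
    by (rule direct_product_module[OF assms(1) regular_left_module[OF assms(1)]])
  interpret r: left_module R "regular_module R" by (rule regular_left_module[OF assms(1)])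
  note L = r.submoduleD[OF assms(2), simplified]
  show ?thesis
    unfolding finsupp_module_def
  proof (rule D.submodule_module, rule D.submoduleI)
    show "{u \<in> \<Pi>\<^sub>E y \<in> Y. L y. finite {y \<in> Y. u y \<noteq> \<zero>\<^bsub>R\<^esub>}}
      \<subseteq> carrier (direct_product Y (\<lambda>_. regular_module R))"
      using L(1) by (auto simp: PiE_iff extensional_def)
    fix x y assume "x \<in> {u \<in> \<Pi>\<^sub>E y \<in> Y. L y. finite {y \<in> Y. u y \<noteq> \<zero>\<^bsub>R\<^esub>}}"
      "y \<in> {u \<in> \<Pi>\<^sub>E y \<in> Y. L y. finite {y \<in> Y. u y \<noteq> \<zero>\<^bsub>R\<^esub>}}"
    then show "x \<oplus>\<^bsub>direct_product Y (\<lambda>_. regular_module R)\<^esub> y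
      \<in> {u \<in> \<Pi>\<^sub>E y \<in> Y. L y. finite {y \<in> Y. u y \<noteq> \<zero>\<^bsub>R\<^esub>}}"
      using L(3) by (auto simp: PiE_iff
          intro: finite_subset[of _ "{i \<in> Y. x i \<noteq> \<zero>\<^bsub>R\<^esub>} \<union> {i \<in> Y. y i \<noteq> \<zero>\<^bsub>R\<^esub>}"])
  next
    fix r x assume "r \<in> carrier R" "x \<in> {u \<in> \<Pi>\<^sub>E y \<in> Y. L y. finite {y \<in> Y. u y \<noteq> \<zero>\<^bsub>R\<^esub>}}"
    then show "r \<odot>\<^bsub>direct_product Y (\<lambda>_. regular_module R)\<^esub> x
      \<in> {u \<in> \<Pi>\<^sub>E y \<in> Y. L y. finite {y \<in> Y. u y \<noteq> \<zero>\<^bsub>R\<^esub>}}"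
      using L(4) by (auto simp: PiE_iff elim!: rev_finite_subset)
  qed (use L(2) in auto)
qed

lemma finsupp_coordinates:
  assumes "ring R" "\<And>y. y \<in> Y \<Longrightarrow> submodule (L y) R (regular_module R)"
  shows "coordinates R (finsupp_module R Y L) Y (\<lambda>y. \<lambda>u \<in> carrier (finsupp_module R Y L). u y)"
proof -
  interpret F: left_module R "finsupp_module R Y L" by (rule finsupp_module_module[OF assms])
  interpret r: left_module R "regular_module R" by (rule regular_left_module[OF assms(1)])
  note L = r.submoduleD(1)[OF assms(2), simplified]
  show ?thesis
    unfolding coordinates_def
  proof (intro conjI ballI)
    fix y assume "y \<in> Y"
    then show "(\<lambda>u \<in> carrier (finsupp_module R Y L). u y) \<in> mod_hom R (finsupp_module R Y L) (regular_module R)"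
      using L by (intro restrict_mod_homI[OF F.left_module_axioms]) (auto simp: PiE_iff)
  next
    fix u assume "u \<in> carrier (finsupp_module R Y L)"
    then show "finsupp R Y (\<lambda>i. (\<lambda>u \<in> carrier (finsupp_module R Y L). u i) u)"
      using L by (auto simp: finsupp_def PiE_iff)
  qed
qed

section \<open>Dual bases of projective modules over a small ring\<close>

locale small_ring = universe U + R?: ring R for U :: "'v itself" and R :: "'v ring" (structure) +
  assumes small_carrier: "small (carrier R)"
begin

lemma regular_small: "carrier R \<prec> (UNIV :: 'v set)"
  using small_carrier by (simp add: small_def)

lemma finsupp_module_small:
  assumes "Y \<prec> (UNIV :: 'v set)" "\<And>y. y \<in> Y \<Longrightarrow> L y \<subseteq> carrier R"
  shows "carrier (finsupp_module R Y L) \<prec> (UNIV :: 'v set)"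
proof (rule subset_small)
  show "(\<Pi>\<^sub>E y \<in> Y. carrier R) \<prec> (UNIV :: 'v set)"
    by (rule PiE_small[OF assms(1) regular_small])
qed (use assms(2) in \<open>auto simp: PiE_iff extensional_def\<close>)

text \<open>The free module on the set \<open>carrier P\<close> maps onto \<open>P\<close>.
  Projectivity gives a section, and the components of the section are the coordinates.\<close>

lemma projective_dual_basis:
  fixes P :: "('v, 'a) module"
  assumes "projective R P" "carrier P \<prec> (UNIV :: 'v set)"
  obtains c where "dual_basis R P (carrier P) (\<lambda>x. x) c"
proof -
  have P: "left_module R P" using assms by (simp add: projective_def)
  interpret P: left_module R P by fact
  let ?F = "finsupp_module R (carrier P) (\<lambda>_. carrier R)"
  interpret r: left_module R "regular_module R" by (rule regular_left_module[OF ring_axioms])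
  have sub: "submodule (carrier R) R (regular_module R)" using r.carrier_submodule by simp
  interpret F: left_module R ?F by (rule finsupp_module_module[OF ring_axioms sub])
  have co: "coordinates R ?F (carrier P) (\<lambda>y. \<lambda>u \<in> carrier ?F. u y)"
    by (rule finsupp_coordinates[OF ring_axioms sub])
  define \<psi> where "\<psi> = (\<lambda>u \<in> carrier ?F. lincomb R P (carrier P) (\<lambda>i. (\<lambda>u \<in> carrier ?F. u i) u) (\<lambda>x. x))"
  have \<psi>: "\<psi> \<in> mod_hom R ?F P"
    unfolding \<psi>_def by (rule lincomb_mod_hom[OF F.left_module_axioms P co]) auto
  have \<psi>_app: "\<psi> u = lincomb R P (carrier P) u (\<lambda>x. x)" if "u \<in> carrier ?F" for u
    using that by (simp add: \<psi>_def)
  have onto: "\<exists>u \<in> carrier ?F. \<psi> u = x" if x: "x \<in> carrier P" for x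
  proof -
    define u where "u = (\<lambda>i \<in> carrier P. if i = x then \<one> else \<zero>)"
    have u: "u \<in> carrier ?F"
      by (auto simp: u_def PiE_iff intro!: finite_subset[of _ "{x}"])
    have "lincomb R P (carrier P) u (\<lambda>x. x) =
      lincomb R P (carrier P) (\<lambda>i. if i = x then \<one> else \<zero>) (\<lambda>x. x)"
      by (rule P.lincomb_cong) (auto simp: u_def)
    also have "\<dots> = x" using P.lincomb_delta[OF x, of "\<lambda>x. x" "\<one>"] x by simp
    finally show ?thesis using u \<psi>_app by blast
  qed
  \<comment> \<open>Lifting is available only against modules with elements in \<open>'v\<close>, so
    the free module and \<open>P\<close> are both replaced by copies there.\<close>
  have "carrier ?F \<prec> (UNIV :: 'v set)" by (rule finsupp_module_small[OF assms(2)]) auto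
  then obtain F' :: "('v, 'v) module" and \<theta> where F': "F' \<in> modules R" "\<theta> \<in> mod_iso R ?F F'"
    using module_copy[OF F.left_module_axioms] by blast
  obtain P' :: "('v, 'v) module" and \<pi> where P': "P' \<in> modules R" "\<pi> \<in> mod_iso R P P'"
    using module_copy[OF P assms(2)] by blast
  have lF': "left_module R F'" and lP': "left_module R P'" using F' P' by (auto simp: modules_def)
  obtain \<theta>' where \<theta>': "\<theta>' \<in> mod_iso R F' ?F" "\<And>u. u \<in> carrier ?F \<Longrightarrow> \<theta>' (\<theta> u) = u"
    by (rule mod_iso_inverse[OF F.left_module_axioms lF' F'(2)]) blast
  define g where "g = compose (carrier F') \<pi> (compose (carrier F') \<psi> \<theta>')"
  have g: "g \<in> mod_hom R F' P'"
    unfolding g_def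
    by (rule compose_mod_hom[OF lF' compose_mod_hom[OF lF' mod_isoD(1)[OF \<theta>'(1)] \<psi>] mod_isoD(1)[OF P'(2)]])
  have "g ` carrier F' = carrier P'"
  proof
    show "g ` carrier F' \<subseteq> carrier P'" using mod_homD(1)[OF g] by auto
    show "carrier P' \<subseteq> g ` carrier F'"
    proof
      fix y assume "y \<in> carrier P'"
      then obtain x where x: "x \<in> carrier P" "y = \<pi> x"
        using mod_isoD(2)[OF P'(2)] by (auto simp: bij_betw_def)
      then obtain u where u: "u \<in> carrier ?F" "\<psi> u = x" using onto by blast
      have "\<theta> u \<in> carrier F'" using mod_homD(1)[OF mod_isoD(1)[OF F'(2)]] u(1) by blast
      moreover have "g (\<theta> u) = y"
        using calculation u x \<theta>'(2)[OF u(1)] by (simp add: g_def compose_def)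
      ultimately show "y \<in> g ` carrier F'" by blast
    qed
  qed
  then obtain h where h: "h \<in> mod_hom R P F'" "compose (carrier P) g h = \<pi>"
    using assms(1) F'(1) P'(1) g mod_isoD(1)[OF P'(2)] unfolding projective_def by metis
  define s where "s = compose (carrier P) \<theta>' h"
  have s: "s \<in> mod_hom R P ?F"
    unfolding s_def by (rule compose_mod_hom[OF P h(1) mod_isoD(1)[OF \<theta>'(1)]])
  have \<psi>s: "\<psi> (s x) = x" if x: "x \<in> carrier P" for x
  proof -
    have hx: "h x \<in> carrier F'" using mod_homD(1)[OF h(1) x] .
    have "\<pi> x = \<pi> (\<psi> (\<theta>' (h x)))"
      using fun_cong[OF h(2), of x] x hx by (simp add: compose_def g_def)
    moreover have "\<psi> (\<theta>' (h x)) \<in> carrier P"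
      using mod_homD(1)[OF \<psi>] mod_homD(1)[OF mod_isoD(1)[OF \<theta>'(1)] hx] by blast
    ultimately have "x = \<psi> (\<theta>' (h x))"
      using mod_isoD(2)[OF P'(2)] x by (auto simp: bij_betw_def inj_on_def)
    then show ?thesis using x by (simp add: s_def compose_def)
  qed
  have sF: "s y \<in> carrier ?F" if "y \<in> carrier P" for y using mod_homD(1)[OF s that] .
  have "dual_basis R P (carrier P) (\<lambda>x. x) (\<lambda>i. \<lambda>y \<in> carrier P. s y i)"
    unfolding dual_basis_def coordinates_def
  proof (intro conjI ballI)
    fix i assume i: "i \<in> carrier P"
    show "(\<lambda>y \<in> carrier P. s y i) \<in> mod_hom R P (regular_module R)"
      by (rule restrict_mod_homI[OF P])
        (use i sF in \<open>auto simp: PiE_iff mod_homD(3)[OF s] mod_homD(4)[OF s]\<close>)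
  next
    fix y assume y: "y \<in> carrier P"
    show "finsupp R (carrier P) (\<lambda>i. (\<lambda>y \<in> carrier P. s y i) y)"
      using sF[OF y] y by (auto simp: finsupp_def PiE_iff)
    show "lincomb R P (carrier P) (\<lambda>i. (\<lambda>y \<in> carrier P. s y i) y) (\<lambda>x. x) = y"
      using \<psi>s[OF y] \<psi>_app[OF sF[OF y]] y by simp
  qed auto
  then show ?thesis using that by blast
qed

text \<open>Through a dual basis the lifting property passes from objects of \<open>LMod R\<close>
  to epimorphisms between modules with elements of any type.\<close>

lemma projective_lift:
  fixes P :: "('v, 'a) module"
  assumes "projective R P" "carrier P \<prec> (UNIV :: 'v set)" "left_module R N" "left_module R L"
    and "g \<in> mod_hom R N L" "g ` carrier N = carrier L" "f \<in> mod_hom R P L"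
  obtains h where "h \<in> mod_hom R P N" "\<And>x. x \<in> carrier P \<Longrightarrow> g (h x) = f x"
proof -
  obtain c where "dual_basis R P (carrier P) (\<lambda>x. x) c"
    by (rule projective_dual_basis[OF assms(1,2)])
  moreover have "left_module R P" using assms(1) by (simp add: projective_def)
  ultimately show ?thesis using dual_basis_lift[OF _ _ assms(3-7)] that by metis
qed

end

section \<open>Direct sum decompositions\<close>

context left_module
begin

lemma diff_zero: "x \<in> carrier M \<Longrightarrow> x \<ominus>\<^bsub>M\<^esub> \<zero>\<^bsub>M\<^esub> = x"
  by (simp add: diff_eq_iff)

lemma diff_diff_eq:
  assumes "x \<in> carrier M" "p \<in> carrier M" "q \<in> carrier M"
  shows "(x \<ominus>\<^bsub>M\<^esub> q) \<ominus>\<^bsub>M\<^esub> (x \<ominus>\<^bsub>M\<^esub> p) = p \<ominus>\<^bsub>M\<^esub> q"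
proof -
  have "(x \<ominus>\<^bsub>M\<^esub> q) \<ominus>\<^bsub>M\<^esub> (x \<ominus>\<^bsub>M\<^esub> p) = (x \<oplus>\<^bsub>M\<^esub> \<ominus>\<^bsub>M\<^esub> x) \<oplus>\<^bsub>M\<^esub> (p \<ominus>\<^bsub>M\<^esub> q)"
    using assms by (simp add: a_minus_def M.minus_add M.add.m_ac)
  then show ?thesis using assms by (simp add: M.r_neg)
qed

end

lemma direct_sum_of_section:
  assumes "left_module R M" "left_module R Q" "f \<in> mod_hom R M Q" "s \<in> mod_hom R Q M"
    and fs: "\<And>y. y \<in> carrier Q \<Longrightarrow> f (s y) = y"
  shows "internal_direct_sum R M (mod_kernel M Q f) (s ` carrier Q)"
proof -
  interpret f: mod_homs R M Q f by (rule mod_homsI) (use assms in auto)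
  interpret s: mod_homs R Q M s by (rule mod_homsI) (use assms in auto)
  show ?thesis
    unfolding internal_direct_sum_def
  proof (intro conjI)
    show "submodule (mod_kernel M Q f) R M" by (rule f.kernel_submodule)
    show "submodule (s ` carrier Q) R M" by (rule s.image_submodule[OF f.N.carrier_submodule])
    show "carrier M = mod_kernel M Q f <+>\<^bsub>M\<^esub> s ` carrier Q"
    proof (intro subset_antisym subsetI)
      fix x assume x: "x \<in> carrier M"
      have "f (x \<ominus>\<^bsub>M\<^esub> s (f x)) = \<zero>\<^bsub>Q\<^esub>"
        using x fs by (simp add: f.f_diff f.N.diff_eq_zero_iff)
      then have "x \<ominus>\<^bsub>M\<^esub> s (f x) \<in> mod_kernel M Q f" using x by (simp add: mod_kernel_def)
      moreover have "x = (x \<ominus>\<^bsub>M\<^esub> s (f x)) \<oplus>\<^bsub>M\<^esub> s (f x)"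
        using x by (simp add: f.M.diff_add_cancel)
      ultimately show "x \<in> mod_kernel M Q f <+>\<^bsub>M\<^esub> s ` carrier Q"
        unfolding f.M.set_add_iff using x by blast
    next
      fix x assume "x \<in> mod_kernel M Q f <+>\<^bsub>M\<^esub> s ` carrier Q"
      then show "x \<in> carrier M" by (auto simp: f.M.set_add_iff mod_kernel_def)
    qed
    show "mod_kernel M Q f \<inter> s ` carrier Q = {\<zero>\<^bsub>M\<^esub>}"
    proof (intro subset_antisym subsetI)
      fix x assume "x \<in> mod_kernel M Q f \<inter> s ` carrier Q"
      then obtain y where "y \<in> carrier Q" "x = s y" "f x = \<zero>\<^bsub>Q\<^esub>" by (auto simp: mod_kernel_def)
      then show "x \<in> {\<zero>\<^bsub>M\<^esub>}" using fs by auto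
    next
      fix x assume "x \<in> {\<zero>\<^bsub>M\<^esub>}"
      moreover have "\<zero>\<^bsub>M\<^esub> = s \<zero>\<^bsub>Q\<^esub>" "f (s \<zero>\<^bsub>Q\<^esub>) = \<zero>\<^bsub>Q\<^esub>" by simp_all
      ultimately show "x \<in> mod_kernel M Q f \<inter> s ` carrier Q"
        by (auto simp: mod_kernel_def simp del: s.f_zero)
    qed
  qed
qed

lemma direct_sum_projection:
  assumes "left_module R M" "internal_direct_sum R M K P"
  obtains \<pi> where "\<pi> \<in> mod_hom R M (M\<lparr>carrier := P\<rparr>)"
    "\<And>x. x \<in> P \<Longrightarrow> \<pi> x = x" "\<And>x. x \<in> K \<Longrightarrow> \<pi> x = \<zero>\<^bsub>M\<^esub>"
    "\<And>x. x \<in> carrier M \<Longrightarrow> x \<ominus>\<^bsub>M\<^esub> \<pi> x \<in> K"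
    "\<And>x. x \<in> carrier M \<Longrightarrow> \<pi> x = \<zero>\<^bsub>M\<^esub> \<longleftrightarrow> x \<in> K"
proof -
  interpret M: left_module R M by fact
  have K: "submodule K R M" and P: "submodule P R M" and sum: "carrier M = K <+>\<^bsub>M\<^esub> P"
    and int: "K \<inter> P = {\<zero>\<^bsub>M\<^esub>}"
    using assms(2) by (auto simp: internal_direct_sum_def)
  note KD = M.submoduleD[OF K] and PD = M.submoduleD[OF P]
  have uniq: "p = q" if "x \<in> carrier M" "p \<in> P" "q \<in> P" "x \<ominus>\<^bsub>M\<^esub> p \<in> K" "x \<ominus>\<^bsub>M\<^esub> q \<in> K" for x p q
  proof -
    have pq: "p \<in> carrier M" "q \<in> carrier M" using that PD(1) by auto
    have "(x \<ominus>\<^bsub>M\<^esub> q) \<ominus>\<^bsub>M\<^esub> (x \<ominus>\<^bsub>M\<^esub> p) = p \<ominus>\<^bsub>M\<^esub> q"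
      using that(1) pq by (rule M.diff_diff_eq)
    then have "p \<ominus>\<^bsub>M\<^esub> q \<in> K" using KD(6)[OF that(5,4)] by simp
    then have "p \<ominus>\<^bsub>M\<^esub> q \<in> K \<inter> P" using PD(6)[OF that(2,3)] by simp
    then have "p \<ominus>\<^bsub>M\<^esub> q = \<zero>\<^bsub>M\<^esub>" unfolding int by simp
    then show ?thesis using pq by (simp add: M.diff_eq_zero_iff)
  qed
  have ex: "\<exists>p \<in> P. x \<ominus>\<^bsub>M\<^esub> p \<in> K" if "x \<in> carrier M" for x
  proof -
    have "\<exists>k \<in> K. \<exists>p \<in> P. x = k \<oplus>\<^bsub>M\<^esub> p"
      using that M.set_add_iff[of x K P] unfolding sum by blast
    then obtain k p where kp: "k \<in> K" "p \<in> P" "x = k \<oplus>\<^bsub>M\<^esub> p" by blast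
    then have "x \<ominus>\<^bsub>M\<^esub> p = k" using KD(1) PD(1) by (subst M.diff_eq_iff[OF that]) (auto intro: M.M.a_comm)
    then have "x \<ominus>\<^bsub>M\<^esub> p \<in> K" using kp by simp
    then show ?thesis using kp(2) by blast
  qed
  \<comment> \<open>\<open>\<pi> x\<close> is the unique \<open>p\<close> in \<open>P\<close> for
    which \<open>x - p\<close> lies in \<open>K\<close>; uniqueness is what gives linearity
    below.\<close>
  define \<pi> where "\<pi> = (\<lambda>x \<in> carrier M. SOME p. p \<in> P \<and> x \<ominus>\<^bsub>M\<^esub> p \<in> K)"
  have \<pi>: "\<pi> x \<in> P" "x \<ominus>\<^bsub>M\<^esub> \<pi> x \<in> K" if "x \<in> carrier M" for x
    using someI_ex[of "\<lambda>p. p \<in> P \<and> x \<ominus>\<^bsub>M\<^esub> p \<in> K"] ex[OF that] that by (auto simp: \<pi>_def)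
  have \<pi>I: "\<pi> x = p" if "x \<in> carrier M" "p \<in> P" "x \<ominus>\<^bsub>M\<^esub> p \<in> K" for x p
    using uniq[OF that(1) \<pi>(1)[OF that(1)] that(2) \<pi>(2)[OF that(1)] that(3)] .
  have \<pi>c: "\<pi> x \<in> carrier M" if "x \<in> carrier M" for x using \<pi>(1)[OF that] PD(1) by auto
  have "\<pi> \<in> mod_hom R M (M\<lparr>carrier := P\<rparr>)"
  proof (rule mod_homI)
    fix x y assume xy: "x \<in> carrier M" "y \<in> carrier M"
    have "(x \<oplus>\<^bsub>M\<^esub> y) \<ominus>\<^bsub>M\<^esub> (\<pi> x \<oplus>\<^bsub>M\<^esub> \<pi> y) = (x \<ominus>\<^bsub>M\<^esub> \<pi> x) \<oplus>\<^bsub>M\<^esub> (y \<ominus>\<^bsub>M\<^esub> \<pi> y)"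
      using xy \<pi>c by (simp add: a_minus_def M.M.minus_add M.M.add.m_ac)
    then show "\<pi> (x \<oplus>\<^bsub>M\<^esub> y) = \<pi> x \<oplus>\<^bsub>M\<lparr>carrier := P\<rparr>\<^esub> \<pi> y"
      using xy \<pi> KD(3) PD(3) by (intro \<pi>I) auto
  next
    fix r x assume rx: "r \<in> carrier R" "x \<in> carrier M"
    then have "r \<odot>\<^bsub>M\<^esub> x \<ominus>\<^bsub>M\<^esub> r \<odot>\<^bsub>M\<^esub> \<pi> x = r \<odot>\<^bsub>M\<^esub> (x \<ominus>\<^bsub>M\<^esub> \<pi> x)"
      using \<pi>c by (simp add: M.smult_r_sub)
    then show "\<pi> (r \<odot>\<^bsub>M\<^esub> x) = r \<odot>\<^bsub>M\<lparr>carrier := P\<rparr>\<^esub> \<pi> x"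
      using rx \<pi> KD(4) PD(4) by (intro \<pi>I) auto
  qed (use \<pi> in \<open>auto simp: \<pi>_def\<close>)
  moreover have "\<pi> x = x" if "x \<in> P" for x
  proof -
    have "x \<ominus>\<^bsub>M\<^esub> x = \<zero>\<^bsub>M\<^esub>" using that PD(1) by (subst M.diff_eq_zero_iff) auto
    then show ?thesis using that PD(1) KD(2) by (intro \<pi>I) auto
  qed
  moreover have \<pi>0: "\<pi> x = \<zero>\<^bsub>M\<^esub>" if "x \<in> K" for x
  proof -
    have "x \<ominus>\<^bsub>M\<^esub> \<zero>\<^bsub>M\<^esub> = x" using that KD(1) M.diff_zero by auto
    then show ?thesis using that PD(2) KD(1) by (intro \<pi>I) auto
  qed
  moreover have "\<pi> x = \<zero>\<^bsub>M\<^esub> \<longleftrightarrow> x \<in> K" if "x \<in> carrier M" for x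
    using \<pi>(2)[OF that] \<pi>0 M.diff_zero[OF that] by auto
  ultimately show ?thesis using that \<pi>(2) by blast
qed

lemma internal_direct_sum_commute:
  assumes "left_module R M" "internal_direct_sum R M K P"
  shows "internal_direct_sum R M P K"
proof -
  interpret M: left_module R M by fact
  have "K <+>\<^bsub>M\<^esub> P = P <+>\<^bsub>M\<^esub> K"
    using assms(2) M.submoduleD(1) unfolding internal_direct_sum_def
    by (auto simp: M.set_add_iff) (metis M.M.a_comm subset_iff)+
  then show ?thesis using assms(2) by (auto simp: internal_direct_sum_def)
qed

text \<open>The map onto its projective image has a section. The range of the section is a
  complement of the kernel and, being isomorphic to the image, is projective.\<close>

lemma (in small_ring) projective_image_splits:
  fixes M :: "('v, 'a) module"
  assumes "left_module R M" "carrier M \<prec> (UNIV :: 'v set)" "left_module R Q" "f \<in> mod_hom R M Q"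
    and "projective R (Q\<lparr>carrier := f ` carrier M\<rparr>)"
  obtains P where "internal_direct_sum R M (mod_kernel M Q f) P" "projective R (M\<lparr>carrier := P\<rparr>)"
proof -
  interpret f: mod_homs R M Q f by (rule mod_homsI) (use assms in auto)
  let ?I = "Q\<lparr>carrier := f ` carrier M\<rparr>"
  have I: "left_module R ?I" using assms(5) by (simp add: projective_def)
  have fI: "f \<in> mod_hom R M ?I" by (rule mod_hom_into_submodule[OF assms(4)]) auto
  have "carrier ?I \<prec> (UNIV :: 'v set)" using image_small[OF assms(2)] by simp
  then obtain s where s: "s \<in> mod_hom R ?I M"
      "\<And>y. y \<in> carrier ?I \<Longrightarrow> f (s y) = (\<lambda>x \<in> carrier ?I. x) y"
    using projective_lift[OF assms(5) _ assms(1) I fI _ id_mod_hom[OF I]]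
    by (metis partial_object.simps(1) partial_object.surjective partial_object.update_convs(1))
  have fs: "f (s y) = y" if "y \<in> carrier ?I" for y using s(2)[OF that] that by simp
  have sum: "internal_direct_sum R M (mod_kernel M Q f) (s ` carrier ?I)"
    using direct_sum_of_section[OF assms(1) I fI s(1) fs] by (simp add: mod_kernel_def)
  let ?P = "M\<lparr>carrier := s ` carrier ?I\<rparr>"
  have P: "submodule (s ` carrier ?I) R M" using sum by (simp add: internal_direct_sum_def)
  have "projective R ?P"
  proof (rule projective_retract[OF assms(5)])
    show "left_module R ?P" by (rule f.M.submodule_module[OF P])
    show "s \<in> mod_hom R ?I ?P" by (rule mod_hom_into_submodule[OF s(1)]) auto
    show "restrict f (s ` carrier ?I) \<in> mod_hom R ?P ?I"
    proof (rule mod_hom_into_submodule[OF f.restrict_mod_hom[OF P]])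
      show "\<And>x. x \<in> carrier ?P \<Longrightarrow> restrict f (s ` carrier ?I) x \<in> f ` carrier M"
        using f.M.submoduleD(1)[OF P] by auto
    qed
    show "\<And>x. x \<in> carrier ?P \<Longrightarrow> s (restrict f (s ` carrier ?I) x) = x"
      using fs by auto
  qed
  then show ?thesis using that sum by blast
qed

section \<open>Left hereditary rings\<close>

text \<open>Kaplansky's argument: a lift on the elements of \<open>S\<close> whose coordinates vanish outside \<open>B\<close>
  extends to \<open>insert b B\<close>, since the \<open>b\<close>-th coordinates form a projective left ideal.\<close>

lemma (in small_ring) hereditary_submodule_projective:
  fixes P :: "('v, 'a) module"
  assumes her: "left_hereditary R" and P: "projective R P" "carrier P \<prec> (UNIV :: 'v set)"
    and S: "submodule S R P"
  shows "projective R (P\<lparr>carrier := S\<rparr>)"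
  unfolding projective_def
proof (intro conjI ballI impI)
  have lP: "left_module R P" using P by (simp add: projective_def)
  interpret P: left_module R P by fact
  note SD = P.submoduleD[OF S]
  show lS: "left_module R (P\<lparr>carrier := S\<rparr>)" by (rule P.submodule_module[OF S])
  fix N L :: "('v, 'v) module" and g f
  assume NL: "N \<in> modules R" "L \<in> modules R" and g: "g \<in> mod_hom R N L"
    and f: "f \<in> mod_hom R (P\<lparr>carrier := S\<rparr>) L" and onto: "g ` carrier N = carrier L"
  have lN: "left_module R N" and lL: "left_module R L" using NL by (auto simp: modules_def)
  interpret g: mod_homs R N L g by (rule mod_homsI[OF lN lL g])
  interpret f: mod_homs R "P\<lparr>carrier := S\<rparr>" L f by (rule mod_homsI[OF lS lL f])
  obtain c where db: "dual_basis R P (carrier P) (\<lambda>x. x) c"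
    by (rule projective_dual_basis[OF P])
  then have co: "coordinates R P (carrier P) c"
    and c_sum: "\<And>y. y \<in> carrier P \<Longrightarrow> lincomb R P (carrier P) (\<lambda>i. c i y) (\<lambda>x. x) = y"
    by (auto simp: dual_basis_def)
  note c = coordinatesD[OF co]
  have c_hom: "mod_homs R P (regular_module R) (c i)" if "i \<in> carrier P" for i
    by (rule mod_homsI[OF lP regular_left_module[OF ring_axioms]])
      (use co that in \<open>auto simp: coordinates_def\<close>)
  have c_zero: "c i \<zero>\<^bsub>P\<^esub> = \<zero>" if "i \<in> carrier P" for i
    using mod_homs.f_zero[OF c_hom[OF that]] by simp
  \<comment> \<open>\<open>T y\<close> is the support of \<open>y\<close> in the dual basis and
    \<open>SB B\<close> the part of \<open>S\<close> supported in \<open>B\<close>. Thus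
    \<open>SB {}\<close> is zero and \<open>SB (carrier P)\<close> is \<open>S\<close>.\<close>
  define T where "T y = {i \<in> carrier P. c i y \<noteq> \<zero>}" for y
  define SB where "SB B = {y \<in> S. T y \<subseteq> B}" for B
  have T_add: "T (x \<oplus>\<^bsub>P\<^esub> y) \<subseteq> T x \<union> T y" if "x \<in> carrier P" "y \<in> carrier P" for x y
    using that c(2) by (auto simp: T_def)
  have T_smult: "T (r \<odot>\<^bsub>P\<^esub> y) \<subseteq> T y" if "r \<in> carrier R" "y \<in> carrier P" for r y
    using that c(3) by (auto simp: T_def)
  have T_zero: "T \<zero>\<^bsub>P\<^esub> = {}" using c_zero by (auto simp: T_def)
  have T_fin: "finite (T y)" if "y \<in> carrier P" for y using c(6)[OF that] by (simp add: T_def)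
  have SB_sub: "submodule (SB B) R P" for B
  proof (rule P.submoduleI)
    show "SB B \<subseteq> carrier P" using SD(1) by (auto simp: SB_def)
    show "\<zero>\<^bsub>P\<^esub> \<in> SB B" using SD(2) T_zero by (auto simp: SB_def)
    show "x \<oplus>\<^bsub>P\<^esub> y \<in> SB B" if "x \<in> SB B" "y \<in> SB B" for x y
    proof -
      have "x \<in> carrier P" "y \<in> carrier P" using that SD(1) by (auto simp: SB_def)
      then show ?thesis using that SD(3) T_add[of x y] by (auto simp: SB_def)
    qed
    show "r \<odot>\<^bsub>P\<^esub> x \<in> SB B" if "r \<in> carrier R" "x \<in> SB B" for r x
    proof -
      have "x \<in> carrier P" using that SD(1) by (auto simp: SB_def)
      then show ?thesis using that SD(4) T_smult[of r x] by (auto simp: SB_def)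
    qed
  qed
  note SBD = P.submoduleD[OF SB_sub]
  have SB_S: "SB B \<subseteq> S" for B by (auto simp: SB_def)
  \<comment> \<open>Partial lifts on the submodules \<open>SB B\<close>, ordered by extension.
    Zorn's lemma takes the place of a well-ordering of the dual basis.\<close>
  define \<A> where "\<A> = {(B, h). B \<subseteq> carrier P \<and> h \<in> mod_hom R (P\<lparr>carrier := SB B\<rparr>) N \<and>
    (\<forall>y \<in> SB B. g (h y) = f y)}"
  define r where "r = {((B, h), (B', h')). (B, h) \<in> \<A> \<and> (B', h') \<in> \<A> \<and> B \<subseteq> B' \<and>
    (\<forall>y \<in> SB B. h' y = h y)}"
  have SB_mono: "SB B \<subseteq> SB B'" if "B \<subseteq> B'" for B B' using that by (auto simp: SB_def)
  have Field_r: "Field r = \<A>"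
    by (fastforce simp: Field_def r_def)
  have po: "Partial_order r"
    unfolding partial_order_on_def preorder_on_def Field_r
  proof (intro conjI)
    show "refl_on \<A> r" by (auto simp: refl_on_def r_def)
    show "r \<subseteq> \<A> \<times> \<A>" by (auto simp: r_def)
    show "trans r"
    proof (rule transI)
      fix a b d assume "(a, b) \<in> r" "(b, d) \<in> r"
      then show "(a, d) \<in> r"
        unfolding r_def using SB_mono by (clarsimp split: prod.splits) (metis subset_iff)
    qed
    show "antisym r"
    proof (rule antisymI)
      fix a b assume ab: "(a, b) \<in> r" "(b, a) \<in> r"
      obtain B h where a: "a = (B, h)" by (cases a)
      obtain B' h' where b: "b = (B', h')" by (cases b)
      have "B = B'" using ab a b by (auto simp: r_def)
      moreover have "h = h'"
        by (rule mod_hom_ext[of h R "P\<lparr>carrier := SB B\<rparr>" N h' N])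
          (use ab a b \<open>B = B'\<close> in \<open>auto simp: r_def \<A>_def\<close>)
      ultimately show "a = b" using a b by simp
    qed
  qed
  have "\<exists>u \<in> Field r. \<forall>a \<in> C. (a, u) \<in> r" if C: "C \<in> Chains r" for C
  proof (cases "C = {}")
    case True
    have "SB {} = {\<zero>\<^bsub>P\<^esub>}"
    proof (intro subset_antisym subsetI)
      fix y assume "y \<in> SB {}"
      then have y: "y \<in> carrier P" "T y = {}" using SD(1) by (auto simp: SB_def)
      then have "{i \<in> carrier P. c i y \<noteq> \<zero>} = {}" by (simp add: T_def)
      then have "lincomb R P (carrier P) (\<lambda>i. c i y) (\<lambda>x. x) = \<zero>\<^bsub>P\<^esub>"
        unfolding lincomb_def by (simp only:) simp
      then show "y \<in> {\<zero>\<^bsub>P\<^esub>}" using c_sum[OF y(1)] by simp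
    qed (use SBD(2) in auto)
    then have "({}, \<lambda>x \<in> SB {}. \<zero>\<^bsub>N\<^esub>) \<in> \<A>"
      using zero_mod_hom[OF P.submodule_module[OF SB_sub] lN, of "{}"] f.f_zero
      by (auto simp: \<A>_def)
    then show ?thesis using True Field_r by auto
  next
    case False
    have CA: "C \<subseteq> \<A>" using C Field_r by (auto simp: Chains_def Field_def)
    define B' where "B' = (\<Union>a \<in> C. fst a)"
    \<comment> \<open>Supports are finite, so a support inside the union lies inside one member of
      the chain. Hence the partial lifts of the chain together define a lift on all of
      \<open>SB B'\<close>.\<close>
    have cover: "\<exists>(B, h) \<in> C. Y \<subseteq> B" if "finite Y" "Y \<subseteq> B'" for Y
    proof -
      note fin = that(1)
      have 1: "Y \<subseteq> \<Union> (fst ` C)" using that(2) by (simp add: B'_def)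
      have 2: "fst ` C \<noteq> {}" using False by simp
      have 3: "subset.chain (fst ` C) (fst ` C)"
        using C unfolding subset_chain_def Chains_def by (fastforce simp: r_def)
      obtain B where "B \<in> fst ` C" "Y \<subseteq> B"
        using finite_subset_Union_chain[OF fin 1 2 3] by metis
      then show ?thesis by (metis (mono_tags, lifting) case_prod_beta imageE)
    qed
    have agree: "h y = h' y" if "(B, h) \<in> C" "(D, h') \<in> C" "y \<in> SB B" "y \<in> SB D" for B h D h' y
    proof -
      have "((B, h), (D, h')) \<in> r \<or> ((D, h'), (B, h)) \<in> r"
        using C that(1,2) by (simp add: Chains_def)
      then show ?thesis using that(3,4) by (auto simp: r_def)
    qed
    define H where "H = (\<lambda>y \<in> SB B'. SOME v. \<exists>(B, h) \<in> C. y \<in> SB B \<and> v = h y)"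
    have sub: "B \<subseteq> B'" if "(B, h) \<in> C" for B h using that by (force simp: B'_def)
    have H_eq: "H y = h y" if "(B, h) \<in> C" "y \<in> SB B" for B h y
    proof -
      have "\<exists>v. \<exists>(B, h) \<in> C. y \<in> SB B \<and> v = h y" using that by blast
      from someI_ex[OF this] obtain D h' where
        "(D, h') \<in> C" "y \<in> SB D" "(SOME v. \<exists>(B, h) \<in> C. y \<in> SB B \<and> v = h y) = h' y" by blast
      then show ?thesis using agree[OF that(1) _ that(2)] SB_mono[OF sub[OF that(1)]] that(2)
        by (auto simp: H_def)
    qed
    have two: "\<exists>B h. (B, h) \<in> C \<and> x \<in> SB B \<and> y \<in> SB B" if "x \<in> SB B'" "y \<in> SB B'" for x y
    proof -
      have "finite (T x \<union> T y)" "T x \<union> T y \<subseteq> B'" using that T_fin SD(1) by (auto simp: SB_def)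
      from cover[OF this] show ?thesis using that by (auto simp: SB_def)
    qed
    have hD: "h \<in> mod_hom R (P\<lparr>carrier := SB B\<rparr>) N" "\<And>y. y \<in> SB B \<Longrightarrow> g (h y) = f y"
      if "(B, h) \<in> C" for B h
      using CA that by (auto simp: \<A>_def)
    have "H \<in> mod_hom R (P\<lparr>carrier := SB B'\<rparr>) N"
    proof (rule mod_homI)
      fix x y assume xy: "x \<in> carrier (P\<lparr>carrier := SB B'\<rparr>)" "y \<in> carrier (P\<lparr>carrier := SB B'\<rparr>)"
      obtain B h where Bh: "(B, h) \<in> C" "x \<in> SB B" "y \<in> SB B" using two xy by force
      then have "H (x \<oplus>\<^bsub>P\<^esub> y) = h (x \<oplus>\<^bsub>P\<^esub> y)" using H_eq SBD(3) by blast
      then show "H (x \<oplus>\<^bsub>P\<lparr>carrier := SB B'\<rparr>\<^esub> y) = H x \<oplus>\<^bsub>N\<^esub> H y"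
        using H_eq[OF Bh(1)] Bh mod_homD(3)[OF hD(1)[OF Bh(1)], of x y] by simp
    next
      fix q x assume qx: "q \<in> carrier R" "x \<in> carrier (P\<lparr>carrier := SB B'\<rparr>)"
      obtain B h where Bh: "(B, h) \<in> C" "x \<in> SB B" using two qx by force
      then have "H (q \<odot>\<^bsub>P\<^esub> x) = h (q \<odot>\<^bsub>P\<^esub> x)" using H_eq SBD(4) qx(1) by blast
      then show "H (q \<odot>\<^bsub>P\<lparr>carrier := SB B'\<rparr>\<^esub> x) = q \<odot>\<^bsub>N\<^esub> H x"
        using H_eq[OF Bh(1)] Bh qx mod_homD(4)[OF hD(1)[OF Bh(1)], of q x] by simp
    next
      fix x assume "x \<in> carrier (P\<lparr>carrier := SB B'\<rparr>)"
      then obtain B h where Bh: "(B, h) \<in> C" "x \<in> SB B" using two by force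
      then show "H x \<in> carrier N" using H_eq mod_homD(1)[OF hD(1)[OF Bh(1)], of x] by simp
    qed (simp add: H_def)
    moreover have "g (H y) = f y" if "y \<in> SB B'" for y
      using two[OF that that] H_eq hD(2) by metis
    moreover have "B' \<subseteq> carrier P" using CA by (force simp: B'_def \<A>_def)
    ultimately have "(B', H) \<in> \<A>" by (simp add: \<A>_def)
    moreover have "(a, (B', H)) \<in> r" if "a \<in> C" for a
      using calculation that CA sub H_eq by (cases a) (auto simp: r_def)
    ultimately show ?thesis using Field_r by blast
  qed
  from Zorns_po_lemma[OF po this] obtain B h where Bh: "(B, h) \<in> \<A>"
    and maxi: "\<And>a. a \<in> \<A> \<Longrightarrow> ((B, h), a) \<in> r \<Longrightarrow> a = (B, h)"
    unfolding Field_r by (metis prod.exhaust)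
  have h: "h \<in> mod_hom R (P\<lparr>carrier := SB B\<rparr>) N" and gh: "\<And>y. y \<in> SB B \<Longrightarrow> g (h y) = f y"
    and BX: "B \<subseteq> carrier P"
    using Bh by (auto simp: \<A>_def)
  interpret h: mod_homs R "P\<lparr>carrier := SB B\<rparr>" N h
    by (rule mod_homsI[OF P.submodule_module[OF SB_sub] lN h])
  have "B = carrier P"
  proof (rule ccontr)
    assume "B \<noteq> carrier P"
    then obtain b where b: "b \<in> carrier P" "b \<notin> B" using BX by auto
    let ?B' = "insert b B"
    let ?S' = "P\<lparr>carrier := SB ?B'\<rparr>"
    \<comment> \<open>The left ideal of \<open>b\<close>-th coordinates is projective by heredity.
      The coordinate map onto it splits, and its kernel on the elements supported in
      \<open>insert b B\<close> is \<open>SB B\<close>, where a lift is already given.\<close>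
    let ?I = "(regular_module R)\<lparr>carrier := c b ` SB ?B'\<rparr>"
    have S': "left_module R ?S'" by (rule P.submodule_module[OF SB_sub])
    interpret S': left_module R ?S' by (rule S')
    have small_S': "carrier ?S' \<prec> (UNIV :: 'v set)"
      by (rule subset_small[OF P(2)]) (use SBD(1) in auto)
    interpret cb: mod_homs R P "regular_module R" "c b" by (rule c_hom[OF b(1)])
    have "submodule (c b ` SB ?B') R (regular_module R)" by (rule cb.image_submodule[OF SB_sub])
    then have I_proj: "projective R ?I" using her by (simp add: left_hereditary_def)
    then have I: "left_module R ?I" by (simp add: projective_def)
    have I_small: "carrier ?I \<prec> (UNIV :: 'v set)"
      using image_small[OF small_S', of "c b"] by simp
    define k where "k = restrict (c b) (SB ?B')"
    have k: "k \<in> mod_hom R ?S' ?I"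
      unfolding k_def by (rule mod_hom_into_submodule[OF cb.restrict_mod_hom[OF SB_sub]]) auto
    have "k ` carrier ?S' = carrier ?I" by (auto simp: k_def)
    from projective_lift[OF I_proj I_small S' I k this id_mod_hom[OF I]]
    obtain s where s: "s \<in> mod_hom R ?I ?S'" "\<And>y. y \<in> carrier ?I \<Longrightarrow> k (s y) = (\<lambda>x \<in> carrier ?I. x) y"
      by blast
    interpret s: mod_homs R ?I ?S' s by (rule mod_homsI[OF I S' s(1)])
    have sS: "s z \<in> SB ?B'" and cs: "c b (s z) = z" if "z \<in> c b ` SB ?B'" for z
      using s.f_closed[of z] s(2)[of z] that by (auto simp: k_def)
    have fs: "compose (carrier ?I) f s \<in> mod_hom R ?I L"
    proof (rule compose_mod_hom[OF I _ f])
      show "s \<in> mod_hom R ?I (P\<lparr>carrier := S\<rparr>)"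
        by (rule mod_hom_cong_target[OF _ _ _ s(1)]) (use SB_S in auto)
    qed
    from projective_lift[OF I_proj I_small lN lL g onto fs]
    obtain n where n: "n \<in> mod_hom R ?I N" "\<And>z. z \<in> carrier ?I \<Longrightarrow> g (n z) = compose (carrier ?I) f s z"
      by blast
    interpret n: mod_homs R ?I N n by (rule mod_homsI[OF I lN n(1)])
    \<comment> \<open>Subtracting the value of the section removes the \<open>b\<close>-th
      coordinate, so \<open>d y\<close> falls into the domain of \<open>h\<close>. The part removed
      is lifted by \<open>n\<close>, which is defined on the ideal.\<close>
    define d where "d y = y \<ominus>\<^bsub>P\<^esub> s (c b y)" for y
    have sb: "s (c b y) \<in> SB ?B'" if "y \<in> SB ?B'" for y using sS that by blast
    have SBc: "y \<in> carrier P" if "y \<in> SB D" for y D using SBD(1) that by auto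
    have d: "d y \<in> SB B" if y: "y \<in> SB ?B'" for y
    proof -
      have "d y \<in> SB ?B'" unfolding d_def by (rule SBD(6)[OF y sb[OF y]])
      moreover have "c b (d y) = \<zero>"
      proof -
        have "c b (s (c b y)) = c b y" using cs y by simp
        then have "c b (d y) = c b y \<ominus>\<^bsub>regular_module R\<^esub> c b y"
          unfolding d_def using cb.f_diff[OF SBc[OF y] SBc[OF sb[OF y]]] by simp
        then show ?thesis using cb.N.diff_eq_zero_iff cb.f_closed[OF SBc[OF y]] by simp
      qed
      ultimately show ?thesis by (auto simp: SB_def T_def)
    qed
    have sI: "c b y \<in> carrier ?I" if "y \<in> SB ?B'" for y using that by auto
    define h' where "h' = (\<lambda>y \<in> SB ?B'. h (d y) \<oplus>\<^bsub>N\<^esub> n (c b y))"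
    have h': "h' \<in> mod_hom R ?S' N"
    proof (rule mod_homI)
      fix x y assume "x \<in> carrier ?S'" "y \<in> carrier ?S'"
      then have xy: "x \<in> SB ?B'" "y \<in> SB ?B'" by auto
      note cl = xy[THEN SBc] xy[THEN sb, THEN SBc]
      have cxy: "c b (x \<oplus>\<^bsub>P\<^esub> y) = c b x \<oplus> c b y" using cl cb.f_add by simp
      have sxy: "s (c b x \<oplus> c b y) = s (c b x) \<oplus>\<^bsub>P\<^esub> s (c b y)"
        using s.f_add[OF sI[OF xy(1)] sI[OF xy(2)]] by simp
      have nxy: "n (c b x \<oplus> c b y) = n (c b x) \<oplus>\<^bsub>N\<^esub> n (c b y)"
        using n.f_add[OF sI[OF xy(1)] sI[OF xy(2)]] by simp
      have "d (x \<oplus>\<^bsub>P\<^esub> y) = d x \<oplus>\<^bsub>P\<^esub> d y"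
        unfolding d_def cxy sxy using cl by (simp add: a_minus_def P.M.minus_add P.M.add.m_ac)
      then have "h (d (x \<oplus>\<^bsub>P\<^esub> y)) = h (d x) \<oplus>\<^bsub>N\<^esub> h (d y)"
        using h.f_add[of "d x" "d y"] d xy by simp
      then show "h' (x \<oplus>\<^bsub>?S'\<^esub> y) = h' x \<oplus>\<^bsub>N\<^esub> h' y"
        using xy SBD(3)[OF xy] d h.f_closed n.f_closed sI cxy nxy
        by (simp add: h'_def g.M.M.add.m_ac)
    next
      fix q y assume "q \<in> carrier R" "y \<in> carrier ?S'"
      then have qy: "q \<in> carrier R" "y \<in> SB ?B'" by auto
      note cl = SBc[OF qy(2)] SBc[OF sb[OF qy(2)]]
      have cq: "c b (q \<odot>\<^bsub>P\<^esub> y) = q \<otimes> c b y" using cl qy cb.f_smult by simp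
      have sq: "s (q \<otimes> c b y) = q \<odot>\<^bsub>P\<^esub> s (c b y)"
        using s.f_smult[OF qy(1) sI[OF qy(2)]] by simp
      have nq: "n (q \<otimes> c b y) = q \<odot>\<^bsub>N\<^esub> n (c b y)"
        using n.f_smult[OF qy(1) sI[OF qy(2)]] by simp
      have "d (q \<odot>\<^bsub>P\<^esub> y) = q \<odot>\<^bsub>P\<^esub> d y"
        unfolding d_def cq sq using cl qy by (simp add: P.smult_r_sub)
      then have "h (d (q \<odot>\<^bsub>P\<^esub> y)) = q \<odot>\<^bsub>N\<^esub> h (d y)"
        using h.f_smult[of q "d y"] d qy by simp
      then show "h' (q \<odot>\<^bsub>?S'\<^esub> y) = q \<odot>\<^bsub>N\<^esub> h' y"
        using qy SBD(4)[OF qy] d h.f_closed n.f_closed sI cq nq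
        by (simp add: h'_def g.M.smult_r_distr)
    qed (use d h.f_closed n.f_closed sI in \<open>auto simp: h'_def\<close>)
    have gh': "g (h' y) = f y" if y: "y \<in> SB ?B'" for y
    proof -
      note cl = SBc[OF y] SBc[OF sb[OF y]]
      have dS: "d y \<in> S" "s (c b y) \<in> S" using d[OF y] sb[OF y] SB_S by auto
      have "g (h' y) = f (d y) \<oplus>\<^bsub>L\<^esub> f (s (c b y))"
        using y d[OF y] h.f_closed n.f_closed sI[OF y] n(2)[OF sI[OF y]] gh
        by (simp add: h'_def g.f_add compose_def)
      also have "\<dots> = f (d y \<oplus>\<^bsub>P\<^esub> s (c b y))" using f.f_add[of "d y" "s (c b y)"] dS by simp
      also have "d y \<oplus>\<^bsub>P\<^esub> s (c b y) = y" unfolding d_def using cl by (rule P.diff_add_cancel)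
      finally show ?thesis .
    qed
    have "(?B', h') \<in> \<A>" using b BX h' gh' by (auto simp: \<A>_def)
    moreover have "h' y = h y" if "y \<in> SB B" for y
    proof -
      have cb0: "c b y = \<zero>" using that b SD(1) by (auto simp: SB_def T_def)
      have "s \<zero> = \<zero>\<^bsub>P\<^esub>" "n \<zero> = \<zero>\<^bsub>N\<^esub>" using s.f_zero n.f_zero by auto
      then show ?thesis using that SB_mono[of B ?B'] cb0 SBc[OF that] h.f_closed[of y]
        by (auto simp: h'_def d_def P.diff_zero)
    qed
    ultimately have "((B, h), (?B', h')) \<in> r" using Bh by (auto simp: r_def)
    then show False using maxi[OF \<open>(?B', h') \<in> \<A>\<close>] b(2) by auto
  qed
  then have "SB B = S" by (auto simp: SB_def T_def)
  then have "h \<in> mod_hom R (P\<lparr>carrier := S\<rparr>) N" "\<And>y. y \<in> S \<Longrightarrow> g (h y) = f y" using h gh by auto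
  moreover have "compose (carrier (P\<lparr>carrier := S\<rparr>)) g h = f"
    by (rule mod_hom_ext[OF compose_mod_hom[OF lS calculation(1) g] f])
      (use calculation(2) in \<open>auto simp: compose_def\<close>)
  ultimately show "\<exists>h \<in> mod_hom R (P\<lparr>carrier := S\<rparr>) N. compose (carrier (P\<lparr>carrier := S\<rparr>)) g h = f"
    by blast
qed

section \<open>Stable modules\<close>

lemma modulesD:
  fixes M :: "('v, 'v) module"
  assumes "M \<in> modules R"
  shows "left_module R M" "carrier M \<prec> (UNIV :: 'v set)"
  using assms by (auto simp: modules_def small_def)

lemma internal_direct_sumD:
  assumes "internal_direct_sum R M K P"
  shows "submodule K R M" "submodule P R M" "carrier M = K <+>\<^bsub>M\<^esub> P" "K \<inter> P = {\<zero>\<^bsub>M\<^esub>}"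
  using assms by (auto simp: internal_direct_sum_def)

context small_ring
begin

lemma regular_in_modules: "regular_module R \<in> modules R"
  using regular_left_module[OF ring_axioms] small_carrier by (simp add: modules_def)

lemma regular_dual_basis:
  "dual_basis R (regular_module R) {()} (\<lambda>_. \<one>) (\<lambda>_. \<lambda>x \<in> carrier R. x)"
proof -
  interpret r: left_module R "regular_module R" by (rule regular_left_module[OF ring_axioms])
  have "(\<lambda>x \<in> carrier R. x) \<in> mod_hom R (regular_module R) (regular_module R)"
    using id_mod_hom[OF r.left_module_axioms] by simp
  moreover have "lincomb R (regular_module R) {()} (\<lambda>i. (\<lambda>x \<in> carrier R. x) y) (\<lambda>_. \<one>) = y"
    if "y \<in> carrier R" for y
  proof -
    have "lincomb R (regular_module R) {()} (\<lambda>i. (\<lambda>x \<in> carrier R. x) y) (\<lambda>_. \<one>) =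
      (\<Oplus>\<^bsub>regular_module R\<^esub> i \<in> {()}. (\<lambda>x \<in> carrier R. x) y \<odot>\<^bsub>regular_module R\<^esub> \<one>)"
      by (rule r.lincomb_eq) (use that in auto)
    also have "\<dots> = y" using that by (subst r.M.finsum_insert) auto
    finally show ?thesis .
  qed
  ultimately show ?thesis
    by (auto simp: dual_basis_def coordinates_def finsupp_def)
qed

lemma regular_projective: "projective R (regular_module R)"
  by (rule dual_basis_projective[OF regular_left_module[OF ring_axioms] regular_dual_basis])

lemma submodule_in_modules:
  assumes "M \<in> modules R" "submodule S R M"
  shows "M\<lparr>carrier := S\<rparr> \<in> modules R"
proof -
  interpret left_module R M using assms by (simp add: modules_def)
  have "S \<prec> (UNIV :: 'v set)"
    by (rule subset_small[OF _ submoduleD(1)[OF assms(2)]]) (use assms(1) in \<open>auto simp: modules_def small_def\<close>)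
  then show ?thesis using submodule_module[OF assms(2)] by (simp add: modules_def small_def)
qed

lemma summand_small:
  fixes M :: "('v, 'a) module"
  assumes "left_module R M" "carrier M \<prec> (UNIV :: 'v set)" "submodule P R M"
  shows "carrier (M\<lparr>carrier := P\<rparr>) \<prec> (UNIV :: 'v set)"
  using subset_small[OF assms(2) left_module.submoduleD(1)[OF assms(1,3)]] by simp

text \<open>If all dual basis coordinates of \<open>x\<close> vanished, its expansion would be
  zero.\<close>

lemma projective_separated:
  fixes P :: "('v, 'a) module"
  assumes "projective R P" "carrier P \<prec> (UNIV :: 'v set)" "x \<in> carrier P" "x \<noteq> \<zero>\<^bsub>P\<^esub>"
  obtains c where "c \<in> mod_hom R P (regular_module R)" "c x \<noteq> \<zero>"
proof -
  interpret P: left_module R P using assms by (simp add: projective_def)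
  obtain c where c: "dual_basis R P (carrier P) (\<lambda>x. x) c"
    by (rule projective_dual_basis[OF assms(1,2)])
  have "\<exists>i \<in> carrier P. c i x \<noteq> \<zero>"
  proof (rule ccontr)
    assume "\<not> ?thesis"
    then have *: "{i \<in> carrier P. c i x \<noteq> \<zero>} = {}" by auto
    have "lincomb R P (carrier P) (\<lambda>i. c i x) (\<lambda>x. x) = \<zero>\<^bsub>P\<^esub>"
      unfolding lincomb_def * by simp
    then show False using c assms(3,4) by (simp add: dual_basis_def)
  qed
  then show ?thesis using that c by (auto simp: dual_basis_def coordinates_def)
qed

text \<open>A nonzero element of a projective summand is detected by some homomorphism to the ring,
  and the projection extends that homomorphism to all of \<open>M\<close>.\<close>

lemma stableI:
  fixes M :: "('v, 'a) module"
  assumes "left_module R M" "carrier M \<prec> (UNIV :: 'v set)"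
    and "\<And>f x. \<lbrakk>f \<in> mod_hom R M (regular_module R); x \<in> carrier M\<rbrakk> \<Longrightarrow> f x = \<zero>"
  shows "stable R M"
  unfolding stable_def
proof (intro allI impI)
  interpret M: left_module R M by fact
  fix K P assume KP: "internal_direct_sum R M K P \<and> projective R (M\<lparr>carrier := P\<rparr>)"
  then have ds: "internal_direct_sum R M K P" and P: "submodule P R M"
    by (auto simp: internal_direct_sum_def)
  obtain \<pi> where \<pi>: "\<pi> \<in> mod_hom R M (M\<lparr>carrier := P\<rparr>)" "\<And>x. x \<in> P \<Longrightarrow> \<pi> x = x"
    by (rule direct_sum_projection[OF assms(1) ds]) (rule that)
  have "x = \<zero>\<^bsub>M\<^esub>" if x: "x \<in> P" for x
  proof (rule ccontr)
    assume "x \<noteq> \<zero>\<^bsub>M\<^esub>"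
    then obtain c where c: "c \<in> mod_hom R (M\<lparr>carrier := P\<rparr>) (regular_module R)" "c x \<noteq> \<zero>"
      using projective_separated[of "M\<lparr>carrier := P\<rparr>" x] KP x summand_small[OF assms(1,2) P] by auto
    have "compose (carrier M) c \<pi> \<in> mod_hom R M (regular_module R)"
      by (rule compose_mod_hom[OF assms(1) \<pi>(1) c(1)])
    then have "compose (carrier M) c \<pi> x = \<zero>" using assms(3) x M.submoduleD(1)[OF P] by blast
    then show False using c(2) x \<pi>(2) M.submoduleD(1)[OF P] by (auto simp: compose_def)
  qed
  then show "P = {\<zero>\<^bsub>M\<^esub>}" using M.submoduleD(2)[OF P] by blast
qed

section \<open>The largest stable submodule over a left hereditary ring\<close>

context
  assumes her: "left_hereditary R"
begin

text \<open>The image is a submodule of a projective module, hence projective by heredity, and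
  splits off. Stability makes the split-off copy zero, so the kernel is all of
  \<open>M\<close>.\<close>

lemma stable_hom_zero:
  fixes M :: "('v, 'a) module" and Q :: "('v, 'b) module"
  assumes "left_module R M" "carrier M \<prec> (UNIV :: 'v set)" "stable R M"
    and Q: "projective R Q" "carrier Q \<prec> (UNIV :: 'v set)"
    and f: "f \<in> mod_hom R M Q" and x: "x \<in> carrier M"
  shows "f x = \<zero>\<^bsub>Q\<^esub>"
proof -
  have lQ: "left_module R Q" using Q by (simp add: projective_def)
  interpret f: mod_homs R M Q f by (rule mod_homsI[OF assms(1) lQ f])
  have "projective R (Q\<lparr>carrier := f ` carrier M\<rparr>)"
    by (rule hereditary_submodule_projective[OF her Q f.image_submodule[OF f.M.carrier_submodule]])
  then obtain P where P: "internal_direct_sum R M (mod_kernel M Q f) P"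
      "projective R (M\<lparr>carrier := P\<rparr>)"
    using projective_image_splits[OF assms(1,2) lQ f] by blast
  then have P0: "P = {\<zero>\<^bsub>M\<^esub>}" using assms(3) by (simp add: stable_def)
  note D = internal_direct_sumD[OF P(1)]
  obtain k p where "k \<in> mod_kernel M Q f" "p \<in> P" "x = k \<oplus>\<^bsub>M\<^esub> p"
    using x unfolding D(3) f.M.set_add_iff by blast
  then show ?thesis using P0 by (auto simp: mod_kernel_def)
qed

lemma R_part_carrier_submodule:
  assumes "M \<in> modules R"
  shows "submodule (carrier (R_part R M)) R M"
proof -
  interpret left_module R M using assms by (simp add: modules_def)
  show ?thesis unfolding R_part_def
    by (simp, rule span_submodule) (use submoduleD(1) in blast)
qed

lemma R_part_eq: "R_part R M = M\<lparr>carrier := carrier (R_part R M)\<rparr>"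
  by (simp add: R_part_def)

lemma R_part_simps [simp]:
  "\<zero>\<^bsub>R_part R M\<^esub> = \<zero>\<^bsub>M\<^esub>" "add (R_part R M) = add M" "smult (R_part R M) = smult M"
  by (simp_all add: R_part_def)

lemma R_part_subset: "M \<in> modules R \<Longrightarrow> carrier (R_part R M) \<subseteq> carrier M"
  using R_part_carrier_submodule left_module.submoduleD(1) by (fastforce simp: modules_def)

lemma R_part_modules: "M \<in> modules R \<Longrightarrow> R_part R M \<in> modules R"
  using submodule_in_modules[OF _ R_part_carrier_submodule] by (simp add: R_part_eq[symmetric])

lemma stable_subset_R_part:
  assumes "M \<in> modules R" "submodule S R M" "stable R (M\<lparr>carrier := S\<rparr>)"
  shows "S \<subseteq> carrier (R_part R M)"
proof -
  interpret left_module R M using assms by (simp add: modules_def)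
  show ?thesis using span_superset assms(2,3) unfolding R_part_def by fastforce
qed

lemma R_part_least:
  assumes "M \<in> modules R" "submodule T R M"
    and "\<And>S. \<lbrakk>submodule S R M; stable R (M\<lparr>carrier := S\<rparr>)\<rbrakk> \<Longrightarrow> S \<subseteq> T"
  shows "carrier (R_part R M) \<subseteq> T"
proof -
  interpret left_module R M using assms by (simp add: modules_def)
  show ?thesis unfolding R_part_def by simp (rule span_subset, use assms in auto)
qed

lemma submodule_stable_hom_zero:
  fixes Q :: "('v, 'b) module"
  assumes "M \<in> modules R" "submodule S R M" "stable R (M\<lparr>carrier := S\<rparr>)"
    and "projective R Q" "carrier Q \<prec> (UNIV :: 'v set)"
    and "f \<in> mod_hom R (M\<lparr>carrier := S\<rparr>) Q" "x \<in> S"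
  shows "f x = \<zero>\<^bsub>Q\<^esub>"
  using stable_hom_zero[of "M\<lparr>carrier := S\<rparr>" Q f x] submodule_in_modules[OF assms(1,2)] assms
  by (simp add: modules_def small_def)

text \<open>The kernel of \<open>f\<close> contains every stable submodule of \<open>M\<close>,
  since maps from stable modules to projectives vanish; hence it contains the submodule they
  generate.\<close>

lemma R_part_hom_zero:
  fixes Q :: "('v, 'b) module"
  assumes M: "M \<in> modules R" and Q: "projective R Q" "carrier Q \<prec> (UNIV :: 'v set)"
    and f: "f \<in> mod_hom R (R_part R M) Q" and x: "x \<in> carrier (R_part R M)"
  shows "f x = \<zero>\<^bsub>Q\<^esub>"
proof -
  have lM: "left_module R M" and lQ: "left_module R Q" and lRM: "left_module R (R_part R M)"
    using M Q R_part_modules[OF M] by (auto simp: modules_def projective_def)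
  interpret M: left_module R M by fact
  interpret f: mod_homs R "R_part R M" Q f by (rule mod_homsI[OF lRM lQ f])
  note RM = R_part_carrier_submodule[OF M]
  define T where "T = {x \<in> carrier (R_part R M). f x \<in> {\<zero>\<^bsub>Q\<^esub>}}"
  have "submodule T R (R_part R M)"
    unfolding T_def by (rule f.vimage_submodule[OF f.N.zero_submodule])
  then have T: "submodule T R M"
    using M.submodule_of_submodule_iff[OF RM] by (simp add: R_part_eq[symmetric])
  have "carrier (R_part R M) \<subseteq> T"
  proof (rule R_part_least[OF M T])
    fix S assume S: "submodule S R M" "stable R (M\<lparr>carrier := S\<rparr>)"
    note SR = stable_subset_R_part[OF M S]
    have "submodule S R (R_part R M)"
      using M.submodule_of_submodule_iff[OF RM] S(1) SR by (simp add: R_part_eq[symmetric])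
    then have "restrict f S \<in> mod_hom R ((R_part R M)\<lparr>carrier := S\<rparr>) Q" by (rule f.restrict_mod_hom)
    then have "restrict f S \<in> mod_hom R (M\<lparr>carrier := S\<rparr>) Q" by (simp add: R_part_def)
    then have "f y = \<zero>\<^bsub>Q\<^esub>" if "y \<in> S" for y
      using submodule_stable_hom_zero[OF M S Q _ that] that by force
    then show "S \<subseteq> T" using SR by (auto simp: T_def)
  qed
  then show ?thesis using x by (auto simp: T_def)
qed

lemma hom_restrict_R_part:
  assumes "M \<in> modules R" "left_module R N" "f \<in> mod_hom R M N"
  shows "restrict f (carrier (R_part R M)) \<in> mod_hom R (R_part R M) N"
proof -
  interpret f: mod_homs R M N f by (rule mod_homsI) (use assms in \<open>auto simp: modules_def\<close>)
  show ?thesis using f.restrict_mod_hom[OF R_part_carrier_submodule[OF assms(1)]]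
    by (simp add: R_part_eq[symmetric])
qed

lemma R_part_hom_zero':
  fixes Q :: "('v, 'b) module"
  assumes M: "M \<in> modules R" and Q: "projective R Q" "carrier Q \<prec> (UNIV :: 'v set)"
    and f: "f \<in> mod_hom R M Q" and x: "x \<in> carrier (R_part R M)"
  shows "f x = \<zero>\<^bsub>Q\<^esub>"
proof -
  have "left_module R Q" using Q by (simp add: projective_def)
  from R_part_hom_zero[OF M Q hom_restrict_R_part[OF M this f] x] x show ?thesis by simp
qed

lemma R_part_stable:
  assumes "M \<in> modules R"
  shows "R_part R M \<in> stable_modules R"
proof -
  have "stable R (R_part R M)"
  proof (rule stableI)
    fix f x assume "f \<in> mod_hom R (R_part R M) (regular_module R)" "x \<in> carrier (R_part R M)"
    from R_part_hom_zero[OF assms regular_projective _ this] regular_small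
    show "f x = \<zero>" by simp
  qed (use R_part_modules[OF assms] in \<open>auto simp: modules_def small_def\<close>)
  then show ?thesis using R_part_modules[OF assms] by (simp add: stable_modules_def)
qed

lemma stable_R_part:
  assumes "M \<in> stable_modules R"
  shows "R_part R M = M"
proof -
  have M: "M \<in> modules R" "stable R M" using assms by (auto simp: stable_modules_def)
  interpret left_module R M using M by (simp add: modules_def)
  have "carrier M \<subseteq> carrier (R_part R M)"
    by (rule stable_subset_R_part[OF M(1) carrier_submodule]) (use M in simp)
  then have "carrier (R_part R M) = carrier M" using R_part_subset[OF M(1)] by auto
  then show ?thesis using R_part_eq[of M] by simp
qed

text \<open>A homomorphism to the ring on the image of \<open>R(M)\<close> pulls back to one on
  \<open>R(M)\<close>, where it vanishes. So the image is a stable submodule of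
  \<open>N\<close>.\<close>

lemma hom_R_part:
  assumes M: "M \<in> modules R" and N: "N \<in> modules R" and f: "f \<in> mod_hom R M N"
    and x: "x \<in> carrier (R_part R M)"
  shows "f x \<in> carrier (R_part R N)"
proof -
  have lM: "left_module R M" and lN: "left_module R N" using M N by (auto simp: modules_def)
  interpret f: mod_homs R M N f by (rule mod_homsI[OF lM lN f])
  let ?S = "carrier (R_part R M)"
  note S = R_part_carrier_submodule[OF M]
  have fS: "submodule (f ` ?S) R N" by (rule f.image_submodule[OF S])
  let ?N = "N\<lparr>carrier := f ` ?S\<rparr>"
  have N': "?N \<in> modules R" by (rule submodule_in_modules[OF N fS])
  have "stable R ?N"
  proof (rule stableI)
    fix g y assume g: "g \<in> mod_hom R ?N (regular_module R)" and y: "y \<in> carrier ?N"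
    have r: "restrict f ?S \<in> mod_hom R (R_part R M) ?N"
      by (rule mod_hom_into_submodule[OF hom_restrict_R_part[OF M lN f]]) auto
    have lR: "left_module R (R_part R M)" using R_part_modules[OF M] by (simp add: modules_def)
    obtain x where xy: "x \<in> ?S" "y = f x" using y by auto
    have "compose ?S g (restrict f ?S) x = \<zero>\<^bsub>regular_module R\<^esub>"
      by (rule R_part_hom_zero[OF M regular_projective _ compose_mod_hom[OF lR r g] xy(1)])
        (simp add: regular_small)
    then show "g y = \<zero>" using xy by (simp add: compose_def)
  qed (use N' in \<open>auto simp: modules_def small_def\<close>)
  then have "f ` ?S \<subseteq> carrier (R_part R N)" by (rule stable_subset_R_part[OF N fS])
  then show ?thesis using x by auto
qed

end

end

section \<open>Splitting off the maximal stable submodule\<close>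

lemma direct_sum_simps [simp]:
  "carrier (direct_sum M N) = carrier M \<times> carrier N"
  "\<zero>\<^bsub>direct_sum M N\<^esub> = (\<zero>\<^bsub>M\<^esub>, \<zero>\<^bsub>N\<^esub>)"
  "(x, y) \<oplus>\<^bsub>direct_sum M N\<^esub> (x', y') = (x \<oplus>\<^bsub>M\<^esub> x', y \<oplus>\<^bsub>N\<^esub> y')"
  "r \<odot>\<^bsub>direct_sum M N\<^esub> (x, y) = (r \<odot>\<^bsub>M\<^esub> x, r \<odot>\<^bsub>N\<^esub> y)"
  by (auto simp: direct_sum_def)

lemma direct_sum_module:
  assumes "left_module R M" "left_module R N"
  shows "left_module R (direct_sum M N)"
proof -
  interpret M: left_module R M by fact
  interpret N: left_module R N by fact
  show ?thesis
  proof (rule left_moduleI)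
    fix x assume "x \<in> carrier (direct_sum M N)"
    then obtain a b where x: "x = (a, b)" "a \<in> carrier M" "b \<in> carrier N" by auto
    then have "(\<ominus>\<^bsub>M\<^esub> a, \<ominus>\<^bsub>N\<^esub> b) \<oplus>\<^bsub>direct_sum M N\<^esub> x = \<zero>\<^bsub>direct_sum M N\<^esub>"
      by (simp add: M.M.l_neg N.M.l_neg)
    then show "\<exists>y \<in> carrier (direct_sum M N). y \<oplus>\<^bsub>direct_sum M N\<^esub> x = \<zero>\<^bsub>direct_sum M N\<^esub>"
      using x by (intro bexI[of _ "(\<ominus>\<^bsub>M\<^esub> a, \<ominus>\<^bsub>N\<^esub> b)"]) auto
  next
    fix x y assume "x \<in> carrier (direct_sum M N)" "y \<in> carrier (direct_sum M N)"
    then show "x \<oplus>\<^bsub>direct_sum M N\<^esub> y = y \<oplus>\<^bsub>direct_sum M N\<^esub> x"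
      by (auto intro: M.M.a_comm N.M.a_comm)
  qed (auto simp: M.R.ring_axioms M.M.a_assoc N.M.a_assoc M.smult_l_distr N.smult_l_distr
    M.smult_r_distr N.smult_r_distr M.smult_assoc1 N.smult_assoc1)
qed

definition R_part_splits :: "'v ring \<Rightarrow> ('v, 'v) module \<Rightarrow> bool" where
  "R_part_splits R M \<longleftrightarrow> (\<exists>P. internal_direct_sum R M (carrier (R_part R M)) P \<and>
     projective R (M\<lparr>carrier := P\<rparr>))"

context small_ring
begin

text \<open>The empty family is a dual basis.\<close>

lemma zero_module_projective:
  assumes "M \<in> modules R"
  shows "M\<lparr>carrier := {\<zero>\<^bsub>M\<^esub>}\<rparr> \<in> projectives R"
proof -
  interpret M: left_module R M using assms by (rule modulesD)
  have Z: "M\<lparr>carrier := {\<zero>\<^bsub>M\<^esub>}\<rparr> \<in> modules R"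
    by (rule submodule_in_modules[OF assms M.zero_submodule])
  interpret Z: left_module R "M\<lparr>carrier := {\<zero>\<^bsub>M\<^esub>}\<rparr>" using Z by (rule modulesD)
  have "lincomb R (M\<lparr>carrier := {\<zero>\<^bsub>M\<^esub>}\<rparr>) {} u b = \<zero>\<^bsub>M\<^esub>" for u :: "nat \<Rightarrow> _" and b
    unfolding lincomb_def using Z.M.finsum_empty by simp
  then have "dual_basis R (M\<lparr>carrier := {\<zero>\<^bsub>M\<^esub>}\<rparr>) ({} :: nat set) undefined undefined"
    by (auto simp: dual_basis_def coordinates_def finsupp_def)
  then have "projective R (M\<lparr>carrier := {\<zero>\<^bsub>M\<^esub>}\<rparr>)"
    by (rule dual_basis_projective[OF Z.left_module_axioms])
  then show ?thesis using Z by (simp add: projectives_def)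
qed

section \<open>Equivalent forms of the splitting of R(M)\<close>

context
  assumes her: "left_hereditary R"
begin

text \<open>The projection onto \<open>P\<close> along \<open>K\<close> has a projective target and
  therefore kills \<open>R(M)\<close>.\<close>

lemma R_part_subset_complement:
  assumes M: "M \<in> modules R" and ds: "internal_direct_sum R M K P" "projective R (M\<lparr>carrier := P\<rparr>)"
  shows "carrier (R_part R M) \<subseteq> K"
proof
  fix x assume x: "x \<in> carrier (R_part R M)"
  note lM = modulesD(1)[OF M]
  obtain \<pi> where \<pi>: "\<pi> \<in> mod_hom R M (M\<lparr>carrier := P\<rparr>)"
    "\<And>x. x \<in> carrier M \<Longrightarrow> \<pi> x = \<zero>\<^bsub>M\<^esub> \<longleftrightarrow> x \<in> K"
    by (rule direct_sum_projection[OF lM ds(1)]) (rule that)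
  have small_P: "carrier (M\<lparr>carrier := P\<rparr>) \<prec> (UNIV :: 'v set)"
    by (rule summand_small[OF modulesD[OF M] internal_direct_sumD(2)[OF ds(1)]])
  have "\<pi> x = \<zero>\<^bsub>M\<^esub>" using R_part_hom_zero'[OF her M ds(2) small_P \<pi>(1) x] by simp
  then show "x \<in> K" using \<pi>(2) x R_part_subset[OF her M] by auto
qed

text \<open>The working criterion: one map to a projective module whose kernel no homomorphism to
  the ring detects. The kernel has a projective complement. A homomorphism from the kernel to the
  ring extends along the projection to \<open>M\<close> and so vanishes, whence the kernel is
  stable; it equals \<open>R(M)\<close> because a complement of a projective summand contains
  \<open>R(M)\<close>.\<close>

lemma R_part_splitsI:
  fixes F :: "('v, 'a) module"
  assumes M: "M \<in> modules R" and F: "projective R F" "carrier F \<prec> (UNIV :: 'v set)"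
    and \<eta>: "\<eta> \<in> mod_hom R M F"
    and vanish: "\<And>f x. \<lbrakk>f \<in> mod_hom R M (regular_module R); x \<in> mod_kernel M F \<eta>\<rbrakk> \<Longrightarrow> f x = \<zero>"
  shows "R_part_splits R M"
proof -
  note lM = modulesD(1)[OF M]
  have lF: "left_module R F" using F by (simp add: projective_def)
  interpret \<eta>: mod_homs R M F \<eta> by (rule mod_homsI[OF lM lF \<eta>])
  have "projective R (F\<lparr>carrier := \<eta> ` carrier M\<rparr>)"
    by (rule hereditary_submodule_projective[OF her F \<eta>.image_submodule[OF \<eta>.M.carrier_submodule]])
  then obtain P where P: "internal_direct_sum R M (mod_kernel M F \<eta>) P"
      "projective R (M\<lparr>carrier := P\<rparr>)"
    using projective_image_splits[OF lM modulesD(2)[OF M] lF \<eta>] by blast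
  let ?K = "mod_kernel M F \<eta>"
  have K: "submodule ?K R M" by (rule \<eta>.kernel_submodule)
  have MK: "M\<lparr>carrier := ?K\<rparr> \<in> modules R" by (rule submodule_in_modules[OF M K])
  obtain \<pi> where \<pi>: "\<pi> \<in> mod_hom R M (M\<lparr>carrier := ?K\<rparr>)" "\<And>x. x \<in> ?K \<Longrightarrow> \<pi> x = x"
    by (rule direct_sum_projection[OF lM internal_direct_sum_commute[OF lM P(1)]]) (rule that)
  have "stable R (M\<lparr>carrier := ?K\<rparr>)"
  proof (rule stableI[OF modulesD[OF MK]])
    fix f x assume f: "f \<in> mod_hom R (M\<lparr>carrier := ?K\<rparr>) (regular_module R)"
      and x: "x \<in> carrier (M\<lparr>carrier := ?K\<rparr>)"
    then have "compose (carrier M) f \<pi> x = \<zero>"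
      using vanish[OF compose_mod_hom[OF lM \<pi>(1) f]] by simp
    then show "f x = \<zero>" using x \<pi>(2) by (simp add: compose_def mod_kernel_def)
  qed
  then have "?K \<subseteq> carrier (R_part R M)" by (rule stable_subset_R_part[OF her M K])
  then have "?K = carrier (R_part R M)" using R_part_subset_complement[OF M P] by blast
  then show ?thesis using P by (auto simp: R_part_splits_def)
qed

text \<open>\<open>R(M)\<close> lies in every complement of a projective summand, so a complement
  inside \<open>R(M)\<close> equals it.\<close>

lemma R_part_splits_iff_xii:
  assumes M: "M \<in> modules R"
  shows "R_part_splits R M \<longleftrightarrow> (\<exists>N P. internal_direct_sum R M N P \<and>
     projective R (M\<lparr>carrier := P\<rparr>) \<and> submodule N R (R_part R M))"
proof
  interpret RM: left_module R "R_part R M" using R_part_modules[OF her M] by (rule modulesD)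
  show "R_part_splits R M \<Longrightarrow> (\<exists>N P. internal_direct_sum R M N P \<and>
     projective R (M\<lparr>carrier := P\<rparr>) \<and> submodule N R (R_part R M))"
    using RM.carrier_submodule by (auto simp: R_part_splits_def)
  assume "\<exists>N P. internal_direct_sum R M N P \<and>
     projective R (M\<lparr>carrier := P\<rparr>) \<and> submodule N R (R_part R M)"
  then obtain N P where *: "internal_direct_sum R M N P" "projective R (M\<lparr>carrier := P\<rparr>)"
    "submodule N R (R_part R M)" by blast
  then have "N = carrier (R_part R M)"
    using R_part_subset_complement[OF M *(1,2)] RM.submoduleD(1)[OF *(3)] by blast
  then show "R_part_splits R M" using * by (auto simp: R_part_splits_def)
qed

text \<open>A least \<open>K\<close> lies in the kernel of each homomorphism \<open>f\<close> to the
  ring: the image of \<open>f\<close> is a left ideal, hence projective, so the kernel is one of the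
  competing \<open>K'\<close>. The projection onto \<open>P\<close> then meets the splitting
  criterion.\<close>

lemma R_part_splits_iff_viii:
  assumes M: "M \<in> modules R"
  shows "R_part_splits R M \<longleftrightarrow> (\<exists>K P. internal_direct_sum R M K P \<and> projective R (M\<lparr>carrier := P\<rparr>) \<and>
     (\<forall>K' P'. internal_direct_sum R M K' P' \<and> projective R (M\<lparr>carrier := P'\<rparr>) \<longrightarrow> K \<subseteq> K'))"
proof
  show "R_part_splits R M \<Longrightarrow> \<exists>K P. internal_direct_sum R M K P \<and> projective R (M\<lparr>carrier := P\<rparr>) \<and>
     (\<forall>K' P'. internal_direct_sum R M K' P' \<and> projective R (M\<lparr>carrier := P'\<rparr>) \<longrightarrow> K \<subseteq> K')"
    using R_part_subset_complement[OF M] unfolding R_part_splits_def by blast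
  assume "\<exists>K P. internal_direct_sum R M K P \<and> projective R (M\<lparr>carrier := P\<rparr>) \<and>
     (\<forall>K' P'. internal_direct_sum R M K' P' \<and> projective R (M\<lparr>carrier := P'\<rparr>) \<longrightarrow> K \<subseteq> K')"
  then obtain K P where ds: "internal_direct_sum R M K P" and P: "projective R (M\<lparr>carrier := P\<rparr>)"
    and least: "\<And>K' P'. \<lbrakk>internal_direct_sum R M K' P'; projective R (M\<lparr>carrier := P'\<rparr>)\<rbrakk> \<Longrightarrow> K \<subseteq> K'"
    by blast
  note lM = modulesD(1)[OF M] and K = internal_direct_sumD(1)[OF ds] and sP = internal_direct_sumD(2)[OF ds]
  obtain \<eta> where \<eta>: "\<eta> \<in> mod_hom R M (M\<lparr>carrier := P\<rparr>)" "\<And>x. x \<in> carrier M \<Longrightarrow> \<eta> x = \<zero>\<^bsub>M\<^esub> \<longleftrightarrow> x \<in> K"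
    by (rule direct_sum_projection[OF lM ds]) (rule that)
  show "R_part_splits R M"
  proof (rule R_part_splitsI[OF M P summand_small[OF modulesD[OF M] sP] \<eta>(1)])
    fix f x assume f: "f \<in> mod_hom R M (regular_module R)"
      and "x \<in> mod_kernel M (M\<lparr>carrier := P\<rparr>) \<eta>"
    then have x: "x \<in> K" using \<eta>(2)[of x] by (simp add: mod_kernel_def)
    interpret f: mod_homs R M "regular_module R" f
      by (rule mod_homsI[OF lM regular_left_module[OF ring_axioms] f])
    have "projective R ((regular_module R)\<lparr>carrier := f ` carrier M\<rparr>)"
      using her f.image_submodule[OF f.M.carrier_submodule] by (simp add: left_hereditary_def)
    then obtain P' where "internal_direct_sum R M (mod_kernel M (regular_module R) f) P'"
        "projective R (M\<lparr>carrier := P'\<rparr>)"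
      using projective_image_splits[OF modulesD[OF M] f.N.left_module_axioms f] by blast
    then have "K \<subseteq> mod_kernel M (regular_module R) f" by (rule least)
    then show "f x = \<zero>" using x by (auto simp: mod_kernel_def)
  qed
qed

text \<open>A projective summand \<open>P'\<close> need not lie in \<open>P\<close>: the graph of
  any map from \<open>P\<close> to \<open>R(M)\<close> is again a complement of \<open>R(M)\<close>.
  The decomposition of \<open>P\<close> is therefore read with an isomorphic copy \<open>P1\<close>
  of \<open>P'\<close> inside \<open>P\<close>. The witness for \<open>P''\<close> is
  \<open>P \<inter> K'\<close>, the kernel of the projection to \<open>P'\<close> restricted to
  \<open>P\<close>.\<close>

lemma R_part_splits_imp_vii:
  assumes M: "M \<in> modules R" and splits: "R_part_splits R M"
  shows "\<exists>K P. internal_direct_sum R M K P \<and> projective R (M\<lparr>carrier := P\<rparr>) \<and>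
         (\<forall>K' P'. internal_direct_sum R M K' P' \<and> projective R (M\<lparr>carrier := P'\<rparr>) \<longrightarrow>
            K \<subseteq> K' \<and>
            (\<exists>P''. submodule P'' R (M\<lparr>carrier := P\<rparr>) \<and> projective R (M\<lparr>carrier := P''\<rparr>) \<and>
               (\<exists>P1. mod_iso R (M\<lparr>carrier := P'\<rparr>) (M\<lparr>carrier := P1\<rparr>) \<noteq> {} \<and>
                  internal_direct_sum R (M\<lparr>carrier := P\<rparr>) P1 P'') \<and>
               internal_direct_sum R (M\<lparr>carrier := K'\<rparr>) K P''))"
proof -
  let ?K = "carrier (R_part R M)"
  obtain P where ds: "internal_direct_sum R M ?K P" and P: "projective R (M\<lparr>carrier := P\<rparr>)"
    using splits by (auto simp: R_part_splits_def)
  note lM = modulesD(1)[OF M]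
  interpret M: left_module R M by (rule lM)
  note D = internal_direct_sumD[OF ds]
  have small_P: "carrier (M\<lparr>carrier := P\<rparr>) \<prec> (UNIV :: 'v set)"
    by (rule summand_small[OF modulesD[OF M] D(2)])
  have lP: "left_module R (M\<lparr>carrier := P\<rparr>)" by (rule M.submodule_module[OF D(2)])
  interpret lP: left_module R "M\<lparr>carrier := P\<rparr>" by (rule lP)
  have "?K \<subseteq> K' \<and>
      (\<exists>P''. submodule P'' R (M\<lparr>carrier := P\<rparr>) \<and> projective R (M\<lparr>carrier := P''\<rparr>) \<and>
         (\<exists>P1. mod_iso R (M\<lparr>carrier := P'\<rparr>) (M\<lparr>carrier := P1\<rparr>) \<noteq> {} \<and>
            internal_direct_sum R (M\<lparr>carrier := P\<rparr>) P1 P'') \<and>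
         internal_direct_sum R (M\<lparr>carrier := K'\<rparr>) ?K P'')"
    if ds': "internal_direct_sum R M K' P'" and P': "projective R (M\<lparr>carrier := P'\<rparr>)" for K' P'
  proof -
    note D' = internal_direct_sumD[OF ds']
    have KK': "?K \<subseteq> K'" by (rule R_part_subset_complement[OF M ds' P'])
    have lP': "left_module R (M\<lparr>carrier := P'\<rparr>)" by (rule M.submodule_module[OF D'(2)])
    have small_P': "carrier (M\<lparr>carrier := P'\<rparr>) \<prec> (UNIV :: 'v set)"
      by (rule summand_small[OF modulesD[OF M] D'(2)])
    have PK': "submodule (P \<inter> K') R M" by (rule M.submodule_Int[OF D(2) D'(1)])
    have P'': "submodule (P \<inter> K') R (M\<lparr>carrier := P\<rparr>)"
      using M.submodule_of_submodule_iff[OF D(2)] PK' by auto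
    have proj: "projective R (M\<lparr>carrier := P \<inter> K'\<rparr>)"
      using hereditary_submodule_projective[OF her P small_P P''] by simp
    obtain \<pi> where \<pi>: "\<pi> \<in> mod_hom R M (M\<lparr>carrier := P'\<rparr>)" "\<And>x. x \<in> P' \<Longrightarrow> \<pi> x = x"
      "\<And>x. x \<in> K' \<Longrightarrow> \<pi> x = \<zero>\<^bsub>M\<^esub>" "\<And>x. x \<in> carrier M \<Longrightarrow> \<pi> x = \<zero>\<^bsub>M\<^esub> \<longleftrightarrow> x \<in> K'"
      by (rule direct_sum_projection[OF lM ds']) (rule that)
    interpret \<pi>: mod_homs R M "M\<lparr>carrier := P'\<rparr>" \<pi> by (rule mod_homsI[OF lM lP' \<pi>(1)])
    have \<rho>: "restrict \<pi> P \<in> mod_hom R (M\<lparr>carrier := P\<rparr>) (M\<lparr>carrier := P'\<rparr>)"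
      by (rule \<pi>.restrict_mod_hom[OF D(2)])
    \<comment> \<open>The projection stays onto when restricted to \<open>P\<close>, because the
      component of \<open>y\<close> in \<open>R(M)\<close> lies in \<open>K'\<close> and is
      killed.\<close>
    have onto: "restrict \<pi> P ` carrier (M\<lparr>carrier := P\<rparr>) = carrier (M\<lparr>carrier := P'\<rparr>)"
    proof
      show "restrict \<pi> P ` carrier (M\<lparr>carrier := P\<rparr>) \<subseteq> carrier (M\<lparr>carrier := P'\<rparr>)"
        using mod_homD(1)[OF \<rho>] by auto
      show "carrier (M\<lparr>carrier := P'\<rparr>) \<subseteq> restrict \<pi> P ` carrier (M\<lparr>carrier := P\<rparr>)"
      proof
        fix y assume "y \<in> carrier (M\<lparr>carrier := P'\<rparr>)"
        then have y: "y \<in> P'" "y \<in> carrier M" using M.submoduleD(1)[OF D'(2)] by auto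
        then obtain k p where kp: "k \<in> ?K" "p \<in> P" "y = k \<oplus>\<^bsub>M\<^esub> p"
          using D(3) M.set_add_iff[of y ?K P] by blast
        have kpM: "k \<in> carrier M" "p \<in> carrier M"
          using kp M.submoduleD(1)[OF D(1)] M.submoduleD(1)[OF D(2)] by auto
        have "y = \<pi> y" using \<pi>(2) y by simp
        also have "\<dots> = \<pi> k \<oplus>\<^bsub>M\<^esub> \<pi> p" using \<pi>.f_add[OF kpM] kp(3) by simp
        also have "\<dots> = \<pi> p"
        proof -
          have "\<pi> p \<in> carrier M" using \<pi>.f_closed[OF kpM(2)] M.submoduleD(1)[OF D'(2)] by auto
          then show ?thesis using \<pi>(3)[of k] kp(1) KK' by (simp add: subset_iff)
        qed
        finally have "y = restrict \<pi> P p" using kp(2) by simp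
        then show "y \<in> restrict \<pi> P ` carrier (M\<lparr>carrier := P\<rparr>)"
          using kp(2) by (intro image_eqI[of _ _ p]) auto
      qed
    qed
    obtain s where s: "s \<in> mod_hom R (M\<lparr>carrier := P'\<rparr>) (M\<lparr>carrier := P\<rparr>)"
        "\<And>y. y \<in> carrier (M\<lparr>carrier := P'\<rparr>) \<Longrightarrow>
          restrict \<pi> P (s y) = (\<lambda>x \<in> carrier (M\<lparr>carrier := P'\<rparr>). x) y"
      by (rule projective_lift[OF P' small_P' lP lP' \<rho> onto id_mod_hom[OF lP']]) (rule that)
    have \<rho>s: "restrict \<pi> P (s y) = y" if "y \<in> carrier (M\<lparr>carrier := P'\<rparr>)" for y
      using s(2)[OF that] that by simp
    have ker: "mod_kernel (M\<lparr>carrier := P\<rparr>) (M\<lparr>carrier := P'\<rparr>) (restrict \<pi> P) = P \<inter> K'"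
      using \<pi>(4) M.submoduleD(1)[OF D(2)] by (auto simp: mod_kernel_def)
    have "internal_direct_sum R (M\<lparr>carrier := P\<rparr>) (P \<inter> K') (s ` P')"
      using direct_sum_of_section[OF lP lP' \<rho> s(1) \<rho>s] unfolding ker by simp
    then have sum1: "internal_direct_sum R (M\<lparr>carrier := P\<rparr>) (s ` P') (P \<inter> K')"
      by (rule internal_direct_sum_commute[OF lP])
    have "s \<in> mod_iso R (M\<lparr>carrier := P'\<rparr>) (M\<lparr>carrier := s ` P'\<rparr>)"
      unfolding mod_iso_def
    proof (intro CollectI conjI)
      show "s \<in> mod_hom R (M\<lparr>carrier := P'\<rparr>) (M\<lparr>carrier := s ` P'\<rparr>)"
        using mod_hom_into_submodule[OF s(1), of "s ` P'"] by simp
      show "bij_betw s (carrier (M\<lparr>carrier := P'\<rparr>)) (carrier (M\<lparr>carrier := s ` P'\<rparr>))"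
        unfolding bij_betw_def using \<rho>s by (auto intro!: inj_on_inverseI[where g = "restrict \<pi> P"])
    qed
    then have iso: "mod_iso R (M\<lparr>carrier := P'\<rparr>) (M\<lparr>carrier := s ` P'\<rparr>) \<noteq> {}" by blast
    interpret K': left_module R "M\<lparr>carrier := K'\<rparr>" by (rule M.submodule_module[OF D'(1)])
    \<comment> \<open>Modular law: as \<open>R(M)\<close> lies in \<open>K'\<close>, the
      decomposition of \<open>M\<close> restricts to one of \<open>K'\<close>.\<close>
    have sum2: "internal_direct_sum R (M\<lparr>carrier := K'\<rparr>) ?K (P \<inter> K')"
      unfolding internal_direct_sum_def
    proof (intro conjI)
      show "submodule ?K R (M\<lparr>carrier := K'\<rparr>)" "submodule (P \<inter> K') R (M\<lparr>carrier := K'\<rparr>)"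
        using M.submodule_of_submodule_iff[OF D'(1)] D(1) KK' PK' by auto
      show "?K \<inter> (P \<inter> K') = {\<zero>\<^bsub>M\<lparr>carrier := K'\<rparr>\<^esub>}"
        using D(4) M.submoduleD(2)[OF D'(1)] by auto
      show "carrier (M\<lparr>carrier := K'\<rparr>) = ?K <+>\<^bsub>M\<lparr>carrier := K'\<rparr>\<^esub> (P \<inter> K')"
      proof (intro subset_antisym subsetI)
        fix x assume "x \<in> ?K <+>\<^bsub>M\<lparr>carrier := K'\<rparr>\<^esub> (P \<inter> K')"
        then show "x \<in> carrier (M\<lparr>carrier := K'\<rparr>)"
          using KK' M.submoduleD(3)[OF D'(1)] by (auto simp: K'.set_add_iff)
      next
        fix x assume "x \<in> carrier (M\<lparr>carrier := K'\<rparr>)"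
        then have x: "x \<in> K'" "x \<in> carrier M" using M.submoduleD(1)[OF D'(1)] by auto
        then obtain k p where kp: "k \<in> ?K" "p \<in> P" "x = k \<oplus>\<^bsub>M\<^esub> p"
          using D(3) M.set_add_iff[of x ?K P] by blast
        have kpM: "k \<in> carrier M" "p \<in> carrier M"
          using kp M.submoduleD(1)[OF D(1)] M.submoduleD(1)[OF D(2)] by auto
        have "x \<ominus>\<^bsub>M\<^esub> k = p" using M.diff_eq_iff[OF x(2) kpM] kp(3) by simp
        moreover have "x \<ominus>\<^bsub>M\<^esub> k \<in> K'" using M.submoduleD(6)[OF D'(1) x(1)] kp(1) KK' by blast
        ultimately have "p \<in> K'" by simp
        then show "x \<in> ?K <+>\<^bsub>M\<lparr>carrier := K'\<rparr>\<^esub> (P \<inter> K')"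
          unfolding K'.set_add_iff using kp by auto
      qed
    qed
    show ?thesis using KK' P'' proj iso sum1 sum2 by blast
  qed
  then show ?thesis using ds P by blast
qed

text \<open>Given a complement \<open>P\<close>, addition identifies the sum of \<open>R(M)\<close>
  and \<open>P\<close> with the sum of \<open>M\<close> and the zero module. Conversely, take the
  second component of the inverse of \<open>\<delta>\<close> on \<open>M\<close>. Where it vanishes,
  the inverse sends \<open>(x, 0)\<close> to some \<open>(k, 0)\<close> with \<open>k\<close> in
  \<open>R(M)\<close>, and the condition on the inclusion forces \<open>x = k\<close>; so the
  splitting criterion applies.\<close>

lemma R_part_splits_iff_xiii:
  assumes M: "M \<in> modules R"
  shows "R_part_splits R M \<longleftrightarrow> (\<exists>P \<in> projectives R. \<exists>P' \<in> projectives R.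
         \<exists>\<delta> \<in> mod_iso R (direct_sum (R_part R M) P) (direct_sum M P').
           \<forall>x \<in> carrier (R_part R M). R_incl R M x = fst (\<delta> (x, \<zero>\<^bsub>P\<^esub>)))"
    (is "_ \<longleftrightarrow> ?rhs")
proof
  note lM = modulesD(1)[OF M]
  interpret M: left_module R M by (rule lM)
  let ?K = "carrier (R_part R M)"
  have lRM: "left_module R (R_part R M)" using R_part_modules[OF her M] by (rule modulesD)
  {
    assume "R_part_splits R M"
    then obtain P where ds: "internal_direct_sum R M ?K P" and P: "projective R (M\<lparr>carrier := P\<rparr>)"
      by (auto simp: R_part_splits_def)
    note D = internal_direct_sumD[OF ds]
    let ?P = "M\<lparr>carrier := P\<rparr>" and ?Z = "M\<lparr>carrier := {\<zero>\<^bsub>M\<^esub>}\<rparr>"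
    have lP: "left_module R ?P" by (rule M.submodule_module[OF D(2)])
    have P': "?P \<in> projectives R"
      using P submodule_in_modules[OF M D(2)] by (simp add: projectives_def)
    have Z: "?Z \<in> projectives R" by (rule zero_module_projective[OF M])
    have KM: "x \<in> carrier M" if "x \<in> ?K" for x using that M.submoduleD(1)[OF D(1)] by auto
    have PM: "x \<in> carrier M" if "x \<in> P" for x using that M.submoduleD(1)[OF D(2)] by auto
    obtain \<pi> where \<pi>: "\<pi> \<in> mod_hom R M ?P" "\<And>x. x \<in> P \<Longrightarrow> \<pi> x = x" "\<And>x. x \<in> ?K \<Longrightarrow> \<pi> x = \<zero>\<^bsub>M\<^esub>"
      by (rule direct_sum_projection[OF lM ds]) (rule that)
    define \<delta> where "\<delta> = (\<lambda>z \<in> carrier (direct_sum (R_part R M) ?P). (fst z \<oplus>\<^bsub>M\<^esub> snd z, \<zero>\<^bsub>M\<^esub>))"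
    have \<pi>_sum: "\<pi> (x \<oplus>\<^bsub>M\<^esub> p) = p" if "x \<in> ?K" "p \<in> P" for x p
      using mod_homD(3)[OF \<pi>(1) KM[OF that(1)] PM[OF that(2)]] that \<pi> PM by simp
    have "\<delta> \<in> mod_iso R (direct_sum (R_part R M) ?P) (direct_sum M ?Z)"
      unfolding mod_iso_def
    proof (intro CollectI conjI)
      show "\<delta> \<in> mod_hom R (direct_sum (R_part R M) ?P) (direct_sum M ?Z)"
        unfolding \<delta>_def
        by (rule restrict_mod_homI[OF direct_sum_module[OF lRM lP]])
          (auto simp: R_part_simps[OF her] KM PM M.M.add.m_ac M.smult_r_distr)
      show "bij_betw \<delta> (carrier (direct_sum (R_part R M) ?P)) (carrier (direct_sum M ?Z))"
        unfolding bij_betw_def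
      proof
        show "inj_on \<delta> (carrier (direct_sum (R_part R M) ?P))"
        proof (rule inj_onI)
          fix z w assume zw: "z \<in> carrier (direct_sum (R_part R M) ?P)"
            "w \<in> carrier (direct_sum (R_part R M) ?P)" "\<delta> z = \<delta> w"
          obtain x p where z: "z = (x, p)" "x \<in> ?K" "p \<in> P" using zw(1) by auto
          obtain y q where w: "w = (y, q)" "y \<in> ?K" "q \<in> P" using zw(2) by auto
          have eq: "x \<oplus>\<^bsub>M\<^esub> p = y \<oplus>\<^bsub>M\<^esub> q" using zw(3) z w by (simp add: \<delta>_def)
          then have "p = q" using \<pi>_sum[OF z(2,3)] \<pi>_sum[OF w(2,3)] by simp
          then have "x = y" using eq KM[OF z(2)] KM[OF w(2)] PM[OF z(3)] by simp
          then show "z = w" using z w \<open>p = q\<close> by simp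
        qed
        show "\<delta> ` carrier (direct_sum (R_part R M) ?P) = carrier (direct_sum M ?Z)"
        proof (intro subset_antisym subsetI)
          fix w assume "w \<in> carrier (direct_sum M ?Z)"
          then obtain m where m: "w = (m, \<zero>\<^bsub>M\<^esub>)" "m \<in> carrier M" by auto
          then obtain k p where "k \<in> ?K" "p \<in> P" "m = k \<oplus>\<^bsub>M\<^esub> p"
            using D(3) M.set_add_iff[of m ?K P] by blast
          then show "w \<in> \<delta> ` carrier (direct_sum (R_part R M) ?P)"
            using m by (intro image_eqI[of _ _ "(k, p)"]) (auto simp: \<delta>_def)
        qed (auto simp: \<delta>_def KM PM)
      qed
    qed
    moreover have "R_incl R M x = fst (\<delta> (x, \<zero>\<^bsub>?P\<^esub>))" if "x \<in> ?K" for x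
      using that KM M.submoduleD(2)[OF D(2)] by (simp add: R_incl_def \<delta>_def)
    ultimately show ?rhs using P' Z by blast
  next
    assume ?rhs
    then obtain P P' \<delta> where P: "P \<in> projectives R" and P': "P' \<in> projectives R"
      and \<delta>: "\<delta> \<in> mod_iso R (direct_sum (R_part R M) P) (direct_sum M P')"
      and fst_\<delta>: "\<And>x. x \<in> ?K \<Longrightarrow> x = fst (\<delta> (x, \<zero>\<^bsub>P\<^esub>))"
      by (auto simp: R_incl_def)
    have lP: "left_module R P" and lP': "left_module R P'"
      using P P' by (auto simp: projectives_def modules_def)
    interpret P: left_module R P by (rule lP)
    interpret P': left_module R P' by (rule lP')
    note l1 = direct_sum_module[OF lRM lP] and l2 = direct_sum_module[OF lM lP']
    obtain \<gamma> where \<gamma>: "\<gamma> \<in> mod_iso R (direct_sum M P') (direct_sum (R_part R M) P)"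
      "\<And>y. y \<in> carrier (direct_sum M P') \<Longrightarrow> \<delta> (\<gamma> y) = y"
      by (rule mod_iso_inverse[OF l1 l2 \<delta>]) (rule that)
    note \<gamma>_hom = mod_isoD(1)[OF \<gamma>(1)]
    have \<gamma>c: "\<gamma> (m, \<zero>\<^bsub>P'\<^esub>) \<in> ?K \<times> carrier P" if "m \<in> carrier M" for m
      using mod_homD(1)[OF \<gamma>_hom, of "(m, \<zero>\<^bsub>P'\<^esub>)"] that by simp
    define q where "q = (\<lambda>m \<in> carrier M. snd (\<gamma> (m, \<zero>\<^bsub>P'\<^esub>)))"
    have q: "q \<in> mod_hom R M P"
      unfolding q_def
    proof (rule restrict_mod_homI[OF lM])
      fix x y assume xy: "x \<in> carrier M" "y \<in> carrier M"
      have "\<gamma> (x \<oplus>\<^bsub>M\<^esub> y, \<zero>\<^bsub>P'\<^esub>) = \<gamma> (x, \<zero>\<^bsub>P'\<^esub>) \<oplus>\<^bsub>direct_sum (R_part R M) P\<^esub> \<gamma> (y, \<zero>\<^bsub>P'\<^esub>)"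
        using mod_homD(3)[OF \<gamma>_hom, of "(x, \<zero>\<^bsub>P'\<^esub>)" "(y, \<zero>\<^bsub>P'\<^esub>)"] xy by simp
      then show "snd (\<gamma> (x \<oplus>\<^bsub>M\<^esub> y, \<zero>\<^bsub>P'\<^esub>)) = snd (\<gamma> (x, \<zero>\<^bsub>P'\<^esub>)) \<oplus>\<^bsub>P\<^esub> snd (\<gamma> (y, \<zero>\<^bsub>P'\<^esub>))"
        by (cases "\<gamma> (x, \<zero>\<^bsub>P'\<^esub>)", cases "\<gamma> (y, \<zero>\<^bsub>P'\<^esub>)") simp
    next
      fix r x assume rx: "r \<in> carrier R" "x \<in> carrier M"
      have "\<gamma> (r \<odot>\<^bsub>M\<^esub> x, \<zero>\<^bsub>P'\<^esub>) = r \<odot>\<^bsub>direct_sum (R_part R M) P\<^esub> \<gamma> (x, \<zero>\<^bsub>P'\<^esub>)"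
        using mod_homD(4)[OF \<gamma>_hom, of r "(x, \<zero>\<^bsub>P'\<^esub>)"] rx by simp
      then show "snd (\<gamma> (r \<odot>\<^bsub>M\<^esub> x, \<zero>\<^bsub>P'\<^esub>)) = r \<odot>\<^bsub>P\<^esub> snd (\<gamma> (x, \<zero>\<^bsub>P'\<^esub>))"
        by (cases "\<gamma> (x, \<zero>\<^bsub>P'\<^esub>)") simp
    qed (use \<gamma>c in force)
    show "R_part_splits R M"
    proof (rule R_part_splitsI[OF M _ _ q])
      show "projective R P" "carrier P \<prec> (UNIV :: 'v set)"
        using P by (auto simp: projectives_def modules_def small_def)
      fix f x assume f: "f \<in> mod_hom R M (regular_module R)" and x: "x \<in> mod_kernel M P q"
      then have xM: "x \<in> carrier M" and "snd (\<gamma> (x, \<zero>\<^bsub>P'\<^esub>)) = \<zero>\<^bsub>P\<^esub>" by (auto simp: mod_kernel_def q_def)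
      then obtain k where k: "k \<in> ?K" "\<gamma> (x, \<zero>\<^bsub>P'\<^esub>) = (k, \<zero>\<^bsub>P\<^esub>)" using \<gamma>c[OF xM] by auto
      then have "\<delta> (k, \<zero>\<^bsub>P\<^esub>) = (x, \<zero>\<^bsub>P'\<^esub>)" using \<gamma>(2)[of "(x, \<zero>\<^bsub>P'\<^esub>)"] xM by simp
      then have "x = k" using fst_\<delta>[OF k(1)] by simp
      then have "x \<in> ?K" using k by simp
      then show "f x = \<zero>"
        using R_part_hom_zero'[OF her M regular_projective _ f] regular_small by simp
    qed
  }
qed

text \<open>The index set \<open>carrier M\<close> suffices for the product: for each \<open>m\<close> one homomorphism to the
  ring detecting \<open>m\<close>, if there is any.\<close>

lemma products_imp_R_part_splits:
  assumes M: "M \<in> modules R"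
    and prods: "\<forall>(I :: 'v set) (M :: 'v \<Rightarrow> ('v, 'v) module).
         small I \<and> (\<forall>i \<in> I. M i \<in> projectives R) \<longrightarrow> projective R (direct_product I M)"
  shows "R_part_splits R M"
proof -
  note lM = modulesD(1)[OF M]
  interpret M: left_module R M by (rule lM)
  let ?R = "regular_module R"
  let ?F = "direct_product (carrier M) (\<lambda>_. ?R)"
  have "?R \<in> projectives R"
    using regular_projective regular_in_modules by (simp add: projectives_def)
  then have F: "projective R ?F" using prods M by (simp add: modules_def)
  have small_F: "carrier ?F \<prec> (UNIV :: 'v set)"
    using PiE_small[OF modulesD(2)[OF M] regular_small] by simp
  have "\<exists>g. g \<in> mod_hom R M ?R \<and> ((\<exists>f \<in> mod_hom R M ?R. f m \<noteq> \<zero>) \<longrightarrow> g m \<noteq> \<zero>)" for m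
    using zero_mod_hom[OF lM regular_left_module[OF ring_axioms]] by blast
  then obtain g where g: "\<And>m. g m \<in> mod_hom R M ?R \<and>
      ((\<exists>f \<in> mod_hom R M ?R. f m \<noteq> \<zero>) \<longrightarrow> g m m \<noteq> \<zero>)" by metis
  have gh: "g m x \<in> carrier R" "y \<in> carrier M \<Longrightarrow> g m (x \<oplus>\<^bsub>M\<^esub> y) = g m x \<oplus> g m y"
    "r \<in> carrier R \<Longrightarrow> g m (r \<odot>\<^bsub>M\<^esub> x) = r \<otimes> g m x" if "x \<in> carrier M" for m x y r
    using that mod_homD[OF conjunct1[OF g[of m]]] by auto
  define \<eta> where "\<eta> = (\<lambda>x \<in> carrier M. \<lambda>m \<in> carrier M. g m x)"
  have \<eta>: "\<eta> \<in> mod_hom R M ?F"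
    unfolding \<eta>_def
    by (rule restrict_mod_homI[OF lM]) (auto simp: gh intro!: restrict_ext)
  show ?thesis
  proof (rule R_part_splitsI[OF M F small_F \<eta>])
    fix f x assume f: "f \<in> mod_hom R M ?R" and x: "x \<in> mod_kernel M ?F \<eta>"
    then have xM: "x \<in> carrier M" and "\<eta> x = (\<lambda>m \<in> carrier M. \<zero>)" by (auto simp: mod_kernel_def)
    moreover have "g x x = \<eta> x x" using xM by (simp add: \<eta>_def)
    ultimately have "g x x = \<zero>" by simp
    then show "f x = \<zero>" using g f by blast
  qed
qed

end

end

section \<open>Coherence\<close>

lemma (in abelian_monoid) finsum_swap:
  assumes "finite A" "finite B" "\<And>a b. \<lbrakk>a \<in> A; b \<in> B\<rbrakk> \<Longrightarrow> f a b \<in> carrier G"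
  shows "(\<Oplus>a \<in> A. \<Oplus>b \<in> B. f a b) = (\<Oplus>b \<in> B. \<Oplus>a \<in> A. f a b)"
  using assms(1,3)
proof (induction A rule: finite_induct)
  case (insert x A)
  have "(\<Oplus>a \<in> insert x A. \<Oplus>b \<in> B. f a b) = (\<Oplus>b \<in> B. f x b) \<oplus> (\<Oplus>a \<in> A. \<Oplus>b \<in> B. f a b)"
    using insert by (intro finsum_insert) (auto intro: finsum_closed)
  also have "\<dots> = (\<Oplus>b \<in> B. f x b) \<oplus> (\<Oplus>b \<in> B. \<Oplus>a \<in> A. f a b)"
    using insert by simp
  also have "\<dots> = (\<Oplus>b \<in> B. f x b \<oplus> (\<Oplus>a \<in> A. f a b))"
    using insert by (intro finsum_addf[symmetric]) (auto intro: finsum_closed)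
  also have "\<dots> = (\<Oplus>b \<in> B. \<Oplus>a \<in> insert x A. f a b)"
    using insert by (intro finsum_cong' finsum_insert[symmetric]) (auto intro: finsum_closed)
  finally show ?case .
qed simp

lemma (in left_module) smult_finsum_left:
  assumes "finite A" "c \<in> A \<rightarrow> carrier R" "x \<in> carrier M"
  shows "(\<Oplus> a \<in> A. c a) \<odot>\<^bsub>M\<^esub> x = (\<Oplus>\<^bsub>M\<^esub> a \<in> A. c a \<odot>\<^bsub>M\<^esub> x)"
  using assms(1,2)
proof (induction A rule: finite_induct)
  case (insert a A)
  then have "c a \<in> carrier R" "c \<in> A \<rightarrow> carrier R" "(\<lambda>a. c a \<odot>\<^bsub>M\<^esub> x) \<in> A \<rightarrow> carrier M"
    using assms(3) by auto
  with insert assms(3) show ?case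
    by (simp add: R.finsum_insert M.finsum_insert smult_l_distr R.finsum_closed)
qed (use assms(3) in simp)

lemma direct_product_projection:
  assumes "ring R" "\<And>i. i \<in> I \<Longrightarrow> left_module R (M i)" "i \<in> I"
  shows "(\<lambda>u \<in> carrier (direct_product I M). u i) \<in> mod_hom R (direct_product I M) (M i)"
  using assms by (intro restrict_mod_homI[OF direct_product_module]) auto

lemma direct_product_finsum:
  assumes "ring R" "\<And>i. i \<in> I \<Longrightarrow> left_module R (M i)" "i \<in> I" "finite A"
    and "g \<in> A \<rightarrow> carrier (direct_product I M)"
  shows "(\<Oplus>\<^bsub>direct_product I M\<^esub> a \<in> A. g a) i = (\<Oplus>\<^bsub>M i\<^esub> a \<in> A. g a i)"
proof -
  interpret p: mod_homs R "direct_product I M" "M i" "\<lambda>u \<in> carrier (direct_product I M). u i"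
    using direct_product_module[of R I M] direct_product_projection[of R I M i] assms
    by (intro mod_homsI) auto
  have "(\<Oplus>\<^bsub>direct_product I M\<^esub> a \<in> A. g a) \<in> carrier (direct_product I M)"
    by (rule p.M.M.finsum_closed[OF assms(5)])
  then have "(\<Oplus>\<^bsub>direct_product I M\<^esub> a \<in> A. g a) i =
    (\<Oplus>\<^bsub>M i\<^esub> a \<in> A. (\<lambda>u \<in> carrier (direct_product I M). u i) (g a))"
    using p.f_finsum[OF assms(4,5)] by simp
  also have "\<dots> = (\<Oplus>\<^bsub>M i\<^esub> a \<in> A. g a i)"
    by (rule p.N.M.finsum_cong') (use assms(3,5) in \<open>auto simp: Pi_iff PiE_iff\<close>)
  finally show ?thesis .
qed

lemma direct_product_eqI:
  assumes "u \<in> carrier (direct_product I M)" "v \<in> carrier (direct_product I M)"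
    and "\<And>i. i \<in> I \<Longrightarrow> u i = v i"
  shows "u = v"
  by (rule PiE_ext) (use assms in auto)

section \<open>Free modules of finite rank and relations\<close>

abbreviation free_module :: "('r, 'x) ring_scheme \<Rightarrow> nat \<Rightarrow> ('r, nat \<Rightarrow> 'r) module" where
  "free_module R n \<equiv> direct_product {..<n} (\<lambda>_. regular_module R)"

definition unit_vector :: "('r, 'x) ring_scheme \<Rightarrow> nat \<Rightarrow> nat \<Rightarrow> nat \<Rightarrow> 'r" where
  "unit_vector R n j = (\<lambda>i \<in> {..<n}. if i = j then \<one>\<^bsub>R\<^esub> else \<zero>\<^bsub>R\<^esub>)"

lemma finsum_regular [simp]: "finsum (regular_module R) = finsum R"
  by (auto simp: finsum_def finprod_def regular_module_def fun_eq_iff)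

context ring
begin

lemma free_module_module: "left_module R (free_module R n)"
  by (rule direct_product_module[OF ring_axioms regular_left_module[OF ring_axioms]])

lemma free_module_finsum:
  assumes "i < n" "finite A" "g \<in> A \<rightarrow> carrier (free_module R n)"
  shows "(\<Oplus>\<^bsub>free_module R n\<^esub> a \<in> A. g a) i = (\<Oplus>a \<in> A. g a i)"
  using direct_product_finsum[OF ring_axioms regular_left_module[OF ring_axioms] _ assms(2,3), of i]
    assms(1) by simp

lemma unit_vector_closed: "unit_vector R n j \<in> carrier (free_module R n)"
  by (auto simp: unit_vector_def)

lemma lincomb_free:
  fixes n :: nat
  assumes "y \<in> {..<n} \<rightarrow> carrier R" "left_module R N" "b \<in> {..<n} \<rightarrow> carrier N"
  shows "lincomb R N {..<n} y b = (\<Oplus>\<^bsub>N\<^esub> j \<in> {..<n}. y j \<odot>\<^bsub>N\<^esub> b j)"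
  by (rule left_module.lincomb_eq[OF assms(2)]) (use assms in auto)

lemma free_dual_basis:
  "dual_basis R (free_module R n) {..<n} (unit_vector R n) (\<lambda>j. \<lambda>u \<in> carrier (free_module R n). u j)"
  unfolding dual_basis_def coordinates_def
proof (intro conjI ballI)
  let ?F = "free_module R n"
  interpret F: left_module R ?F by (rule free_module_module)
  show "(\<lambda>u \<in> carrier ?F. u i) \<in> mod_hom R ?F (regular_module R)" if "i \<in> {..<n}" for i
    by (rule direct_product_projection[OF ring_axioms regular_left_module[OF ring_axioms] that])
  show "unit_vector R n \<in> {..<n} \<rightarrow> carrier ?F" using unit_vector_closed by auto
  fix y assume y: "y \<in> carrier ?F"
  show "finsupp R {..<n} (\<lambda>i. (\<lambda>u \<in> carrier ?F. u i) y)"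
    using y by (auto simp: finsupp_def PiE_iff)
  have yc: "y \<in> {..<n} \<rightarrow> carrier R" using y by (auto simp: PiE_iff)
  have "lincomb R ?F {..<n} (\<lambda>i. (\<lambda>u \<in> carrier ?F. u i) y) (unit_vector R n) =
    (\<Oplus>\<^bsub>?F\<^esub> j \<in> {..<n}. y j \<odot>\<^bsub>?F\<^esub> unit_vector R n j)"
    using lincomb_free[OF yc free_module_module, of "unit_vector R n"] unit_vector_closed y by simp
  also have "\<dots> = y"
  proof (rule direct_product_eqI[OF _ y])
    have cl: "(\<lambda>j. y j \<odot>\<^bsub>?F\<^esub> unit_vector R n j) \<in> {..<n} \<rightarrow> carrier ?F"
      using yc unit_vector_closed by (intro funcsetI F.smult_closed) auto
    show "(\<Oplus>\<^bsub>?F\<^esub> j \<in> {..<n}. y j \<odot>\<^bsub>?F\<^esub> unit_vector R n j) \<in> carrier ?F"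
      by (rule F.M.finsum_closed[OF cl])
    fix i assume i: "i \<in> {..<n}"
    have "(\<Oplus>\<^bsub>?F\<^esub> j \<in> {..<n}. y j \<odot>\<^bsub>?F\<^esub> unit_vector R n j) i =
      (\<Oplus>j \<in> {..<n}. (y j \<odot>\<^bsub>?F\<^esub> unit_vector R n j) i)"
      using free_module_finsum[OF _ _ cl, of i] i by simp
    also have "\<dots> = (\<Oplus>j \<in> {..<n}. if i = j then y j else \<zero>)"
      by (rule finsum_cong') (use i yc in \<open>auto simp: unit_vector_def Pi_iff\<close>)
    also have "\<dots> = y i"
      by (rule finsum_singleton) (use i yc in \<open>auto simp: Pi_iff\<close>)
    finally show "(\<Oplus>\<^bsub>?F\<^esub> j \<in> {..<n}. y j \<odot>\<^bsub>?F\<^esub> unit_vector R n j) i = y i" .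
  qed
  finally show "lincomb R ?F {..<n} (\<lambda>i. (\<lambda>u \<in> carrier ?F. u i) y) (unit_vector R n) = y" .
qed

lemma free_hom:
  assumes "left_module R N" "b \<in> {..<n} \<rightarrow> carrier N"
  shows "(\<lambda>y \<in> carrier (free_module R n). \<Oplus>\<^bsub>N\<^esub> j \<in> {..<n}. y j \<odot>\<^bsub>N\<^esub> b j) \<in> mod_hom R (free_module R n) N"
proof -
  interpret N: left_module R N by fact
  have "(\<lambda>y \<in> carrier (free_module R n). lincomb R N {..<n} (\<lambda>j. (\<lambda>u \<in> carrier (free_module R n). u j) y) b)
     \<in> mod_hom R (free_module R n) N"
    by (rule lincomb_mod_hom[OF free_module_module assms(1)
          conjunct1[OF free_dual_basis[unfolded dual_basis_def]] assms(2)])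
  moreover have "(\<lambda>y \<in> carrier (free_module R n). lincomb R N {..<n} (\<lambda>j. (\<lambda>u \<in> carrier (free_module R n). u j) y) b)
    = (\<lambda>y \<in> carrier (free_module R n). \<Oplus>\<^bsub>N\<^esub> j \<in> {..<n}. y j \<odot>\<^bsub>N\<^esub> b j)"
  proof (rule restrict_ext)
    fix y assume y: "y \<in> carrier (free_module R n)"
    then have "y \<in> {..<n} \<rightarrow> carrier R" by (auto simp: PiE_iff)
    from lincomb_free[OF this assms] y
    show "lincomb R N {..<n} (\<lambda>j. (\<lambda>u \<in> carrier (free_module R n). u j) y) b =
      (\<Oplus>\<^bsub>N\<^esub> j \<in> {..<n}. y j \<odot>\<^bsub>N\<^esub> b j)" by simp
  qed
  ultimately show ?thesis by simp
qed

end

context left_module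
begin

lemma span_in_submodule:
  assumes "submodule T R M" "X \<subseteq> T"
  shows "submodule_span R (M\<lparr>carrier := T\<rparr>) X = submodule_span R M X"
proof
  have "submodule (submodule_span R M X) R M" using span_submodule assms submoduleD(1) by blast
  moreover have "submodule_span R M X \<subseteq> T" by (rule span_subset[OF assms])
  ultimately show "submodule_span R (M\<lparr>carrier := T\<rparr>) X \<subseteq> submodule_span R M X"
    using submodule_of_submodule_iff[OF assms(1)] span_superset
    unfolding submodule_span_def[of R "M\<lparr>carrier := T\<rparr>"] by blast
  show "submodule_span R M X \<subseteq> submodule_span R (M\<lparr>carrier := T\<rparr>) X"
    unfolding submodule_span_def using submodule_of_submodule_iff[OF assms(1)] by blast
qed

lemma finitely_generated_submodule_iff:
  assumes "submodule T R M"
  shows "finitely_generated R (M\<lparr>carrier := T\<rparr>) \<longleftrightarrow>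
    (\<exists>X. finite X \<and> X \<subseteq> T \<and> submodule_span R M X = T)"
  unfolding finitely_generated_def using span_in_submodule[OF assms] by auto

text \<open>The combinations with one coefficient for each generator already form a
  submodule.\<close>

lemma span_finite_sum:
  assumes "finite D" "D \<subseteq> carrier M" "y \<in> submodule_span R M D"
  obtains z where "z \<in> D \<rightarrow> carrier R" "y = (\<Oplus>\<^bsub>M\<^esub> d \<in> D. z d \<odot>\<^bsub>M\<^esub> d)"
proof -
  define S where "S = {(\<Oplus>\<^bsub>M\<^esub> d \<in> D. z d \<odot>\<^bsub>M\<^esub> d) |z. z \<in> D \<rightarrow> carrier R}"
  have eq: "(\<Oplus>\<^bsub>M\<^esub> d \<in> D. z d \<odot>\<^bsub>M\<^esub> d) = lincomb R M D z (\<lambda>d. d)" if "z \<in> D \<rightarrow> carrier R" for z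
    by (rule lincomb_eq[symmetric]) (use assms(1,2) that in auto)
  have fs: "finsupp R D z" if "z \<in> D \<rightarrow> carrier R" for z
    using that assms(1) by (simp add: finsupp_def)
  have id: "(\<lambda>d. d) \<in> D \<rightarrow> carrier M" using assms(2) by auto
  have S: "S = {lincomb R M D z (\<lambda>d. d) |z. z \<in> D \<rightarrow> carrier R}"
    unfolding S_def by (intro Collect_cong ex_cong1) (auto simp: eq)
  have "submodule S R M"
  proof (rule submoduleI)
    show "S \<subseteq> carrier M" unfolding S using id by auto
    have "\<zero>\<^bsub>M\<^esub> = lincomb R M D (\<lambda>_. \<zero>) (\<lambda>d. d)" by (simp add: lincomb_def)
    then show "\<zero>\<^bsub>M\<^esub> \<in> S" unfolding S by (auto intro!: exI[of _ "\<lambda>_. \<zero>"])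
    fix x y assume "x \<in> S" "y \<in> S"
    then obtain u v where u: "u \<in> D \<rightarrow> carrier R" "x = lincomb R M D u (\<lambda>d. d)"
      and v: "v \<in> D \<rightarrow> carrier R" "y = lincomb R M D v (\<lambda>d. d)" unfolding S by auto
    then have "x \<oplus>\<^bsub>M\<^esub> y = lincomb R M D (\<lambda>d. u d \<oplus> v d) (\<lambda>d. d)"
      using lincomb_add[OF fs fs id] by simp
    moreover have "(\<lambda>d. u d \<oplus> v d) \<in> D \<rightarrow> carrier R" using u v by auto
    ultimately show "x \<oplus>\<^bsub>M\<^esub> y \<in> S" unfolding S by blast
  next
    fix r x assume r: "r \<in> carrier R" and "x \<in> S"
    then obtain u where u: "u \<in> D \<rightarrow> carrier R" "x = lincomb R M D u (\<lambda>d. d)" unfolding S by auto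
    then have "r \<odot>\<^bsub>M\<^esub> x = lincomb R M D (\<lambda>d. r \<otimes> u d) (\<lambda>d. d)"
      using lincomb_smult[OF r fs id] by simp
    moreover have "(\<lambda>d. r \<otimes> u d) \<in> D \<rightarrow> carrier R" using u r by auto
    ultimately show "r \<odot>\<^bsub>M\<^esub> x \<in> S" unfolding S by blast
  qed
  moreover have "D \<subseteq> S"
  proof
    fix d assume d: "d \<in> D"
    have "lincomb R M D (\<lambda>i. if i = d then \<one> else \<zero>) (\<lambda>d. d) = d"
      using lincomb_delta[OF d id, of "\<one>"] d assms(2) by auto
    then show "d \<in> S" unfolding S by (auto intro!: exI[of _ "\<lambda>i. if i = d then \<one> else \<zero>"])
  qed
  ultimately have "submodule_span R M D \<subseteq> S" by (rule span_subset)
  then show ?thesis using that assms(3) unfolding S_def by auto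
qed

end

text \<open>The syzygies of the family \<open>k\<close>, with the coefficients on the left. Over the
  opposite ring the products turn around, and these become the solutions \<open>y\<close> of an
  equation with the given \<open>k i\<close> on the left.\<close>

definition relations :: "('r, 'x) ring_scheme \<Rightarrow> nat \<Rightarrow> (nat \<Rightarrow> 'r) \<Rightarrow> (nat \<Rightarrow> 'r) set" where
  "relations R n k = {y \<in> carrier (free_module R n). (\<Oplus>\<^bsub>R\<^esub> i \<in> {..<n}. y i \<otimes>\<^bsub>R\<^esub> k i) = \<zero>\<^bsub>R\<^esub>}"

text \<open>By Schanuel's trick, whether the relations between given generators are finitely generated
  does not depend on the generators.\<close>

lemma (in ring) left_coherent_iff:
  "left_coherent R \<longleftrightarrow> (\<forall>n k. k \<in> {..<n} \<rightarrow> carrier R \<longrightarrow>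
     finitely_generated R ((free_module R n)\<lparr>carrier := relations R n k\<rparr>))"
proof -
  let ?R = "regular_module R"
  note lR = regular_left_module[OF ring_axioms]
  interpret r: left_module R ?R by (rule lR)
  define \<phi> where "\<phi> n k = (\<lambda>y \<in> carrier (free_module R n). \<Oplus>i \<in> {..<n}. y i \<otimes> k i)" for n k
  have \<phi>: "\<phi> n k \<in> mod_hom R (free_module R n) ?R" if "k \<in> {..<n} \<rightarrow> carrier R" for n k
    using free_hom[OF lR, of k n] that by (simp add: \<phi>_def)
  have ker: "mod_kernel (free_module R n) ?R (\<phi> n k) = relations R n k" for n k
    by (auto simp: mod_kernel_def relations_def \<phi>_def)
  have im_sub: "submodule (\<phi> n k ` carrier (free_module R n)) R ?R"
    if "k \<in> {..<n} \<rightarrow> carrier R" for n k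
  proof -
    interpret f: mod_homs R "free_module R n" ?R "\<phi> n k"
      by (rule mod_homsI[OF free_module_module lR \<phi>[OF that]])
    show ?thesis by (rule f.image_submodule[OF f.M.carrier_submodule])
  qed
  have im: "\<phi> n k ` carrier (free_module R n) = submodule_span R ?R (k ` {..<n})"
    if k: "k \<in> {..<n} \<rightarrow> carrier R" for n k
  proof
    interpret f: mod_homs R "free_module R n" ?R "\<phi> n k"
      by (rule mod_homsI[OF free_module_module lR \<phi>[OF k]])
    have kc: "k ` {..<n} \<subseteq> carrier ?R" using k by auto
    show "submodule_span R ?R (k ` {..<n}) \<subseteq> \<phi> n k ` carrier (free_module R n)"
    proof (rule r.span_subset[OF im_sub[OF k]], rule image_subsetI)
      fix j assume j: "j \<in> {..<n}"
      have "\<phi> n k (unit_vector R n j) = (\<Oplus>i \<in> {..<n}. if j = i then k i else \<zero>)"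
        unfolding \<phi>_def using unit_vector_closed[of n j]
        by (simp, intro finsum_cong') (use k in \<open>auto simp: unit_vector_def Pi_iff\<close>)
      also have "\<dots> = k j" by (rule finsum_singleton) (use j k in \<open>auto simp: Pi_iff\<close>)
      finally show "k j \<in> \<phi> n k ` carrier (free_module R n)"
        using unit_vector_closed[of n j] by (metis imageI)
    qed
    show "\<phi> n k ` carrier (free_module R n) \<subseteq> submodule_span R ?R (k ` {..<n})"
    proof (rule image_subsetI)
      fix y assume y: "y \<in> carrier (free_module R n)"
      note sp = r.span_submodule[OF kc]
      have "(\<Oplus>\<^bsub>?R\<^esub> i \<in> {..<n}. y i \<odot>\<^bsub>?R\<^esub> k i) \<in> submodule_span R ?R (k ` {..<n})"
        by (rule r.submodule_finsum[OF sp], rule funcsetI, rule r.submoduleD(4)[OF sp])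
          (use y r.span_superset[of "k ` {..<n}"] in \<open>auto simp: PiE_iff\<close>)
      then show "\<phi> n k y \<in> submodule_span R ?R (k ` {..<n})" using y by (simp add: \<phi>_def)
    qed
  qed
  show ?thesis
  proof
    assume lc: "left_coherent R"
    show "\<forall>n k. k \<in> {..<n} \<rightarrow> carrier R \<longrightarrow>
     finitely_generated R ((free_module R n)\<lparr>carrier := relations R n k\<rparr>)"
    proof (intro allI impI)
      fix n :: nat and k assume k: "k \<in> {..<n} \<rightarrow> carrier R"
      let ?F = "free_module R n" and ?I = "\<phi> n k ` carrier (free_module R n)"
      let ?RI = "?R\<lparr>carrier := ?I\<rparr>"
      interpret F: left_module R ?F by (rule free_module_module)
      have I: "submodule ?I R ?R" by (rule im_sub[OF k])
      have "finitely_generated R ?RI"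
        unfolding r.finitely_generated_submodule_iff[OF I] unfolding im[OF k]
        by (intro exI[of _ "k ` {..<n}"]) (simp add: r.span_superset)
      then have "finitely_presented R ?RI" using lc I by (simp add: left_coherent_def)
      then obtain m f where f: "f \<in> mod_hom R (free_module R m) ?RI"
        and f_onto: "f ` carrier (free_module R m) = carrier ?RI"
        and fg: "finitely_generated R ((free_module R m)\<lparr>carrier := mod_kernel (free_module R m) ?RI f\<rparr>)"
        unfolding finitely_presented_def Let_def by blast
      let ?G = "free_module R m"
      have lRI: "left_module R ?RI" by (rule r.submodule_module[OF I])
      interpret f: mod_homs R ?G ?RI f by (rule mod_homsI[OF free_module_module lRI f])
      obtain D where D: "finite D" "D \<subseteq> mod_kernel ?G ?RI f"
          "submodule_span R ?G D = mod_kernel ?G ?RI f"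
        using fg unfolding f.M.finitely_generated_submodule_iff[OF f.kernel_submodule] by blast
      have \<phi>I: "\<phi> n k \<in> mod_hom R ?F ?RI" by (rule mod_hom_into_submodule[OF \<phi>[OF k]]) auto
      interpret \<phi>: mod_homs R ?F ?RI "\<phi> n k" by (rule mod_homsI[OF free_module_module lRI \<phi>I])
      have \<phi>_onto: "\<phi> n k ` carrier ?F = carrier ?RI" by simp
      obtain A where A: "A \<in> mod_hom R ?F ?G" "\<And>x. x \<in> carrier ?F \<Longrightarrow> f (A x) = \<phi> n k x"
        by (rule dual_basis_lift[OF free_module_module free_dual_basis free_module_module lRI f f_onto \<phi>I])
          (rule that)
      obtain B where B: "B \<in> mod_hom R ?G ?F" "\<And>x. x \<in> carrier ?G \<Longrightarrow> \<phi> n k (B x) = f x"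
        by (rule dual_basis_lift[OF free_module_module free_dual_basis free_module_module lRI \<phi>I \<phi>_onto f])
          (rule that)
      interpret A: mod_homs R ?F ?G A by (rule mod_homsI[OF free_module_module free_module_module A(1)])
      interpret B: mod_homs R ?G ?F B by (rule mod_homsI[OF free_module_module free_module_module B(1)])
      \<comment> \<open>\<open>A\<close> and \<open>B\<close> lift the two maps onto the ideal
        through each other. The difference \<open>\<psi>\<close> of the identity and the composite
        of \<open>A\<close> and \<open>B\<close> sends the whole free module into the
        relations.\<close>
      define \<psi> where "\<psi> = (\<lambda>y \<in> carrier ?F. (\<lambda>y \<in> carrier ?F. y) y \<ominus>\<^bsub>?F\<^esub> compose (carrier ?F) B A y)"
      have \<psi>: "\<psi> \<in> mod_hom R ?F ?F"
        unfolding \<psi>_def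
        by (rule diff_mod_hom[OF free_module_module free_module_module id_mod_hom[OF free_module_module]
              compose_mod_hom[OF free_module_module A(1) B(1)]])
      interpret \<psi>: mod_homs R ?F ?F \<psi> by (rule mod_homsI[OF free_module_module free_module_module \<psi>])
      have \<psi>_app: "\<psi> y = y \<ominus>\<^bsub>?F\<^esub> B (A y)" if "y \<in> carrier ?F" for y
        using that by (simp add: \<psi>_def compose_def)
      let ?K = "relations R n k"
      have Ksub: "submodule ?K R ?F"
      proof -
        have "mod_kernel ?F ?RI (\<phi> n k) = mod_kernel ?F ?R (\<phi> n k)" by (simp add: mod_kernel_def)
        then show ?thesis using \<phi>.kernel_submodule ker by simp
      qed
      have KI: "y \<in> ?K \<longleftrightarrow> y \<in> carrier ?F \<and> \<phi> n k y = \<zero>" for y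
        unfolding ker[symmetric] by (simp add: mod_kernel_def)
      have \<psi>K: "\<psi> y \<in> ?K" if y: "y \<in> carrier ?F" for y
      proof -
        have "\<phi> n k (\<psi> y) = \<phi> n k y \<ominus>\<^bsub>?RI\<^esub> \<phi> n k (B (A y))"
          unfolding \<psi>_app[OF y] by (rule \<phi>.f_diff[OF y B.f_closed[OF A.f_closed[OF y]]])
        also have "\<phi> n k (B (A y)) = \<phi> n k y" using A(2)[OF y] B(2)[OF A.f_closed[OF y]] by simp
        also have "\<phi> n k y \<ominus>\<^bsub>?RI\<^esub> \<phi> n k y = \<zero>"
          using f.N.diff_eq_zero_iff[OF \<phi>.f_closed[OF y] \<phi>.f_closed[OF y]] by simp
        finally show ?thesis using KI \<psi>.f_closed[OF y] by blast
      qed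
      have BK: "B d \<in> ?K" if "d \<in> mod_kernel ?G ?RI f" for d
        using that KI B(2)[of d] B.f_closed[of d] by (simp add: mod_kernel_def)
      \<comment> \<open>A relation \<open>y\<close> equals \<open>\<psi> y\<close> plus
        \<open>B (A y)\<close>. The first term is a combination of the images of the unit vectors,
        and \<open>A y\<close> lies in the kernel of \<open>f\<close>, which \<open>D\<close>
        generates.\<close>
      define X where "X = \<psi> ` unit_vector R n ` {..<n} \<union> B ` D"
      have "finite X" using D(1) by (simp add: X_def)
      moreover have XK: "X \<subseteq> ?K" unfolding X_def using \<psi>K BK D(2) unit_vector_closed by blast
      moreover have "submodule_span R ?F X = ?K"
      proof
        show "submodule_span R ?F X \<subseteq> ?K" by (rule F.span_subset[OF Ksub XK])
        have sp: "submodule (submodule_span R ?F X) R ?F"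
          by (rule F.span_submodule) (use XK F.submoduleD(1)[OF Ksub] in blast)
        show "?K \<subseteq> submodule_span R ?F X"
        proof
          fix y assume "y \<in> ?K"
          then have y: "y \<in> carrier ?F" "\<phi> n k y = \<zero>" using KI by auto
          have yc: "y \<in> {..<n} \<rightarrow> carrier R" using y by (auto simp: PiE_iff)
          have "lincomb R ?F {..<n} (\<lambda>i. (\<lambda>u \<in> carrier ?F. u i) y) (unit_vector R n) = y"
            using free_dual_basis[of n] y unfolding dual_basis_def by blast
          then have "y = lincomb R ?F {..<n} y (unit_vector R n)" using y by simp
          then have "\<psi> y = lincomb R ?F {..<n} y (\<lambda>i. \<psi> (unit_vector R n i))"
            using \<psi>.f_lincomb[of "{..<n}" y "unit_vector R n"] yc unit_vector_closed
            by (simp add: finsupp_def)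
          also have "\<dots> \<in> submodule_span R ?F X"
            by (rule F.submodule_lincomb[OF sp yc]) (use F.span_superset[of X] in \<open>auto simp: X_def\<close>)
          finally have 1: "\<psi> y \<in> submodule_span R ?F X" .
          have "submodule {x \<in> carrier ?G. B x \<in> submodule_span R ?F X} R ?G"
            by (rule B.vimage_submodule[OF sp])
          moreover have "D \<subseteq> {x \<in> carrier ?G. B x \<in> submodule_span R ?F X}"
            using D(2) F.span_superset[of X] by (auto simp: X_def mod_kernel_def)
          ultimately have "submodule_span R ?G D \<subseteq> {x \<in> carrier ?G. B x \<in> submodule_span R ?F X}"
            by (rule f.M.span_subset)
          moreover have "A y \<in> mod_kernel ?G ?RI f"
            using y A(2)[OF y(1)] A.f_closed[OF y(1)] by (simp add: mod_kernel_def)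
          ultimately have 2: "B (A y) \<in> submodule_span R ?F X" using D(3) by blast
          have "y = \<psi> y \<oplus>\<^bsub>?F\<^esub> B (A y)"
            unfolding \<psi>_app[OF y(1)]
            by (rule F.diff_add_cancel[OF y(1) B.f_closed[OF A.f_closed[OF y(1)]], symmetric])
          then show "y \<in> submodule_span R ?F X" using F.submoduleD(3)[OF sp 1 2] by simp
        qed
      qed
      ultimately show "finitely_generated R (?F\<lparr>carrier := ?K\<rparr>)"
        unfolding F.finitely_generated_submodule_iff[OF Ksub] by blast
    qed
  next
    assume fg: "\<forall>n k. k \<in> {..<n} \<rightarrow> carrier R \<longrightarrow>
     finitely_generated R ((free_module R n)\<lparr>carrier := relations R n k\<rparr>)"
    show "left_coherent R"
      unfolding left_coherent_def
    proof (intro allI impI)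
      fix I assume "submodule I R ?R \<and> finitely_generated R (?R\<lparr>carrier := I\<rparr>)"
      then have I: "submodule I R ?R" and "finitely_generated R (?R\<lparr>carrier := I\<rparr>)" by auto
      then obtain X where X: "finite X" "X \<subseteq> I" "submodule_span R ?R X = I"
        unfolding r.finitely_generated_submodule_iff[OF I] by blast
      obtain k and n :: nat where kX: "k ` {..<n} = X"
        using ex_bij_betw_nat_finite[OF X(1)] by (auto simp: bij_betw_def atLeast0LessThan)
      have k: "k \<in> {..<n} \<rightarrow> carrier R" using kX X(2) r.submoduleD(1)[OF I] by auto
      let ?F = "free_module R n"
      have imI: "\<phi> n k ` carrier ?F = I" using im[OF k] kX X(3) by simp
      have f: "\<phi> n k \<in> mod_hom R ?F (?R\<lparr>carrier := I\<rparr>)"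
        by (rule mod_hom_into_submodule[OF \<phi>[OF k]]) (use imI in blast)
      moreover have "mod_kernel ?F (?R\<lparr>carrier := I\<rparr>) (\<phi> n k) = relations R n k"
        unfolding ker[symmetric] by (simp add: mod_kernel_def)
      ultimately show "finitely_presented R (?R\<lparr>carrier := I\<rparr>)"
        unfolding finitely_presented_def Let_def using fg k imI
        by (intro exI[of _ n] bexI[of _ "\<phi> n k"]) auto
    qed
  qed
qed

section \<open>Products of projective modules and coherence\<close>

lemma opposite_ring_simps [simp]:
  "carrier (opposite_ring R) = carrier R" "\<zero>\<^bsub>opposite_ring R\<^esub> = \<zero>\<^bsub>R\<^esub>"
  "\<one>\<^bsub>opposite_ring R\<^esub> = \<one>\<^bsub>R\<^esub>" "add (opposite_ring R) = add R"
  "x \<otimes>\<^bsub>opposite_ring R\<^esub> y = y \<otimes>\<^bsub>R\<^esub> x" "finsum (opposite_ring R) = finsum R"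
  by (auto simp: opposite_ring_def finsum_def)

lemma (in ring) opposite_ring: "ring (opposite_ring R)"
proof (rule ringI)
  show "abelian_group (opposite_ring R)"
  proof (rule abelian_groupI)
    fix x assume "x \<in> carrier (opposite_ring R)"
    then show "\<exists>y \<in> carrier (opposite_ring R). y \<oplus>\<^bsub>opposite_ring R\<^esub> x = \<zero>\<^bsub>opposite_ring R\<^esub>"
      by (auto intro!: bexI[of _ "\<ominus> x"] l_neg)
  qed (auto simp: a_assoc intro: a_comm)
  show "Group.monoid (opposite_ring R)"
    by (rule Group.monoidI) (auto simp: m_assoc)
qed (auto simp: l_distr r_distr)

context small_ring
begin

text \<open>Condition (ii) indexes families by elements of \<open>'v\<close>, whereas the products
  formed below are indexed by relations or by pairs of a number and a set. Reindexing along an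
  embedding makes the given product a retract of one indexed in \<open>'v\<close>.\<close>

lemma product_any_index:
  fixes M :: "'i \<Rightarrow> ('v, 'v) module"
  assumes prods: "\<forall>(I :: 'v set) (M :: 'v \<Rightarrow> ('v, 'v) module).
         small I \<and> (\<forall>i \<in> I. M i \<in> projectives R) \<longrightarrow> projective R (direct_product I M)"
    and I: "I \<prec> (UNIV :: 'v set)" and M: "\<And>i. i \<in> I \<Longrightarrow> M i \<in> projectives R"
  shows "projective R (direct_product I M)"
proof -
  obtain e :: "'i \<Rightarrow> 'v" where e: "inj_on e I" "small (e ` I)" by (rule small_embedding[OF I])
  define d where "d = inv_into I e"
  have de: "d (e i) = i" if "i \<in> I" for i using e(1) that by (simp add: d_def)
  let ?D = "direct_product I M" and ?E = "direct_product (e ` I) (\<lambda>j. M (d j))"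
  have lM: "left_module R (M i)" if "i \<in> I" for i using M[OF that] by (auto simp: projectives_def modules_def)
  have lD: "left_module R ?D" by (rule direct_product_module[OF ring_axioms lM])
  have lE: "left_module R ?E" by (rule direct_product_module[OF ring_axioms]) (auto simp: de lM)
  have E: "projective R ?E" using prods e(2) M de by auto
  show ?thesis
  proof (rule projective_retract[OF E lD])
    show "(\<lambda>v \<in> carrier ?D. \<lambda>j \<in> e ` I. v (d j)) \<in> mod_hom R ?D ?E"
      by (rule restrict_mod_homI[OF lD]) (auto simp: de PiE_iff intro!: restrict_ext)
    show "(\<lambda>u \<in> carrier ?E. \<lambda>i \<in> I. u (e i)) \<in> mod_hom R ?E ?D"
    proof (rule restrict_mod_homI[OF lE])
      fix u assume u: "u \<in> carrier ?E"
      show "(\<lambda>i \<in> I. u (e i)) \<in> carrier ?D" using u de by (auto simp: PiE_iff)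
      show "(\<lambda>i \<in> I. (r \<odot>\<^bsub>?E\<^esub> u) (e i)) = r \<odot>\<^bsub>?D\<^esub> (\<lambda>i \<in> I. u (e i))" for r
        by (auto intro!: restrict_ext simp: de)
      show "(\<lambda>i \<in> I. (u \<oplus>\<^bsub>?E\<^esub> v) (e i)) = (\<lambda>i \<in> I. u (e i)) \<oplus>\<^bsub>?D\<^esub> (\<lambda>i \<in> I. v (e i))" for v
        by (auto intro!: restrict_ext simp: de)
    qed
    show "(\<lambda>u \<in> carrier ?E. \<lambda>i \<in> I. u (e i)) ((\<lambda>v \<in> carrier ?D. \<lambda>j \<in> e ` I. v (d j)) v) = v"
      if v: "v \<in> carrier ?D" for v
    proof -
      have "(\<lambda>j \<in> e ` I. v (d j)) \<in> carrier ?E" using v de by (auto simp: PiE_iff)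
      moreover have "(\<lambda>i \<in> I. (\<lambda>j \<in> e ` I. v (d j)) (e i)) = v"
        using v de by (auto simp: PiE_iff extensional_def fun_eq_iff)
      ultimately show ?thesis using v by simp
    qed
  qed
qed

text \<open>The product of copies of the ring indexed by the relations themselves carries a
  universal solution, the elements \<open>m i\<close> with \<open>m i y = y i\<close>. The
  coordinates of this solution in a dual basis are relations, only finitely many of them nonzero,
  and reading the expansion of \<open>m i\<close> at the place \<open>y\<close> writes
  \<open>y\<close> as a combination of them with coefficients \<open>w y\<close>.\<close>

lemma products_imp_right_coherent:
  assumes prods: "\<forall>(I :: 'v set) (M :: 'v \<Rightarrow> ('v, 'v) module).
         small I \<and> (\<forall>i \<in> I. M i \<in> projectives R) \<longrightarrow> projective R (direct_product I M)"
  shows "right_coherent R"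
proof -
  let ?S = "opposite_ring R" and ?R = "regular_module R"
  interpret S: ring ?S by (rule opposite_ring)
  note lR = regular_left_module[OF ring_axioms]
  show ?thesis
    unfolding right_coherent_def S.left_coherent_iff
  proof (intro allI impI)
    fix n :: nat and k assume "k \<in> {..<n} \<rightarrow> carrier ?S"
    then have k: "k \<in> {..<n} \<rightarrow> carrier R" by simp
    let ?F = "free_module ?S n" and ?K = "relations ?S n k"
    let ?D = "direct_product ?K (\<lambda>_. ?R)"
    interpret F: left_module ?S ?F by (rule S.free_module_module)
    have K_iff: "y \<in> ?K \<longleftrightarrow> y \<in> ({..<n} \<rightarrow>\<^sub>E carrier R) \<and> (\<Oplus> i \<in> {..<n}. k i \<otimes> y i) = \<zero>" for y
      by (simp add: relations_def)
    have "?K \<subseteq> ({..<n} \<rightarrow>\<^sub>E carrier R)" using K_iff by blast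
    moreover have "({..<n} \<rightarrow>\<^sub>E carrier R) \<prec> (UNIV :: 'v set)"
      by (rule PiE_small[OF finite_small regular_small]) simp
    ultimately have K_small: "?K \<prec> (UNIV :: 'v set)" using subset_small by blast
    have "?R \<in> projectives R"
      using regular_projective regular_in_modules by (simp add: projectives_def)
    then have D: "projective R ?D" using product_any_index[OF prods K_small] by simp
    have lD: "left_module R ?D" by (rule direct_product_module[OF ring_axioms lR])
    interpret D: left_module R ?D by (rule lD)
    have D_small: "carrier ?D \<prec> (UNIV :: 'v set)" using PiE_small[OF K_small regular_small] by simp
    obtain c where c: "dual_basis R ?D (carrier ?D) (\<lambda>x. x) c"
      by (rule projective_dual_basis[OF D D_small])
    then have co: "coordinates R ?D (carrier ?D) c" and c_sum:
      "\<And>y. y \<in> carrier ?D \<Longrightarrow> lincomb R ?D (carrier ?D) (\<lambda>i. c i y) (\<lambda>x. x) = y"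
      by (auto simp: dual_basis_def)
    note cD = coordinatesD[OF co]
    define m where "m i = (\<lambda>y \<in> ?K. y i)" for i
    have m: "m i \<in> carrier ?D" if "i < n" for i using that K_iff by (auto simp: m_def PiE_iff)
    have km: "(\<Oplus>\<^bsub>?D\<^esub> i \<in> {..<n}. k i \<odot>\<^bsub>?D\<^esub> m i) = \<zero>\<^bsub>?D\<^esub>"
    proof (rule direct_product_eqI)
      have cl: "(\<lambda>i. k i \<odot>\<^bsub>?D\<^esub> m i) \<in> {..<n} \<rightarrow> carrier ?D"
        using k m by (intro funcsetI D.smult_closed) auto
      then show "(\<Oplus>\<^bsub>?D\<^esub> i \<in> {..<n}. k i \<odot>\<^bsub>?D\<^esub> m i) \<in> carrier ?D" by (rule D.M.finsum_closed)
      show "\<zero>\<^bsub>?D\<^esub> \<in> carrier ?D" by (rule D.M.zero_closed)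
      fix y assume y: "y \<in> ?K"
      have "(\<Oplus>\<^bsub>?D\<^esub> i \<in> {..<n}. k i \<odot>\<^bsub>?D\<^esub> m i) y = (\<Oplus> i \<in> {..<n}. (k i \<odot>\<^bsub>?D\<^esub> m i) y)"
        using direct_product_finsum[OF ring_axioms lR y _ cl] by simp
      also have "\<dots> = (\<Oplus> i \<in> {..<n}. k i \<otimes> y i)"
        by (rule finsum_cong') (use k y K_iff in \<open>auto simp: m_def PiE_iff Pi_iff\<close>)
      finally show "(\<Oplus>\<^bsub>?D\<^esub> i \<in> {..<n}. k i \<odot>\<^bsub>?D\<^esub> m i) y = \<zero>\<^bsub>?D\<^esub> y" using y K_iff by simp
    qed
    define W where "W = (\<Union>i<n. {w \<in> carrier ?D. c w (m i) \<noteq> \<zero>})"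
    have W_fin: "finite W" unfolding W_def using cD(6) m by auto
    have W_sub: "W \<subseteq> carrier ?D" by (auto simp: W_def)
    define g where "g w = (\<lambda>i \<in> {..<n}. c w (m i))" for w
    \<comment> \<open>Applying the coordinate \<open>c w\<close> to the vanishing sum of the
      \<open>k i\<close> times \<open>m i\<close> shows that the row of coordinates is a
      relation.\<close>
    have gK: "g w \<in> ?K" if w: "w \<in> carrier ?D" for w
    proof -
      interpret cw: mod_homs R ?D ?R "c w"
        by (rule mod_homsI[OF lD lR]) (use co w in \<open>auto simp: coordinates_def\<close>)
      have cl: "(\<lambda>i. k i \<odot>\<^bsub>?D\<^esub> m i) \<in> {..<n} \<rightarrow> carrier ?D"
        using k m by (intro funcsetI D.smult_closed) auto
      have "\<zero> = c w (\<Oplus>\<^bsub>?D\<^esub> i \<in> {..<n}. k i \<odot>\<^bsub>?D\<^esub> m i)" unfolding km using cw.f_zero by simp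
      also have "\<dots> = (\<Oplus> i \<in> {..<n}. c w (k i \<odot>\<^bsub>?D\<^esub> m i))" using cw.f_finsum[OF _ cl] by simp
      also have "\<dots> = (\<Oplus> i \<in> {..<n}. k i \<otimes> g w i)"
        by (rule finsum_cong') (use k m w cD(1,3) in \<open>auto simp: g_def Pi_iff simp del: direct_product_simps\<close>)
      finally show ?thesis using m w cD(1) unfolding K_iff
        by (auto simp: g_def PiE_iff simp del: direct_product_simps)
    qed
    have Ksub: "submodule ?K ?S ?F"
    proof -
      interpret f: mod_homs ?S ?F "regular_module ?S"
        "\<lambda>y \<in> carrier ?F. \<Oplus>\<^bsub>regular_module ?S\<^esub> j \<in> {..<n}. y j \<odot>\<^bsub>regular_module ?S\<^esub> k j"
        by (rule mod_homsI[OF S.free_module_module regular_left_module[OF opposite_ring] S.free_hom])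
          (use regular_left_module[OF opposite_ring] k in auto)
      show ?thesis using f.kernel_submodule by (simp add: mod_kernel_def relations_def cong: conj_cong)
    qed
    have "submodule_span ?S ?F (g ` W) = ?K"
    proof
      show "submodule_span ?S ?F (g ` W) \<subseteq> ?K"
        by (rule F.span_subset[OF Ksub]) (use gK W_sub in blast)
      have gF: "g w \<in> carrier ?F" if "w \<in> carrier ?D" for w using gK[OF that] F.submoduleD(1)[OF Ksub] by blast
      have sp: "submodule (submodule_span ?S ?F (g ` W)) ?S ?F"
        by (rule F.span_submodule) (use gF W_sub in blast)
      show "?K \<subseteq> submodule_span ?S ?F (g ` W)"
      proof
        fix y assume y: "y \<in> ?K"
        have wy: "w y \<in> carrier R" if "w \<in> carrier ?D" for w using that y by (auto simp: PiE_iff)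
        have cl: "(\<lambda>w. w y \<odot>\<^bsub>?F\<^esub> g w) \<in> W \<rightarrow> carrier ?F"
          using wy gF W_sub by (intro funcsetI F.smult_closed) auto
        have "y = (\<Oplus>\<^bsub>?F\<^esub> w \<in> W. w y \<odot>\<^bsub>?F\<^esub> g w)"
        proof (rule direct_product_eqI)
          show "y \<in> carrier ?F" using y F.submoduleD(1)[OF Ksub] by blast
          show "(\<Oplus>\<^bsub>?F\<^esub> w \<in> W. w y \<odot>\<^bsub>?F\<^esub> g w) \<in> carrier ?F" by (rule F.M.finsum_closed[OF cl])
          fix i assume "i \<in> {..<n}"
          then have i: "i < n" by simp
          have cl': "(\<lambda>w. c w (m i) \<odot>\<^bsub>?D\<^esub> w) \<in> W \<rightarrow> carrier ?D"
            using cD(1)[OF _ m[OF i]] W_sub by (intro funcsetI D.smult_closed) auto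
          have "m i = lincomb R ?D (carrier ?D) (\<lambda>w. c w (m i)) (\<lambda>x. x)" using c_sum[OF m[OF i]] by simp
          also have "\<dots> = (\<Oplus>\<^bsub>?D\<^esub> w \<in> W. c w (m i) \<odot>\<^bsub>?D\<^esub> w)"
            by (rule D.lincomb_eq[OF W_fin W_sub _ cD(5)[OF m[OF i]]]) (use i in \<open>auto simp: W_def\<close>)
          finally have "m i y = (\<Oplus>\<^bsub>?D\<^esub> w \<in> W. c w (m i) \<odot>\<^bsub>?D\<^esub> w) y" by simp
          also have "\<dots> = (\<Oplus> w \<in> W. (c w (m i) \<odot>\<^bsub>?D\<^esub> w) y)"
            using direct_product_finsum[OF ring_axioms lR y W_fin cl'] by simp
          also have "\<dots> = (\<Oplus> w \<in> W. (w y \<odot>\<^bsub>?F\<^esub> g w) i)"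
            by (rule finsum_cong') (use i y W_sub wy cD(1)[OF _ m[OF i]] in \<open>auto simp: g_def Pi_iff subset_iff\<close>)
          also have "\<dots> = (\<Oplus>\<^bsub>?F\<^esub> w \<in> W. w y \<odot>\<^bsub>?F\<^esub> g w) i"
            using S.free_module_finsum[OF i W_fin cl] by simp
          finally show "y i = (\<Oplus>\<^bsub>?F\<^esub> w \<in> W. w y \<odot>\<^bsub>?F\<^esub> g w) i" using y by (simp add: m_def)
        qed
        also have "\<dots> \<in> submodule_span ?S ?F (g ` W)"
          by (rule F.submodule_finsum[OF sp], rule funcsetI, rule F.submoduleD(4)[OF sp])
            (use wy W_sub F.span_superset[of "g ` W"] in auto)
        finally show "y \<in> submodule_span ?S ?F (g ` W)" .
      qed
    qed
    then show "finitely_generated ?S (?F\<lparr>carrier := ?K\<rparr>)"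
      unfolding F.finitely_generated_submodule_iff[OF Ksub]
      using W_fin gK W_sub by (intro exI[of _ "g ` W"]) auto
  qed
qed

text \<open>The equational criterion for flatness, in the direct product of projective modules.\<close>

lemma coherent_product_relations:
  fixes M :: "'i \<Rightarrow> ('v, 'v) module"
  assumes coh: "right_coherent R" and M: "\<And>i. i \<in> I \<Longrightarrow> M i \<in> projectives R"
    and k: "k \<in> {..<n :: nat} \<rightarrow> carrier R" and q: "q \<in> {..<n} \<rightarrow> carrier (direct_product I M)"
    and rel: "(\<Oplus>\<^bsub>direct_product I M\<^esub> j \<in> {..<n}. k j \<odot>\<^bsub>direct_product I M\<^esub> q j) = \<zero>\<^bsub>direct_product I M\<^esub>"
  obtains D \<zeta> where "finite D" "D \<subseteq> {..<n} \<rightarrow>\<^sub>E carrier R"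
    "\<And>d. d \<in> D \<Longrightarrow> (\<Oplus> j \<in> {..<n}. k j \<otimes> d j) = \<zero>"
    "\<zeta> \<in> D \<rightarrow> carrier (direct_product I M)"
    "\<And>j. j < n \<Longrightarrow> q j = (\<Oplus>\<^bsub>direct_product I M\<^esub> d \<in> D. d j \<odot>\<^bsub>direct_product I M\<^esub> \<zeta> d)"
proof -
  let ?S = "opposite_ring R" and ?R = "regular_module R" and ?D = "direct_product I M"
  interpret S: ring ?S by (rule opposite_ring)
  note lR = regular_left_module[OF ring_axioms]
  have lM: "left_module R (M i)" if "i \<in> I" for i using M[OF that] by (auto simp: projectives_def modules_def)
  have lD: "left_module R ?D" by (rule direct_product_module[OF ring_axioms lM])
  interpret D: left_module R ?D by (rule lD)
  let ?F = "free_module ?S n" and ?K = "relations ?S n k"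
  interpret F: left_module ?S ?F by (rule S.free_module_module)
  have K_iff: "y \<in> ?K \<longleftrightarrow> y \<in> ({..<n} \<rightarrow>\<^sub>E carrier R) \<and> (\<Oplus> i \<in> {..<n}. k i \<otimes> y i) = \<zero>" for y
    by (simp add: relations_def)
  have Ksub: "submodule ?K ?S ?F"
  proof -
    interpret f: mod_homs ?S ?F "regular_module ?S"
      "\<lambda>y \<in> carrier ?F. \<Oplus>\<^bsub>regular_module ?S\<^esub> j \<in> {..<n}. y j \<odot>\<^bsub>regular_module ?S\<^esub> k j"
      by (rule mod_homsI[OF S.free_module_module regular_left_module[OF opposite_ring] S.free_hom])
        (use regular_left_module[OF opposite_ring] k in auto)
    show ?thesis using f.kernel_submodule by (simp add: mod_kernel_def relations_def cong: conj_cong)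
  qed
  have "finitely_generated ?S (?F\<lparr>carrier := ?K\<rparr>)"
    using coh k unfolding right_coherent_def S.left_coherent_iff by simp
  then obtain D where D: "finite D" "D \<subseteq> ?K" "submodule_span ?S ?F D = ?K"
    unfolding F.finitely_generated_submodule_iff[OF Ksub] by blast
  have D_sub: "D \<subseteq> {..<n} \<rightarrow>\<^sub>E carrier R" using D(2) K_iff by blast
  have dR: "d j \<in> carrier R" if "d \<in> D" "j < n" for d j using that D_sub by auto
  \<comment> \<open>\<open>D\<close> generates the relations as a right module, so the coefficients
    stand to the right of the entries \<open>d j\<close>.\<close>
  have solve: "\<exists>z. z \<in> D \<rightarrow> carrier R \<and> (\<forall>j<n. y j = (\<Oplus> d \<in> D. d j \<otimes> z d))"
    if y: "y \<in> ?K" for y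
  proof -
    have DF: "D \<subseteq> carrier ?F" using D_sub by simp
    have "y \<in> submodule_span ?S ?F D" using y D(3) by simp
    from F.span_finite_sum[OF D(1) DF this]
    obtain z where z: "z \<in> D \<rightarrow> carrier ?S" "y = (\<Oplus>\<^bsub>?F\<^esub> d \<in> D. z d \<odot>\<^bsub>?F\<^esub> d)" by blast
    have cl: "(\<lambda>d. z d \<odot>\<^bsub>?F\<^esub> d) \<in> D \<rightarrow> carrier ?F"
      using z(1) DF by (intro funcsetI F.smult_closed) auto
    have "y j = (\<Oplus> d \<in> D. d j \<otimes> z d)" if j: "j < n" for j
    proof -
      have "y j = (\<Oplus> d \<in> D. (z d \<odot>\<^bsub>?F\<^esub> d) j)"
        using S.free_module_finsum[OF j D(1) cl] z(2) by simp
      also have "\<dots> = (\<Oplus> d \<in> D. d j \<otimes> z d)"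
        by (rule finsum_cong') (use j z(1) dR in \<open>auto simp: Pi_iff\<close>)
      finally show ?thesis .
    qed
    then show ?thesis using z(1) by auto
  qed
  have "\<exists>\<zeta>. \<zeta> \<in> D \<rightarrow> carrier (M i) \<and> (\<forall>j<n. q j i = (\<Oplus>\<^bsub>M i\<^esub> d \<in> D. d j \<odot>\<^bsub>M i\<^esub> \<zeta> d))"
    if i: "i \<in> I" for i
  proof -
    interpret Mi: left_module R "M i" by (rule lM[OF i])
    have Mi_small: "carrier (M i) \<prec> (UNIV :: 'v set)"
      using M[OF i] by (auto simp: projectives_def modules_def small_def)
    have qi: "q j i \<in> carrier (M i)" if "j < n" for j using q i that by (auto simp: Pi_iff PiE_iff)
    have kq: "(\<Oplus>\<^bsub>M i\<^esub> j \<in> {..<n}. k j \<odot>\<^bsub>M i\<^esub> q j i) = \<zero>\<^bsub>M i\<^esub>"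
    proof -
      have cl: "(\<lambda>j. k j \<odot>\<^bsub>?D\<^esub> q j) \<in> {..<n} \<rightarrow> carrier ?D"
        using k q by (intro funcsetI D.smult_closed) auto
      have "\<zero>\<^bsub>M i\<^esub> = (\<Oplus>\<^bsub>?D\<^esub> j \<in> {..<n}. k j \<odot>\<^bsub>?D\<^esub> q j) i" unfolding rel using i by simp
      also have "\<dots> = (\<Oplus>\<^bsub>M i\<^esub> j \<in> {..<n}. (k j \<odot>\<^bsub>?D\<^esub> q j) i)"
        by (rule direct_product_finsum[OF ring_axioms lM i _ cl]) simp_all
      also have "\<dots> = (\<Oplus>\<^bsub>M i\<^esub> j \<in> {..<n}. k j \<odot>\<^bsub>M i\<^esub> q j i)"
        by (rule Mi.M.finsum_cong') (use i k qi in \<open>auto simp: Pi_iff\<close>)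
      finally show ?thesis by simp
    qed
    obtain c where c: "dual_basis R (M i) (carrier (M i)) (\<lambda>x. x) c"
      using projective_dual_basis[OF _ Mi_small] M[OF i] by (auto simp: projectives_def)
    then have co: "coordinates R (M i) (carrier (M i)) c" and c_sum:
      "\<And>y. y \<in> carrier (M i) \<Longrightarrow> lincomb R (M i) (carrier (M i)) (\<lambda>i. c i y) (\<lambda>x. x) = y"
      by (auto simp: dual_basis_def)
    note cD = coordinatesD[OF co]
    \<comment> \<open>Each dual basis coordinate of the \<open>i\<close>-th components solves the
      same scalar equation and is therefore a combination of \<open>D\<close>.\<close>
    have "(\<lambda>j \<in> {..<n}. c w (q j i)) \<in> ?K" if w: "w \<in> carrier (M i)" for w
    proof -
      interpret cw: mod_homs R "M i" ?R "c w"
        by (rule mod_homsI[OF lM[OF i] lR]) (use co w in \<open>auto simp: coordinates_def\<close>)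
      have cl: "(\<lambda>j. k j \<odot>\<^bsub>M i\<^esub> q j i) \<in> {..<n} \<rightarrow> carrier (M i)" using k qi by auto
      have "\<zero> = c w (\<Oplus>\<^bsub>M i\<^esub> j \<in> {..<n}. k j \<odot>\<^bsub>M i\<^esub> q j i)" unfolding kq using cw.f_zero by simp
      also have "\<dots> = (\<Oplus> j \<in> {..<n}. c w (k j \<odot>\<^bsub>M i\<^esub> q j i))" using cw.f_finsum[OF _ cl] by simp
      also have "\<dots> = (\<Oplus> j \<in> {..<n}. k j \<otimes> (\<lambda>j \<in> {..<n}. c w (q j i)) j)"
        by (rule finsum_cong') (use k qi w cD(1,3) in \<open>auto simp: Pi_iff\<close>)
      finally show ?thesis using qi w cD(1) unfolding K_iff by auto
    qed
    from solve[OF this] have "\<forall>w. \<exists>z. w \<in> carrier (M i) \<longrightarrow> z \<in> D \<rightarrow> carrier R \<and>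
      (\<forall>j<n. (\<lambda>j \<in> {..<n}. c w (q j i)) j = (\<Oplus> d \<in> D. d j \<otimes> z d))" by blast
    then obtain z where z: "\<And>w. w \<in> carrier (M i) \<Longrightarrow> z w \<in> D \<rightarrow> carrier R"
      "\<And>w j. \<lbrakk>w \<in> carrier (M i); j < n\<rbrakk> \<Longrightarrow> c w (q j i) = (\<Oplus> d \<in> D. d j \<otimes> z w d)"
      by (subst (asm) choice_iff) auto
    define W where "W = (\<Union>j<n. {w \<in> carrier (M i). c w (q j i) \<noteq> \<zero>})"
    have W_fin: "finite W" unfolding W_def using cD(6) qi by auto
    have W_sub: "W \<subseteq> carrier (M i)" by (auto simp: W_def)
    \<comment> \<open>The coefficients \<open>z w d\<close> are collected by \<open>d\<close>
      instead of \<open>w\<close>; the computation below exchanges the two sums.\<close>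
    define \<zeta> where "\<zeta> d = (\<Oplus>\<^bsub>M i\<^esub> w \<in> W. z w d \<odot>\<^bsub>M i\<^esub> w)" for d
    have zR: "z w d \<in> carrier R" if "w \<in> W" "d \<in> D" for w d using z(1) that W_sub by auto
    have zw: "z w d \<odot>\<^bsub>M i\<^esub> w \<in> carrier (M i)" if "w \<in> W" "d \<in> D" for w d
      using zR[OF that] that W_sub by auto
    have \<zeta>c: "\<zeta> d \<in> carrier (M i)" if "d \<in> D" for d
      unfolding \<zeta>_def by (rule Mi.M.finsum_closed) (use zw that in auto)
    have "q j i = (\<Oplus>\<^bsub>M i\<^esub> d \<in> D. d j \<odot>\<^bsub>M i\<^esub> \<zeta> d)" if j: "j < n" for j
    proof -
      have "q j i = (\<Oplus>\<^bsub>M i\<^esub> w \<in> W. c w (q j i) \<odot>\<^bsub>M i\<^esub> w)"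
        using c_sum[OF qi[OF j]] Mi.lincomb_eq[OF W_fin W_sub _ cD(5)[OF qi[OF j]], of "\<lambda>x. x"] j
        by (auto simp: W_def)
      also have "\<dots> = (\<Oplus>\<^bsub>M i\<^esub> w \<in> W. \<Oplus>\<^bsub>M i\<^esub> d \<in> D. d j \<odot>\<^bsub>M i\<^esub> (z w d \<odot>\<^bsub>M i\<^esub> w))"
      proof (rule Mi.M.finsum_cong'[OF refl])
        show "(\<lambda>w. \<Oplus>\<^bsub>M i\<^esub> d \<in> D. d j \<odot>\<^bsub>M i\<^esub> (z w d \<odot>\<^bsub>M i\<^esub> w)) \<in> W \<rightarrow> carrier (M i)"
          using zR W_sub dR j by (intro funcsetI Mi.M.finsum_closed Mi.smult_closed) auto
        fix w assume w: "w \<in> W"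
        then have wM: "w \<in> carrier (M i)" using W_sub by auto
        have "c w (q j i) \<odot>\<^bsub>M i\<^esub> w = (\<Oplus>\<^bsub>M i\<^esub> d \<in> D. (d j \<otimes> z w d) \<odot>\<^bsub>M i\<^esub> w)"
          unfolding z(2)[OF wM j]
          by (rule Mi.smult_finsum_left[OF D(1) _ wM]) (use dR[OF _ j] zR[OF w] in auto)
        also have "\<dots> = (\<Oplus>\<^bsub>M i\<^esub> d \<in> D. d j \<odot>\<^bsub>M i\<^esub> (z w d \<odot>\<^bsub>M i\<^esub> w))"
          by (rule Mi.M.finsum_cong'[OF refl])
            (use dR[OF _ j] zR[OF w] wM in \<open>auto simp: Mi.smult_assoc1\<close>)
        finally show "c w (q j i) \<odot>\<^bsub>M i\<^esub> w = (\<Oplus>\<^bsub>M i\<^esub> d \<in> D. d j \<odot>\<^bsub>M i\<^esub> (z w d \<odot>\<^bsub>M i\<^esub> w))" .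
      qed
      also have "\<dots> = (\<Oplus>\<^bsub>M i\<^esub> d \<in> D. \<Oplus>\<^bsub>M i\<^esub> w \<in> W. d j \<odot>\<^bsub>M i\<^esub> (z w d \<odot>\<^bsub>M i\<^esub> w))"
        by (rule Mi.M.finsum_swap[OF W_fin D(1)]) (use zw dR[OF _ j] in auto)
      also have "\<dots> = (\<Oplus>\<^bsub>M i\<^esub> d \<in> D. d j \<odot>\<^bsub>M i\<^esub> \<zeta> d)"
      proof (rule Mi.M.finsum_cong'[OF refl])
        show "(\<lambda>d. d j \<odot>\<^bsub>M i\<^esub> \<zeta> d) \<in> D \<rightarrow> carrier (M i)" using \<zeta>c dR[OF _ j] by auto
        show "(\<Oplus>\<^bsub>M i\<^esub> w \<in> W. d j \<odot>\<^bsub>M i\<^esub> (z w d \<odot>\<^bsub>M i\<^esub> w)) = d j \<odot>\<^bsub>M i\<^esub> \<zeta> d" if "d \<in> D" for d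
          unfolding \<zeta>_def
          by (rule Mi.finsum_smult[symmetric, OF W_fin dR[OF that j]]) (use zw that in auto)
      qed
      finally show ?thesis .
    qed
    then show ?thesis using \<zeta>c by (intro exI[of _ \<zeta>]) auto
  qed
  then have "\<forall>i. \<exists>\<zeta>. i \<in> I \<longrightarrow> \<zeta> \<in> D \<rightarrow> carrier (M i) \<and>
    (\<forall>j<n. q j i = (\<Oplus>\<^bsub>M i\<^esub> d \<in> D. d j \<odot>\<^bsub>M i\<^esub> \<zeta> d))" by blast
  then obtain \<zeta> where \<zeta>: "\<And>i. i \<in> I \<Longrightarrow> \<zeta> i \<in> D \<rightarrow> carrier (M i)"
    "\<And>i j. \<lbrakk>i \<in> I; j < n\<rbrakk> \<Longrightarrow> q j i = (\<Oplus>\<^bsub>M i\<^esub> d \<in> D. d j \<odot>\<^bsub>M i\<^esub> \<zeta> i d)"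
    by (subst (asm) choice_iff) auto
  \<comment> \<open>\<open>D\<close> was found from \<open>k\<close> alone and is the same for every
    \<open>i\<close>. This is why the componentwise solutions assemble into elements of an infinite
    product.\<close>
  define Z where "Z d = (\<lambda>i \<in> I. \<zeta> i d)" for d
  have Z: "Z \<in> D \<rightarrow> carrier ?D" using \<zeta>(1) by (auto simp: Z_def Pi_iff)
  have "q j = (\<Oplus>\<^bsub>?D\<^esub> d \<in> D. d j \<odot>\<^bsub>?D\<^esub> Z d)" if j: "j < n" for j
  proof (rule direct_product_eqI)
    have cl: "(\<lambda>d. d j \<odot>\<^bsub>?D\<^esub> Z d) \<in> D \<rightarrow> carrier ?D"
      using Z dR[OF _ j] by (intro funcsetI D.smult_closed) auto
    show "q j \<in> carrier ?D" using q j by auto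
    show "(\<Oplus>\<^bsub>?D\<^esub> d \<in> D. d j \<odot>\<^bsub>?D\<^esub> Z d) \<in> carrier ?D" by (rule D.M.finsum_closed[OF cl])
    fix i assume i: "i \<in> I"
    interpret Mi: left_module R "M i" by (rule lM[OF i])
    have "(\<Oplus>\<^bsub>?D\<^esub> d \<in> D. d j \<odot>\<^bsub>?D\<^esub> Z d) i = (\<Oplus>\<^bsub>M i\<^esub> d \<in> D. (d j \<odot>\<^bsub>?D\<^esub> Z d) i)"
      by (rule direct_product_finsum[OF ring_axioms lM i D(1) cl])
    also have "\<dots> = (\<Oplus>\<^bsub>M i\<^esub> d \<in> D. d j \<odot>\<^bsub>M i\<^esub> \<zeta> i d)"
      by (rule Mi.M.finsum_cong'[OF refl]) (use i \<zeta>(1)[OF i] dR[OF _ j] in \<open>auto simp: Z_def\<close>)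
    finally show "q j i = (\<Oplus>\<^bsub>?D\<^esub> d \<in> D. d j \<odot>\<^bsub>?D\<^esub> Z d) i" using \<zeta>(2)[OF i j] by simp
  qed
  then show ?thesis using that[OF D(1) D_sub _ Z] D(2) K_iff by blast
qed

end

lemma (in small_ring) perfect_coherent_imp_product_projective:
  fixes M :: "'i \<Rightarrow> ('v, 'v) module"
  assumes perf: "left_perfect R" and coh: "right_coherent R"
    and I: "I \<prec> (UNIV :: 'v set)" and M: "\<And>i. i \<in> I \<Longrightarrow> M i \<in> projectives R"
  shows "projective R (direct_product I M)"
proof -
  let ?D = "direct_product I M"
  have lM: "left_module R (M i)" and sM: "carrier (M i) \<prec> (UNIV :: 'v set)" if "i \<in> I" for i
    using M[OF that] by (auto simp: projectives_def modules_def small_def)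
  have lD: "left_module R ?D" by (rule direct_product_module[OF ring_axioms lM])
  interpret D: left_module R ?D by (rule lD)
  have "carrier ?D \<prec> (UNIV :: 'v set)" using PiE_small[OF I sM] by simp
  then obtain M' :: "('v, 'v) module" and \<theta> where M': "M' \<in> modules R" and \<theta>: "\<theta> \<in> mod_iso R ?D M'"
    using module_copy[OF lD] by blast
  note lM' = modulesD(1)[OF M']
  obtain \<theta>' where \<theta>': "\<theta>' \<in> mod_iso R M' ?D" "\<And>x. x \<in> carrier ?D \<Longrightarrow> \<theta>' (\<theta> x) = x"
    "\<And>y. y \<in> carrier M' \<Longrightarrow> \<theta> (\<theta>' y) = y"
    by (rule mod_iso_inverse[OF lD lM' \<theta>]) (rule that)
  obtain P p where cover: "projective_cover R M' P p" using perf M' by (auto simp: left_perfect_def)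
  then have P: "P \<in> modules R" "projective R P" and p: "p \<in> mod_hom R P M'"
    and p_onto: "p ` carrier P = carrier M'" and sf: "superfluous R P (mod_kernel P M' p)"
    by (auto simp: projective_cover_def projectives_def)
  note lP = modulesD(1)[OF P(1)] and P_small = modulesD(2)[OF P(1)]
  interpret P: left_module R P by (rule lP)
  let ?K = "mod_kernel P M' p"
  have Ksub: "submodule ?K R P" using sf by (simp add: superfluous_def)
  define q where "q = compose (carrier P) \<theta>' p"
  have q: "q \<in> mod_hom R P ?D" unfolding q_def by (rule compose_mod_hom[OF lP p mod_isoD(1)[OF \<theta>'(1)]])
  interpret q: mod_homs R P ?D q by (rule mod_homsI[OF lP lD q])
  interpret \<theta>: mod_homs R ?D M' \<theta> by (rule mod_homsI[OF lD lM' mod_isoD(1)[OF \<theta>]])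
  have \<theta>q: "\<theta> (q y) = p y" if "y \<in> carrier P" for y
    using \<theta>'(3)[OF mod_homD(1)[OF p that]] that by (simp add: q_def compose_def)
  have q_ker: "y \<in> ?K" if "y \<in> carrier P" "q y = \<zero>\<^bsub>?D\<^esub>" for y
    using that \<theta>q[OF that(1)] \<theta>.f_zero by (simp add: mod_kernel_def)
  have q_onto: "\<exists>y \<in> carrier P. q y = x" if x: "x \<in> carrier ?D" for x
  proof -
    obtain y where y: "y \<in> carrier P" "p y = \<theta> x"
      using p_onto \<theta>.f_closed[OF x] by (metis imageE)
    then have "q y = x" using \<theta>'(2)[OF x] by (simp add: q_def compose_def)
    then show ?thesis using y by blast
  qed
  obtain c where c: "dual_basis R P (carrier P) (\<lambda>x. x) c" by (rule projective_dual_basis[OF P(2) P_small])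
  then have co: "coordinates R P (carrier P) c"
    and c_sum: "\<And>y. y \<in> carrier P \<Longrightarrow> lincomb R P (carrier P) (\<lambda>i. c i y) (\<lambda>x. x) = y"
    by (auto simp: dual_basis_def)
  note cD = coordinatesD[OF co]
  have "\<kappa> = \<zero>\<^bsub>P\<^esub>" if \<kappa>: "\<kappa> \<in> ?K" for \<kappa>
  proof -
    have \<kappa>P: "\<kappa> \<in> carrier P" "p \<kappa> = \<zero>\<^bsub>M'\<^esub>" using \<kappa> by (auto simp: mod_kernel_def)
    define X where "X = {x \<in> carrier P. c x \<kappa> \<noteq> \<zero>}"
    have X: "finite X" "X \<subseteq> carrier P" using cD(6)[OF \<kappa>P(1)] by (auto simp: X_def)
    obtain x and n :: nat where x: "bij_betw x {..<n} X"
      using ex_bij_betw_nat_finite[OF X(1)] by (auto simp: atLeast0LessThan)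
    have xP: "x j \<in> carrier P" if "j < n" for j using x X(2) that by (auto simp: bij_betw_def)
    define k where "k j = c (x j) \<kappa>" for j
    have k: "k \<in> {..<n} \<rightarrow> carrier R" using cD(1) xP \<kappa>P(1) by (auto simp: k_def)
    have kR: "k j \<in> carrier R" if "j < n" for j using k that by auto
    have \<kappa>_sum: "\<kappa> = (\<Oplus>\<^bsub>P\<^esub> j \<in> {..<n}. k j \<odot>\<^bsub>P\<^esub> x j)"
    proof -
      have "\<kappa> = (\<Oplus>\<^bsub>P\<^esub> y \<in> X. c y \<kappa> \<odot>\<^bsub>P\<^esub> y)" using c_sum[OF \<kappa>P(1)] by (simp add: lincomb_def X_def)
      also have "X = x ` {..<n}" using x by (simp add: bij_betw_def)
      also have "(\<Oplus>\<^bsub>P\<^esub> y \<in> x ` {..<n}. c y \<kappa> \<odot>\<^bsub>P\<^esub> y) = (\<Oplus>\<^bsub>P\<^esub> j \<in> {..<n}. c (x j) \<kappa> \<odot>\<^bsub>P\<^esub> x j)"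
        by (rule P.M.finsum_reindex) (use x xP cD(1) \<kappa>P(1) in \<open>auto simp: bij_betw_def\<close>)
      finally show ?thesis by (simp add: k_def)
    qed
    have cl1: "(\<lambda>j. k j \<odot>\<^bsub>P\<^esub> x j) \<in> {..<n} \<rightarrow> carrier P" using k xP by auto
    have qx: "(\<lambda>j. q (x j)) \<in> {..<n} \<rightarrow> carrier ?D" using xP by (auto simp del: direct_product_simps)
    have rel: "(\<Oplus>\<^bsub>?D\<^esub> j \<in> {..<n}. k j \<odot>\<^bsub>?D\<^esub> q (x j)) = \<zero>\<^bsub>?D\<^esub>"
    proof -
      have "(\<Oplus>\<^bsub>?D\<^esub> j \<in> {..<n}. k j \<odot>\<^bsub>?D\<^esub> q (x j)) = (\<Oplus>\<^bsub>?D\<^esub> j \<in> {..<n}. q (k j \<odot>\<^bsub>P\<^esub> x j))"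
        by (rule D.M.finsum_cong'[OF refl])
          (use kR xP q.f_smult q.f_closed cl1 in \<open>auto simp del: direct_product_simps\<close>)
      also have "\<dots> = q \<kappa>" unfolding \<kappa>_sum by (rule q.f_finsum[symmetric, OF _ cl1]) simp
      also have "\<dots> = \<theta>' \<zero>\<^bsub>M'\<^esub>" using \<kappa>P by (simp add: q_def compose_def)
      also have "\<dots> = \<zero>\<^bsub>?D\<^esub>" using \<theta>'(2)[OF D.M.zero_closed] \<theta>.f_zero by metis
      finally show ?thesis .
    qed
    obtain D \<zeta> where D: "finite D" "D \<subseteq> {..<n} \<rightarrow>\<^sub>E carrier R"
      and kd: "\<And>d. d \<in> D \<Longrightarrow> (\<Oplus> j \<in> {..<n}. k j \<otimes> d j) = \<zero>"
      and \<zeta>: "\<zeta> \<in> D \<rightarrow> carrier ?D"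
      and q\<zeta>: "\<And>j. j < n \<Longrightarrow> q (x j) = (\<Oplus>\<^bsub>?D\<^esub> d \<in> D. d j \<odot>\<^bsub>?D\<^esub> \<zeta> d)"
      by (rule coherent_product_relations[OF coh M k qx rel]) (assumption, rule that)
    have dR: "d j \<in> carrier R" if "d \<in> D" "j < n" for d j using that D(2) by auto
    have "\<exists>\<omega>. \<forall>d \<in> D. \<omega> d \<in> carrier P \<and> q (\<omega> d) = \<zeta> d"
      using q_onto \<zeta> by (intro bchoice) blast
    then obtain \<omega> where \<omega>: "\<And>d. d \<in> D \<Longrightarrow> \<omega> d \<in> carrier P" "\<And>d. d \<in> D \<Longrightarrow> q (\<omega> d) = \<zeta> d" by blast
    \<comment> \<open>\<open>s j\<close> has the same image as \<open>x j\<close>, but the sum of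
      the \<open>k j\<close> times \<open>s j\<close> vanishes already in \<open>P\<close> and not
      only in the product.\<close>
    define s where "s j = (\<Oplus>\<^bsub>P\<^esub> d \<in> D. d j \<odot>\<^bsub>P\<^esub> \<omega> d)" for j
    have cl2: "(\<lambda>d. d j \<odot>\<^bsub>P\<^esub> \<omega> d) \<in> D \<rightarrow> carrier P" if "j < n" for j using dR[OF _ that] \<omega>(1) by auto
    have s: "s j \<in> carrier P" if "j < n" for j unfolding s_def by (rule P.M.finsum_closed[OF cl2[OF that]])
    have qs: "q (s j) = q (x j)" if j: "j < n" for j
    proof -
      have "q (s j) = (\<Oplus>\<^bsub>?D\<^esub> d \<in> D. q (d j \<odot>\<^bsub>P\<^esub> \<omega> d))" unfolding s_def by (rule q.f_finsum[OF D(1) cl2[OF j]])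
      also have "\<dots> = (\<Oplus>\<^bsub>?D\<^esub> d \<in> D. d j \<odot>\<^bsub>?D\<^esub> \<zeta> d)"
      proof (rule D.M.finsum_cong'[OF refl])
        show "(\<lambda>d. d j \<odot>\<^bsub>?D\<^esub> \<zeta> d) \<in> D \<rightarrow> carrier ?D"
          using \<zeta> dR[OF _ j] by (intro funcsetI D.smult_closed) auto
        show "q (d j \<odot>\<^bsub>P\<^esub> \<omega> d) = d j \<odot>\<^bsub>?D\<^esub> \<zeta> d" if "d \<in> D" for d
          using q.f_smult[OF dR[OF that j] \<omega>(1)[OF that]] \<omega>(2)[OF that] by simp
      qed
      finally show ?thesis using q\<zeta>[OF j] by simp
    qed
    define \<kappa>' where "\<kappa>' j = x j \<ominus>\<^bsub>P\<^esub> s j" for j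
    have \<kappa>'K: "\<kappa>' j \<in> ?K" if "j < n" for j
    proof (rule q_ker)
      show "\<kappa>' j \<in> carrier P" using xP s that by (simp add: \<kappa>'_def)
      have "q (\<kappa>' j) = q (x j) \<ominus>\<^bsub>?D\<^esub> q (s j)" unfolding \<kappa>'_def by (rule q.f_diff[OF xP[OF that] s[OF that]])
      then show "q (\<kappa>' j) = \<zero>\<^bsub>?D\<^esub>"
        using qs[OF that] D.diff_eq_zero_iff[OF q.f_closed[OF xP[OF that]] q.f_closed[OF xP[OF that]]] by simp
    qed
    have \<kappa>'P: "\<kappa>' j \<in> carrier P" if "j < n" for j using \<kappa>'K[OF that] by (simp add: mod_kernel_def)
    have ks: "(\<Oplus>\<^bsub>P\<^esub> j \<in> {..<n}. k j \<odot>\<^bsub>P\<^esub> s j) = \<zero>\<^bsub>P\<^esub>"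
    proof -
      have "(\<Oplus>\<^bsub>P\<^esub> j \<in> {..<n}. k j \<odot>\<^bsub>P\<^esub> s j) = (\<Oplus>\<^bsub>P\<^esub> j \<in> {..<n}. \<Oplus>\<^bsub>P\<^esub> d \<in> D. (k j \<otimes> d j) \<odot>\<^bsub>P\<^esub> \<omega> d)"
      proof (rule P.M.finsum_cong'[OF refl])
        show "(\<lambda>j. \<Oplus>\<^bsub>P\<^esub> d \<in> D. (k j \<otimes> d j) \<odot>\<^bsub>P\<^esub> \<omega> d) \<in> {..<n} \<rightarrow> carrier P"
          using kR dR \<omega>(1) by (intro funcsetI P.M.finsum_closed) auto
        fix j assume "j \<in> {..<n}"
        then have j: "j < n" by simp
        have "k j \<odot>\<^bsub>P\<^esub> s j = (\<Oplus>\<^bsub>P\<^esub> d \<in> D. k j \<odot>\<^bsub>P\<^esub> (d j \<odot>\<^bsub>P\<^esub> \<omega> d))"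
          unfolding s_def by (rule P.finsum_smult[OF D(1) kR[OF j] cl2[OF j]])
        also have "\<dots> = (\<Oplus>\<^bsub>P\<^esub> d \<in> D. (k j \<otimes> d j) \<odot>\<^bsub>P\<^esub> \<omega> d)"
          by (rule P.M.finsum_cong'[OF refl]) (use kR[OF j] dR[OF _ j] \<omega>(1) in \<open>auto simp: P.smult_assoc1\<close>)
        finally show "k j \<odot>\<^bsub>P\<^esub> s j = (\<Oplus>\<^bsub>P\<^esub> d \<in> D. (k j \<otimes> d j) \<odot>\<^bsub>P\<^esub> \<omega> d)" .
      qed
      also have "\<dots> = (\<Oplus>\<^bsub>P\<^esub> d \<in> D. \<Oplus>\<^bsub>P\<^esub> j \<in> {..<n}. (k j \<otimes> d j) \<odot>\<^bsub>P\<^esub> \<omega> d)"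
        by (rule P.M.finsum_swap) (use D(1) kR dR \<omega>(1) in auto)
      also have "\<dots> = (\<Oplus>\<^bsub>P\<^esub> d \<in> D. \<zero>\<^bsub>P\<^esub>)"
      proof (rule P.M.finsum_cong'[OF refl])
        fix d assume d: "d \<in> D"
        have "(\<Oplus>\<^bsub>P\<^esub> j \<in> {..<n}. (k j \<otimes> d j) \<odot>\<^bsub>P\<^esub> \<omega> d) = (\<Oplus> j \<in> {..<n}. k j \<otimes> d j) \<odot>\<^bsub>P\<^esub> \<omega> d"
          by (rule P.smult_finsum_left[symmetric]) (use kR dR[OF d] \<omega>(1)[OF d] in auto)
        then show "(\<Oplus>\<^bsub>P\<^esub> j \<in> {..<n}. (k j \<otimes> d j) \<odot>\<^bsub>P\<^esub> \<omega> d) = \<zero>\<^bsub>P\<^esub>"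
          using kd[OF d] \<omega>(1)[OF d] by simp
      qed auto
      finally show ?thesis by simp
    qed
    have k\<kappa>': "(\<Oplus>\<^bsub>P\<^esub> j \<in> {..<n}. k j \<odot>\<^bsub>P\<^esub> \<kappa>' j) = \<kappa>"
    proof -
      have "\<kappa> = (\<Oplus>\<^bsub>P\<^esub> j \<in> {..<n}. k j \<odot>\<^bsub>P\<^esub> \<kappa>' j \<oplus>\<^bsub>P\<^esub> k j \<odot>\<^bsub>P\<^esub> s j)"
        unfolding \<kappa>_sum
      proof (rule P.M.finsum_cong'[OF refl])
        show "(\<lambda>j. k j \<odot>\<^bsub>P\<^esub> \<kappa>' j \<oplus>\<^bsub>P\<^esub> k j \<odot>\<^bsub>P\<^esub> s j) \<in> {..<n} \<rightarrow> carrier P" using kR \<kappa>'P s by auto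
        fix j assume "j \<in> {..<n}"
        then have j: "j < n" by simp
        have "x j = \<kappa>' j \<oplus>\<^bsub>P\<^esub> s j" unfolding \<kappa>'_def by (rule P.diff_add_cancel[symmetric, OF xP[OF j] s[OF j]])
        then show "k j \<odot>\<^bsub>P\<^esub> x j = k j \<odot>\<^bsub>P\<^esub> \<kappa>' j \<oplus>\<^bsub>P\<^esub> k j \<odot>\<^bsub>P\<^esub> s j"
          using P.smult_r_distr[OF kR[OF j] \<kappa>'P[OF j] s[OF j]] by simp
      qed
      also have "\<dots> = (\<Oplus>\<^bsub>P\<^esub> j \<in> {..<n}. k j \<odot>\<^bsub>P\<^esub> \<kappa>' j) \<oplus>\<^bsub>P\<^esub> (\<Oplus>\<^bsub>P\<^esub> j \<in> {..<n}. k j \<odot>\<^bsub>P\<^esub> s j)"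
        by (rule P.M.finsum_addf) (use kR \<kappa>'P s in auto)
      finally show ?thesis unfolding ks using kR \<kappa>'P by (simp add: P.M.finsum_closed)
    qed
    have co': "coordinates R P {..<n} (\<lambda>j. c (x j))"
      using co xP by (auto simp: coordinates_def finsupp_def)
    \<comment> \<open>The coordinates at the \<open>x j\<close> are kept, with
      \<open>\<kappa>' j\<close> in place of \<open>x j\<close>. As the \<open>k j\<close> combine
      the \<open>s j\<close> to zero, this replacement leaves \<open>\<kappa>\<close>
      unchanged.\<close>
    define \<phi> where "\<phi> = (\<lambda>y \<in> carrier P. lincomb R P {..<n} (\<lambda>j. c (x j) y) \<kappa>')"
    have \<phi>: "\<phi> \<in> mod_hom R P P" unfolding \<phi>_def
      by (rule lincomb_mod_hom[OF lP lP co']) (use \<kappa>'P in auto)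
    have \<phi>K: "\<phi> y \<in> ?K" if "y \<in> carrier P" for y
      unfolding \<phi>_def using that P.submodule_lincomb[OF Ksub, of "\<lambda>j. c (x j) y" "{..<n}" \<kappa>'] \<kappa>'K
        cD(1) xP by auto
    have \<phi>\<kappa>: "\<phi> \<kappa> = \<kappa>"
    proof -
      have "\<phi> \<kappa> = lincomb R P {..<n} k \<kappa>'" using \<kappa>P(1) by (simp add: \<phi>_def k_def[abs_def])
      also have "\<dots> = (\<Oplus>\<^bsub>P\<^esub> j \<in> {..<n}. k j \<odot>\<^bsub>P\<^esub> \<kappa>' j)" by (rule lincomb_free[OF k lP]) (use \<kappa>'P in auto)
      finally show ?thesis using k\<kappa>' by simp
    qed
    define \<psi> where "\<psi> = (\<lambda>y \<in> carrier P. (\<lambda>y \<in> carrier P. y) y \<ominus>\<^bsub>P\<^esub> \<phi> y)"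
    have \<psi>: "\<psi> \<in> mod_hom R P P" unfolding \<psi>_def by (rule diff_mod_hom[OF lP lP id_mod_hom[OF lP] \<phi>])
    interpret \<psi>: mod_homs R P P \<psi> by (rule mod_homsI[OF lP lP \<psi>])
    have \<psi>_app: "\<psi> y = y \<ominus>\<^bsub>P\<^esub> \<phi> y" if "y \<in> carrier P" for y using that by (simp add: \<psi>_def)
    have \<phi>c: "\<phi> y \<in> carrier P" if "y \<in> carrier P" for y using mod_homD(1)[OF \<phi> that] .
    have full: "L = carrier P" if "submodule L R P" "?K <+>\<^bsub>P\<^esub> L = carrier P" for L
      using sf that by (simp add: superfluous_def)
    have \<psi>_onto: "\<psi> ` carrier P = carrier P"
    proof (rule full[OF \<psi>.image_submodule[OF P.carrier_submodule]])
      show "?K <+>\<^bsub>P\<^esub> \<psi> ` carrier P = carrier P"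
      proof (intro subset_antisym subsetI)
        fix y assume "y \<in> ?K <+>\<^bsub>P\<^esub> \<psi> ` carrier P"
        then show "y \<in> carrier P" by (auto simp: P.set_add_iff mod_kernel_def)
      next
        fix y assume y: "y \<in> carrier P"
        have "y = \<phi> y \<oplus>\<^bsub>P\<^esub> \<psi> y"
          unfolding \<psi>_app[OF y] using P.diff_add_cancel[OF y \<phi>c[OF y]] P.M.a_comm[OF \<phi>c[OF y]] y \<phi>c[OF y] by simp
        then show "y \<in> ?K <+>\<^bsub>P\<^esub> \<psi> ` carrier P" unfolding P.set_add_iff using \<phi>K[OF y] y by blast
      qed
    qed
    obtain t where t: "t \<in> mod_hom R P P" "\<And>y. y \<in> carrier P \<Longrightarrow> \<psi> (t y) = (\<lambda>y \<in> carrier P. y) y"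
      by (rule projective_lift[OF P(2) P_small lP lP \<psi> \<psi>_onto id_mod_hom[OF lP]]) (rule that)
    have "internal_direct_sum R P (mod_kernel P P \<psi>) (t ` carrier P)"
      by (rule direct_sum_of_section[OF lP lP \<psi> t(1)]) (use t(2) in simp)
    note ds = internal_direct_sumD[OF this]
    \<comment> \<open>Superfluity is used a second time: the kernel of \<open>\<psi>\<close> lies in
      \<open>?K\<close>, so the range of the section \<open>t\<close> is all of \<open>P\<close>,
      and the kernel meets it in zero.\<close>
    have "t ` carrier P = carrier P"
    proof (rule full[OF ds(2)])
      have "mod_kernel P P \<psi> \<subseteq> ?K"
      proof
        fix y assume "y \<in> mod_kernel P P \<psi>"
        then have y: "y \<in> carrier P" "\<psi> y = \<zero>\<^bsub>P\<^esub>" by (auto simp: mod_kernel_def)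
        then have "y = \<phi> y" using \<psi>_app P.diff_eq_zero_iff \<phi>c by simp
        then show "y \<in> ?K" using \<phi>K[OF y(1)] by simp
      qed
      then have "mod_kernel P P \<psi> <+>\<^bsub>P\<^esub> t ` carrier P \<subseteq> ?K <+>\<^bsub>P\<^esub> t ` carrier P"
        by (intro subsetI, unfold P.set_add_iff) blast
      then have "carrier P \<subseteq> ?K <+>\<^bsub>P\<^esub> t ` carrier P" using ds(3) by blast
      moreover have "?K <+>\<^bsub>P\<^esub> t ` carrier P \<subseteq> carrier P"
        using mod_homD(1)[OF t(1)] by (auto simp: P.set_add_iff mod_kernel_def)
      ultimately show "?K <+>\<^bsub>P\<^esub> t ` carrier P = carrier P" by blast
    qed
    moreover have "\<kappa> \<in> mod_kernel P P \<psi>"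
    proof -
      have "\<psi> \<kappa> = \<kappa> \<ominus>\<^bsub>P\<^esub> \<kappa>" using \<psi>_app[OF \<kappa>P(1)] \<phi>\<kappa> by simp
      then show ?thesis using P.diff_eq_zero_iff[OF \<kappa>P(1) \<kappa>P(1)] \<kappa>P(1) by (simp add: mod_kernel_def)
    qed
    ultimately show ?thesis using ds(4) \<kappa>P(1) by blast
  qed
  then have "mod_kernel P ?D q = {\<zero>\<^bsub>P\<^esub>}"
    using q_ker q.f_zero by (auto simp: mod_kernel_def simp del: direct_product_simps)
  then have "inj_on q (carrier P)" using q.inj_on_iff_kernel by simp
  moreover have "q ` carrier P = carrier ?D"
    using q_onto q.f_closed by (blast intro: subset_antisym)
  ultimately have "q \<in> mod_iso R P ?D" using q by (simp add: mod_iso_def bij_betw_def)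
  then show ?thesis by (rule projective_iso[OF P(2) lD])
qed

section \<open>Descending chains of principal right ideals\<close>

text \<open>A minimum condition on elements in place of a chain condition on ideals: some
  \<open>a\<close> in \<open>A\<close> has \<open>aR\<close> minimal among the right ideals
  generated by members of \<open>A\<close>. In this form it is applied below to sets of idempotents,
  of corner elements and of scalars acting on a module.\<close>

definition principal_right_dcc :: "('r, 'x) ring_scheme \<Rightarrow> bool" where
  "principal_right_dcc R \<longleftrightarrow> (\<forall>A. A \<subseteq> carrier R \<and> A \<noteq> {} \<longrightarrow>
     (\<exists>a \<in> A. \<forall>r \<in> carrier R. a \<otimes>\<^bsub>R\<^esub> r \<in> A \<longrightarrow> (\<exists>s \<in> carrier R. a = a \<otimes>\<^bsub>R\<^esub> r \<otimes>\<^bsub>R\<^esub> s)))"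

text \<open>If the minimum condition fails at every element of \<open>A\<close>, a strictly smaller
  right ideal can be chosen again and again.\<close>

lemma (in ring) not_dcc_chain:
  assumes "\<not> principal_right_dcc R"
  obtains a where "\<And>n :: nat. a n \<in> carrier R" "\<And>n. \<exists>r \<in> carrier R. a (Suc n) = a n \<otimes> r"
    "\<And>n s. s \<in> carrier R \<Longrightarrow> a n \<noteq> a (Suc n) \<otimes> s"
proof -
  obtain A where A: "A \<subseteq> carrier R" "A \<noteq> {}" and
    "\<forall>a \<in> A. \<exists>r \<in> carrier R. a \<otimes> r \<in> A \<and> (\<forall>s \<in> carrier R. a \<noteq> a \<otimes> r \<otimes> s)"
  proof -
    from assms obtain A where "A \<subseteq> carrier R" "A \<noteq> {}" and
      "\<not> (\<exists>a \<in> A. \<forall>r \<in> carrier R. a \<otimes> r \<in> A \<longrightarrow> (\<exists>s \<in> carrier R. a = a \<otimes> r \<otimes> s))"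
      unfolding principal_right_dcc_def by auto
    then show ?thesis using that[of A] by blast
  qed
  then obtain \<rho> where \<rho>: "\<And>a. a \<in> A \<Longrightarrow> \<rho> a \<in> carrier R" "\<And>a. a \<in> A \<Longrightarrow> a \<otimes> \<rho> a \<in> A"
    "\<And>a s. \<lbrakk>a \<in> A; s \<in> carrier R\<rbrakk> \<Longrightarrow> a \<noteq> a \<otimes> \<rho> a \<otimes> s" by metis
  obtain a0 where "a0 \<in> A" using A(2) by blast
  define a where "a n = ((\<lambda>x. x \<otimes> \<rho> x) ^^ n) a0" for n
  have "a n \<in> A" for n
    by (induction n) (use \<open>a0 \<in> A\<close> \<rho>(2) in \<open>auto simp: a_def\<close>)
  then have aA: "a n \<in> A" for n .
  have a_Suc: "a (Suc n) = a n \<otimes> \<rho> (a n)" for n by (simp add: a_def)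
  show ?thesis
  proof (rule that)
    show "a n \<in> carrier R" for n using aA A(1) by blast
    show "\<exists>r \<in> carrier R. a (Suc n) = a n \<otimes> r" for n using a_Suc \<rho>(1)[OF aA] by blast
    show "a n \<noteq> a (Suc n) \<otimes> s" if "s \<in> carrier R" for n s
      using \<rho>(3)[OF aA that] unfolding a_Suc .
  qed
qed

text \<open>Chase's argument. If \<open>a\<^sub>0 R \<supset> a\<^sub>1 R \<supset> \<dots>\<close> and \<open>c\<close> are the coordinates of a projective product of copies
  of the ring, then almost all coordinates of \<open>a\<^sub>m z\<close> lie in all \<open>a\<^sub>n R\<close> for some \<open>m\<close> and all
  \<open>z\<close> supported in the rows from \<open>m\<close> on; otherwise an element with infinitely many nonzero
  coordinates is obtained by diagonalisation.\<close>

lemma (in ring) chase_diagonal: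
  fixes X :: "'x set"
  defines "D \<equiv> direct_product ((UNIV :: nat set) \<times> X) (\<lambda>_. regular_module R)"
  assumes a: "\<And>n :: nat. a n \<in> carrier R" "\<And>n. \<exists>r \<in> carrier R. a (Suc n) = a n \<otimes> r"
    and co: "coordinates R D W c"
  obtains m W0 where "finite W0" "W0 \<subseteq> W"
    "\<And>w z n. \<lbrakk>w \<in> W - W0; z \<in> carrier D; \<forall>i < m. \<forall>x \<in> X. z (i, x) = \<zero>\<rbrakk>
      \<Longrightarrow> \<exists>s \<in> carrier R. c w (a m \<odot>\<^bsub>D\<^esub> z) = a n \<otimes> s"
proof (rule ccontr)
  note found = that
  assume no: "\<not> thesis"
  \<comment> \<open>Elements supported in the rows from \<open>m\<close> on; the first index counts
    rows.\<close>
  define low where "low m z \<longleftrightarrow> (\<forall>i x. i < m \<longrightarrow> x \<in> X \<longrightarrow> z (i, x) = \<zero>)" for m :: nat and z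
  interpret D: left_module R D
    unfolding D_def by (rule direct_product_module[OF ring_axioms regular_left_module[OF ring_axioms]])
  interpret r: left_module R "regular_module R" by (rule regular_left_module[OF ring_axioms])
  note cD = coordinatesD[OF co]
  have D_eqI: "u = v" if "u \<in> carrier D" "v \<in> carrier D" "\<And>i x. x \<in> X \<Longrightarrow> u (i, x) = v (i, x)" for u v
    by (rule direct_product_eqI[OF that(1,2)[unfolded D_def]]) (use that(3) in auto)
  \<comment> \<open>A failure at stage \<open>m\<close> outside the finite set \<open>W0\<close>:
    some coordinate of \<open>a m\<close> times \<open>z\<close> does not lie in the right ideal of
    \<open>a n\<close>.\<close>
  define bad where "bad m W0 w z n \<longleftrightarrow> w \<in> W - W0 \<and> z \<in> carrier D \<and> low m z \<and>
    (\<forall>s \<in> carrier R. c w (a m \<odot>\<^bsub>D\<^esub> z) \<noteq> a n \<otimes> s)" for m W0 w z n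
  have ex_bad: "\<exists>w z n. bad m W0 w z n" if "finite W0" "W0 \<subseteq> W" for m W0
  proof (rule ccontr)
    assume none: "\<not> (\<exists>w z n. bad m W0 w z n)"
    have thesis
    proof (rule found[OF that])
      fix w z n assume *: "w \<in> W - W0" "z \<in> carrier D" "\<forall>i < m. \<forall>x \<in> X. z (i, x) = \<zero>"
      have "\<not> bad m W0 w z n" using none by blast
      then show "\<exists>s \<in> carrier R. c w (a m \<odot>\<^bsub>D\<^esub> z) = a n \<otimes> s"
        using * by (auto simp: bad_def low_def)
    qed
    then show False using no by simp
  qed
  define G where "G m W0 = (SOME p. bad m W0 (fst p) (fst (snd p)) (snd (snd p)))" for m W0
  define gw gz gn where "gw m W0 = fst (G m W0)" and "gz m W0 = fst (snd (G m W0))"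
    and "gn m W0 = snd (snd (G m W0))" for m W0
  have g: "bad m W0 (gw m W0) (gz m W0) (gn m W0)" if "finite W0" "W0 \<subseteq> W" for m W0
  proof -
    have "\<exists>w z n. bad m W0 w z n" by (rule ex_bad[OF that])
    then obtain w z n where "bad m W0 w z n" by blast
    then have "\<exists>p. bad m W0 (fst p) (fst (snd p)) (snd (snd p))"
      by (intro exI[of _ "(w, z, n)"]) simp
    from someI_ex[OF this] show ?thesis unfolding gw_def gz_def gn_def G_def .
  qed
  \<comment> \<open>The state consists of a row bound and of the finite set of coordinates touched
    so far. The new bound is at least \<open>n\<close>, so every later term lies in the right ideal
    of \<open>a n\<close> and cannot repair the failure at \<open>w\<close>. It also increases
    strictly, so only finitely many terms reach a given row. Enlarging the finite set makes later
    choices of \<open>w\<close> blind to the present term.\<close>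
  define step where "step st = (let m = fst st; W0 = snd st; w = gw m W0; z = gz m W0; n = gn m W0 in
    (max (Suc m) n, W0 \<union> {v \<in> W. c v (a m \<odot>\<^bsub>D\<^esub> z) \<noteq> \<zero>}))" for st
  define st where "st k = (step ^^ k) (0, {})" for k
  define m where "m k = fst (st k)" for k
  define V where "V k = snd (st k)" for k
  define w where "w k = gw (m k) (V k)" for k
  define z where "z k = gz (m k) (V k)" for k
  define nn where "nn k = gn (m k) (V k)" for k
  have m_Suc: "m (Suc k) = max (Suc (m k)) (nn k)"
    and V_Suc: "V (Suc k) = V k \<union> {v \<in> W. c v (a (m k) \<odot>\<^bsub>D\<^esub> z k) \<noteq> \<zero>}" for k
    by (simp_all add: m_def V_def z_def nn_def st_def step_def Let_def)
  have V: "finite (V k) \<and> V k \<subseteq> W" for k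
  proof (induction k)
    case 0
    then show ?case by (simp add: V_def st_def)
  next
    case (Suc k)
    then have "z k \<in> carrier D" using g[of "V k" "m k"] by (simp add: bad_def z_def)
    then have "finite {v \<in> W. c v (a (m k) \<odot>\<^bsub>D\<^esub> z k) \<noteq> \<zero>}"
      using cD(6) D.smult_closed a(1) by blast
    then show ?case using Suc V_Suc by auto
  qed
  have bad: "bad (m k) (V k) (w k) (z k) (nn k)" for k
    unfolding w_def z_def nn_def using g V by blast
  have zD: "z k \<in> carrier D" and wW: "w k \<in> W" "w k \<notin> V k" and low: "low (m k) (z k)" for k
    using bad[of k] by (auto simp: bad_def)
  have m_ge: "k \<le> m k" for k
  proof (induction k)
    case (Suc k)
    then show ?case using m_Suc[of k] by simp
  qed simp
  have m_mono: "m j \<le> m k" if "j \<le> k" for j k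
  proof (rule lift_Suc_mono_le[OF _ that])
    show "m k \<le> m (Suc k)" for k using m_Suc[of k] by simp
  qed
  have V_mono: "V j \<subseteq> V k" if "j \<le> k" for j k
  proof (rule lift_Suc_mono_le[OF _ that])
    show "V k \<subseteq> V (Suc k)" for k using V_Suc[of k] by simp
  qed
  have a_div: "\<exists>t \<in> carrier R. a j = a i \<otimes> t" if "i \<le> j" for i j
    using that
  proof (induction j rule: dec_induct)
    case base
    then show ?case using a(1) by (intro bexI[of _ \<one>]) auto
  next
    case (step j)
    then obtain t where t: "t \<in> carrier R" "a j = a i \<otimes> t" by blast
    obtain r where "r \<in> carrier R" "a (Suc j) = a j \<otimes> r" using a(2) by blast
    then show ?case using t a(1) by (intro bexI[of _ "t \<otimes> r"]) (auto simp: m_assoc)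
  qed
  have zR: "z k (i, x) \<in> carrier R" if "x \<in> X" for k i x
    using zD[of k] that by (auto simp: D_def PiE_iff)
  \<comment> \<open>The infinite sum of the terms \<open>a (m j)\<close> times \<open>z j\<close>
    from \<open>k\<close> on. Since \<open>z j\<close> vanishes in the rows below
    \<open>m j\<close>, and \<open>m j \<ge> j\<close>, the terms with \<open>j > i\<close> do not
    reach row \<open>i\<close>, so a finite sum gives the entry.\<close>
  define tail where "tail k = (\<lambda>(i, x) \<in> UNIV \<times> X. \<Oplus>j \<in> {k..i}. a (m j) \<otimes> z j (i, x))" for k
  have tailD: "tail k \<in> carrier D" for k
    using a(1) zR by (auto simp: tail_def D_def intro!: finsum_closed)
  have tail_step: "tail k = a (m k) \<odot>\<^bsub>D\<^esub> z k \<oplus>\<^bsub>D\<^esub> tail (Suc k)" for k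
  proof -
    have "tail k (i, x) = (a (m k) \<odot>\<^bsub>D\<^esub> z k \<oplus>\<^bsub>D\<^esub> tail (Suc k)) (i, x)" if x: "x \<in> X" for i x
    proof (cases "k \<le> i")
      case True
      then have "{k..i} = insert k {Suc k..i}" by auto
      then have "(\<Oplus>j \<in> {k..i}. a (m j) \<otimes> z j (i, x)) =
          a (m k) \<otimes> z k (i, x) \<oplus> (\<Oplus>j \<in> {Suc k..i}. a (m j) \<otimes> z j (i, x))"
        using a(1) zR x by (simp add: finsum_insert)
      then show ?thesis using x by (simp add: tail_def D_def)
    next
      case False
      then have "z k (i, x) = \<zero>" using low[of k] m_ge[of k] x by (simp add: low_def)
      then show ?thesis using False x a(1) by (simp add: tail_def D_def)
    qed
    moreover have "a (m k) \<odot>\<^bsub>D\<^esub> z k \<oplus>\<^bsub>D\<^esub> tail (Suc k) \<in> carrier D"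
      using D.smult_closed[OF a(1) zD] tailD by blast
    ultimately show ?thesis using D_eqI[OF tailD] by blast
  qed
  have tail_div: "\<exists>v \<in> carrier D. tail k = a (m k) \<odot>\<^bsub>D\<^esub> v" for k
  proof -
    have "\<forall>j. \<exists>t. k \<le> j \<longrightarrow> t \<in> carrier R \<and> a (m j) = a (m k) \<otimes> t"
      using a_div m_mono by blast
    then obtain t where t: "\<And>j. k \<le> j \<Longrightarrow> t j \<in> carrier R" "\<And>j. k \<le> j \<Longrightarrow> a (m j) = a (m k) \<otimes> t j"
      by metis
    define v where "v = (\<lambda>(i, x) \<in> UNIV \<times> X. \<Oplus>j \<in> {k..i}. t j \<otimes> z j (i, x))"
    have vD: "v \<in> carrier D" using t zR by (auto simp: v_def D_def intro!: finsum_closed)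
    have "tail k (i, x) = (a (m k) \<odot>\<^bsub>D\<^esub> v) (i, x)" if x: "x \<in> X" for i x
    proof -
      have "(\<Oplus>j \<in> {k..i}. a (m j) \<otimes> z j (i, x)) = (\<Oplus>j \<in> {k..i}. a (m k) \<otimes> (t j \<otimes> z j (i, x)))"
      proof (rule finsum_cong'[OF refl])
        show "(\<lambda>j. a (m k) \<otimes> (t j \<otimes> z j (i, x))) \<in> {k..i} \<rightarrow> carrier R" using t(1) a(1) zR x by auto
        fix j assume "j \<in> {k..i}"
        then have j: "k \<le> j" by simp
        show "a (m j) \<otimes> z j (i, x) = a (m k) \<otimes> (t j \<otimes> z j (i, x))"
          unfolding t(2)[OF j] by (rule m_assoc[OF a(1) t(1)[OF j] zR[OF x]])
      qed
      also have "\<dots> = a (m k) \<otimes> (\<Oplus>j \<in> {k..i}. t j \<otimes> z j (i, x))"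
        by (rule finsum_rdistr[symmetric]) (use t(1) a(1) zR x in auto)
      finally show ?thesis using x by (simp add: tail_def v_def D_def)
    qed
    then have "tail k = a (m k) \<odot>\<^bsub>D\<^esub> v" using D_eqI[OF tailD D.smult_closed[OF a(1) vD]] by blast
    then show ?thesis using vD by blast
  qed
  have not_div: "c (w k) (a (m k) \<odot>\<^bsub>D\<^esub> z k) \<noteq> a (nn k) \<otimes> s" if "s \<in> carrier R" for k s
    using bad[of k] that by (auto simp: bad_def)
  have w_V: "w j \<in> V k" if "j < k" for j k
  proof -
    have "c (w j) (a (m j) \<odot>\<^bsub>D\<^esub> z j) \<noteq> \<zero>" using not_div[of \<zero> j] a(1) by simp
    then have "w j \<in> V (Suc j)" using V_Suc wW by blast
    then show ?thesis using V_mono[of "Suc j" k] that by auto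
  qed
  then have "inj w" using wW(2) by (metis linorder_cases injI)
  have c_tail: "c (w k) (tail 0) = c (w k) (tail j)" if "j \<le> k" for j k
    using that
  proof (induction j)
    case (Suc j)
    have "w k \<notin> V (Suc j)" using V_mono[OF Suc.prems] wW(2) by blast
    then have "c (w k) (a (m j) \<odot>\<^bsub>D\<^esub> z j) = \<zero>" using V_Suc wW by blast
    then have "c (w k) (tail j) = c (w k) (tail (Suc j))"
      using cD(1,2)[OF wW(1)] tail_step[of j] D.smult_closed[OF a(1) zD] tailD by simp
    then show ?case using Suc by simp
  qed simp
  \<comment> \<open>At the coordinate \<open>w k\<close> the earlier terms contribute nothing, the
    \<open>k\<close>-th term is not in the right ideal of \<open>a (nn k)\<close> and the remainder
    is. So the total is nonzero, and since the \<open>w k\<close> are distinct, one element would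
    have infinitely many nonzero coordinates.\<close>
  have "c (w k) (tail 0) \<noteq> \<zero>" for k
  proof
    assume 0: "c (w k) (tail 0) = \<zero>"
    obtain v where v: "v \<in> carrier D" "tail (Suc k) = a (m (Suc k)) \<odot>\<^bsub>D\<^esub> v" using tail_div by blast
    obtain t where t: "t \<in> carrier R" "a (m (Suc k)) = a (nn k) \<otimes> t"
      using a_div[of "nn k" "m (Suc k)"] m_Suc by auto
    have cv: "c (w k) v \<in> carrier R" using cD(1) wW v by blast
    have "\<zero> = c (w k) (a (m k) \<odot>\<^bsub>D\<^esub> z k) \<oplus> c (w k) (tail (Suc k))"
      using 0 c_tail[of k k] cD(2)[OF wW(1) D.smult_closed[OF a(1) zD] tailD] tail_step[of k] by simp
    also have "c (w k) (tail (Suc k)) = a (nn k) \<otimes> (t \<otimes> c (w k) v)"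
      unfolding v(2) using cD(3)[OF wW(1) a(1) v(1), of k "m (Suc k)"] m_assoc[OF a(1) t(1) cv, of "nn k"]
      by (simp add: t(2)[symmetric])
    finally have "c (w k) (a (m k) \<odot>\<^bsub>D\<^esub> z k) = \<ominus> (a (nn k) \<otimes> (t \<otimes> c (w k) v))"
      using cD(1)[OF wW(1) D.smult_closed[OF a(1) zD]] a(1) t cv by (simp add: minus_equality)
    also have "\<dots> = a (nn k) \<otimes> (\<ominus> (t \<otimes> c (w k) v))" using a(1) t cv by (simp add: r_minus)
    finally show False using not_div[of "\<ominus> (t \<otimes> c (w k) v)" k] t cv by simp
  qed
  then have "range w \<subseteq> {i \<in> W. c i (tail 0) \<noteq> \<zero>}" using wW by blast
  then have "finite (range w)" using cD(6)[OF tailD[of 0]] finite_subset by blast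
  then show False using \<open>inj w\<close> finite_imageD infinite_UNIV_nat by blast
qed

text \<open>The diagonal lemma controls all coordinates outside a finite \<open>W0\<close>, on the
  rows from \<open>m\<close> on. Two unit vectors in row \<open>m\<close> with equal coordinates on
  \<open>W0\<close> have a difference \<open>d\<close> such that every coordinate of
  \<open>a m\<close> times \<open>d\<close> lies in the right ideal of \<open>a (Suc m)\<close>. As
  some entry of \<open>d\<close> is one, \<open>a m\<close> lies there as well, against the choice
  of the chain.\<close>

lemma (in small_ring) products_imp_dcc:
  assumes prods: "\<forall>(I :: 'v set) (M :: 'v \<Rightarrow> ('v, 'v) module).
         small I \<and> (\<forall>i \<in> I. M i \<in> projectives R) \<longrightarrow> projective R (direct_product I M)"
  shows "principal_right_dcc R"
proof (rule ccontr)
  assume "\<not> principal_right_dcc R"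
  then obtain a where a: "\<And>n :: nat. a n \<in> carrier R" "\<And>n. \<exists>r \<in> carrier R. a (Suc n) = a n \<otimes> r"
    "\<And>n s. s \<in> carrier R \<Longrightarrow> a n \<noteq> a (Suc n) \<otimes> s"
    by (rule not_dcc_chain) (rule that)
  \<comment> \<open>All finite sequences of ring elements. Every table of values on a finite set of
    coordinates embeds into \<open>Y\<close>, whichever the finite set is; \<open>W0\<close> is
    known only after the product has been formed.\<close>
  define Y :: "(nat \<Rightarrow> 'v) set" where "Y = (\<Union>n. {..<n} \<rightarrow>\<^sub>E carrier R)"
  have Y: "Y \<prec> (UNIV :: 'v set)"
    unfolding Y_def by (intro UN_small[OF nat_small] PiE_small finite_small regular_small) simp
  \<comment> \<open>Each row has one place for every subset of \<open>Y\<close>: by Cantor's theorem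
    too many to be separated by the tables of coordinates on \<open>W0\<close>.\<close>
  define I :: "(nat \<times> (nat \<Rightarrow> 'v) set) set" where "I = UNIV \<times> Pow Y"
  have I: "I \<prec> (UNIV :: 'v set)" unfolding I_def by (rule Times_small[OF nat_small Pow_small[OF Y]])
  let ?R = "regular_module R" and ?D = "direct_product I (\<lambda>_. regular_module R)"
  have "?R \<in> projectives R"
    using regular_projective regular_in_modules by (simp add: projectives_def)
  then have D: "projective R ?D" by (intro product_any_index[OF prods I])
  have D_small: "carrier ?D \<prec> (UNIV :: 'v set)" using PiE_small[OF I regular_small] by simp
  note lR = regular_left_module[OF ring_axioms]
  have lD: "left_module R ?D" by (rule direct_product_module[OF ring_axioms lR])
  interpret D: left_module R ?D by (rule lD)
  interpret r: left_module R ?R by (rule lR)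
  let ?W = "carrier ?D"
  obtain c where c: "dual_basis R ?D ?W (\<lambda>x. x) c"
    by (rule projective_dual_basis[OF D D_small])
  then have co: "coordinates R ?D ?W c" and c_sum:
    "\<And>y. y \<in> carrier ?D \<Longrightarrow> lincomb R ?D ?W (\<lambda>i. c i y) (\<lambda>x. x) = y"
    by (auto simp: dual_basis_def)
  note cD = coordinatesD[OF co]
  obtain m W0 where W0: "finite W0" "W0 \<subseteq> ?W" and deep:
    "\<And>w z n. \<lbrakk>w \<in> ?W - W0; z \<in> ?W; \<forall>i < m. \<forall>x \<in> Pow Y. z (i, x) = \<zero>\<rbrakk>
      \<Longrightarrow> \<exists>s \<in> carrier R. c w (a m \<odot>\<^bsub>?D\<^esub> z) = a n \<otimes> s"
    by (rule chase_diagonal[where a = a and X = "Pow Y" and W = ?W and c = c,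
          OF a(1,2), folded I_def, OF co]) (rule that)
  define \<delta> where "\<delta> x = (\<lambda>p \<in> I. if p = (m, x) then \<one> else \<zero>)" for x
  have \<delta>: "\<delta> x \<in> ?W" for x by (auto simp: \<delta>_def)
  define \<theta> where "\<theta> x = (\<lambda>w \<in> W0. c w (\<delta> x))" for x
  have "\<not> inj_on \<theta> (Pow Y)"
  proof
    assume inj: "inj_on \<theta> (Pow Y)"
    have \<theta>: "\<theta> ` Pow Y \<subseteq> W0 \<rightarrow>\<^sub>E carrier R" using cD(1) \<delta> W0(2) by (auto simp: \<theta>_def)
    obtain h and n :: nat where h: "bij_betw h {..<n} W0"
      using ex_bij_betw_nat_finite[OF W0(1)] by (auto simp: atLeast0LessThan)
    have "inj_on (\<lambda>f. \<lambda>i \<in> {..<n}. f (h i)) (W0 \<rightarrow>\<^sub>E carrier R)"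
    proof (rule inj_onI)
      fix f g assume fg: "f \<in> W0 \<rightarrow>\<^sub>E carrier R" "g \<in> W0 \<rightarrow>\<^sub>E carrier R"
        "(\<lambda>i \<in> {..<n}. f (h i)) = (\<lambda>i \<in> {..<n}. g (h i))"
      show "f = g"
      proof (rule PiE_ext[OF fg(1,2)])
        fix w assume "w \<in> W0"
        then obtain i where "i < n" "w = h i" using h by (auto simp: bij_betw_def)
        then show "f w = g w" using fun_cong[OF fg(3), of i] by simp
      qed
    qed
    moreover have "(\<lambda>f. \<lambda>i \<in> {..<n}. f (h i)) ` (W0 \<rightarrow>\<^sub>E carrier R) \<subseteq> Y"
      using h unfolding Y_def by (intro image_subsetI UN_I[of n]) (auto simp: bij_betw_def PiE_iff)
    ultimately have "(W0 \<rightarrow>\<^sub>E carrier R) \<lesssim> Y" unfolding lepoll_def by blast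
    moreover have "Pow Y \<lesssim> (W0 \<rightarrow>\<^sub>E carrier R)" using inj \<theta> unfolding lepoll_def by blast
    ultimately have "Pow Y \<lesssim> Y" by (rule lepoll_trans[rotated])
    then show False using lesspoll_Pow_self[of Y] lesspoll_trans2 lesspoll_not_refl by blast
  qed
  then obtain x x' where x: "x \<in> Pow Y" "x' \<in> Pow Y" "x \<noteq> x'" "\<theta> x = \<theta> x'"
    by (auto simp: inj_on_def)
  define d where "d = \<delta> x \<ominus>\<^bsub>?D\<^esub> \<delta> x'"
  have d: "d \<in> ?W" unfolding d_def by (rule D.M.minus_closed[OF \<delta> \<delta>])
  have d_at: "d p = \<delta> x p \<ominus>\<^bsub>?R\<^esub> \<delta> x' p" if p: "p \<in> I" for p
  proof -
    interpret p: mod_homs R ?D ?R "\<lambda>u \<in> carrier ?D. u p"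
      by (rule mod_homsI[OF lD lR direct_product_projection[OF ring_axioms lR p]])
    show ?thesis using p.f_diff[OF \<delta> \<delta>, of x x'] d \<delta>[of x] \<delta>[of x'] unfolding d_def by simp
  qed
  have low: "d (i, y) = \<zero>" if "i < m" "y \<in> Pow Y" for i y
  proof -
    have "\<delta> x (i, y) = \<zero>" "\<delta> x' (i, y) = \<zero>" using that by (auto simp: \<delta>_def I_def)
    then show ?thesis using d_at[of "(i, y)"] that r.diff_zero[of "\<zero>"] by (simp add: I_def)
  qed
  have d_m: "d (m, x) = \<one>"
  proof -
    have "\<delta> x (m, x) = \<one>" "\<delta> x' (m, x) = \<zero>" using x by (auto simp: \<delta>_def I_def)
    then show ?thesis using d_at[of "(m, x)"] x(1) r.diff_zero[of "\<one>"] by (simp add: I_def)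
  qed
  have ad: "a m \<odot>\<^bsub>?D\<^esub> d \<in> ?W" by (rule D.smult_closed[OF a(1) d])
  have div: "\<exists>s \<in> carrier R. c w (a m \<odot>\<^bsub>?D\<^esub> d) = a (Suc m) \<otimes> s" if w: "w \<in> ?W" for w
  proof (cases "w \<in> W0")
    case True
    interpret cw: mod_homs R ?D ?R "c w"
      by (rule mod_homsI[OF lD lR]) (use co w in \<open>auto simp: coordinates_def\<close>)
    have "c w (\<delta> x) = c w (\<delta> x')" using fun_cong[OF x(4), of w] True by (simp add: \<theta>_def)
    then have "c w d = \<zero>"
      using cw.f_diff[OF \<delta> \<delta>, of x x'] r.diff_eq_zero_iff[OF cw.f_closed[OF \<delta>] cw.f_closed[OF \<delta>]]
      unfolding d_def by simp
    then have "c w (a m \<odot>\<^bsub>?D\<^esub> d) = a (Suc m) \<otimes> \<zero>" using cD(3)[OF w a(1) d] a(1) by simp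
    then show ?thesis by blast
  next
    case False
    then show ?thesis using deep[OF _ d] low w by blast
  qed
  let ?S = "opposite_ring R"
  interpret S: left_module ?S "regular_module ?S" by (rule regular_left_module[OF opposite_ring])
  \<comment> \<open>The right ideal of \<open>a (Suc m)\<close>, treated as a submodule over the
    opposite ring so that closure under finite sums is at hand.\<close>
  let ?A = "{a (Suc m) \<otimes> s |s. s \<in> carrier R}"
  have A: "submodule ?A ?S (regular_module ?S)"
  proof (rule S.submoduleI)
    show "?A \<subseteq> carrier (regular_module ?S)" using a(1) by auto
    show "\<zero>\<^bsub>regular_module ?S\<^esub> \<in> ?A" using a(1) by (auto intro!: exI[of _ "\<zero>"])
    show "u \<oplus>\<^bsub>regular_module ?S\<^esub> v \<in> ?A" if "u \<in> ?A" "v \<in> ?A" for u v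
      using that a(1) by (auto simp: r_distr[symmetric])
    show "q \<odot>\<^bsub>regular_module ?S\<^esub> u \<in> ?A" if "q \<in> carrier ?S" "u \<in> ?A" for q u
      using that a(1) by (auto simp: m_assoc)
  qed
  have mx: "(m, x) \<in> I" using x by (simp add: I_def)
  let ?V = "{w \<in> ?W. c w (a m \<odot>\<^bsub>?D\<^esub> d) \<noteq> \<zero>}"
  have V: "finite ?V" by (rule cD(6)[OF ad])
  have cl: "(\<lambda>w. c w (a m \<odot>\<^bsub>?D\<^esub> d) \<odot>\<^bsub>?D\<^esub> w) \<in> ?V \<rightarrow> ?W"
    using cD(1)[OF _ ad] by (intro funcsetI D.smult_closed) auto
  have "a m \<odot>\<^bsub>?D\<^esub> d = (\<Oplus>\<^bsub>?D\<^esub> w \<in> ?V. c w (a m \<odot>\<^bsub>?D\<^esub> d) \<odot>\<^bsub>?D\<^esub> w)"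
    using c_sum[OF ad] by (simp only: lincomb_def)
  then have "(a m \<odot>\<^bsub>?D\<^esub> d) (m, x) = (\<Oplus> w \<in> ?V. (c w (a m \<odot>\<^bsub>?D\<^esub> d) \<odot>\<^bsub>?D\<^esub> w) (m, x))"
    using direct_product_finsum[OF ring_axioms lR mx V cl] by simp
  also have "\<dots> = (\<Oplus>\<^bsub>regular_module ?S\<^esub> w \<in> ?V. (c w (a m \<odot>\<^bsub>?D\<^esub> d) \<odot>\<^bsub>?D\<^esub> w) (m, x))" by simp
  also have "\<dots> \<in> ?A"
  proof (rule S.submodule_finsum[OF A], rule funcsetI)
    fix w assume "w \<in> ?V"
    then have w: "w \<in> ?W" by simp
    obtain s where s: "s \<in> carrier R" "c w (a m \<odot>\<^bsub>?D\<^esub> d) = a (Suc m) \<otimes> s" using div[OF w] by blast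
    have "w (m, x) \<in> carrier R" using w mx by (auto simp: PiE_iff)
    then have "(c w (a m \<odot>\<^bsub>?D\<^esub> d) \<odot>\<^bsub>?D\<^esub> w) (m, x) = a (Suc m) \<otimes> (s \<otimes> w (m, x))"
      using s a(1) mx by (simp add: m_assoc del: s(2))
    then show "(c w (a m \<odot>\<^bsub>?D\<^esub> d) \<odot>\<^bsub>?D\<^esub> w) (m, x) \<in> ?A"
      using s \<open>w (m, x) \<in> carrier R\<close> by blast
  qed
  finally have "(a m \<odot>\<^bsub>?D\<^esub> d) (m, x) \<in> ?A" .
  then have "a m \<in> ?A" using mx d_m a(1) by simp
  then show False using a(3) by blast
qed

section \<open>Projective covers\<close>

definition primitive_idempotent :: "('r, 'x) ring_scheme \<Rightarrow> 'r \<Rightarrow> bool" where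
  "primitive_idempotent R e \<longleftrightarrow> e \<in> carrier R \<and> e \<noteq> \<zero>\<^bsub>R\<^esub> \<and> e \<otimes>\<^bsub>R\<^esub> e = e \<and>
     (\<forall>g \<in> carrier R. g \<otimes>\<^bsub>R\<^esub> g = g \<and> e \<otimes>\<^bsub>R\<^esub> g = g \<and> g \<otimes>\<^bsub>R\<^esub> e = g \<longrightarrow> g = \<zero>\<^bsub>R\<^esub> \<or> g = e)"

lemma dccE:
  assumes "principal_right_dcc R" "A \<subseteq> carrier R" "A \<noteq> {}"
  obtains a where "a \<in> A"
    "\<And>r. \<lbrakk>r \<in> carrier R; a \<otimes>\<^bsub>R\<^esub> r \<in> A\<rbrakk> \<Longrightarrow> \<exists>s \<in> carrier R. a = a \<otimes>\<^bsub>R\<^esub> r \<otimes>\<^bsub>R\<^esub> s"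
proof -
  have "\<exists>a \<in> A. \<forall>r \<in> carrier R. a \<otimes>\<^bsub>R\<^esub> r \<in> A \<longrightarrow> (\<exists>s \<in> carrier R. a = a \<otimes>\<^bsub>R\<^esub> r \<otimes>\<^bsub>R\<^esub> s)"
    using assms unfolding principal_right_dcc_def by simp
  then show ?thesis using that by blast
qed

section \<open>Primitive idempotents under the minimum condition\<close>

context ring
begin

text \<open>A minimal choice \<open>a\<close> among the nonzero idempotents of \<open>gRg\<close>.
  For a nonzero idempotent \<open>h\<close> below \<open>a\<close> minimality gives
  \<open>a = h s\<close>, whence \<open>h a = a\<close> and so \<open>h = a\<close>.\<close>

lemma primitive_below:
  assumes dcc: "principal_right_dcc R" and g: "g \<in> carrier R" "g \<noteq> \<zero>" "g \<otimes> g = g"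
  obtains e where "primitive_idempotent R e" "g \<otimes> e = e" "e \<otimes> g = e"
proof -
  define A where "A = {e \<in> carrier R. e \<noteq> \<zero> \<and> e \<otimes> e = e \<and> g \<otimes> e = e \<and> e \<otimes> g = e}"
  have "A \<subseteq> carrier R \<and> A \<noteq> {}" using g by (auto simp: A_def)
  then have "A \<subseteq> carrier R" "A \<noteq> {}" by auto
  then obtain a where a: "a \<in> A"
    and min: "\<And>r. \<lbrakk>r \<in> carrier R; a \<otimes> r \<in> A\<rbrakk> \<Longrightarrow> \<exists>s \<in> carrier R. a = a \<otimes> r \<otimes> s"
    by (rule dccE[OF dcc]) (rule that)
  have aR: "a \<in> carrier R" "a \<otimes> a = a" "g \<otimes> a = a" "a \<otimes> g = a" "a \<noteq> \<zero>" using a by (auto simp: A_def)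
  have "h = a" if h: "h \<in> carrier R" "h \<otimes> h = h" "a \<otimes> h = h" "h \<otimes> a = h" "h \<noteq> \<zero>" for h
  proof -
    have "g \<otimes> h = h" "h \<otimes> g = h" using aR h g(1) by (metis m_assoc)+
    then have "h \<in> A" using h by (simp add: A_def)
    then obtain s where s: "s \<in> carrier R" "a = h \<otimes> s" using min[of h] h by auto
    then have "h \<otimes> a = a" using h by (metis m_assoc)
    then show ?thesis using h by simp
  qed
  then have "primitive_idempotent R a" unfolding primitive_idempotent_def using aR by blast
  then show ?thesis using that aR by blast
qed

text \<open>The minimum condition is applied to the possible remainders: idempotents that are
  orthogonal to finitely many primitive ones and add up to one with them. From a nonzero remainder
  another primitive idempotent could be split off, which would make the right ideal smaller.\<close>

lemma primitive_decomposition: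
  assumes dcc: "principal_right_dcc R"
  obtains E where "finite E" "\<And>e. e \<in> E \<Longrightarrow> primitive_idempotent R e" "(\<Oplus>e \<in> E. e) = \<one>"
proof -
  define A where "A = {g \<in> carrier R. g \<otimes> g = g \<and> (\<exists>E. finite E \<and> (\<forall>e \<in> E. primitive_idempotent R e \<and>
    e \<otimes> g = \<zero> \<and> g \<otimes> e = \<zero>) \<and> (\<Oplus>e \<in> E. e) \<oplus> g = \<one>)}"
  have "\<one> \<in> A" by (auto simp: A_def intro!: exI[of _ "{}"])
  moreover have "A \<subseteq> carrier R" by (auto simp: A_def)
  ultimately have "A \<subseteq> carrier R \<and> A \<noteq> {}" by blast
  then have "A \<subseteq> carrier R" "A \<noteq> {}" by auto
  then obtain g where g: "g \<in> A"
    and min: "\<And>r. \<lbrakk>r \<in> carrier R; g \<otimes> r \<in> A\<rbrakk> \<Longrightarrow> \<exists>s \<in> carrier R. g = g \<otimes> r \<otimes> s"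
    by (rule dccE[OF dcc]) (rule that)
  have gR: "g \<in> carrier R" "g \<otimes> g = g" using g by (auto simp: A_def)
  obtain E where E: "finite E" "\<And>e. e \<in> E \<Longrightarrow> primitive_idempotent R e"
    "\<And>e. e \<in> E \<Longrightarrow> e \<otimes> g = \<zero>" "\<And>e. e \<in> E \<Longrightarrow> g \<otimes> e = \<zero>" "(\<Oplus>e \<in> E. e) \<oplus> g = \<one>"
    using g by (auto simp: A_def)
  have ER: "e \<in> carrier R" if "e \<in> E" for e using E(2)[OF that] by (simp add: primitive_idempotent_def)
  have "g = \<zero>"
  proof (rule ccontr)
    assume "g \<noteq> \<zero>"
    then obtain f where f: "primitive_idempotent R f" "g \<otimes> f = f" "f \<otimes> g = f"
      using primitive_below[OF dcc gR(1) _ gR(2)] by blast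
    then have fR: "f \<in> carrier R" "f \<otimes> f = f" "f \<noteq> \<zero>" by (auto simp: primitive_idempotent_def)
    define h where "h = g \<otimes> (\<one> \<ominus> f)"
    have h: "h \<in> carrier R" using gR fR by (simp add: h_def)
    have h_eq: "h = g \<ominus> f" unfolding h_def a_minus_def using gR fR f(2) by (simp add: r_distr r_minus)
    have fh: "f \<otimes> h = \<zero>" unfolding h_eq a_minus_def using gR fR f by (simp add: r_distr r_minus r_neg)
    have hf: "h \<otimes> f = \<zero>" unfolding h_eq a_minus_def using gR fR f by (simp add: l_distr l_minus r_neg)
    have gh: "g \<otimes> h = h" unfolding h_def using gR fR by (simp add: m_assoc[symmetric])
    have hh: "h \<otimes> h = h"
    proof -
      have "h \<otimes> h = g \<otimes> h \<ominus> f \<otimes> h"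
        using gR fR h by (subst h_eq) (simp add: a_minus_def l_distr l_minus)
      then show ?thesis using fh gh h by (simp add: a_minus_def)
    qed
    have orth: "e \<otimes> h = \<zero>" "h \<otimes> e = \<zero>" if e: "e \<in> E" for e
    proof -
      have "e \<otimes> f = \<zero>" using E(3)[OF e] f(2) ER[OF e] gR fR by (metis m_assoc l_null)
      moreover have "f \<otimes> e = \<zero>" using E(4)[OF e] f(3) ER[OF e] gR fR by (metis m_assoc r_null)
      ultimately show "e \<otimes> h = \<zero>" "h \<otimes> e = \<zero>"
        using E(3,4)[OF e] ER[OF e] gR fR
        by (simp_all add: h_eq a_minus_def l_distr r_distr l_minus r_minus)
    qed
    have fE: "f \<notin> E" using E(3)[of f] f(3) fR(3) by auto
    have "(\<Oplus>e \<in> insert f E. e) \<oplus> h = \<one>"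
    proof -
      have S: "(\<Oplus>e \<in> E. e) \<in> carrier R" using ER by (intro finsum_closed) auto
      have "(\<Oplus>e \<in> insert f E. e) = f \<oplus> (\<Oplus>e \<in> E. e)"
        using E(1) fE ER fR by (intro finsum_insert) auto
      then have "(\<Oplus>e \<in> insert f E. e) \<oplus> h = (\<Oplus>e \<in> E. e) \<oplus> (h \<oplus> f)"
        using S h fR by (simp add: a_ac)
      also have "h \<oplus> f = g" unfolding h_eq using gR fR by (simp add: a_minus_def a_assoc l_neg)
      finally show ?thesis using E(5) by simp
    qed
    then have "h \<in> A"
      unfolding A_def using h hh E(1,2) f(1) fh hf orth
      by (intro CollectI conjI exI[of _ "insert f E"]) auto
    then obtain s where s: "s \<in> carrier R" "g = h \<otimes> s" using min[of "\<one> \<ominus> f"] fR by (auto simp: h_def)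
    \<comment> \<open>Minimality has given \<open>g = h s\<close>. But \<open>f\<close> lies below
      \<open>g\<close> and is orthogonal to \<open>h\<close>, so it would be zero.\<close>
    have "f = f \<otimes> (h \<otimes> s)" using f(3) s(2) by simp
    also have "\<dots> = \<zero>" using fh fR h s by (simp add: m_assoc[symmetric])
    finally show False using fR(3) by simp
  qed
  then have "(\<Oplus>e \<in> E. e) = \<one>" using E(5) ER by (simp add: finsum_closed Pi_iff)
  then show ?thesis using that E by blast
qed

end

section \<open>Corners of a left hereditary ring\<close>

context small_ring
begin

text \<open>The kernel of \<open>Re \<rightarrow> Ry\<close> is a direct summand of \<open>Re\<close>, as \<open>Ry\<close> is projective.\<close>

lemma primitive_mult_injective:
  assumes her: "left_hereditary R" and e: "primitive_idempotent R e"
    and y: "y \<in> carrier R" "e \<otimes> y = y" "y \<noteq> \<zero>"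
    and r: "r \<in> carrier R" "r \<otimes> e = r" "r \<otimes> y = \<zero>"
  shows "r = \<zero>"
proof -
  let ?R = "regular_module R"
  note lR = regular_left_module[OF ring_axioms]
  interpret r: left_module R ?R by (rule lR)
  have eR: "e \<in> carrier R" "e \<otimes> e = e" using e by (auto simp: primitive_idempotent_def)
  define \<phi> where "\<phi> = (\<lambda>r \<in> carrier ?R. r \<otimes> y)"
  have \<phi>: "\<phi> \<in> mod_hom R ?R ?R"
    unfolding \<phi>_def by (rule restrict_mod_homI[OF lR]) (use y in \<open>auto simp: l_distr m_assoc\<close>)
  interpret \<phi>: mod_homs R ?R ?R \<phi> by (rule mod_homsI[OF lR lR \<phi>])
  let ?I = "?R\<lparr>carrier := \<phi> ` carrier ?R\<rparr>"
  have I: "submodule (\<phi> ` carrier ?R) R ?R" by (rule \<phi>.image_submodule[OF r.carrier_submodule])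
  have lI: "left_module R ?I" by (rule r.submodule_module[OF I])
  have I_proj: "projective R ?I" using her I by (simp add: left_hereditary_def)
  have I_small: "carrier ?I \<prec> (UNIV :: 'v set)"
    using image_small[OF regular_small, of \<phi>] by simp
  have \<phi>I: "\<phi> \<in> mod_hom R ?R ?I" by (rule mod_hom_into_submodule[OF \<phi>]) auto
  have onto: "\<phi> ` carrier ?R = carrier ?I" by simp
  obtain \<sigma> where \<sigma>: "\<sigma> \<in> mod_hom R ?I ?R" "\<And>z. z \<in> carrier ?I \<Longrightarrow> \<phi> (\<sigma> z) = (\<lambda>z \<in> carrier ?I. z) z"
    by (rule projective_lift[OF I_proj I_small lR lI \<phi>I onto id_mod_hom[OF lI]]) (rule that)
  interpret \<sigma>: mod_homs R ?I ?R \<sigma> by (rule mod_homsI[OF lI lR \<sigma>(1)])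
  have yI: "y \<in> carrier ?I" using y by (auto simp: \<phi>_def intro!: image_eqI[of _ _ "\<one>"])
  have \<sigma>y: "\<sigma> y \<in> carrier R" using \<sigma>.f_closed[OF yI] by simp
  have \<sigma>_mult: "\<sigma> (s \<otimes> y) = s \<otimes> \<sigma> y" if "s \<in> carrier R" for s
    using \<sigma>.f_smult[OF that yI] by simp
  \<comment> \<open>The section of multiplication by \<open>y\<close> yields an idempotent
    \<open>h\<close> of \<open>eRe\<close> with \<open>h y = y\<close>. Primitivity forces
    \<open>h = e\<close>, and then \<open>r = r h\<close> vanishes because \<open>r\<close> times
    \<open>\<sigma> y\<close> is \<open>\<sigma>\<close> of the product \<open>r y\<close>, which is
    zero.\<close>
  define h where "h = \<sigma> y \<otimes> e"
  have h: "h \<in> carrier R" using \<sigma>y eR by (simp add: h_def)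
  have \<sigma>yy: "\<sigma> y \<otimes> y = y" using \<sigma>(2)[OF yI] yI \<sigma>y by (simp add: \<phi>_def)
  have hy: "h \<otimes> y = y" using \<sigma>yy y eR \<sigma>y by (simp add: h_def m_assoc)
  have eh: "e \<otimes> h = h"
    using \<sigma>_mult[OF eR(1)] y(2) eR \<sigma>y by (simp add: h_def m_assoc[symmetric])
  have he: "h \<otimes> e = h" using eR \<sigma>y by (simp add: h_def m_assoc)
  have hh: "h \<otimes> h = h"
  proof -
    have "h \<otimes> \<sigma> y = \<sigma> y" using \<sigma>_mult[OF h] hy by simp
    then have "h \<otimes> \<sigma> y \<otimes> e = h" by (simp add: h_def)
    then show ?thesis using h \<sigma>y eR by (simp add: h_def m_assoc)
  qed
  have "h \<noteq> \<zero>" using hy y by auto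
  then have "h = e" using e h hh eh he unfolding primitive_idempotent_def by blast
  have "r \<otimes> \<sigma> y = \<zero>" using \<sigma>_mult[OF r(1)] r(3) \<sigma>.f_zero by simp
  then have "r \<otimes> h = \<zero>" using r \<sigma>y eR by (simp add: h_def m_assoc[symmetric])
  then show ?thesis using \<open>h = e\<close> r by simp
qed

text \<open>\<open>eRe\<close> is a division ring. A nonzero \<open>y\<close> of \<open>eRe\<close>
  whose right ideal is minimal among those of such elements satisfies \<open>y = y x s\<close>, as
  \<open>y x\<close> is again nonzero. So \<open>y\<close> annihilates \<open>e - x s\<close>, and
  injectivity of multiplication makes this difference zero.\<close>

lemma primitive_corner_division:
  assumes her: "left_hereditary R" and dcc: "principal_right_dcc R" and e: "primitive_idempotent R e"
    and x: "x \<in> carrier R" "e \<otimes> x = x" "x \<otimes> e = x" "x \<noteq> \<zero>"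
  obtains w where "w \<in> carrier R" "x \<otimes> w = e"
proof -
  have eR: "e \<in> carrier R" "e \<otimes> e = e" using e by (auto simp: primitive_idempotent_def)
  define A where "A = {y \<in> carrier R. e \<otimes> y = y \<and> y \<otimes> e = y \<and> y \<noteq> \<zero>}"
  have "A \<subseteq> carrier R \<and> A \<noteq> {}" using x by (auto simp: A_def)
  then have "A \<subseteq> carrier R" "A \<noteq> {}" by auto
  then obtain y where y: "y \<in> A"
    and min: "\<And>r. \<lbrakk>r \<in> carrier R; y \<otimes> r \<in> A\<rbrakk> \<Longrightarrow> \<exists>s \<in> carrier R. y = y \<otimes> r \<otimes> s"
    by (rule dccE[OF dcc]) (rule that)
  have yR: "y \<in> carrier R" "e \<otimes> y = y" "y \<otimes> e = y" "y \<noteq> \<zero>" using y by (auto simp: A_def)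
  have "y \<otimes> x \<noteq> \<zero>"
    using primitive_mult_injective[OF her e x(1,2,4) yR(1,3)] yR(4) by blast
  moreover have "e \<otimes> (y \<otimes> x) = y \<otimes> x" "y \<otimes> x \<otimes> e = y \<otimes> x"
    using eR yR x by (simp_all add: m_assoc[symmetric]) (simp add: m_assoc)
  ultimately have "y \<otimes> x \<in> A" using yR x by (simp add: A_def)
  then obtain s where s: "s \<in> carrier R" "y = y \<otimes> x \<otimes> s" using min x by blast
  define v where "v = e \<ominus> x \<otimes> s"
  have v: "v \<in> carrier R" using eR x s by (simp add: v_def)
  have "e \<otimes> v = v"
    using eR x s by (simp add: v_def a_minus_def r_distr r_minus m_assoc[symmetric])
  moreover have "y \<otimes> v = \<zero>"
  proof -
    have "y \<otimes> v = y \<oplus> \<ominus> (y \<otimes> x \<otimes> s)"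
      using eR x s yR by (simp add: v_def a_minus_def r_distr r_minus m_assoc)
    then show ?thesis using s(2) yR(1) by (simp add: r_neg)
  qed
  ultimately have "v = \<zero>"
    using primitive_mult_injective[OF her e v _ _ yR(1,3)] yR(4) by blast
  moreover have "e = x \<otimes> s \<oplus> v"
    unfolding v_def using eR x s by (simp add: a_minus_def a_comm[of e] r_neg2)
  ultimately have "x \<otimes> s = e" using x s by simp
  then show ?thesis using that s by blast
qed

end

text \<open>Here \<open>J\<close> plays the role of the Jacobson radical, and the elements of \<open>E\<close> are local
  idempotents.\<close>

locale local_decomposition = small_ring U R for U :: "'v itself" and R :: "'v ring" (structure) +
  fixes E J :: "'v set"
  assumes dcc: "principal_right_dcc R"
    and E: "finite E" "E \<subseteq> carrier R" "(\<Oplus>\<^bsub>R\<^esub>e \<in> E. e) = \<one>\<^bsub>R\<^esub>" "\<And>e. e \<in> E \<Longrightarrow> e \<otimes>\<^bsub>R\<^esub> e = e"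
    and J_subset: "J \<subseteq> carrier R"
    and J_left: "\<And>r a. \<lbrakk>r \<in> carrier R; a \<in> J\<rbrakk> \<Longrightarrow> r \<otimes>\<^bsub>R\<^esub> a \<in> J"
    and J_right: "\<And>r a. \<lbrakk>r \<in> carrier R; a \<in> J\<rbrakk> \<Longrightarrow> a \<otimes>\<^bsub>R\<^esub> r \<in> J"
    and local: "\<And>e z. \<lbrakk>e \<in> E; z \<in> carrier R; z \<otimes>\<^bsub>R\<^esub> e = z; z \<notin> J\<rbrakk> \<Longrightarrow> \<exists>b \<in> carrier R. b \<otimes>\<^bsub>R\<^esub> z = e"
    and absorb: "\<And>a c. \<lbrakk>a \<in> carrier R; c \<in> J; a \<otimes>\<^bsub>R\<^esub> c = a\<rbrakk> \<Longrightarrow> a = \<zero>\<^bsub>R\<^esub>"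

text \<open>\<open>J\<close> is the largest two-sided ideal whose corners at the idempotents of
  \<open>E\<close> all vanish. An element \<open>z\<close> of \<open>Re\<close> outside
  \<open>J\<close> has a multiple with a nonzero corner; that corner is invertible, which leads to a
  left inverse of \<open>z\<close> relative to \<open>e\<close>. Absorption rests on the relation
  \<open>fJe \<noteq> 0\<close> being a strict order on the finite set \<open>E\<close>.\<close>

lemma (in small_ring) hereditary_local_decomposition:
  assumes her: "left_hereditary R" and dcc: "principal_right_dcc R"
  obtains E J where "local_decomposition R E J"
proof -
  obtain E where E: "finite E" "\<And>e. e \<in> E \<Longrightarrow> primitive_idempotent R e" "(\<Oplus>e \<in> E. e) = \<one>"
    by (rule primitive_decomposition[OF dcc]) (rule that)
  have ER: "e \<in> carrier R" "e \<otimes> e = e" "e \<noteq> \<zero>" if "e \<in> E" for e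
    using E(2)[OF that] by (auto simp: primitive_idempotent_def)
  define J where "J = {a \<in> carrier R. \<forall>e \<in> E. \<forall>r \<in> carrier R. \<forall>s \<in> carrier R.
    e \<otimes> (r \<otimes> a \<otimes> s) \<otimes> e = \<zero>}"
  have J_left: "q \<otimes> a \<in> J" if q: "q \<in> carrier R" and a: "a \<in> J" for q a
  proof -
    have aR: "a \<in> carrier R" using a by (simp add: J_def)
    have "e \<otimes> (r \<otimes> (q \<otimes> a) \<otimes> s) \<otimes> e = \<zero>"
      if "e \<in> E" "r \<in> carrier R" "s \<in> carrier R" for e r s
    proof -
      have "e \<otimes> ((r \<otimes> q) \<otimes> a \<otimes> s) \<otimes> e = \<zero>" using a that q by (simp add: J_def)
      then show ?thesis using that q aR by (simp add: m_assoc)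
    qed
    then show ?thesis using q aR by (simp add: J_def)
  qed
  have J_right: "a \<otimes> q \<in> J" if q: "q \<in> carrier R" and a: "a \<in> J" for q a
  proof -
    have aR: "a \<in> carrier R" using a by (simp add: J_def)
    have "e \<otimes> (r \<otimes> (a \<otimes> q) \<otimes> s) \<otimes> e = \<zero>"
      if "e \<in> E" "r \<in> carrier R" "s \<in> carrier R" for e r s
    proof -
      have "e \<otimes> (r \<otimes> a \<otimes> (q \<otimes> s)) \<otimes> e = \<zero>" using a that q by (simp add: J_def)
      then show ?thesis using that q aR by (simp add: m_assoc)
    qed
    then show ?thesis using q aR by (simp add: J_def)
  qed
  have JR: "a \<in> carrier R" if "a \<in> J" for a using that by (simp add: J_def)
  have local: "\<exists>b \<in> carrier R. b \<otimes> z = e" if e: "e \<in> E" and z: "z \<in> carrier R" "z \<otimes> e = z" "z \<notin> J" for e z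
  proof -
    obtain f r s where f: "f \<in> E" and rs: "r \<in> carrier R" "s \<in> carrier R"
      and nz: "f \<otimes> (r \<otimes> z \<otimes> s) \<otimes> f \<noteq> \<zero>" using z by (auto simp: J_def)
    note eR = ER[OF e] and fR = ER[OF f]
    define x where "x = f \<otimes> r \<otimes> z"
    define y where "y = e \<otimes> s \<otimes> f"
    have x: "x \<in> carrier R" "f \<otimes> x = x" "x \<otimes> e = x"
      unfolding x_def using fR eR rs z by (simp_all add: m_assoc) (simp add: m_assoc[symmetric])
    have y: "y \<in> carrier R" "e \<otimes> y = y" "y \<otimes> f = y"
      unfolding y_def using fR eR rs by (simp_all add: m_assoc) (simp add: m_assoc[symmetric])
    have xy: "x \<otimes> y = f \<otimes> (r \<otimes> z \<otimes> s) \<otimes> f"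
    proof -
      have "x \<otimes> y = (x \<otimes> e) \<otimes> s \<otimes> f" using x(1) eR fR rs by (simp add: y_def m_assoc)
      then show ?thesis using x eR fR rs z by (simp add: x_def m_assoc)
    qed
    have xy': "x \<otimes> y \<in> carrier R" "f \<otimes> (x \<otimes> y) = x \<otimes> y" "x \<otimes> y \<otimes> f = x \<otimes> y"
      using x y fR by (simp_all add: m_assoc[symmetric]) (simp add: m_assoc)
    obtain w where w: "w \<in> carrier R" "x \<otimes> y \<otimes> w = f"
      by (rule primitive_corner_division[OF her dcc E(2)[OF f] xy']) (use nz xy that in auto)
    \<comment> \<open>As \<open>x y w = f\<close>, the element \<open>g\<close> is a nonzero
      idempotent of \<open>eRe\<close> and so equals \<open>e\<close>. Written out as
      \<open>y w f r z\<close> it exhibits the left inverse of \<open>z\<close>.\<close>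
    define g where "g = y \<otimes> w \<otimes> x"
    have gR: "g \<in> carrier R" using x y w by (simp add: g_def)
    have xg: "x \<otimes> g = x" using w x y by (simp add: g_def m_assoc[symmetric])
    have "g \<otimes> g = y \<otimes> w \<otimes> (x \<otimes> g)" using x y w gR by (simp add: g_def m_assoc)
    then have gg: "g \<otimes> g = g" unfolding xg by (simp add: g_def)
    have eg: "e \<otimes> g = g" "g \<otimes> e = g"
      using x y w eR by (simp_all add: g_def m_assoc[symmetric]) (simp add: m_assoc)
    have "f \<noteq> \<zero>" by (rule fR(3))
    then have "x \<noteq> \<zero>" using w y by auto
    then have "g \<noteq> \<zero>" using xg x by auto
    then have "g = e" using E(2)[OF e] gR gg eg unfolding primitive_idempotent_def by blast
    then have "(y \<otimes> w \<otimes> (f \<otimes> r)) \<otimes> z = e"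
      using x y w fR rs z by (simp add: g_def x_def m_assoc)
    then show ?thesis using y w fR rs by (intro bexI[of _ "y \<otimes> w \<otimes> (f \<otimes> r)"]) auto
  qed
  have absorb: "a = \<zero>" if a: "a \<in> carrier R" "c \<in> J" "a \<otimes> c = a" for a c
  proof (rule ccontr)
    assume "a \<noteq> \<zero>"
    define B where "B = {(f, e). f \<in> E \<and> e \<in> E \<and> (\<exists>x \<in> J. f \<otimes> x \<otimes> e \<noteq> \<zero>)}"
    have "trans B"
    proof (rule transI)
      fix g f e assume "(g, f) \<in> B" "(f, e) \<in> B"
      then obtain x y where *: "g \<in> E" "f \<in> E" "e \<in> E" "x \<in> J" "y \<in> J"
        "g \<otimes> x \<otimes> f \<noteq> \<zero>" "f \<otimes> y \<otimes> e \<noteq> \<zero>" by (auto simp: B_def)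
      note R = ER(1,2)[OF *(1)] ER(1,2)[OF *(2)] ER(1,2)[OF *(3)] JR[OF *(4)] JR[OF *(5)]
      \<comment> \<open>Multiplication by the nonzero second factor is injective on
        \<open>Rf\<close>, so the product of two nonzero elements is nonzero; this is
        transitivity.\<close>
      have "(g \<otimes> x \<otimes> f) \<otimes> (f \<otimes> y \<otimes> e) \<noteq> \<zero>"
      proof
        assume 0: "(g \<otimes> x \<otimes> f) \<otimes> (f \<otimes> y \<otimes> e) = \<zero>"
        have "g \<otimes> x \<otimes> f = \<zero>"
          by (rule primitive_mult_injective[OF her E(2)[OF *(2)] _ _ *(7) _ _ 0])
            (use R in \<open>simp_all add: m_assoc\<close>, use R in \<open>simp_all add: m_assoc[symmetric]\<close>)
        then show False using *(6) by simp
      qed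
      then have "g \<otimes> (x \<otimes> (f \<otimes> f) \<otimes> y) \<otimes> e \<noteq> \<zero>" using R(1,3,5,7,8) by (simp add: m_assoc)
      moreover have "x \<otimes> (f \<otimes> f) \<otimes> y \<in> J" using J_left *(5) R by simp
      ultimately show "(g, e) \<in> B" using * unfolding B_def by blast
    qed
    moreover have "(e, e) \<notin> B" for e
    proof
      assume "(e, e) \<in> B"
      then obtain x where x: "e \<in> E" "x \<in> J" "e \<otimes> x \<otimes> e \<noteq> \<zero>" by (auto simp: B_def)
      then have "e \<otimes> (\<one> \<otimes> x \<otimes> \<one>) \<otimes> e = \<zero>" unfolding J_def by blast
      then show False using x JR by simp
    qed
    ultimately have "acyclic B" unfolding acyclic_def by (simp add: trancl_id)
    moreover have "finite B" by (rule finite_subset[of _ "E \<times> E"]) (auto simp: B_def E(1))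
    ultimately have wfB: "wf B" by (intro finite_acyclic_wf)
    define S where "S = {e \<in> E. a \<otimes> e \<noteq> \<zero>}"
    have split: "x = (\<Oplus>f \<in> E. x \<otimes> f)" if "x \<in> carrier R" for x
    proof -
      have "x = x \<otimes> (\<Oplus>e \<in> E. e)" using E(3) that by simp
      also have "\<dots> = (\<Oplus>f \<in> E. x \<otimes> f)" by (rule finsum_rdistr) (use E(1) ER that in auto)
      finally show ?thesis .
    qed
    have nonzero_term: "\<exists>f \<in> E. h f \<noteq> \<zero>" if "(\<Oplus>f \<in> E. h f) \<noteq> \<zero>" for h
    proof (rule ccontr)
      assume "\<not> ?thesis"
      then have "(\<Oplus>f \<in> E. h f) = (\<Oplus>f \<in> E. \<zero>)" by (intro finsum_cong') auto
      then show False using that by simp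
    qed
    have "\<exists>e \<in> E. a \<otimes> e \<noteq> \<zero>" using nonzero_term[of "\<lambda>e. a \<otimes> e"] split[OF a(1)] \<open>a \<noteq> \<zero>\<close> by simp
    then obtain e0 where "e0 \<in> S" by (auto simp: S_def)
    \<comment> \<open>For \<open>e\<close> minimal with \<open>a e \<noteq> 0\<close>, the equation
      \<open>a c = a\<close> inserts some \<open>f\<close> with \<open>a f \<noteq> 0\<close> and
      \<open>f c e \<noteq> 0\<close>, that is, a predecessor of \<open>e\<close> that still
      violates minimality.\<close>
    then obtain e where e: "e \<in> S" and min: "\<And>f. (f, e) \<in> B \<Longrightarrow> f \<notin> S" using wfE_min[OF wfB] by metis
    have eE: "e \<in> E" "a \<otimes> e \<noteq> \<zero>" using e by (auto simp: S_def)
    have "(\<Oplus>f \<in> E. a \<otimes> f \<otimes> (c \<otimes> e)) = (\<Oplus>f \<in> E. a \<otimes> f) \<otimes> (c \<otimes> e)"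
      by (rule finsum_ldistr[symmetric]) (use E(1) ER eE a JR in auto)
    also have "\<dots> = a \<otimes> (c \<otimes> e)" using split[OF a(1)] by simp
    also have "\<dots> = a \<otimes> e" using a JR ER[OF eE(1)] by (simp add: m_assoc[symmetric])
    finally obtain f where f: "f \<in> E" "a \<otimes> f \<otimes> (c \<otimes> e) \<noteq> \<zero>"
      using nonzero_term[of "\<lambda>f. a \<otimes> f \<otimes> (c \<otimes> e)"] eE(2) by auto
    have R: "f \<in> carrier R" "e \<in> carrier R" "c \<in> carrier R" using ER f eE a JR by auto
    have "a \<otimes> f \<noteq> \<zero>" using f(2) R by auto
    moreover have "f \<otimes> c \<otimes> e \<noteq> \<zero>" using f(2) R a(1) by (auto simp: m_assoc)
    ultimately show False using min[of f] f(1) eE(1) a(2) by (auto simp: S_def B_def)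
  qed
  have "local_decomposition R E J"
    by (intro local_decomposition.intro local_decomposition_axioms.intro small_ring_axioms dcc)
      (use E ER JR J_left J_right local absorb in auto)
  then show ?thesis by (rule that)
qed

text \<open>For an idempotent \<open>e y\<close> the equation in \<open>L y\<close> describes the
  left ideal that it generates. The vectors with \<open>e y\<close> at place \<open>y\<close> and
  zero elsewhere, together with the entries as coordinates, form a dual basis of the direct
  sum.\<close>

lemma (in small_ring) finsupp_module_dual_basis:
  assumes e: "\<And>y. y \<in> Y \<Longrightarrow> e y \<in> carrier R" "\<And>y. y \<in> Y \<Longrightarrow> e y \<otimes> e y = e y"
  defines "L \<equiv> \<lambda>y. {r \<in> carrier R. r \<otimes> e y = r}"
  defines "b \<equiv> \<lambda>y. \<lambda>x \<in> Y. if x = y then e y else \<zero>"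
  shows "\<And>y. y \<in> Y \<Longrightarrow> submodule (L y) R (regular_module R)"
    and "dual_basis R (finsupp_module R Y L) Y b (\<lambda>y. \<lambda>u \<in> carrier (finsupp_module R Y L). u y)"
proof -
  interpret r: left_module R "regular_module R" by (rule regular_left_module[OF ring_axioms])
  show L: "submodule (L y) R (regular_module R)" if "y \<in> Y" for y
    by (rule r.submoduleI) (use e(1)[OF that] in \<open>auto simp: L_def l_distr m_assoc\<close>)
  let ?F = "finsupp_module R Y L"
  interpret F: left_module R ?F by (rule finsupp_module_module[OF ring_axioms L])
  have co: "coordinates R ?F Y (\<lambda>y. \<lambda>u \<in> carrier ?F. u y)" by (rule finsupp_coordinates[OF ring_axioms L])
  have b: "b y \<in> carrier ?F" if "y \<in> Y" for y
    using that e by (auto simp: b_def L_def intro!: finite_subset[of _ "{y}"])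
  have "lincomb R ?F Y (\<lambda>i. (\<lambda>u \<in> carrier ?F. u i) u) b = u" if u: "u \<in> carrier ?F" for u
  proof -
    have uR: "u y \<in> carrier R" "u y \<otimes> e y = u y" if "y \<in> Y" for y
      using u that by (auto simp: L_def PiE_iff)
    have eq: "lincomb R ?F Y (\<lambda>i. (\<lambda>u \<in> carrier ?F. u i) u) b = lincomb R ?F Y u b" using u by simp
    let ?v = "lincomb R ?F Y u b"
    have v: "?v \<in> carrier ?F" by (rule F.lincomb_closed) (use uR b in auto)
    have "?v x = u x" if x: "x \<in> Y" for x
    proof -
      interpret p: mod_homs R ?F "regular_module R" "\<lambda>u \<in> carrier ?F. u x"
        by (rule mod_homsI[OF F.left_module_axioms r.left_module_axioms])
          (use co x in \<open>auto simp: coordinates_def\<close>)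
      have "?v x = lincomb R (regular_module R) Y u (\<lambda>y. (\<lambda>u \<in> carrier ?F. u x) (b y))"
        using p.f_lincomb[of Y u b] v u uR b by (simp add: finsupp_def)
      also have "\<dots> = lincomb R (regular_module R) Y u (\<lambda>y. if x = y then e y else \<zero>)"
        by (rule r.lincomb_cong)
          (use uR b x e(1) in \<open>simp_all add: b_def Pi_iff del: finsupp_module_simps\<close>)
      also have "\<dots> = (\<Oplus>\<^bsub>regular_module R\<^esub> y \<in> {y \<in> Y. u y \<noteq> \<zero>} \<union> {x}.
          u y \<odot>\<^bsub>regular_module R\<^esub> (if x = y then e y else \<zero>))"
        by (rule r.lincomb_eq) (use u uR x e(1) in auto)
      also have "\<dots> = (\<Oplus> y \<in> {y \<in> Y. u y \<noteq> \<zero>} \<union> {x}. if x = y then u y else \<zero>)"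
        unfolding finsum_regular by (rule finsum_cong') (use uR x in auto)
      also have "\<dots> = u x"
        by (rule finsum_singleton) (use u uR x in auto)
      finally show ?thesis .
    qed
    then have "?v = u" using v u by (intro PiE_ext[of _ Y L]) auto
    then show ?thesis using eq by simp
  qed
  then show "dual_basis R ?F Y b (\<lambda>y. \<lambda>u \<in> carrier ?F. u y)"
    unfolding dual_basis_def using co b by blast
qed

text \<open>Only the products themselves are collected; the submodule \<open>JM\<close> is their
  span.\<close>

definition radical_part :: "('r, 'x) ring_scheme \<Rightarrow> 'r set \<Rightarrow> ('r, 'a) module \<Rightarrow> 'a set" where
  "radical_part R J M = {b \<odot>\<^bsub>M\<^esub> x |b x. b \<in> J \<and> x \<in> carrier M}"

section \<open>Nakayama's lemma and the construction of projective covers\<close>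

context local_decomposition
begin

text \<open>Nakayama's lemma for modules of any size. If \<open>N\<close> is proper, take
  \<open>a\<close> with \<open>aM\<close> not inside \<open>N\<close> and \<open>aR\<close> minimal.
  For \<open>b\<close> in \<open>J\<close> the product \<open>a b\<close> sends \<open>M\<close>
  into \<open>N\<close>: otherwise minimality would give \<open>a = a b s\<close>, and absorption
  \<open>a = 0\<close>. So \<open>a\<close> sends \<open>N\<close>, \<open>JM\<close> and their span
  into \<open>N\<close>, and this span is \<open>M\<close>.\<close>

lemma nakayama:
  assumes "left_module R M" "submodule N R M"
    and gen: "submodule_span R M (N \<union> radical_part R J M) = carrier M"
  shows "N = carrier M"
proof (rule ccontr)
  interpret M: left_module R M by fact
  note ND = M.submoduleD[OF assms(2)]
  assume "N \<noteq> carrier M"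
  then obtain x0 where x0: "x0 \<in> carrier M" "x0 \<notin> N" using ND(1) by auto
  define A where "A = {a \<in> carrier R. \<exists>x \<in> carrier M. a \<odot>\<^bsub>M\<^esub> x \<notin> N}"
  have "\<one> \<in> A" using x0 by (auto simp: A_def)
  moreover have "A \<subseteq> carrier R" by (auto simp: A_def)
  ultimately have "A \<subseteq> carrier R" "A \<noteq> {}" by blast+
  then obtain a where a: "a \<in> A"
    and min: "\<And>r. \<lbrakk>r \<in> carrier R; a \<otimes> r \<in> A\<rbrakk> \<Longrightarrow> \<exists>s \<in> carrier R. a = a \<otimes> r \<otimes> s"
    by (rule dccE[OF dcc]) (rule that)
  have aR: "a \<in> carrier R" using a by (simp add: A_def)
  have aN: "a \<noteq> \<zero>" using a ND(2) by (auto simp: A_def)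
  have ab: "a \<odot>\<^bsub>M\<^esub> (b \<odot>\<^bsub>M\<^esub> x) \<in> N" if b: "b \<in> J" and x: "x \<in> carrier M" for b x
  proof (rule ccontr)
    assume "a \<odot>\<^bsub>M\<^esub> (b \<odot>\<^bsub>M\<^esub> x) \<notin> N"
    moreover have bR: "b \<in> carrier R" using b J_subset by auto
    ultimately have "a \<otimes> b \<in> A" using aR x by (auto simp: A_def M.smult_assoc1)
    then obtain s where s: "s \<in> carrier R" "a = a \<otimes> b \<otimes> s" using min bR by blast
    have "a \<otimes> (b \<otimes> s) = a" using s aR bR by (simp add: m_assoc)
    then have "a = \<zero>" using absorb[OF aR] J_right[OF s(1) b] by blast
    then show False using aN by simp
  qed
  define T where "T = {x \<in> carrier M. \<forall>r \<in> carrier R. a \<odot>\<^bsub>M\<^esub> (r \<odot>\<^bsub>M\<^esub> x) \<in> N}"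
  have "submodule T R M"
  proof (rule M.submoduleI)
    show "T \<subseteq> carrier M" by (auto simp: T_def)
    show "\<zero>\<^bsub>M\<^esub> \<in> T" using ND(2) aR by (auto simp: T_def)
    show "x \<oplus>\<^bsub>M\<^esub> y \<in> T" if "x \<in> T" "y \<in> T" for x y
      using that ND(3) aR by (auto simp: T_def M.smult_r_distr)
    show "s \<odot>\<^bsub>M\<^esub> x \<in> T" if "s \<in> carrier R" "x \<in> T" for s x
      using that by (auto simp: T_def M.smult_assoc1[symmetric])
  qed
  moreover have "N \<subseteq> T" using ND aR by (auto simp: T_def)
  moreover have "radical_part R J M \<subseteq> T"
  proof
    fix y assume "y \<in> radical_part R J M"
    then obtain b x where bx: "y = b \<odot>\<^bsub>M\<^esub> x" "b \<in> J" "x \<in> carrier M" by (auto simp: radical_part_def)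
    then have "b \<in> carrier R" using J_subset by auto
    then show "y \<in> T" using bx ab[OF J_left] by (auto simp: T_def M.smult_assoc1[symmetric])
  qed
  ultimately have "submodule_span R M (N \<union> radical_part R J M) \<subseteq> T"
    by (intro M.span_subset) auto
  then have T: "carrier M \<subseteq> T" using gen by simp
  obtain x where x: "x \<in> carrier M" "a \<odot>\<^bsub>M\<^esub> x \<notin> N" using a by (auto simp: A_def)
  then have "x \<in> T" using T by blast
  then have "a \<odot>\<^bsub>M\<^esub> (\<one> \<odot>\<^bsub>M\<^esub> x) \<in> N" unfolding T_def using R.one_closed by blast
  then show False using x by simp
qed

text \<open>A pair \<open>(m, e)\<close> stands for the homomorphism from \<open>Re\<close> to
  \<open>M\<close> that sends \<open>e\<close> to \<open>m\<close>. The idempotent is recorded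
  because several of them may fix the same \<open>m\<close>.\<close>

definition local_elements :: "('v, 'a) module \<Rightarrow> ('a \<times> 'v) set" where
  "local_elements M = {(m, e). m \<in> carrier M \<and> e \<in> E \<and> e \<odot>\<^bsub>M\<^esub> m = m}"

text \<open>Independence of the classes in \<open>M/JM\<close>, expressed inside \<open>M\<close>:
  the coefficients come from the left ideals \<open>Re\<close> and count as zero when they lie in
  \<open>J\<close>.\<close>

definition independent :: "('v, 'a) module \<Rightarrow> ('a \<times> 'v) set \<Rightarrow> bool" where
  "independent M Y \<longleftrightarrow> (\<forall>S u. finite S \<and> S \<subseteq> Y \<and> u \<in> S \<rightarrow> carrier R \<and>
     (\<forall>y \<in> S. u y \<otimes> snd y = u y) \<and>
     (\<Oplus>\<^bsub>M\<^esub> y \<in> S. u y \<odot>\<^bsub>M\<^esub> fst y) \<in> submodule_span R M (radical_part R J M) \<longrightarrow>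
     (\<forall>y \<in> S. u y \<in> J))"

lemma independentD:
  assumes "independent M Y" "finite S" "S \<subseteq> Y" "u \<in> S \<rightarrow> carrier R"
    and "\<And>y. y \<in> S \<Longrightarrow> u y \<otimes> snd y = u y"
    and "(\<Oplus>\<^bsub>M\<^esub> y \<in> S. u y \<odot>\<^bsub>M\<^esub> fst y) \<in> submodule_span R M (radical_part R J M)"
    and "y \<in> S"
  shows "u y \<in> J"
proof -
  have "finite S \<and> S \<subseteq> Y \<and> u \<in> S \<rightarrow> carrier R \<and> (\<forall>y \<in> S. u y \<otimes> snd y = u y) \<and>
     (\<Oplus>\<^bsub>M\<^esub> y \<in> S. u y \<odot>\<^bsub>M\<^esub> fst y) \<in> submodule_span R M (radical_part R J M)"
    using assms by simp
  with assms(1,7) show ?thesis unfolding independent_def by meson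
qed

text \<open>Independence concerns finitely many elements at a time, so unions of chains inherit it
  and Zorn's lemma applies.\<close>

lemma maximal_independent:
  obtains Y where "Y \<subseteq> local_elements M" "independent M Y"
    "\<And>Z. \<lbrakk>Z \<subseteq> local_elements M; independent M Z; Y \<subseteq> Z\<rbrakk> \<Longrightarrow> Z = Y"
proof -
  define \<A> where "\<A> = {Y. Y \<subseteq> local_elements M \<and> independent M Y}"
  have "\<exists>Y \<in> \<A>. \<forall>Z \<in> \<A>. Y \<subseteq> Z \<longrightarrow> Z = Y"
  proof (rule subset_Zorn')
    fix C assume C: "subset.chain \<A> C"
    show "\<Union>C \<in> \<A>"
      unfolding \<A>_def
    proof (intro CollectI conjI)
      show "\<Union>C \<subseteq> local_elements M" using C by (auto simp: subset_chain_def \<A>_def)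
      show "independent M (\<Union>C)"
        unfolding independent_def
      proof (intro allI impI, elim conjE)
        fix S u assume *: "finite S" "S \<subseteq> \<Union>C" "u \<in> S \<rightarrow> carrier R"
          "\<forall>y \<in> S. u y \<otimes> snd y = u y"
          "(\<Oplus>\<^bsub>M\<^esub> y \<in> S. u y \<odot>\<^bsub>M\<^esub> fst y) \<in> submodule_span R M (radical_part R J M)"
        show "\<forall>y \<in> S. u y \<in> J"
        proof (cases "C = {}")
          case False
          from finite_subset_Union_chain[OF *(1,2) False C]
          obtain Y where "Y \<in> C" "S \<subseteq> Y" by metis
          then have "independent M Y" using C by (auto simp: subset_chain_def \<A>_def)
          then show ?thesis using * \<open>S \<subseteq> Y\<close> unfolding independent_def by blast
        qed (use * in auto)
      qed
    qed
  qed
  then obtain Y where Y: "Y \<in> \<A>" and max: "\<And>Z. \<lbrakk>Z \<in> \<A>; Y \<subseteq> Z\<rbrakk> \<Longrightarrow> Z = Y" by blast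
  show ?thesis
  proof (rule that)
    show "Y \<subseteq> local_elements M" "independent M Y" using Y by (simp_all add: \<A>_def)
    show "Z = Y" if "Z \<subseteq> local_elements M" "independent M Z" "Y \<subseteq> Z" for Z
      using max[of Z] that by (simp add: \<A>_def)
  qed
qed

text \<open>An exchange argument modulo \<open>JM\<close>. A local element \<open>m\<close> outside
  \<open>Y\<close> occurs in some dependence with a coefficient not in \<open>J\<close>, since
  otherwise \<open>Y\<close> itself would be dependent. That coefficient can be multiplied to
  \<open>e\<close> from the left, so \<open>m\<close> lies in the span of \<open>Y\<close> and
  \<open>JM\<close>. The idempotents add up to one, so this span is everything, and Nakayama's lemma
  removes \<open>JM\<close>.\<close>

lemma maximal_independent_generates:
  assumes lM: "left_module R M" and Y: "Y \<subseteq> local_elements M" "independent M Y"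
    and max: "\<And>Z. \<lbrakk>Z \<subseteq> local_elements M; independent M Z; Y \<subseteq> Z\<rbrakk> \<Longrightarrow> Z = Y"
  shows "submodule_span R M (fst ` Y) = carrier M"
proof -
  interpret M: left_module R M by fact
  let ?N = "submodule_span R M (fst ` Y)"
  have YM: "fst y \<in> carrier M" if "y \<in> Y" for y using that Y(1) by (auto simp: local_elements_def)
  have N: "submodule ?N R M" by (rule M.span_submodule) (use YM in auto)
  let ?G = "submodule_span R M (?N \<union> radical_part R J M)"
  have rM: "radical_part R J M \<subseteq> carrier M" using J_subset by (auto simp: radical_part_def)
  have G: "submodule ?G R M"
    by (rule M.span_submodule) (use M.submoduleD(1)[OF N] rM in auto)
  have sub_G: "?N \<subseteq> ?G" "radical_part R J M \<subseteq> ?G" using M.span_superset by blast+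
  have R: "submodule (submodule_span R M (radical_part R J M)) R M" by (rule M.span_submodule[OF rM])
  have RG: "submodule_span R M (radical_part R J M) \<subseteq> ?G" by (rule M.span_subset[OF G sub_G(2)])
  note GD = M.submoduleD[OF G]
  have YG: "fst y \<in> ?G" if "y \<in> Y" for y using that M.span_superset[of "fst ` Y"] sub_G(1) by blast
  have local_G: "m \<in> ?G" if me: "(m, e) \<in> local_elements M" for m e
  proof (cases "(m, e) \<in> Y")
    case True
    then show ?thesis using YG by force
  next
    case False
    have m: "m \<in> carrier M" "e \<in> E" "e \<odot>\<^bsub>M\<^esub> m = m" using me by (auto simp: local_elements_def)
    have eR: "e \<in> carrier R" using m E by auto
    have "\<not> independent M (insert (m, e) Y)"
      using max[of "insert (m, e) Y"] False me Y(1) by auto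
    then obtain S u where S: "finite S" "S \<subseteq> insert (m, e) Y" and u: "u \<in> S \<rightarrow> carrier R"
      and ue: "\<And>y. y \<in> S \<Longrightarrow> u y \<otimes> snd y = u y"
      and sum: "(\<Oplus>\<^bsub>M\<^esub> y \<in> S. u y \<odot>\<^bsub>M\<^esub> fst y) \<in> submodule_span R M (radical_part R J M)"
      and notJ: "\<not> (\<forall>y \<in> S. u y \<in> J)"
      unfolding independent_def by blast
    have "(m, e) \<in> S"
    proof (rule ccontr)
      assume "(m, e) \<notin> S"
      then have "S \<subseteq> Y" using S(2) by auto
      then show False using Y(2) S(1) u ue sum notJ unfolding independent_def by blast
    qed
    define S' where "S' = S - {(m, e)}"
    have S': "finite S'" "S' \<subseteq> Y" "(m, e) \<notin> S'" "S = insert (m, e) S'" "S' \<subseteq> S"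
      using S \<open>(m, e) \<in> S\<close> by (auto simp: S'_def)
    define a where "a = u (m, e)"
    have a: "a \<in> carrier R" "a \<otimes> e = a" using u ue[of "(m, e)"] \<open>(m, e) \<in> S\<close> by (auto simp: a_def)
    have cl: "(\<lambda>y. u y \<odot>\<^bsub>M\<^esub> fst y) \<in> S' \<rightarrow> carrier M"
    proof (intro funcsetI M.smult_closed)
      fix y assume "y \<in> S'"
      then show "u y \<in> carrier R" "fst y \<in> carrier M" using u YM[of y] S'(2,5) by blast+
    qed
    let ?t = "\<Oplus>\<^bsub>M\<^esub> y \<in> S'. u y \<odot>\<^bsub>M\<^esub> fst y"
    have t: "?t \<in> carrier M" by (rule M.M.finsum_closed[OF cl])
    have sum': "a \<odot>\<^bsub>M\<^esub> m \<oplus>\<^bsub>M\<^esub> ?t \<in> submodule_span R M (radical_part R J M)"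
      using sum S' cl a m by (simp add: M.M.finsum_insert a_def)
    have am: "a \<odot>\<^bsub>M\<^esub> m \<in> carrier M" using a m by simp
    have "a \<notin> J"
    proof
      assume aJ: "a \<in> J"
      then have amJ: "a \<odot>\<^bsub>M\<^esub> m \<in> submodule_span R M (radical_part R J M)"
        using m M.span_superset[of "radical_part R J M"] by (auto simp: radical_part_def)
      have "?t = (a \<odot>\<^bsub>M\<^esub> m \<oplus>\<^bsub>M\<^esub> ?t) \<ominus>\<^bsub>M\<^esub> a \<odot>\<^bsub>M\<^esub> m"
        using M.diff_eq_iff[of "a \<odot>\<^bsub>M\<^esub> m \<oplus>\<^bsub>M\<^esub> ?t" "a \<odot>\<^bsub>M\<^esub> m" ?t] am t by simp
      also have "\<dots> \<in> submodule_span R M (radical_part R J M)" by (rule M.submoduleD(6)[OF R sum' amJ])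
      finally have tJ: "?t \<in> submodule_span R M (radical_part R J M)" .
      have "u y \<in> J" if "y \<in> S'" for y
      proof (rule independentD[OF Y(2) S'(1,2) _ _ tJ that])
        show "u \<in> S' \<rightarrow> carrier R" using u S'(5) by blast
        show "u z \<otimes> snd z = u z" if "z \<in> S'" for z using ue S'(5) that by blast
      qed
      then show False using notJ aJ S'(4) by (auto simp: a_def)
    qed
    then obtain b where b: "b \<in> carrier R" "b \<otimes> a = e" using local[OF m(2) a] by blast
    have tG: "?t \<in> ?G"
      by (rule M.submodule_finsum[OF G], rule funcsetI, rule GD(4)) (use u S' YG in auto)
    have "a \<odot>\<^bsub>M\<^esub> m = (a \<odot>\<^bsub>M\<^esub> m \<oplus>\<^bsub>M\<^esub> ?t) \<ominus>\<^bsub>M\<^esub> ?t"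
      using M.diff_eq_iff[of "a \<odot>\<^bsub>M\<^esub> m \<oplus>\<^bsub>M\<^esub> ?t" ?t "a \<odot>\<^bsub>M\<^esub> m"] am t M.M.a_comm[OF am t] by simp
    also have "\<dots> \<in> ?G" using GD(6) sum' RG tG by blast
    finally have "b \<odot>\<^bsub>M\<^esub> (a \<odot>\<^bsub>M\<^esub> m) \<in> ?G" using GD(4) b by blast
    then show ?thesis using b a m by (simp add: M.smult_assoc1[symmetric])
  qed
  have "carrier M \<subseteq> ?G"
  proof
    fix x assume x: "x \<in> carrier M"
    have "x = (\<Oplus>e \<in> E. e) \<odot>\<^bsub>M\<^esub> x" using E(3) x by simp
    also have "\<dots> = (\<Oplus>\<^bsub>M\<^esub> e \<in> E. e \<odot>\<^bsub>M\<^esub> x)" by (rule M.smult_finsum_left) (use E x in auto)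
    also have "\<dots> \<in> ?G"
    proof (rule M.submodule_finsum[OF G], rule funcsetI)
      fix e assume e: "e \<in> E"
      then have "(e \<odot>\<^bsub>M\<^esub> x, e) \<in> local_elements M"
        using x E(2) E(4)[OF e] by (auto simp: local_elements_def M.smult_assoc1[symmetric])
      then show "e \<odot>\<^bsub>M\<^esub> x \<in> ?G" by (rule local_G)
    qed
    finally show "x \<in> ?G" .
  qed
  then have "?G = carrier M" using GD(1) by blast
  then show ?thesis by (rule nakayama[OF lM N])
qed

lemma projective_cover_exists:
  assumes M: "M \<in> modules R"
  shows "\<exists>P p. projective_cover R M P p"
proof -
  note lM = modulesD(1)[OF M]
  interpret M: left_module R M by (rule lM)
  obtain Y where Y: "Y \<subseteq> local_elements M" "independent M Y"
    and max: "\<And>Z. \<lbrakk>Z \<subseteq> local_elements M; independent M Z; Y \<subseteq> Z\<rbrakk> \<Longrightarrow> Z = Y"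
    by (rule maximal_independent) (rule that)
  have span: "submodule_span R M (fst ` Y) = carrier M"
    by (rule maximal_independent_generates[OF lM Y max])
  have YM: "fst y \<in> carrier M" "snd y \<in> E" "snd y \<odot>\<^bsub>M\<^esub> fst y = fst y" if "y \<in> Y" for y
    using that Y(1) by (auto simp: local_elements_def)
  have YR: "snd y \<in> carrier R" "snd y \<otimes> snd y = snd y" if "y \<in> Y" for y
    using YM(2)[OF that] E(2,4) by auto
  define L where "L y = {r \<in> carrier R. r \<otimes> snd y = r}" for y :: "'v \<times> 'v"
  define b where "b y = (\<lambda>x \<in> Y. if x = y then snd y else \<zero>)" for y
  let ?F = "finsupp_module R Y L"
  have L: "submodule (L y) R (regular_module R)" if "y \<in> Y" for y
    using finsupp_module_dual_basis(1)[of Y snd] YR that unfolding L_def by blast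
  have db: "dual_basis R ?F Y b (\<lambda>y. \<lambda>u \<in> carrier ?F. u y)"
    using finsupp_module_dual_basis(2)[of Y snd] YR unfolding L_def b_def by blast
  then have co: "coordinates R ?F Y (\<lambda>y. \<lambda>u \<in> carrier ?F. u y)" and b: "b \<in> Y \<rightarrow> carrier ?F"
    and b_sum: "\<And>u. u \<in> carrier ?F \<Longrightarrow> lincomb R ?F Y (\<lambda>i. (\<lambda>u \<in> carrier ?F. u i) u) b = u"
    by (auto simp only: dual_basis_def)
  have lF: "left_module R ?F" by (rule finsupp_module_module[OF ring_axioms L])
  interpret F: left_module R ?F by (rule lF)
  have F_proj: "projective R ?F" by (rule dual_basis_projective[OF lF db])
  have "Y \<prec> (UNIV :: 'v set)"
  proof (rule subset_small)
    show "carrier M \<times> carrier R \<prec> (UNIV :: 'v set)" by (rule Times_small[OF modulesD(2)[OF M] regular_small])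
    show "Y \<subseteq> carrier M \<times> carrier R" using Y(1) E(2) by (auto simp: local_elements_def)
  qed
  then have F_small: "carrier ?F \<prec> (UNIV :: 'v set)"
    by (rule finsupp_module_small) (auto simp: L_def)
  define \<pi> where "\<pi> = (\<lambda>u \<in> carrier ?F. lincomb R M Y (\<lambda>i. (\<lambda>u \<in> carrier ?F. u i) u) fst)"
  have fst_Y: "fst \<in> Y \<rightarrow> carrier M" using YM by auto
  have \<pi>: "\<pi> \<in> mod_hom R ?F M" unfolding \<pi>_def by (rule lincomb_mod_hom[OF lF lM co fst_Y])
  have \<pi>_app: "\<pi> u = lincomb R M Y u fst" if "u \<in> carrier ?F" for u
    using that by (simp add: \<pi>_def)
  interpret \<pi>: mod_homs R ?F M \<pi> by (rule mod_homsI[OF lF lM \<pi>])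
  have uR: "u y \<in> carrier R" "u y \<otimes> snd y = u y" if "u \<in> carrier ?F" "y \<in> Y" for u y
    using that by (auto simp: L_def PiE_iff)
  have \<pi>_onto: "\<pi> ` carrier ?F = carrier M"
  proof
    show "\<pi> ` carrier ?F \<subseteq> carrier M" using \<pi>.f_closed by blast
    have "fst y \<in> \<pi> ` carrier ?F" if y: "y \<in> Y" for y
    proof -
      have bF: "b y \<in> carrier ?F" using b y by blast
      have "\<pi> (b y) = lincomb R M Y (\<lambda>i. if i = y then snd y else \<zero>) fst"
        unfolding \<pi>_app[OF bF] by (rule M.lincomb_cong) (use YR[OF y] fst_Y in \<open>auto simp: b_def\<close>)
      also have "\<dots> = fst y" using M.lincomb_delta[OF y fst_Y YR(1)[OF y]] YM(3)[OF y] by simp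
      finally show ?thesis using bF by (metis imageI)
    qed
    then have "submodule_span R M (fst ` Y) \<subseteq> \<pi> ` carrier ?F"
      by (intro M.span_subset \<pi>.image_submodule F.carrier_submodule) auto
    then show "carrier M \<subseteq> \<pi> ` carrier ?F" using span by simp
  qed
  have \<pi>_ker: "u y \<in> J" if u: "u \<in> carrier ?F" "\<pi> u = \<zero>\<^bsub>M\<^esub>" and y: "y \<in> Y" for u y
  proof -
    \<comment> \<open>\<open>y\<close> is joined to the support so that the conclusion also covers a
      vanishing coefficient at \<open>y\<close>.\<close>
    let ?S = "{i \<in> Y. u i \<noteq> \<zero>} \<union> {y}"
    have S: "finite ?S" "?S \<subseteq> Y" using u(1) y by auto
    have u': "u \<in> Y \<rightarrow> carrier R" using uR(1)[OF u(1)] by blast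
    have "(\<Oplus>\<^bsub>M\<^esub> y \<in> ?S. u y \<odot>\<^bsub>M\<^esub> fst y) = \<zero>\<^bsub>M\<^esub>"
    proof -
      have "lincomb R M Y u fst = (\<Oplus>\<^bsub>M\<^esub> y \<in> ?S. u y \<odot>\<^bsub>M\<^esub> fst y)"
        by (rule M.lincomb_eq[OF S _ u' fst_Y]) auto
      then show ?thesis using u(2) \<pi>_app[OF u(1)] by simp
    qed
    moreover have "\<zero>\<^bsub>M\<^esub> \<in> submodule_span R M (radical_part R J M)"
      by (rule M.submoduleD(2)[OF M.span_submodule]) (use J_subset in \<open>auto simp: radical_part_def\<close>)
    ultimately have sum: "(\<Oplus>\<^bsub>M\<^esub> y \<in> ?S. u y \<odot>\<^bsub>M\<^esub> fst y) \<in> submodule_span R M (radical_part R J M)"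
      by simp
    show ?thesis
    proof (rule independentD[OF Y(2) S _ _ sum])
      show "u \<in> ?S \<rightarrow> carrier R" using u' S(2) by blast
      show "u z \<otimes> snd z = u z" if "z \<in> ?S" for z using uR(2)[OF u(1)] S(2) that by blast
    qed simp
  qed
  obtain P :: "('v, 'v) module" and \<theta> where P: "P \<in> modules R" and \<theta>: "\<theta> \<in> mod_iso R ?F P"
    using module_copy[OF lF F_small] by blast
  note lP = modulesD(1)[OF P]
  interpret P: left_module R P by (rule lP)
  interpret \<theta>: mod_homs R ?F P \<theta> by (rule mod_homsI[OF lF lP mod_isoD(1)[OF \<theta>]])
  obtain \<theta>' where \<theta>': "\<theta>' \<in> mod_iso R P ?F" "\<And>x. x \<in> carrier ?F \<Longrightarrow> \<theta>' (\<theta> x) = x"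
    "\<And>y. y \<in> carrier P \<Longrightarrow> \<theta> (\<theta>' y) = y"
    by (rule mod_iso_inverse[OF lF lP \<theta>]) (rule that)
  have \<theta>'c: "\<theta>' x \<in> carrier ?F" if "x \<in> carrier P" for x
    by (rule mod_homD(1)[OF mod_isoD(1)[OF \<theta>'(1)] that])
  define p where "p = compose (carrier P) \<pi> \<theta>'"
  have p: "p \<in> mod_hom R P M" unfolding p_def by (rule compose_mod_hom[OF lP mod_isoD(1)[OF \<theta>'(1)] \<pi>])
  interpret p: mod_homs R P M p by (rule mod_homsI[OF lP lM p])
  have p_onto: "p ` carrier P = carrier M"
  proof
    show "p ` carrier P \<subseteq> carrier M" using p.f_closed by blast
    show "carrier M \<subseteq> p ` carrier P"
    proof
      fix x assume "x \<in> carrier M"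
      then obtain u where u: "u \<in> carrier ?F" "x = \<pi> u" using \<pi>_onto by blast
      then have "x = p (\<theta> u)" using \<theta>'(2)[OF u(1)] \<theta>.f_closed[OF u(1)] by (simp add: p_def compose_def)
      then show "x \<in> p ` carrier P" using \<theta>.f_closed[OF u(1)] by blast
    qed
  qed
  have rP: "radical_part R J P \<subseteq> carrier P" using J_subset by (auto simp: radical_part_def)
  have ker_rad: "mod_kernel P M p \<subseteq> submodule_span R P (radical_part R J P)"
  proof
    fix \<kappa> assume "\<kappa> \<in> mod_kernel P M p"
    then have \<kappa>: "\<kappa> \<in> carrier P" "p \<kappa> = \<zero>\<^bsub>M\<^esub>" by (auto simp: mod_kernel_def)
    define u where "u = \<theta>' \<kappa>"
    have u: "u \<in> carrier ?F" "\<pi> u = \<zero>\<^bsub>M\<^esub>" using \<theta>'c[OF \<kappa>(1)] \<kappa> by (auto simp: u_def p_def compose_def)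
    have fs: "finsupp R Y u" using u(1) uR(1)[OF u(1)] by (auto simp: finsupp_def)
    have "u = lincomb R ?F Y u b" using b_sum[OF u(1)] u(1) by simp
    then have "\<kappa> = \<theta> (lincomb R ?F Y u b)" using \<theta>'(3)[OF \<kappa>(1)] by (simp add: u_def)
    also have "\<dots> = lincomb R P Y u (\<lambda>y. \<theta> (b y))" by (rule \<theta>.f_lincomb[OF fs b])
    also have "\<dots> \<in> submodule_span R P (radical_part R J P)"
      unfolding lincomb_def
    proof (rule P.submodule_finsum[OF P.span_submodule[OF rP]], rule funcsetI)
      fix y assume "y \<in> {i \<in> Y. u i \<noteq> \<zero>}"
      then have y: "y \<in> Y" by simp
      then have "b y \<in> carrier ?F" using b by blast
      then have "u y \<in> J" "\<theta> (b y) \<in> carrier P" using \<pi>_ker[OF u y] \<theta>.f_closed by blast+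
      then show "u y \<odot>\<^bsub>P\<^esub> \<theta> (b y) \<in> submodule_span R P (radical_part R J P)"
        using P.span_superset[of "radical_part R J P"] unfolding radical_part_def by blast
    qed
    finally show "\<kappa> \<in> submodule_span R P (radical_part R J P)" .
  qed
  have "superfluous R P (mod_kernel P M p)"
    unfolding superfluous_def
  proof (intro conjI allI impI)
    show "submodule (mod_kernel P M p) R P" by (rule p.kernel_submodule)
    fix S assume "submodule S R P \<and> mod_kernel P M p <+>\<^bsub>P\<^esub> S = carrier P"
    then have S: "submodule S R P" and sum: "mod_kernel P M p <+>\<^bsub>P\<^esub> S = carrier P" by auto
    let ?G = "submodule_span R P (S \<union> radical_part R J P)"
    have G: "submodule ?G R P" by (rule P.span_submodule) (use P.submoduleD(1)[OF S] rP in auto)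
    have "submodule_span R P (radical_part R J P) \<subseteq> ?G"
      by (rule P.span_subset[OF G]) (use P.span_superset in blast)
    then have "mod_kernel P M p \<subseteq> ?G" "S \<subseteq> ?G" using ker_rad P.span_superset[of "S \<union> radical_part R J P"] by auto
    then have "mod_kernel P M p <+>\<^bsub>P\<^esub> S \<subseteq> ?G"
      by (intro subsetI, unfold P.set_add_iff) (auto intro!: P.submoduleD(3)[OF G])
    then have "?G = carrier P" using sum P.submoduleD(1)[OF G] by blast
    then show "S = carrier P" by (rule nakayama[OF lP S])
  qed
  moreover have "P \<in> projectives R"
    using P projective_iso[OF F_proj lP \<theta>] by (simp add: projectives_def)
  ultimately show ?thesis using p p_onto unfolding projective_cover_def by blast
qed

end

lemma (in small_ring) hereditary_dcc_imp_left_perfect: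
  assumes "left_hereditary R" "principal_right_dcc R"
  shows "left_perfect R"
proof -
  obtain E J where "local_decomposition R E J" by (rule hereditary_local_decomposition[OF assms])
  then interpret local_decomposition U R E J .
  show ?thesis unfolding left_perfect_def using projective_cover_exists by blast
qed

section \<open>Adjunctions and limits\<close>

lemma is_functorD:
  assumes "is_functor C D F"
  shows "category C" "category D"
    and "\<And>a. a \<in> Obj C \<Longrightarrow> on_obj F a \<in> Obj D"
    and "\<And>a b f. \<lbrakk>a \<in> Obj C; b \<in> Obj C; f \<in> Hom C a b\<rbrakk>
      \<Longrightarrow> on_arr F a b f \<in> Hom D (on_obj F a) (on_obj F b)"
    and "\<And>a. a \<in> Obj C \<Longrightarrow> on_arr F a a (Id C a) = Id D (on_obj F a)"
    and "\<And>a b c f g. \<lbrakk>a \<in> Obj C; b \<in> Obj C; c \<in> Obj C; f \<in> Hom C a b; g \<in> Hom C b c\<rbrakk>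
      \<Longrightarrow> on_arr F a c (Comp C a b c g f) =
        Comp D (on_obj F a) (on_obj F b) (on_obj F c) (on_arr F b c g) (on_arr F a b f)"
  using assms unfolding is_functor_def by blast+

lemma id_functor_simps [simp]: "on_obj id_functor a = a" "on_arr id_functor a b f = f"
  by (simp_all add: id_functor_def)

lemma comp_functor_simps [simp]:
  "on_obj (comp_functor G F) a = on_obj G (on_obj F a)"
  "on_arr (comp_functor G F) a b f = on_arr G (on_obj F a) (on_obj F b) (on_arr F a b f)"
  by (simp_all add: comp_functor_def)

lemma full_subcategory_simps [simp]:
  "Obj (full_subcategory C S) = Obj C \<inter> S" "Hom (full_subcategory C S) = Hom C"
  "Id (full_subcategory C S) = Id C" "Comp (full_subcategory C S) = Comp C"
  by (simp_all add: full_subcategory_def)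

lemma full_subcategory_category: "category C \<Longrightarrow> category (full_subcategory C S)"
  unfolding category_def by simp

lemma inclusion_functor: "category C \<Longrightarrow> is_functor (full_subcategory C S) C id_functor"
  using full_subcategory_category[of C S] by (simp add: is_functor_def)

lemma id_functor_functor: "category C \<Longrightarrow> is_functor C C id_functor"
  by (simp add: is_functor_def)

lemma comp_functor_functor:
  assumes "is_functor C D F" "is_functor D B G"
  shows "is_functor C B (comp_functor G F)"
  unfolding is_functor_def
  using is_functorD[OF assms(1)] is_functorD[OF assms(2)] by simp

text \<open>The arrow \<open>a \<rightarrow> G d\<close> corresponding to \<open>h : b \<rightarrow> d\<close> under a universal arrow \<open>u : a \<rightarrow> G b\<close>.\<close>

abbreviation transpose ::
    "('o, 'm) category \<Rightarrow> ('p, 'n, 'o, 'm) functor_data \<Rightarrow> 'o \<Rightarrow> 'p \<Rightarrow> 'm \<Rightarrow> 'p \<Rightarrow> 'n \<Rightarrow> 'm" where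
  "transpose C G a b u d h \<equiv> Comp C a (on_obj G b) (on_obj G d) (on_arr G b d h) u"

lemma transpose_Comp:
  assumes "is_functor D C G"
    and "a \<in> Obj C" "b \<in> Obj D" "d \<in> Obj D" "d' \<in> Obj D" "u \<in> Hom C a (on_obj G b)"
    and "h \<in> Hom D b d" "g \<in> Hom D d d'"
  shows "transpose C G a b u d' (Comp D b d d' g h) =
    Comp C a (on_obj G d) (on_obj G d') (on_arr G d d' g) (transpose C G a b u d h)"
proof -
  note G = is_functorD[OF assms(1)]
  interpret category C by (rule G(2))
  show ?thesis using assms(2-) by (simp add: G Comp_assoc)
qed

text \<open>\<open>F\<close> acts on arrows through unique factorisation, which makes the unit
  natural by definition, and the counit is the arrow whose transpose is an identity. The remaining
  equations compare arrows out of some \<open>r a\<close>, which are equal once their transposes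
  are.\<close>

lemma universal_arrows_adjunction:
  assumes G: "is_functor D C G"
    and r: "\<And>a. a \<in> Obj C \<Longrightarrow> r a \<in> Obj D"
    and \<eta>: "\<And>a. a \<in> Obj C \<Longrightarrow> \<eta> a \<in> Hom C a (on_obj G (r a))"
    and univ: "\<And>a d f. \<lbrakk>a \<in> Obj C; d \<in> Obj D; f \<in> Hom C a (on_obj G d)\<rbrakk> \<Longrightarrow>
      \<exists>!h. h \<in> Hom D (r a) d \<and> transpose C G a (r a) (\<eta> a) d h = f"
  obtains F \<epsilon> where "on_obj F = r" "adjunction C D F G \<eta> \<epsilon>"
proof -
  note G' = is_functorD[OF G]
  interpret C: category C by (rule G'(2))
  interpret D: category D by (rule G'(1))
  note [simp] = C.Comp_in_Hom C.Id_in_Hom C.Comp_Id_left C.Comp_Id_right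
    D.Comp_in_Hom D.Id_in_Hom D.Comp_Id_left D.Comp_Id_right G'(3-5) r \<eta> transpose_Comp[OF G]
  let ?T = "\<lambda>a d h. transpose C G a (r a) (\<eta> a) d h"
  define fac where "fac a d f = (THE h. h \<in> Hom D (r a) d \<and> ?T a d h = f)" for a d f
  have fac [simp]: "fac a d f \<in> Hom D (r a) d" "?T a d (fac a d f) = f"
    if "a \<in> Obj C" "d \<in> Obj D" "f \<in> Hom C a (on_obj G d)" for a d f
    using theI'[OF univ[OF that]] unfolding fac_def by blast+
  have uniq: "h = h'"
    if "a \<in> Obj C" "d \<in> Obj D" "h \<in> Hom D (r a) d" "h' \<in> Hom D (r a) d" "?T a d h = ?T a d h'" for a d h h'
    using univ[of a d "?T a d h'"] that by fastforce
  define F where "F = \<lparr>on_obj = r, on_arr = (\<lambda>a b f. fac a (r b) (Comp C a b (on_obj G (r b)) (\<eta> b) f))\<rparr>"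
  have on_obj [simp]: "on_obj F a = r a" for a by (simp add: F_def)
  have on_arr [simp]: "on_arr F a b f \<in> Hom D (r a) (r b)"
    "?T a (r b) (on_arr F a b f) = Comp C a b (on_obj G (r b)) (\<eta> b) f"
    if "a \<in> Obj C" "b \<in> Obj C" "f \<in> Hom C a b" for a b f
    using that by (simp_all add: F_def)
  have F: "is_functor C D F"
    unfolding is_functor_def
  proof (intro conjI ballI C.category_axioms D.category_axioms)
    show "on_arr F a a (Id C a) = Id D (on_obj F a)" if "a \<in> Obj C" for a
      by (rule uniq[of a "r a"]) (use that in simp_all)
    fix a b c f g assume *: "a \<in> Obj C" "b \<in> Obj C" "c \<in> Obj C" "f \<in> Hom C a b" "g \<in> Hom C b c"
    show "on_arr F a c (Comp C a b c g f) =
      Comp D (on_obj F a) (on_obj F b) (on_obj F c) (on_arr F b c g) (on_arr F a b f)"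
      by (rule uniq[of a "r c"]) (use * in \<open>simp_all add: C.Comp_assoc\<close>)
  qed auto
  define \<epsilon> where "\<epsilon> d = fac (on_obj G d) d (Id C (on_obj G d))" for d
  have \<epsilon> [simp]: "\<epsilon> d \<in> Hom D (r (on_obj G d)) d" "?T (on_obj G d) d (\<epsilon> d) = Id C (on_obj G d)"
    if "d \<in> Obj D" for d
    using that by (simp_all add: \<epsilon>_def)
  have "adjunction C D F G \<eta> \<epsilon>"
    unfolding adjunction_def natural_transformation_def
  proof (intro conjI ballI F G id_functor_functor C.category_axioms D.category_axioms
      comp_functor_functor[OF F G] comp_functor_functor[OF G F])
    fix d d' f assume *: "d \<in> Obj D" "d' \<in> Obj D" "f \<in> Hom D d d'"
    show "Comp D (on_obj (comp_functor F G) d) (on_obj (comp_functor F G) d') (on_obj id_functor d') (\<epsilon> d') (on_arr (comp_functor F G) d d' f) =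
      Comp D (on_obj (comp_functor F G) d) (on_obj id_functor d) (on_obj id_functor d') (on_arr id_functor d d' f) (\<epsilon> d)"
      by (rule uniq[of "on_obj G d" d']) (use * G'(4)[OF *] in \<open>simp_all add: C.Comp_assoc\<close>)
  next
    fix a assume "a \<in> Obj C"
    then show "Comp D (on_obj F a) (on_obj F (on_obj G (on_obj F a))) (on_obj F a)
          (\<epsilon> (on_obj F a)) (on_arr F a (on_obj G (on_obj F a)) (\<eta> a)) = Id D (on_obj F a)"
      by (intro uniq[of a "r a"]) (simp_all add: C.Comp_assoc)
  qed auto
  moreover have "on_obj F = r" by (simp add: F_def)
  ultimately show ?thesis using that by blast
qed

text \<open>Recovers universal arrows from unit and counit: the factorisation of \<open>f\<close> is
  the counit after the image of \<open>f\<close> under \<open>F\<close>.\<close>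

lemma adjunctionD:
  assumes "adjunction C D F G \<eta> \<epsilon>"
  shows "is_functor C D F" "is_functor D C G"
    and "\<And>a. a \<in> Obj C \<Longrightarrow> \<eta> a \<in> Hom C a (on_obj G (on_obj F a))"
    and "\<And>a d f. \<lbrakk>a \<in> Obj C; d \<in> Obj D; f \<in> Hom C a (on_obj G d)\<rbrakk> \<Longrightarrow>
      \<exists>!h. h \<in> Hom D (on_obj F a) d \<and> transpose C G a (on_obj F a) (\<eta> a) d h = f"
proof -
  show F: "is_functor C D F" and G: "is_functor D C G" using assms by (auto simp: adjunction_def)
  note F' = is_functorD[OF F] and G' = is_functorD[OF G]
  interpret C: category C by (rule G'(2))
  interpret D: category D by (rule G'(1))
  note nat = assms[unfolded adjunction_def natural_transformation_def, simplified]
  show \<eta>: "\<And>a. a \<in> Obj C \<Longrightarrow> \<eta> a \<in> Hom C a (on_obj G (on_obj F a))" using nat by blast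
  have \<epsilon>: "\<And>d. d \<in> Obj D \<Longrightarrow> \<epsilon> d \<in> Hom D (on_obj F (on_obj G d)) d"
    and \<epsilon>_nat: "\<And>d d' f. \<lbrakk>d \<in> Obj D; d' \<in> Obj D; f \<in> Hom D d d'\<rbrakk> \<Longrightarrow>
      Comp D (on_obj F (on_obj G d)) (on_obj F (on_obj G d')) d' (\<epsilon> d') (on_arr F (on_obj G d) (on_obj G d') (on_arr G d d' f)) =
      Comp D (on_obj F (on_obj G d)) d d' f (\<epsilon> d)"
    and unit_counit: "\<And>a. a \<in> Obj C \<Longrightarrow> Comp D (on_obj F a) (on_obj F (on_obj G (on_obj F a))) (on_obj F a)
          (\<epsilon> (on_obj F a)) (on_arr F a (on_obj G (on_obj F a)) (\<eta> a)) = Id D (on_obj F a)"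
      "\<And>d. d \<in> Obj D \<Longrightarrow> transpose C G (on_obj G d) (on_obj F (on_obj G d)) (\<eta> (on_obj G d)) d (\<epsilon> d) = Id C (on_obj G d)"
    using nat by blast+
  note [simp] = C.Comp_in_Hom C.Comp_Id_left D.Comp_in_Hom D.Comp_Id_right F'(3,4) G'(3,4) \<eta> \<epsilon>
  fix a d f assume *: "a \<in> Obj C" "d \<in> Obj D" "f \<in> Hom C a (on_obj G d)"
  let ?b = "on_obj F a" and ?c = "on_obj F (on_obj G d)"
  let ?h = "Comp D ?b ?c d (\<epsilon> d) (on_arr F a (on_obj G d) f)"
  show "\<exists>!h. h \<in> Hom D ?b d \<and> transpose C G a ?b (\<eta> a) d h = f"
  proof (rule ex1I[of _ ?h])
    have "transpose C G a ?b (\<eta> a) ?c (on_arr F a (on_obj G d) f) =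
      Comp C a (on_obj G d) (on_obj G ?c) (\<eta> (on_obj G d)) f"
      using nat * by simp
    then have "transpose C G a ?b (\<eta> a) d ?h = f"
      using * by (simp add: transpose_Comp[OF G] C.Comp_assoc unit_counit)
    then show "?h \<in> Hom D ?b d \<and> transpose C G a ?b (\<eta> a) d ?h = f" using * by simp
    fix h assume h: "h \<in> Hom D ?b d \<and> transpose C G a ?b (\<eta> a) d h = f"
    have "?h = Comp D ?b ?c d (\<epsilon> d) (on_arr F a (on_obj G d) (transpose C G a ?b (\<eta> a) d h))" using h by simp
    also have "\<dots> = Comp D ?b (on_obj F (on_obj G ?b)) d (Comp D (on_obj F (on_obj G ?b)) ?c d
        (\<epsilon> d) (on_arr F (on_obj G ?b) (on_obj G d) (on_arr G ?b d h))) (on_arr F a (on_obj G ?b) (\<eta> a))"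
      using * conjunct1[OF h] by (simp add: F'(6) D.Comp_assoc)
    also have "\<dots> = Comp D ?b ?b d h (Comp D ?b (on_obj F (on_obj G ?b)) ?b (\<epsilon> ?b) (on_arr F a (on_obj G ?b) (\<eta> a)))"
      using * conjunct1[OF h] by (simp add: \<epsilon>_nat D.Comp_assoc)
    also have "\<dots> = h" using * conjunct1[OF h] by (simp add: unit_counit)
    finally show "h = ?h" ..
  qed
qed

text \<open>A cone over the image diagram transposes to a cone over \<open>T\<close>. Its
  factorisation through \<open>x\<close> is transposed back, and transposition being bijective keeps
  uniqueness.\<close>

lemma right_adjoint_preserves_limits:
  assumes "has_left_adjoint D C G"
  shows "preserves_limits_of_shape J D C G"
  unfolding preserves_limits_of_shape_def
proof (intro allI impI, elim conjE)
  obtain F \<eta> \<epsilon> where adj: "adjunction C D F G \<eta> \<epsilon>" using assms by (auto simp: has_left_adjoint_def)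
  note A = adjunctionD[OF adj]
  note F' = is_functorD[OF A(1)] and G' = is_functorD[OF A(2)]
  interpret C: category C by (rule G'(2))
  interpret D: category D by (rule G'(1))
  fix T x p assume T: "is_functor J D T" and lim: "is_limit J D T x p"
  note T' = is_functorD[OF T]
  have x: "x \<in> Obj D" and p: "\<And>i. i \<in> Obj J \<Longrightarrow> p i \<in> Hom D x (on_obj T i)"
    and p_nat: "\<And>i j u. \<lbrakk>i \<in> Obj J; j \<in> Obj J; u \<in> Hom J i j\<rbrakk> \<Longrightarrow>
      Comp D x (on_obj T i) (on_obj T j) (on_arr T i j u) (p i) = p j"
    and univ: "\<And>y q. is_cone J D T y q \<Longrightarrow>
      \<exists>!h. h \<in> Hom D y x \<and> (\<forall>i \<in> Obj J. Comp D y x (on_obj T i) (p i) h = q i)"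
    using lim by (auto simp: is_limit_def is_cone_def)
  note [simp] = C.Comp_in_Hom D.Comp_in_Hom F'(3) G'(3,4) T'(3,4) A(3) transpose_Comp[OF A(2)] x p p_nat
  let ?Gx = "on_obj G x" and ?Gp = "\<lambda>i. on_arr G x (on_obj T i) (p i)"
  show "is_limit J C (comp_functor G T) ?Gx ?Gp"
    unfolding is_limit_def
  proof (intro conjI allI impI)
    show "is_cone J C (comp_functor G T) ?Gx ?Gp" by (simp add: is_cone_def flip: G'(6))
    fix y q assume "is_cone J C (comp_functor G T) y q"
    then have y [simp]: "y \<in> Obj C" and q [simp]: "\<And>i. i \<in> Obj J \<Longrightarrow> q i \<in> Hom C y (on_obj G (on_obj T i))"
      and q_nat: "\<And>i j u. \<lbrakk>i \<in> Obj J; j \<in> Obj J; u \<in> Hom J i j\<rbrakk> \<Longrightarrow>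
        Comp C y (on_obj G (on_obj T i)) (on_obj G (on_obj T j)) (on_arr G (on_obj T i) (on_obj T j) (on_arr T i j u)) (q i) = q j"
      by (auto simp: is_cone_def)
    let ?Fy = "on_obj F y"
    let ?T = "transpose C G y ?Fy (\<eta> y)"
    have uniq: "h = h'" if "d \<in> Obj D" "h \<in> Hom D ?Fy d" "h' \<in> Hom D ?Fy d" "?T d h = ?T d h'" for d h h'
      using A(4)[of y d "?T d h'"] that by fastforce
    define q' where "q' i = (THE h. h \<in> Hom D ?Fy (on_obj T i) \<and> ?T (on_obj T i) h = q i)" for i
    have q' [simp]: "q' i \<in> Hom D ?Fy (on_obj T i)" "?T (on_obj T i) (q' i) = q i" if "i \<in> Obj J" for i
      using theI'[OF A(4)[OF y T'(3)[OF that] q[OF that]]] unfolding q'_def by blast+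
    have "is_cone J D T ?Fy q'"
      unfolding is_cone_def
    proof (intro conjI ballI)
      fix i j u assume "i \<in> Obj J" "j \<in> Obj J" "u \<in> Hom J i j"
      then show "Comp D ?Fy (on_obj T i) (on_obj T j) (on_arr T i j u) (q' i) = q' j"
        by (intro uniq[of "on_obj T j"]) (simp_all add: q_nat)
    qed simp_all
    from univ[OF this] obtain k where k: "k \<in> Hom D ?Fy x"
      "\<And>i. i \<in> Obj J \<Longrightarrow> Comp D ?Fy x (on_obj T i) (p i) k = q' i"
      and k_uniq: "\<And>k'. \<lbrakk>k' \<in> Hom D ?Fy x; \<forall>i \<in> Obj J. Comp D ?Fy x (on_obj T i) (p i) k' = q' i\<rbrakk> \<Longrightarrow> k' = k"
      by blast
    have tr: "Comp C y ?Gx (on_obj G (on_obj T i)) (?Gp i) (?T x h) = ?T (on_obj T i) (Comp D ?Fy x (on_obj T i) (p i) h)"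
      if "i \<in> Obj J" "h \<in> Hom D ?Fy x" for i h
      using that by simp
    show "\<exists>!h. h \<in> Hom C y ?Gx \<and> (\<forall>i \<in> Obj J. Comp C y ?Gx (on_obj (comp_functor G T) i) (?Gp i) h = q i)"
    proof (rule ex1I[of _ "?T x k"])
      show "?T x k \<in> Hom C y ?Gx \<and>
        (\<forall>i \<in> Obj J. Comp C y ?Gx (on_obj (comp_functor G T) i) (?Gp i) (?T x k) = q i)"
        using k by (simp add: tr del: transpose_Comp[OF A(2)])
      fix h assume h: "h \<in> Hom C y ?Gx \<and> (\<forall>i \<in> Obj J. Comp C y ?Gx (on_obj (comp_functor G T) i) (?Gp i) h = q i)"
      then obtain k' where k': "k' \<in> Hom D ?Fy x" "?T x k' = h" using A(4)[OF y x] by blast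
      have "Comp D ?Fy x (on_obj T i) (p i) k' = q' i" if "i \<in> Obj J" for i
        by (rule uniq[of "on_obj T i"]) (use that k' h in simp_all)
      then have "k' = k" using k_uniq k'(1) by blast
      then show "h = ?T x k" using k'(2) by simp
    qed
  qed
qed

section \<open>The category of modules and the stable category\<close>

lemma LMod_simps [simp]:
  "Obj (LMod R) = modules R" "Hom (LMod R) = mod_hom R"
  "Id (LMod R) M = (\<lambda>x \<in> carrier M. x)" "Comp (LMod R) L M N g f = compose (carrier L) g f"
  by (simp_all add: LMod_def)

lemma LMod_category: "category (LMod R)"
proof
  fix L M N K f g h
  assume "L \<in> Obj (LMod R)" "M \<in> Obj (LMod R)" "N \<in> Obj (LMod R)" "K \<in> Obj (LMod R)"
    and f: "f \<in> Hom (LMod R) L M" and g: "g \<in> Hom (LMod R) M N" and h: "h \<in> Hom (LMod R) N K"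
  then show "Comp (LMod R) L N K h (Comp (LMod R) L M N g f) = Comp (LMod R) L M K (Comp (LMod R) M N K h g) f"
    using mod_homD(1)[of f R L M] by (auto simp: compose_def intro!: restrict_ext)
next
  fix L M N f g
  assume "L \<in> Obj (LMod R)" "f \<in> Hom (LMod R) L M" "g \<in> Hom (LMod R) M N"
  then show "Comp (LMod R) L M N g f \<in> Hom (LMod R) L N"
    using compose_mod_hom[of R L f M g N] by (simp add: modules_def)
next
  fix M N f assume f: "f \<in> Hom (LMod R) M N"
  show "Comp (LMod R) M M N f (Id (LMod R) M) = f"
    using f mod_homD(2)[of f R M N] by (auto simp: compose_def fun_eq_iff)
  show "Comp (LMod R) M N N (Id (LMod R) N) f = f"
    using f mod_homD(1,2)[of f R M N] by (auto simp: compose_def fun_eq_iff)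
qed (auto simp: modules_def intro: id_mod_hom)

lemma LMod_stable_simps [simp]:
  "Obj (LMod_stable R) = modules R" "Hom (LMod_stable R) M N = mod_hom R M N // stable_rel R M N"
  "Id (LMod_stable R) M = stable_class R M M (\<lambda>x \<in> carrier M. x)"
  by (simp_all add: LMod_stable_def)

section \<open>Stable equivalence of homomorphisms\<close>

context small_ring
begin

lemma direct_sum_projective:
  fixes P :: "('v, 'a) module" and Q :: "('v, 'b) module"
  assumes P: "projective R P" and Q: "projective R Q"
  shows "projective R (direct_sum P Q)"
  unfolding projective_def
proof (intro conjI ballI impI)
  have lP: "left_module R P" and lQ: "left_module R Q" using P Q by (auto simp: projective_def)
  interpret P: left_module R P by (rule lP)
  interpret Q: left_module R Q by (rule lQ)
  show lPQ: "left_module R (direct_sum P Q)" by (rule direct_sum_module[OF lP lQ])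
  fix N L :: "('v, 'v) module" and g f
  assume *: "N \<in> modules R" "L \<in> modules R" "g \<in> mod_hom R N L" "f \<in> mod_hom R (direct_sum P Q) L"
    "g ` carrier N = carrier L"
  note lN = modulesD(1)[OF *(1)] and lL = modulesD(1)[OF *(2)]
  interpret g: mod_homs R N L g by (rule mod_homsI[OF lN lL *(3)])
  interpret f: mod_homs R "direct_sum P Q" L f by (rule mod_homsI[OF lPQ lL *(4)])
  have f_add: "f (x, y) \<oplus>\<^bsub>L\<^esub> f (x', y') = f (x \<oplus>\<^bsub>P\<^esub> x', y \<oplus>\<^bsub>Q\<^esub> y')"
    if "x \<in> carrier P" "x' \<in> carrier P" "y \<in> carrier Q" "y' \<in> carrier Q" for x x' y y'
    using f.f_add[of "(x, y)" "(x', y')"] that by simp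
  have f_smult: "r \<odot>\<^bsub>L\<^esub> f (x, y) = f (r \<odot>\<^bsub>P\<^esub> x, r \<odot>\<^bsub>Q\<^esub> y)"
    if "r \<in> carrier R" "x \<in> carrier P" "y \<in> carrier Q" for r x y
    using f.f_smult[of r "(x, y)"] that by simp
  have "(\<lambda>x \<in> carrier P. f (x, \<zero>\<^bsub>Q\<^esub>)) \<in> mod_hom R P L"
    by (rule restrict_mod_homI[OF lP]) (auto simp: f_add f_smult)
  then obtain h1 where h1: "h1 \<in> mod_hom R P N" "compose (carrier P) g h1 = (\<lambda>x \<in> carrier P. f (x, \<zero>\<^bsub>Q\<^esub>))"
    using P * unfolding projective_def by blast
  have "(\<lambda>y \<in> carrier Q. f (\<zero>\<^bsub>P\<^esub>, y)) \<in> mod_hom R Q L"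
    by (rule restrict_mod_homI[OF lQ]) (auto simp: f_add f_smult)
  then obtain h2 where h2: "h2 \<in> mod_hom R Q N" "compose (carrier Q) g h2 = (\<lambda>y \<in> carrier Q. f (\<zero>\<^bsub>P\<^esub>, y))"
    using Q * unfolding projective_def by blast
  have gh1: "g (h1 x) = f (x, \<zero>\<^bsub>Q\<^esub>)" if "x \<in> carrier P" for x
    using fun_cong[OF h1(2), of x] that by (simp add: compose_def)
  have gh2: "g (h2 y) = f (\<zero>\<^bsub>P\<^esub>, y)" if "y \<in> carrier Q" for y
    using fun_cong[OF h2(2), of y] that by (simp add: compose_def)
  define h where "h = (\<lambda>z \<in> carrier (direct_sum P Q). h1 (fst z) \<oplus>\<^bsub>N\<^esub> h2 (snd z))"
  note c1 = mod_homD(1)[OF h1(1)] and c2 = mod_homD(1)[OF h2(1)]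
  have h: "h \<in> mod_hom R (direct_sum P Q) N"
    unfolding h_def
  proof (rule restrict_mod_homI[OF lPQ])
    fix z assume "z \<in> carrier (direct_sum P Q)"
    then obtain x y where z: "z = (x, y)" "x \<in> carrier P" "y \<in> carrier Q" by auto
    then show "h1 (fst z) \<oplus>\<^bsub>N\<^esub> h2 (snd z) \<in> carrier N" using c1 c2 by simp
    fix r assume r: "r \<in> carrier R"
    show "h1 (fst (r \<odot>\<^bsub>direct_sum P Q\<^esub> z)) \<oplus>\<^bsub>N\<^esub> h2 (snd (r \<odot>\<^bsub>direct_sum P Q\<^esub> z)) =
      r \<odot>\<^bsub>N\<^esub> (h1 (fst z) \<oplus>\<^bsub>N\<^esub> h2 (snd z))"
      using z r c1 c2 mod_homD(4)[OF h1(1)] mod_homD(4)[OF h2(1)] by (simp add: g.M.smult_r_distr)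
  next
    fix z w assume "z \<in> carrier (direct_sum P Q)" "w \<in> carrier (direct_sum P Q)"
    then obtain x y x' y' where "z = (x, y)" "x \<in> carrier P" "y \<in> carrier Q"
      "w = (x', y')" "x' \<in> carrier P" "y' \<in> carrier Q" by auto
    then show "h1 (fst (z \<oplus>\<^bsub>direct_sum P Q\<^esub> w)) \<oplus>\<^bsub>N\<^esub> h2 (snd (z \<oplus>\<^bsub>direct_sum P Q\<^esub> w)) =
      (h1 (fst z) \<oplus>\<^bsub>N\<^esub> h2 (snd z)) \<oplus>\<^bsub>N\<^esub> (h1 (fst w) \<oplus>\<^bsub>N\<^esub> h2 (snd w))"
      using c1 c2 mod_homD(3)[OF h1(1)] mod_homD(3)[OF h2(1)] by (simp add: g.M.M.add.m_ac)
  qed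
  moreover have "compose (carrier (direct_sum P Q)) g h = f"
  proof (rule mod_hom_ext[OF compose_mod_hom[OF lPQ h *(3)] *(4)])
    fix z assume "z \<in> carrier (direct_sum P Q)"
    then obtain x y where z: "z = (x, y)" "x \<in> carrier P" "y \<in> carrier Q" by auto
    then show "compose (carrier (direct_sum P Q)) g h z = f z"
      using c1 c2 gh1 gh2 f_add[of x "\<zero>\<^bsub>P\<^esub>" "\<zero>\<^bsub>Q\<^esub>" y] by (simp add: compose_def h_def g.f_add)
  qed
  ultimately show "\<exists>h \<in> mod_hom R (direct_sum P Q) N. compose (carrier (direct_sum P Q)) g h = f" by blast
qed

text \<open>Allows the factorisation to pass through a small projective module of any type, which is
  copied into \<open>'v\<close>. The condition is put additively to keep subtraction out of the
  applications.\<close>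

lemma stable_relI:
  fixes P :: "('v, 'a) module"
  assumes M: "M \<in> modules R" and N: "N \<in> modules R"
    and f: "f \<in> mod_hom R M N" and g: "g \<in> mod_hom R M N"
    and P: "projective R P" "carrier P \<prec> (UNIV :: 'v set)" and u: "u \<in> mod_hom R M P" and v: "v \<in> mod_hom R P N"
    and eq: "\<And>x. x \<in> carrier M \<Longrightarrow> f x = g x \<oplus>\<^bsub>N\<^esub> v (u x)"
  shows "(f, g) \<in> stable_rel R M N"
proof -
  note lM = modulesD(1)[OF M] and lN = modulesD(1)[OF N]
  have lP: "left_module R P" using P by (simp add: projective_def)
  interpret N: left_module R N by (rule lN)
  obtain P' :: "('v, 'v) module" and \<phi> where P': "P' \<in> modules R" and \<phi>: "\<phi> \<in> mod_iso R P P'"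
    using module_copy[OF lP P(2)] by blast
  note lP' = modulesD(1)[OF P']
  obtain \<psi> where \<psi>: "\<psi> \<in> mod_iso R P' P" "\<And>x. x \<in> carrier P \<Longrightarrow> \<psi> (\<phi> x) = x"
    by (rule mod_iso_inverse[OF lP lP' \<phi>]) (rule that)
  have P'_proj: "P' \<in> projectives R" using P' projective_iso[OF P(1) lP' \<phi>] by (simp add: projectives_def)
  have u': "compose (carrier M) \<phi> u \<in> mod_hom R M P'" by (rule compose_mod_hom[OF lM u mod_isoD(1)[OF \<phi>]])
  have v': "compose (carrier P') v \<psi> \<in> mod_hom R P' N" by (rule compose_mod_hom[OF lP' mod_isoD(1)[OF \<psi>(1)] v])
  have "(\<lambda>x \<in> carrier M. f x \<ominus>\<^bsub>N\<^esub> g x) = compose (carrier M) (compose (carrier P') v \<psi>) (compose (carrier M) \<phi> u)"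
  proof (rule mod_hom_ext[OF diff_mod_hom[OF lM lN f g] compose_mod_hom[OF lM u' v']])
    fix x assume x: "x \<in> carrier M"
    have ux: "u x \<in> carrier P" by (rule mod_homD(1)[OF u x])
    have "f x \<ominus>\<^bsub>N\<^esub> g x = v (u x)"
      using N.diff_eq_iff[OF mod_homD(1)[OF f x] mod_homD(1)[OF g x] mod_homD(1)[OF v ux]] eq[OF x] by simp
    then show "(\<lambda>x \<in> carrier M. f x \<ominus>\<^bsub>N\<^esub> g x) x = compose (carrier M) (compose (carrier P') v \<psi>) (compose (carrier M) \<phi> u) x"
      using x \<psi>(2)[OF ux] mod_homD(1)[OF mod_isoD(1)[OF \<phi>] ux] by (simp add: compose_def)
  qed
  then show ?thesis unfolding stable_rel_def factors_through_projective_def using f g P'_proj u' v' by blast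
qed

lemma stable_relE:
  assumes M: "M \<in> modules R" and N: "N \<in> modules R" and rel: "(f, g) \<in> stable_rel R M N"
  obtains P u v where "f \<in> mod_hom R M N" "g \<in> mod_hom R M N" "P \<in> projectives R"
    "u \<in> mod_hom R M P" "v \<in> mod_hom R P N" "\<And>x. x \<in> carrier M \<Longrightarrow> f x = g x \<oplus>\<^bsub>N\<^esub> v (u x)"
proof -
  interpret N: left_module R N using N by (rule modulesD)
  obtain P u v where *: "f \<in> mod_hom R M N" "g \<in> mod_hom R M N" "P \<in> projectives R"
    "u \<in> mod_hom R M P" "v \<in> mod_hom R P N" "(\<lambda>x \<in> carrier M. f x \<ominus>\<^bsub>N\<^esub> g x) = compose (carrier M) v u"
    using rel unfolding stable_rel_def factors_through_projective_def by blast
  have "f x = g x \<oplus>\<^bsub>N\<^esub> v (u x)" if x: "x \<in> carrier M" for x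
  proof -
    have "f x \<ominus>\<^bsub>N\<^esub> g x = v (u x)" using fun_cong[OF *(6), of x] x by (simp add: compose_def)
    then show ?thesis
      using N.diff_eq_iff[OF mod_homD(1)[OF *(1) x] mod_homD(1)[OF *(2) x] mod_homD(1)[OF *(5) mod_homD(1)[OF *(4) x]]]
      by simp
  qed
  then show ?thesis using that * by blast
qed

lemma projectives_small:
  "P \<in> projectives R \<Longrightarrow> projective R P \<and> carrier P \<prec> (UNIV :: 'v set) \<and> left_module R P"
  by (auto simp: projectives_def modules_def small_def)

text \<open>Transitivity adds two factorisations, so the sum passes through the direct sum of the
  two projectives. Reflexivity uses zero maps through the ring.\<close>

lemma stable_rel_equiv:
  assumes M: "M \<in> modules R" and N: "N \<in> modules R"
  shows "equiv (mod_hom R M N) (stable_rel R M N)"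
proof (rule equivI)
  note lM = modulesD(1)[OF M] and lN = modulesD(1)[OF N]
  interpret N: left_module R N by (rule lN)
  interpret r: left_module R "regular_module R" by (rule regular_left_module[OF ring_axioms])
  show "stable_rel R M N \<subseteq> mod_hom R M N \<times> mod_hom R M N" by (auto simp: stable_rel_def)
  show "refl_on (mod_hom R M N) (stable_rel R M N)"
  proof (rule refl_onI)
    fix f assume f: "f \<in> mod_hom R M N"
    show "(f, f) \<in> stable_rel R M N"
      by (rule stable_relI[OF M N f f regular_projective _ zero_mod_hom[OF lM r.left_module_axioms]
            zero_mod_hom[OF r.left_module_axioms lN]])
        (use regular_small mod_homD(1)[OF f] in auto)
  qed
  show "sym (stable_rel R M N)"
  proof (rule symI)
    fix f g assume "(f, g) \<in> stable_rel R M N"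
    then obtain P u v where *: "f \<in> mod_hom R M N" "g \<in> mod_hom R M N" "P \<in> projectives R"
      "u \<in> mod_hom R M P" "v \<in> mod_hom R P N" "\<And>x. x \<in> carrier M \<Longrightarrow> f x = g x \<oplus>\<^bsub>N\<^esub> v (u x)"
      by (rule stable_relE[OF M N]) (rule that)
    note P = projectives_small[OF *(3)]
    have v': "(\<lambda>x \<in> carrier P. (\<lambda>x \<in> carrier P. \<zero>\<^bsub>N\<^esub>) x \<ominus>\<^bsub>N\<^esub> v x) \<in> mod_hom R P N"
      using P by (intro diff_mod_hom[OF _ lN zero_mod_hom[OF _ lN] *(5)]) auto
    show "(g, f) \<in> stable_rel R M N"
    proof (rule stable_relI[OF M N *(2,1) _ _ *(4) v'])
      fix x assume x: "x \<in> carrier M"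
      have ux: "u x \<in> carrier P" by (rule mod_homD(1)[OF *(4) x])
      show "g x = f x \<oplus>\<^bsub>N\<^esub> (\<lambda>x \<in> carrier P. (\<lambda>x \<in> carrier P. \<zero>\<^bsub>N\<^esub>) x \<ominus>\<^bsub>N\<^esub> v x) (u x)"
        using ux *(6)[OF x] mod_homD(1)[OF *(2) x] mod_homD(1)[OF *(5) ux]
        by (simp add: a_minus_def N.M.a_assoc N.M.r_neg)
    qed (use P in auto)
  qed
  show "trans (stable_rel R M N)"
  proof (rule transI)
    fix f g h assume "(f, g) \<in> stable_rel R M N" "(g, h) \<in> stable_rel R M N"
    obtain P u v where *: "f \<in> mod_hom R M N" "g \<in> mod_hom R M N" "P \<in> projectives R"
      "u \<in> mod_hom R M P" "v \<in> mod_hom R P N" "\<And>x. x \<in> carrier M \<Longrightarrow> f x = g x \<oplus>\<^bsub>N\<^esub> v (u x)"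
      by (rule stable_relE[OF M N \<open>(f, g) \<in> stable_rel R M N\<close>]) (rule that)
    obtain P' u' v' where **: "h \<in> mod_hom R M N" "P' \<in> projectives R"
      "u' \<in> mod_hom R M P'" "v' \<in> mod_hom R P' N" "\<And>x. x \<in> carrier M \<Longrightarrow> g x = h x \<oplus>\<^bsub>N\<^esub> v' (u' x)"
      by (rule stable_relE[OF M N \<open>(g, h) \<in> stable_rel R M N\<close>]) (rule that)
    note P = projectives_small[OF *(3)] and P' = projectives_small[OF **(2)]
    interpret P: left_module R P using P by simp
    interpret P': left_module R P' using P' by simp
    have U: "(\<lambda>x \<in> carrier M. (u x, u' x)) \<in> mod_hom R M (direct_sum P P')"
      by (rule restrict_mod_homI[OF lM])
        (use mod_homD[OF *(4)] mod_homD[OF **(3)] in auto)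
    have V: "(\<lambda>z \<in> carrier (direct_sum P P'). v (fst z) \<oplus>\<^bsub>N\<^esub> v' (snd z)) \<in> mod_hom R (direct_sum P P') N"
    proof (rule restrict_mod_homI[OF direct_sum_module[OF P.left_module_axioms P'.left_module_axioms]])
      show "\<And>r x. r \<in> carrier R \<Longrightarrow> x \<in> carrier (direct_sum P P') \<Longrightarrow>
           v (fst (r \<odot>\<^bsub>direct_sum P P'\<^esub> x)) \<oplus>\<^bsub>N\<^esub> v' (snd (r \<odot>\<^bsub>direct_sum P P'\<^esub> x)) = r \<odot>\<^bsub>N\<^esub> (v (fst x) \<oplus>\<^bsub>N\<^esub> v' (snd x))"
        using mod_homD[OF *(5)] mod_homD[OF **(4)] by (auto simp: N.smult_r_distr)
      show "\<And>x y. x \<in> carrier (direct_sum P P') \<Longrightarrow> y \<in> carrier (direct_sum P P') \<Longrightarrow>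
           v (fst (x \<oplus>\<^bsub>direct_sum P P'\<^esub> y)) \<oplus>\<^bsub>N\<^esub> v' (snd (x \<oplus>\<^bsub>direct_sum P P'\<^esub> y)) =
           (v (fst x) \<oplus>\<^bsub>N\<^esub> v' (snd x)) \<oplus>\<^bsub>N\<^esub> (v (fst y) \<oplus>\<^bsub>N\<^esub> v' (snd y))"
        using mod_homD[OF *(5)] mod_homD[OF **(4)] by (auto simp: N.M.add.m_ac)
    qed (use mod_homD[OF *(5)] mod_homD[OF **(4)] in auto)
    show "(f, h) \<in> stable_rel R M N"
    proof (rule stable_relI[OF M N *(1) **(1) _ _ U V])
      show "projective R (direct_sum P P')" using P P' by (intro direct_sum_projective) auto
      show "carrier (direct_sum P P') \<prec> (UNIV :: 'v set)" using P P' Times_small[of "carrier P" "carrier P'"] by simp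
      fix x assume x: "x \<in> carrier M"
      have c: "u x \<in> carrier P" "u' x \<in> carrier P'" by (rule mod_homD(1)[OF *(4) x], rule mod_homD(1)[OF **(3) x])
      show "f x = h x \<oplus>\<^bsub>N\<^esub> (\<lambda>z \<in> carrier (direct_sum P P'). v (fst z) \<oplus>\<^bsub>N\<^esub> v' (snd z)) ((\<lambda>x \<in> carrier M. (u x, u' x)) x)"
        using x c *(6)[OF x] **(5)[OF x] mod_homD(1)[OF **(1) x] mod_homD(1)[OF *(5) c(1)] mod_homD(1)[OF **(4) c(2)]
        by (simp add: N.M.add.m_ac)
    qed
  qed
qed

lemma stable_class_eq_iff:
  assumes "M \<in> modules R" "N \<in> modules R" "f \<in> mod_hom R M N" "g \<in> mod_hom R M N"
  shows "stable_class R M N f = stable_class R M N g \<longleftrightarrow> (f, g) \<in> stable_rel R M N"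
  unfolding stable_class_def by (rule eq_equiv_class_iff[OF stable_rel_equiv[OF assms(1,2)] assms(3,4)])

lemma stable_class_in_Hom:
  "f \<in> mod_hom R M N \<Longrightarrow> stable_class R M N f \<in> Hom (LMod_stable R) M N"
  unfolding stable_class_def by (simp add: quotientI)

lemma stable_HomE:
  assumes "u \<in> Hom (LMod_stable R) M N"
  obtains f where "f \<in> mod_hom R M N" "u = stable_class R M N f"
  using assms unfolding stable_class_def by (auto elim: quotientE)

text \<open>The two factors are changed one at a time; the factorisation of the change is composed
  with the factor that stays.\<close>

lemma stable_rel_compose:
  assumes L: "L \<in> modules R" and M: "M \<in> modules R" and N: "N \<in> modules R"
    and f: "(f, f') \<in> stable_rel R L M" and g: "(g, g') \<in> stable_rel R M N"
  shows "(compose (carrier L) g f, compose (carrier L) g' f') \<in> stable_rel R L N"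
proof -
  note lL = modulesD(1)[OF L] and lM = modulesD(1)[OF M] and lN = modulesD(1)[OF N]
  obtain P u v where *: "f \<in> mod_hom R L M" "f' \<in> mod_hom R L M" "P \<in> projectives R"
      "u \<in> mod_hom R L P" "v \<in> mod_hom R P M" "\<And>x. x \<in> carrier L \<Longrightarrow> f x = f' x \<oplus>\<^bsub>M\<^esub> v (u x)"
    by (rule stable_relE[OF L M f]) (rule that)
  obtain P' u' v' where **: "g \<in> mod_hom R M N" "g' \<in> mod_hom R M N" "P' \<in> projectives R"
      "u' \<in> mod_hom R M P'" "v' \<in> mod_hom R P' N" "\<And>x. x \<in> carrier M \<Longrightarrow> g x = g' x \<oplus>\<^bsub>N\<^esub> v' (u' x)"
    by (rule stable_relE[OF M N g]) (rule that)
  note P = projectives_small[OF *(3)] and P' = projectives_small[OF **(3)]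
  interpret N: left_module R N by (rule lN)
  have lP: "left_module R P" using P by simp
  have "(compose (carrier L) g f, compose (carrier L) g f') \<in> stable_rel R L N"
  proof (rule stable_relI[OF L N compose_mod_hom[OF lL *(1) **(1)] compose_mod_hom[OF lL *(2) **(1)] _ _
        *(4) compose_mod_hom[OF lP *(5) **(1)]])
    fix x assume x: "x \<in> carrier L"
    have c: "u x \<in> carrier P" "f' x \<in> carrier M" "v (u x) \<in> carrier M"
      using mod_homD(1)[OF *(4) x] mod_homD(1)[OF *(2) x] mod_homD(1)[OF *(5)] by auto
    show "compose (carrier L) g f x = compose (carrier L) g f' x \<oplus>\<^bsub>N\<^esub> compose (carrier P) g v (u x)"
      using x c *(6)[OF x] mod_homD(3)[OF **(1) c(2,3)] by (simp add: compose_def)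
  qed (use P in auto)
  moreover have "(compose (carrier L) g f', compose (carrier L) g' f') \<in> stable_rel R L N"
  proof (rule stable_relI[OF L N compose_mod_hom[OF lL *(2) **(1)] compose_mod_hom[OF lL *(2) **(2)] _ _
        compose_mod_hom[OF lL *(2) **(4)] **(5)])
    fix x assume x: "x \<in> carrier L"
    show "compose (carrier L) g f' x = compose (carrier L) g' f' x \<oplus>\<^bsub>N\<^esub> v' (compose (carrier L) u' f' x)"
      using x **(6)[OF mod_homD(1)[OF *(2) x]] by (simp add: compose_def)
  qed (use P' in auto)
  ultimately show ?thesis using stable_rel_equiv[OF L N] by (meson equivE transD)
qed

text \<open>Composition of classes is defined as a union over all pairs of representatives. It
  collapses because every pair yields the same class.\<close>

lemma stable_Comp:
  assumes L: "L \<in> modules R" and M: "M \<in> modules R" and N: "N \<in> modules R"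
    and f: "f \<in> mod_hom R L M" and g: "g \<in> mod_hom R M N"
  shows "Comp (LMod_stable R) L M N (stable_class R M N g) (stable_class R L M f) =
    stable_class R L N (compose (carrier L) g f)"
proof -
  have ff: "f \<in> stable_class R L M f" and gg: "g \<in> stable_class R M N g"
    unfolding stable_class_def
    using equiv_class_self[OF stable_rel_equiv] L M N f g by blast+
  have "stable_class R L N (compose (carrier L) g' f') = stable_class R L N (compose (carrier L) g f)"
    if "g' \<in> stable_class R M N g" "f' \<in> stable_class R L M f" for g' f'
  proof -
    have "(f, f') \<in> stable_rel R L M" "(g, g') \<in> stable_rel R M N" using that by (auto simp: stable_class_def)
    from stable_rel_compose[OF L M N this]
    show ?thesis unfolding stable_class_def using equiv_class_eq[OF stable_rel_equiv[OF L N]] by metis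
  qed
  then have "(\<Union>g' \<in> stable_class R M N g. \<Union>f' \<in> stable_class R L M f. stable_class R L N (compose (carrier L) g' f'))
    = stable_class R L N (compose (carrier L) g f)" using ff gg by blast
  then show ?thesis by (simp add: LMod_stable_def)
qed

lemma LMod_stable_category: "category (LMod_stable R)"
proof
  note CC = category.Comp_in_Hom[OF LMod_category, simplified]
  fix L M N K u v w
  assume *: "L \<in> Obj (LMod_stable R)" "M \<in> Obj (LMod_stable R)" "N \<in> Obj (LMod_stable R)" "K \<in> Obj (LMod_stable R)"
    and "u \<in> Hom (LMod_stable R) L M" "v \<in> Hom (LMod_stable R) M N" "w \<in> Hom (LMod_stable R) N K"
  then obtain f g h where f: "f \<in> mod_hom R L M" "u = stable_class R L M f"
    and g: "g \<in> mod_hom R M N" "v = stable_class R M N g"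
    and h: "h \<in> mod_hom R N K" "w = stable_class R N K h" by (meson stable_HomE)
  have o: "L \<in> modules R" "M \<in> modules R" "N \<in> modules R" "K \<in> modules R" using * by auto
  show "Comp (LMod_stable R) L N K w (Comp (LMod_stable R) L M N v u) =
    Comp (LMod_stable R) L M K (Comp (LMod_stable R) M N K w v) u"
    using category.Comp_assoc[OF LMod_category, of L R M N K f g h] o f(1) g(1) h(1)
      CC[OF o(1,2,3) f(1) g(1)] CC[OF o(2,3,4) g(1) h(1)]
    by (simp add: f(2) g(2) h(2) stable_Comp)
next
  fix L M N u v
  assume *: "L \<in> Obj (LMod_stable R)" "M \<in> Obj (LMod_stable R)" "N \<in> Obj (LMod_stable R)"
    and "u \<in> Hom (LMod_stable R) L M" "v \<in> Hom (LMod_stable R) M N"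
  then obtain f g where f: "f \<in> mod_hom R L M" "u = stable_class R L M f"
    and g: "g \<in> mod_hom R M N" "v = stable_class R M N g" by (meson stable_HomE)
  have o: "L \<in> modules R" "M \<in> modules R" "N \<in> modules R" using * by auto
  show "Comp (LMod_stable R) L M N v u \<in> Hom (LMod_stable R) L N"
    using stable_class_in_Hom[OF compose_mod_hom[OF modulesD(1)[OF o(1)] f(1) g(1)]] stable_Comp[OF o f(1) g(1)]
    by (simp add: f(2) g(2))
next
  fix M N u assume *: "M \<in> Obj (LMod_stable R)" "N \<in> Obj (LMod_stable R)" and "u \<in> Hom (LMod_stable R) M N"
  then obtain f where f: "f \<in> mod_hom R M N" "u = stable_class R M N f" by (meson stable_HomE)
  have o: "M \<in> modules R" "N \<in> modules R" using * by auto
  show "Comp (LMod_stable R) M M N u (Id (LMod_stable R) M) = u"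
    using stable_Comp[OF o(1,1,2) id_mod_hom[OF modulesD(1)[OF o(1)]] f(1)]
      category.Comp_Id_right[OF LMod_category, of M R N f] o f by simp
  show "Comp (LMod_stable R) M N N (Id (LMod_stable R) N) u = u"
    using stable_Comp[OF o(1,2,2) f(1) id_mod_hom[OF modulesD(1)[OF o(2)]]]
      category.Comp_Id_left[OF LMod_category, of M R N f] o f by simp
next
  fix M assume "M \<in> Obj (LMod_stable R)"
  then show "Id (LMod_stable R) M \<in> Hom (LMod_stable R) M M"
    using stable_class_in_Hom[OF id_mod_hom] by (simp add: modules_def)
qed

lemma Q_functor_simps [simp]:
  "on_obj (Q_functor R) M = M" "on_arr (Q_functor R) M N f = stable_class R M N f"
  by (simp_all add: Q_functor_def)

lemma Q_functor_functor: "is_functor (LMod R) (LMod_stable R) (Q_functor R)"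
  unfolding is_functor_def
  using LMod_category LMod_stable_category stable_class_in_Hom stable_Comp by simp

text \<open>If the identity is stably zero, it factors through a projective module, of which
  \<open>M\<close> is then a retract.\<close>

lemma stable_zero_projective:
  assumes M: "M \<in> modules R"
    and rel: "((\<lambda>x \<in> carrier M. x), (\<lambda>x \<in> carrier M. \<zero>\<^bsub>M\<^esub>)) \<in> stable_rel R M M"
  shows "projective R M"
proof -
  interpret M: left_module R M using M by (rule modulesD)
  obtain P u v where *: "P \<in> projectives R" "u \<in> mod_hom R M P" "v \<in> mod_hom R P M"
    "\<And>x. x \<in> carrier M \<Longrightarrow> (\<lambda>x \<in> carrier M. x) x = (\<lambda>x \<in> carrier M. \<zero>\<^bsub>M\<^esub>) x \<oplus>\<^bsub>M\<^esub> v (u x)"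
    by (rule stable_relE[OF M M rel]) (rule that)
  show ?thesis
  proof (rule projective_retract[OF _ M.left_module_axioms *(2,3)])
    show "projective R P" using projectives_small[OF *(1)] by simp
    show "v (u x) = x" if "x \<in> carrier M" for x
      using *(4)[OF that] that mod_homD(1)[OF *(3) mod_homD(1)[OF *(2) that]] by simp
  qed
qed

lemma projective_target_stable_zero:
  assumes M: "M \<in> modules R" and P: "P \<in> projectives R" and f: "f \<in> mod_hom R M P"
  shows "(f, (\<lambda>x \<in> carrier M. \<zero>\<^bsub>P\<^esub>)) \<in> stable_rel R M P"
proof -
  note P' = projectives_small[OF P]
  interpret P: left_module R P using P' by simp
  note lM = modulesD(1)[OF M]
  show ?thesis
    by (rule stable_relI[OF M _ f zero_mod_hom[OF lM P.left_module_axioms] _ _ f id_mod_hom[OF P.left_module_axioms]])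
      (use P P' mod_homD(1)[OF f] in \<open>auto simp: projectives_def\<close>)
qed

end

section \<open>The conditions on limits, adjoints and reflections\<close>

text \<open>The quotient is realised on chosen representatives of the cosets, because the cosets
  themselves are not elements of \<open>'v\<close>.\<close>

lemma (in small_ring) quotient_exists:
  assumes M: "M \<in> modules R" and S: "submodule S R M"
  obtains Q q where "Q \<in> modules R" "q \<in> mod_hom R M Q" "q ` carrier M = carrier Q" "mod_kernel M Q q = S"
proof -
  interpret M: left_module R M using M by (rule modulesD)
  note SD = M.submoduleD[OF S]
  define rep where "rep x = (SOME y. y \<in> carrier M \<and> x \<ominus>\<^bsub>M\<^esub> y \<in> S)" for x
  have rep: "rep x \<in> carrier M" "x \<ominus>\<^bsub>M\<^esub> rep x \<in> S" if "x \<in> carrier M" for x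
  proof -
    have "x \<ominus>\<^bsub>M\<^esub> x \<in> S" using M.diff_eq_zero_iff[OF that that] SD(2) by simp
    with that have "\<exists>y. y \<in> carrier M \<and> x \<ominus>\<^bsub>M\<^esub> y \<in> S" by blast
    from someI_ex[OF this] show "rep x \<in> carrier M" "x \<ominus>\<^bsub>M\<^esub> rep x \<in> S" unfolding rep_def by blast+
  qed
  have swap: "y \<ominus>\<^bsub>M\<^esub> x \<in> S" if "x \<in> carrier M" "y \<in> carrier M" "x \<ominus>\<^bsub>M\<^esub> y \<in> S" for x y
  proof -
    have "\<ominus>\<^bsub>M\<^esub> (x \<ominus>\<^bsub>M\<^esub> y) = y \<ominus>\<^bsub>M\<^esub> x" using that(1,2) by (simp add: a_minus_def M.M.minus_add M.M.add.m_ac)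
    then show ?thesis using SD(5)[OF that(3)] by simp
  qed
  have tr: "x \<ominus>\<^bsub>M\<^esub> z \<in> S"
    if "x \<in> carrier M" "y \<in> carrier M" "z \<in> carrier M" "x \<ominus>\<^bsub>M\<^esub> y \<in> S" "y \<ominus>\<^bsub>M\<^esub> z \<in> S" for x y z
  proof -
    have "(x \<ominus>\<^bsub>M\<^esub> z) \<ominus>\<^bsub>M\<^esub> (x \<ominus>\<^bsub>M\<^esub> y) = y \<ominus>\<^bsub>M\<^esub> z" by (rule M.diff_diff_eq[OF that(1,2,3)])
    then have "x \<ominus>\<^bsub>M\<^esub> z = (x \<ominus>\<^bsub>M\<^esub> y) \<oplus>\<^bsub>M\<^esub> (y \<ominus>\<^bsub>M\<^esub> z)"
      using M.diff_eq_iff[of "x \<ominus>\<^bsub>M\<^esub> z" "x \<ominus>\<^bsub>M\<^esub> y" "y \<ominus>\<^bsub>M\<^esub> z"] that(1-3) by simp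
    then show ?thesis using SD(3)[OF that(4,5)] by simp
  qed
  have rep_eq: "rep x = rep y" if "x \<in> carrier M" "y \<in> carrier M" "x \<ominus>\<^bsub>M\<^esub> y \<in> S" for x y
  proof -
    have "(x \<ominus>\<^bsub>M\<^esub> z \<in> S) = (y \<ominus>\<^bsub>M\<^esub> z \<in> S)" if "z \<in> carrier M" for z
      using tr[of x y z] tr[of y x z] swap[of x y] that \<open>x \<in> carrier M\<close> \<open>y \<in> carrier M\<close> \<open>x \<ominus>\<^bsub>M\<^esub> y \<in> S\<close> by blast
    then have "(\<lambda>z. z \<in> carrier M \<and> x \<ominus>\<^bsub>M\<^esub> z \<in> S) = (\<lambda>z. z \<in> carrier M \<and> y \<ominus>\<^bsub>M\<^esub> z \<in> S)" by blast
    then show ?thesis by (simp add: rep_def)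
  qed
  have rep_add: "rep (rep x \<oplus>\<^bsub>M\<^esub> rep y) = rep (x \<oplus>\<^bsub>M\<^esub> y)" if "x \<in> carrier M" "y \<in> carrier M" for x y
  proof (rule rep_eq[symmetric])
    have "(x \<oplus>\<^bsub>M\<^esub> y) \<ominus>\<^bsub>M\<^esub> (rep x \<oplus>\<^bsub>M\<^esub> rep y) = (x \<ominus>\<^bsub>M\<^esub> rep x) \<oplus>\<^bsub>M\<^esub> (y \<ominus>\<^bsub>M\<^esub> rep y)"
      using that rep by (simp add: a_minus_def M.M.minus_add M.M.add.m_ac)
    then show "(x \<oplus>\<^bsub>M\<^esub> y) \<ominus>\<^bsub>M\<^esub> (rep x \<oplus>\<^bsub>M\<^esub> rep y) \<in> S" using SD(3) rep that by simp
  qed (use that rep in auto)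
  have rep_smult: "rep (r \<odot>\<^bsub>M\<^esub> rep x) = rep (r \<odot>\<^bsub>M\<^esub> x)" if "r \<in> carrier R" "x \<in> carrier M" for r x
  proof (rule rep_eq[symmetric])
    have "r \<odot>\<^bsub>M\<^esub> x \<ominus>\<^bsub>M\<^esub> r \<odot>\<^bsub>M\<^esub> rep x = r \<odot>\<^bsub>M\<^esub> (x \<ominus>\<^bsub>M\<^esub> rep x)" using that rep by (simp add: M.smult_r_sub)
    then show "r \<odot>\<^bsub>M\<^esub> x \<ominus>\<^bsub>M\<^esub> r \<odot>\<^bsub>M\<^esub> rep x \<in> S" using SD(4) rep that by simp
  qed (use that rep in auto)
  define Q :: "('v, 'v) module" where "Q = \<lparr>carrier = rep ` carrier M, mult = undefined, one = undefined,
    zero = rep \<zero>\<^bsub>M\<^esub>, add = (\<lambda>x y. rep (x \<oplus>\<^bsub>M\<^esub> y)), smult = (\<lambda>r x. rep (r \<odot>\<^bsub>M\<^esub> x))\<rparr>"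
  have lQ: "left_module R Q"
  proof (rule left_moduleI)
    fix X assume "X \<in> carrier Q"
    then obtain x where x: "x \<in> carrier M" "X = rep x" by (auto simp: Q_def)
    have "rep (\<ominus>\<^bsub>M\<^esub> x) \<oplus>\<^bsub>Q\<^esub> X = \<zero>\<^bsub>Q\<^esub>" using x by (simp add: Q_def rep_add M.M.l_neg)
    then show "\<exists>y \<in> carrier Q. y \<oplus>\<^bsub>Q\<^esub> X = \<zero>\<^bsub>Q\<^esub>" using x by (auto simp: Q_def)
  next
    fix X Y Z assume "X \<in> carrier Q" "Y \<in> carrier Q" "Z \<in> carrier Q"
    then obtain x y z where "x \<in> carrier M" "X = rep x" "y \<in> carrier M" "Y = rep y" "z \<in> carrier M" "Z = rep z"
      by (auto simp: Q_def)
    then show "(X \<oplus>\<^bsub>Q\<^esub> Y) \<oplus>\<^bsub>Q\<^esub> Z = X \<oplus>\<^bsub>Q\<^esub> (Y \<oplus>\<^bsub>Q\<^esub> Z)" by (simp add: Q_def rep_add M.M.a_assoc)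
  next
    fix X Y assume "X \<in> carrier Q" "Y \<in> carrier Q"
    then obtain x y where "x \<in> carrier M" "X = rep x" "y \<in> carrier M" "Y = rep y" by (auto simp: Q_def)
    then show "X \<oplus>\<^bsub>Q\<^esub> Y = Y \<oplus>\<^bsub>Q\<^esub> X" "X \<oplus>\<^bsub>Q\<^esub> Y \<in> carrier Q"
      by (auto simp: Q_def rep_add M.M.a_comm)
    show "r \<odot>\<^bsub>Q\<^esub> (X \<oplus>\<^bsub>Q\<^esub> Y) = r \<odot>\<^bsub>Q\<^esub> X \<oplus>\<^bsub>Q\<^esub> r \<odot>\<^bsub>Q\<^esub> Y" if "r \<in> carrier R" for r
      using \<open>x \<in> carrier M\<close> \<open>X = rep x\<close> \<open>y \<in> carrier M\<close> \<open>Y = rep y\<close> that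
      by (simp add: Q_def rep_add rep_smult M.smult_r_distr)
  next
    fix X assume "X \<in> carrier Q"
    then obtain x where x: "x \<in> carrier M" "X = rep x" by (auto simp: Q_def)
    then show "\<zero>\<^bsub>Q\<^esub> \<oplus>\<^bsub>Q\<^esub> X = X" "\<one> \<odot>\<^bsub>Q\<^esub> X = X"
      by (simp_all add: Q_def rep_add rep_smult)
    fix r assume r: "r \<in> carrier R"
    show "r \<odot>\<^bsub>Q\<^esub> X \<in> carrier Q" using x r rep by (auto simp: Q_def)
    fix s assume s: "s \<in> carrier R"
    show "(r \<oplus> s) \<odot>\<^bsub>Q\<^esub> X = r \<odot>\<^bsub>Q\<^esub> X \<oplus>\<^bsub>Q\<^esub> s \<odot>\<^bsub>Q\<^esub> X" "(r \<otimes> s) \<odot>\<^bsub>Q\<^esub> X = r \<odot>\<^bsub>Q\<^esub> (s \<odot>\<^bsub>Q\<^esub> X)"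
      using x r s by (simp_all add: Q_def rep_add rep_smult M.smult_l_distr M.smult_assoc1)
  qed (auto simp: Q_def ring_axioms)
  have "carrier Q \<prec> (UNIV :: 'v set)" using image_small[OF modulesD(2)[OF M], of rep] by (simp add: Q_def)
  then have Q: "Q \<in> modules R" using lQ by (simp add: modules_def small_def)
  have q: "restrict rep (carrier M) \<in> mod_hom R M Q"
    by (rule restrict_mod_homI[OF M.left_module_axioms]) (auto simp: Q_def rep_add rep_smult)
  have "rep x = rep \<zero>\<^bsub>M\<^esub> \<longleftrightarrow> x \<in> S" if x: "x \<in> carrier M" for x
  proof
    assume eq: "rep x = rep \<zero>\<^bsub>M\<^esub>"
    have "x \<ominus>\<^bsub>M\<^esub> \<zero>\<^bsub>M\<^esub> \<in> S"
    proof (rule tr[OF x rep(1)[OF x] M.M.zero_closed rep(2)[OF x]])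
      show "rep x \<ominus>\<^bsub>M\<^esub> \<zero>\<^bsub>M\<^esub> \<in> S" unfolding eq
        by (rule swap[OF M.M.zero_closed rep(1)[OF M.M.zero_closed] rep(2)[OF M.M.zero_closed]])
    qed
    then show "x \<in> S" using M.diff_zero[OF x] by simp
  next
    assume "x \<in> S"
    then show "rep x = rep \<zero>\<^bsub>M\<^esub>" using rep_eq[OF x M.M.zero_closed] M.diff_zero[OF x] by simp
  qed
  then have "mod_kernel M Q (restrict rep (carrier M)) = S"
    using SD(1) by (auto simp: mod_kernel_def Q_def)
  moreover have "restrict rep (carrier M) ` carrier M = carrier Q" by (simp add: Q_def)
  ultimately show ?thesis using that Q q by blast
qed

text \<open>That epimorphisms are onto is seen by comparing the projection modulo the image with the
  zero map: both agree after \<open>f\<close>.\<close>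

lemma (in small_ring) epi_arrow_LMod_iff:
  assumes M: "M \<in> modules R" and N: "N \<in> modules R"
  shows "epi_arrow (LMod R) M N f \<longleftrightarrow> f \<in> mod_hom R M N \<and> f ` carrier M = carrier N"
proof (intro iffI conjI; (elim conjE)?)
  note lM = modulesD(1)[OF M] and lN = modulesD(1)[OF N]
  assume epi: "epi_arrow (LMod R) M N f"
  then show f: "f \<in> mod_hom R M N" by (simp add: epi_arrow_def)
  interpret f: mod_homs R M N f by (rule mod_homsI[OF lM lN f])
  obtain Q q where Q: "Q \<in> modules R" and q: "q \<in> mod_hom R N Q" and ker: "mod_kernel N Q q = f ` carrier M"
    by (rule quotient_exists[OF N f.image_submodule[OF f.M.carrier_submodule]]) (rule that)
  have lQ: "left_module R Q" using Q by (rule modulesD)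
  have "compose (carrier M) q f = compose (carrier M) (\<lambda>x \<in> carrier N. \<zero>\<^bsub>Q\<^esub>) f"
    using ker by (auto simp: compose_def mod_kernel_def intro!: restrict_ext)
  then have "q = (\<lambda>x \<in> carrier N. \<zero>\<^bsub>Q\<^esub>)"
    using epi Q q zero_mod_hom[OF lN lQ] by (simp add: epi_arrow_def)
  then have "mod_kernel N Q q = carrier N" by (auto simp: mod_kernel_def)
  then show "f ` carrier M = carrier N" using ker by simp
next
  assume f: "f \<in> mod_hom R M N" and onto: "f ` carrier M = carrier N"
  show "epi_arrow (LMod R) M N f"
    unfolding epi_arrow_def
  proof (intro conjI ballI impI)
    show "f \<in> Hom (LMod R) M N" using f by simp
    fix K g h assume "K \<in> Obj (LMod R)" and g: "g \<in> Hom (LMod R) N K" and h: "h \<in> Hom (LMod R) N K"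
      and eq: "Comp (LMod R) M N K g f = Comp (LMod R) M N K h f"
    show "g = h"
    proof (rule mod_hom_ext)
      show "g \<in> mod_hom R N K" "h \<in> mod_hom R N K" using g h by auto
      fix y assume "y \<in> carrier N"
      then obtain x where "x \<in> carrier M" "y = f x" using onto by blast
      then show "g y = h y" using fun_cong[OF eq, of x] by (simp add: compose_def)
    qed
  qed
qed

section \<open>Reflections in the projective modules and preserved limits\<close>

context small_ring
begin

text \<open>The ring is projective, so the inclusion of a left ideal into it factors through the
  unit, which is therefore injective. Being also an epimorphism, the unit is an isomorphism from the
  ideal to a projective module.\<close>

lemma epireflective_imp_hereditary:
  assumes "epireflective (LMod R) (projectives R)"
  shows "left_hereditary R"
  unfolding left_hereditary_def
proof (intro allI impI)
  let ?R = "regular_module R"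
  fix I assume I: "submodule I R ?R"
  obtain F \<eta> \<epsilon> where adj: "adjunction (LMod R) (full_subcategory (LMod R) (projectives R)) F id_functor \<eta> \<epsilon>"
    and epi: "\<And>M. M \<in> modules R \<Longrightarrow> epi_arrow (LMod R) M (on_obj F M) (\<eta> M)"
    using assms by (auto simp: epireflective_def)
  note A = adjunctionD[OF adj, simplified]
  let ?I = "?R\<lparr>carrier := I\<rparr>"
  note lR = regular_left_module[OF ring_axioms]
  have MI: "?I \<in> modules R" by (rule submodule_in_modules[OF regular_in_modules I])
  let ?F = "on_obj F ?I" and ?\<eta> = "\<eta> ?I"
  have F: "?F \<in> modules R" "?F \<in> projectives R" using is_functorD(3)[OF A(1), of ?I] MI by auto
  have \<eta>: "?\<eta> \<in> mod_hom R ?I ?F" by (rule A(3)[OF MI])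
  have incl: "(\<lambda>x \<in> I. x) \<in> mod_hom R ?I ?R" by (rule incl_mod_hom[OF lR I])
  have "?R \<in> projectives R"
    using regular_projective regular_in_modules by (simp add: projectives_def)
  then obtain h where "compose (carrier ?I) h ?\<eta> = (\<lambda>x \<in> I. x)"
    using A(4)[OF MI _ incl] regular_in_modules by blast
  then have h: "h (?\<eta> x) = x" if "x \<in> I" for x using that by (auto simp: compose_def fun_eq_iff split: if_splits)
  have "inj_on ?\<eta> (carrier ?I)" using h by (auto intro!: inj_on_inverseI[where g = h])
  moreover have "?\<eta> ` carrier ?I = carrier ?F" using epi[OF MI] epi_arrow_LMod_iff[OF MI F(1)] by blast
  ultimately have iso: "?\<eta> \<in> mod_iso R ?I ?F" using \<eta> by (simp add: mod_iso_def bij_betw_def)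
  obtain \<theta> where \<theta>: "\<theta> \<in> mod_iso R ?F ?I"
    by (rule mod_iso_inverse[OF modulesD(1)[OF MI] modulesD(1)[OF F(1)] iso]) (rule that)
  show "projective R ?I"
    by (rule projective_iso[OF _ modulesD(1)[OF MI] \<theta>]) (use F in \<open>simp add: projectives_def\<close>)
qed

lemma epireflective_imp_reflective:
  "epireflective C S \<Longrightarrow> reflective C S"
  by (auto simp: epireflective_def reflective_def has_left_adjoint_def)

text \<open>Every homomorphism from \<open>M\<close> to the ring factors through the unit and
  vanishes on its kernel, so the unit meets the splitting criterion.\<close>

lemma reflective_imp_R_part_splits:
  assumes her: "left_hereditary R" and refl: "reflective (LMod R) (projectives R)" and M: "M \<in> modules R"
  shows "R_part_splits R M"
proof -
  let ?R = "regular_module R"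
  obtain F \<eta> \<epsilon> where adj: "adjunction (LMod R) (full_subcategory (LMod R) (projectives R)) F id_functor \<eta> \<epsilon>"
    using refl by (auto simp: reflective_def has_left_adjoint_def)
  note A = adjunctionD[OF adj, simplified]
  let ?F = "on_obj F M"
  have F: "?F \<in> modules R" "?F \<in> projectives R" using is_functorD(3)[OF A(1), of M] M by auto
  note F' = projectives_small[OF F(2)]
  have reg: "?R \<in> modules R \<and> ?R \<in> projectives R"
    using regular_projective regular_in_modules by (simp add: projectives_def)
  show ?thesis
  proof (rule R_part_splitsI[OF her M _ _ A(3)[OF M]])
    fix f x assume f: "f \<in> mod_hom R M ?R" and "x \<in> mod_kernel M ?F (\<eta> M)"
    then have x: "x \<in> carrier M" "\<eta> M x = \<zero>\<^bsub>?F\<^esub>" by (auto simp: mod_kernel_def)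
    obtain h where h: "h \<in> mod_hom R ?F ?R" "compose (carrier M) h (\<eta> M) = f"
      using A(4)[OF M reg f] by blast
    interpret h: mod_homs R ?F ?R h
      by (rule mod_homsI[OF _ regular_left_module[OF ring_axioms] h(1)]) (use F' in simp)
    show "f x = \<zero>" using fun_cong[OF h(2), of x] x h.f_zero by (simp add: compose_def)
  qed (use F' in auto)
qed

text \<open>When all projections are stably zero, the identity and the zero endomorphism of
  \<open>M\<close> induce the same cone. Uniqueness of factorisation equates them in the stable
  category, and then \<open>M\<close> is projective.\<close>

lemma stable_limit_projective:
  assumes T: "\<And>i. i \<in> Obj J \<Longrightarrow> on_obj T i \<in> modules R" and M: "M \<in> modules R"
    and p: "\<And>i. i \<in> Obj J \<Longrightarrow> p i \<in> mod_hom R M (on_obj T i)"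
    and zero: "\<And>i. i \<in> Obj J \<Longrightarrow> (p i, (\<lambda>x \<in> carrier M. \<zero>\<^bsub>on_obj T i\<^esub>)) \<in> stable_rel R M (on_obj T i)"
    and lim: "is_limit J (LMod_stable R) (comp_functor (Q_functor R) T) M (\<lambda>i. stable_class R M (on_obj T i) (p i))"
  shows "projective R M"
proof -
  note lM = modulesD(1)[OF M]
  let ?id = "\<lambda>x \<in> carrier M. x" and ?z = "\<lambda>x \<in> carrier M. \<zero>\<^bsub>M\<^esub>"
  have id: "?id \<in> mod_hom R M M" and z: "?z \<in> mod_hom R M M"
    by (rule id_mod_hom[OF lM], rule zero_mod_hom[OF lM lM])
  have cone: "is_cone J (LMod_stable R) (comp_functor (Q_functor R) T) M (\<lambda>i. stable_class R M (on_obj T i) (p i))"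
    using lim by (simp add: is_limit_def)
  then have uniq: "\<exists>!h. h \<in> Hom (LMod_stable R) M M \<and> (\<forall>i \<in> Obj J. Comp (LMod_stable R) M M (on_obj T i)
      (stable_class R M (on_obj T i) (p i)) h = stable_class R M (on_obj T i) (p i))"
    using lim by (simp add: is_limit_def)
  have "Comp (LMod_stable R) M M (on_obj T i) (stable_class R M (on_obj T i) (p i)) (stable_class R M M ?id)
    = stable_class R M (on_obj T i) (p i)" if i: "i \<in> Obj J" for i
    using stable_Comp[OF M M T[OF i] id p[OF i]] category.Comp_Id_right[OF LMod_category, of M R "on_obj T i" "p i"]
      M T[OF i] p[OF i] by simp
  moreover have "Comp (LMod_stable R) M M (on_obj T i) (stable_class R M (on_obj T i) (p i)) (stable_class R M M ?z)
    = stable_class R M (on_obj T i) (p i)" if i: "i \<in> Obj J" for i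
  proof -
    let ?N = "on_obj T i"
    have lN: "left_module R ?N" using T[OF i] by (rule modulesD)
    interpret p: mod_homs R M ?N "p i" by (rule mod_homsI[OF lM lN p[OF i]])
    have "compose (carrier M) (p i) ?z = (\<lambda>x \<in> carrier M. \<zero>\<^bsub>?N\<^esub>)"
      by (auto simp: compose_def)
    then have "Comp (LMod_stable R) M M ?N (stable_class R M ?N (p i)) (stable_class R M M ?z)
      = stable_class R M ?N (\<lambda>x \<in> carrier M. \<zero>\<^bsub>?N\<^esub>)" using stable_Comp[OF M M T[OF i] z p[OF i]] by simp
    also have "\<dots> = stable_class R M ?N (p i)"
      using stable_class_eq_iff[OF M T[OF i] p[OF i] zero_mod_hom[OF lM lN]] zero[OF i] by simp
    finally show ?thesis .
  qed
  ultimately have "stable_class R M M ?id = stable_class R M M ?z"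
    using uniq stable_class_in_Hom[OF id] stable_class_in_Hom[OF z] by blast
  then have "(?id, ?z) \<in> stable_rel R M M" using stable_class_eq_iff[OF M M id z] by simp
  then show ?thesis by (rule stable_zero_projective[OF M])
qed

text \<open>The only arrow from \<open>i\<close> to itself is named \<open>i\<close>, so that
  objects and arrows share one type.\<close>

definition discrete_category :: "'i set \<Rightarrow> ('i, 'i) category" where
  "discrete_category I = \<lparr>Obj = I, Hom = (\<lambda>i j. if i = j then {i} else {}), Id = (\<lambda>i. i),
     Comp = (\<lambda>i j k g f. f)\<rparr>"

text \<open>Objects and arrows use the same two names: \<open>a\<close> is the name of every
  identity, and both names are arrows from \<open>a\<close> to \<open>b\<close>. In every composite
  one factor is an identity, which explains the case distinction.\<close>

definition parallel_category :: "'i \<Rightarrow> 'i \<Rightarrow> ('i, 'i) category" where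
  "parallel_category a b = \<lparr>Obj = {a, b},
     Hom = (\<lambda>i j. if i = j then {a} else if i = a \<and> j = b then {a, b} else {}), Id = (\<lambda>i. a),
     Comp = (\<lambda>i j k g f. if i = j then g else f)\<rparr>"

text \<open>The product is the limit of a discrete diagram, and its projections, having projective
  targets, are stably zero. A copy \<open>D'\<close> with elements in \<open>'v\<close> serves as
  the limit object.\<close>

lemma preserves_limits_imp_products:
  assumes pres: "\<forall>J :: ('v, 'v) category. small_category J \<longrightarrow>
      preserves_limits_of_shape J (LMod R) (LMod_stable R) (Q_functor R)"
    and I: "small I" and M: "\<forall>i \<in> I. M i \<in> projectives R"
  shows "projective R (direct_product (I :: 'v set) M)"
proof -
  let ?D = "direct_product I M" and ?J = "discrete_category I"
  have lM: "left_module R (M i)" and sM: "carrier (M i) \<prec> (UNIV :: 'v set)" and mM: "M i \<in> modules R" if "i \<in> I" for i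
    using M that by (auto simp: projectives_def modules_def small_def)
  have lD: "left_module R ?D" by (rule direct_product_module[OF ring_axioms lM])
  have "carrier ?D \<prec> (UNIV :: 'v set)" using PiE_small[OF _ sM] I by (simp add: small_def)
  then obtain D' :: "('v, 'v) module" and \<theta> where D': "D' \<in> modules R" and \<theta>: "\<theta> \<in> mod_iso R ?D D'"
    using module_copy[OF lD] by blast
  note lD' = modulesD(1)[OF D']
  obtain \<theta>' where \<theta>': "\<theta>' \<in> mod_iso R D' ?D" "\<And>x. x \<in> carrier ?D \<Longrightarrow> \<theta>' (\<theta> x) = x"
    "\<And>y. y \<in> carrier D' \<Longrightarrow> \<theta> (\<theta>' y) = y"
    by (rule mod_iso_inverse[OF lD lD' \<theta>]) (rule that)
  note \<theta>'_hom = mod_isoD(1)[OF \<theta>'(1)]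
  have J: "category ?J" by unfold_locales (auto simp: discrete_category_def split: if_splits)
  have "small (Hom ?J i j)" for i j
    unfolding small_def by (rule finite_small) (simp add: discrete_category_def)
  then have "small_category ?J"
    using J I by (simp add: small_category_def) (simp add: discrete_category_def)
  then have pres_J: "preserves_limits_of_shape ?J (LMod R) (LMod_stable R) (Q_functor R)" using pres by blast
  define T where "T = \<lparr>on_obj = M, on_arr = (\<lambda>i j (u :: 'v). \<lambda>x \<in> carrier (M i). x)\<rparr>"
  have T: "is_functor ?J (LMod R) T"
    unfolding is_functor_def
  proof (intro conjI ballI J LMod_category)
    show "on_obj T i \<in> Obj (LMod R)" if "i \<in> Obj ?J" for i
      using that mM by (simp add: T_def discrete_category_def)
    show "on_arr T i j u \<in> Hom (LMod R) (on_obj T i) (on_obj T j)"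
      if "i \<in> Obj ?J" "j \<in> Obj ?J" "u \<in> Hom ?J i j" for i j u
      using that id_mod_hom[OF lM] by (auto simp: T_def discrete_category_def split: if_splits)
    show "on_arr T i i (Id ?J i) = Id (LMod R) (on_obj T i)" for i by (simp add: T_def)
    show "on_arr T i k (Comp ?J i j k v u) = Comp (LMod R) (on_obj T i) (on_obj T j) (on_obj T k) (on_arr T j k v) (on_arr T i j u)"
      if "u \<in> Hom ?J i j" "v \<in> Hom ?J j k" for i j k u v
      using that by (auto simp: T_def discrete_category_def compose_def split: if_splits)
  qed
  define p where "p i = (\<lambda>y \<in> carrier D'. \<theta>' y i)" for i
  have p: "p i \<in> mod_hom R D' (M i)" if i: "i \<in> I" for i
  proof -
    have "compose (carrier D') (\<lambda>u \<in> carrier ?D. u i) \<theta>' \<in> mod_hom R D' (M i)"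
      by (rule compose_mod_hom[OF lD' \<theta>'_hom direct_product_projection[OF ring_axioms lM i]])
    moreover have "compose (carrier D') (\<lambda>u \<in> carrier ?D. u i) \<theta>' = p i"
      using mod_homD(1)[OF \<theta>'_hom] by (auto simp: compose_def p_def intro!: restrict_ext)
    ultimately show ?thesis by simp
  qed
  have lim: "is_limit ?J (LMod R) T D' p"
    unfolding is_limit_def
  proof (intro conjI allI impI)
    show "is_cone ?J (LMod R) T D' p"
      unfolding is_cone_def
    proof (intro conjI ballI)
      show "D' \<in> Obj (LMod R)" using D' by simp
      show "p i \<in> Hom (LMod R) D' (on_obj T i)" if "i \<in> Obj ?J" for i
        using that p by (simp add: T_def discrete_category_def)
      show "Comp (LMod R) D' (on_obj T i) (on_obj T j) (on_arr T i j u) (p i) = p j"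
        if "i \<in> Obj ?J" "u \<in> Hom ?J i j" for i j u
      proof -
        have ij: "i = j" "i \<in> I" using that by (auto simp: discrete_category_def split: if_splits)
        then show ?thesis using mod_homD(1)[OF p] by (auto simp: T_def compose_def p_def intro!: restrict_ext)
      qed
    qed
    fix Y q assume "is_cone ?J (LMod R) T Y q"
    then have Y: "Y \<in> modules R" and q: "\<And>i. i \<in> I \<Longrightarrow> q i \<in> mod_hom R Y (M i)"
      by (auto simp: is_cone_def T_def discrete_category_def)
    note lY = modulesD(1)[OF Y]
    define k where "k = (\<lambda>y \<in> carrier Y. \<lambda>i \<in> I. q i y)"
    have k: "k \<in> mod_hom R Y ?D"
      unfolding k_def
      by (rule restrict_mod_homI[OF lY])
        (auto simp: mod_homD(1)[OF q] mod_homD(3)[OF q] mod_homD(4)[OF q] intro!: restrict_ext)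
    let ?h = "compose (carrier Y) \<theta> k"
    have h: "?h \<in> mod_hom R Y D'" by (rule compose_mod_hom[OF lY k mod_isoD(1)[OF \<theta>]])
    show "\<exists>!h. h \<in> Hom (LMod R) Y D' \<and> (\<forall>i \<in> Obj ?J. Comp (LMod R) Y D' (on_obj T i) (p i) h = q i)"
    proof (rule ex1I[of _ ?h], intro conjI ballI)
      show "?h \<in> Hom (LMod R) Y D'" using h by simp
      fix i assume "i \<in> Obj ?J"
      then have i: "i \<in> I" by (simp add: discrete_category_def)
      show "Comp (LMod R) Y D' (on_obj T i) (p i) ?h = q i"
      proof (rule mod_hom_ext[OF _ q[OF i]])
        show "Comp (LMod R) Y D' (on_obj T i) (p i) ?h \<in> mod_hom R Y (M i)"
          using compose_mod_hom[OF lY h p[OF i]] by simp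
        fix y assume y: "y \<in> carrier Y"
        have ky: "k y \<in> carrier ?D" by (rule mod_homD(1)[OF k y])
        have "\<theta>' (\<theta> (k y)) i = q i y" using \<theta>'(2)[OF ky] i y by (simp add: k_def)
        then show "Comp (LMod R) Y D' (on_obj T i) (p i) ?h y = q i y"
          using y mod_homD(1)[OF mod_isoD(1)[OF \<theta>] ky] by (simp add: compose_def p_def)
      qed
    next
      fix h' assume h': "h' \<in> Hom (LMod R) Y D' \<and> (\<forall>i \<in> Obj ?J. Comp (LMod R) Y D' (on_obj T i) (p i) h' = q i)"
      then have h'_hom: "h' \<in> mod_hom R Y D'" by simp
      show "h' = ?h"
      proof (rule mod_hom_ext[OF h'_hom h])
        fix y assume y: "y \<in> carrier Y"
        have hy: "h' y \<in> carrier D'" by (rule mod_homD(1)[OF h'_hom y])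
        have "\<theta>' (h' y) = k y"
        proof (rule direct_product_eqI[OF mod_homD(1)[OF \<theta>'_hom hy] mod_homD(1)[OF k y]])
          fix i assume i: "i \<in> I"
          then have "compose (carrier Y) (p i) h' = q i" using h' by (simp add: discrete_category_def)
          from fun_cong[OF this, of y] show "\<theta>' (h' y) i = k y i" using y i hy by (simp add: compose_def p_def k_def)
        qed
        then have "\<theta> (\<theta>' (h' y)) = \<theta> (k y)" by simp
        then show "h' y = ?h y" using \<theta>'(3)[OF hy] y by (simp add: compose_def)
      qed
    qed
  qed
  have "is_limit ?J (LMod_stable R) (comp_functor (Q_functor R) T) (on_obj (Q_functor R) D')
      (\<lambda>i. on_arr (Q_functor R) D' (on_obj T i) (p i))"
    using pres_J T lim unfolding preserves_limits_of_shape_def by blast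
  then have lim': "is_limit ?J (LMod_stable R) (comp_functor (Q_functor R) T) D'
      (\<lambda>i. stable_class R D' (on_obj T i) (p i))" by simp
  have "projective R D'"
    by (rule stable_limit_projective[OF _ D' _ _ lim'])
      (use mM p projective_target_stable_zero[OF D'] M in \<open>auto simp: T_def discrete_category_def\<close>)
  then show ?thesis by (rule projective_iso[OF _ lD \<theta>'(1)])
qed

text \<open>A left ideal is the equalizer of the projection of the ring modulo the ideal and the
  zero map. Both legs of the limit cone are stably zero: the inclusion has a projective target, and
  the other leg is zero.\<close>

lemma preserves_limits_imp_hereditary:
  assumes pres: "\<forall>J :: ('v, 'v) category. small_category J \<longrightarrow>
      preserves_limits_of_shape J (LMod R) (LMod_stable R) (Q_functor R)"
  shows "left_hereditary R"
  unfolding left_hereditary_def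
proof (intro allI impI)
  let ?R = "regular_module R"
  fix I assume I: "submodule I R ?R"
  let ?I = "?R\<lparr>carrier := I\<rparr>"
  note lR = regular_left_module[OF ring_axioms]
  have MI: "?I \<in> modules R" by (rule submodule_in_modules[OF regular_in_modules I])
  note lI = modulesD(1)[OF MI]
  obtain Q q where Q: "Q \<in> modules R" and q: "q \<in> mod_hom R ?R Q" and ker: "mod_kernel ?R Q q = I"
    by (rule quotient_exists[OF regular_in_modules I]) (rule that)
  note lQ = modulesD(1)[OF Q]
  obtain a b :: 'v where ab: "a \<noteq> b"
    using infinite_universe by (metis finite.emptyI finite.insertI finite_subset insertCI subsetI UNIV_I)
  let ?J = "parallel_category a b"
  have J: "category ?J" using ab by unfold_locales (auto simp: parallel_category_def split: if_splits)
  have "small (Hom ?J i j)" for i j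
    unfolding small_def by (rule finite_small) (simp add: parallel_category_def)
  moreover have "small (Obj ?J)"
    unfolding small_def by (rule finite_small) (simp add: parallel_category_def)
  ultimately have "small_category ?J" using J by (simp add: small_category_def)
  then have pres_J: "preserves_limits_of_shape ?J (LMod R) (LMod_stable R) (Q_functor R)" using pres by blast
  define ob where "ob i = (if i = a then ?R else Q)" for i
  \<comment> \<open>The parallel arrow named \<open>a\<close> becomes the quotient map and the one
    named \<open>b\<close> the zero map.\<close>
  define T where "T = \<lparr>on_obj = ob, on_arr = (\<lambda>i j u. if i = j then (\<lambda>x \<in> carrier (ob i). x)
    else if u = a then q else (\<lambda>x \<in> carrier ?R. \<zero>\<^bsub>Q\<^esub>))\<rparr>"
  have ob: "ob i \<in> modules R" for i using Q regular_in_modules by (simp add: ob_def)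
  have z: "(\<lambda>x \<in> carrier ?R. \<zero>\<^bsub>Q\<^esub>) \<in> mod_hom R ?R Q" by (rule zero_mod_hom[OF lR lQ])
  have T_hom: "on_arr T i j u \<in> mod_hom R (ob i) (ob j)" if "u \<in> Hom ?J i j" for i j u
    using that ab q z id_mod_hom[OF modulesD(1)[OF ob]]
    by (auto simp: T_def ob_def parallel_category_def split: if_splits)
  have T: "is_functor ?J (LMod R) T"
    unfolding is_functor_def
  proof (intro conjI ballI J LMod_category)
    show "on_obj T i \<in> Obj (LMod R)" for i using ob by (simp add: T_def)
    show "on_arr T i j u \<in> Hom (LMod R) (on_obj T i) (on_obj T j)" if "u \<in> Hom ?J i j" for i j u
      using T_hom[OF that] by (simp add: T_def)
    show "on_arr T i i (Id ?J i) = Id (LMod R) (on_obj T i)" for i by (simp add: T_def)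
    fix i j k u v assume "i \<in> Obj ?J" "j \<in> Obj ?J" "k \<in> Obj ?J" and u: "u \<in> Hom ?J i j" and v: "v \<in> Hom ?J j k"
    show "on_arr T i k (Comp ?J i j k v u) = Comp (LMod R) (on_obj T i) (on_obj T j) (on_obj T k) (on_arr T j k v) (on_arr T i j u)"
    proof (cases "i = j")
      case True
      then show ?thesis
        using category.Comp_Id_right[OF LMod_category, of "ob j" R "ob k" "on_arr T j k v"] ob T_hom[OF v]
        by (simp add: parallel_category_def) (simp add: T_def)
    next
      case False
      then have "j = k" using u v ab by (auto simp: parallel_category_def split: if_splits)
      then show ?thesis
        using False category.Comp_Id_left[OF LMod_category, of "ob i" R "ob j" "on_arr T i j u"] ob T_hom[OF u]
        by (simp add: parallel_category_def) (simp add: T_def)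
    qed
  qed
  define p where "p i = (if i = a then (\<lambda>x \<in> I. x) else (\<lambda>x \<in> I. \<zero>\<^bsub>Q\<^esub>))" for i
  have p: "p i \<in> mod_hom R ?I (ob i)" for i
    using incl_mod_hom[OF lR I] zero_mod_hom[OF lI lQ] by (simp add: p_def ob_def)
  have qI: "q x = \<zero>\<^bsub>Q\<^esub>" if "x \<in> I" for x using that ker by (auto simp: mod_kernel_def)
  have IR: "x \<in> carrier ?R" if "x \<in> I" for x using that left_module.submoduleD(1)[OF lR I] by auto
  have lim: "is_limit ?J (LMod R) T ?I p"
    unfolding is_limit_def
  proof (intro conjI allI impI)
    show "is_cone ?J (LMod R) T ?I p"
      unfolding is_cone_def
    proof (intro conjI ballI)
      show "?I \<in> Obj (LMod R)" using MI by simp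
      show "p i \<in> Hom (LMod R) ?I (on_obj T i)" for i using p by (simp add: T_def)
      fix i j u assume "i \<in> Obj ?J" "j \<in> Obj ?J" and u: "u \<in> Hom ?J i j"
      show "Comp (LMod R) ?I (on_obj T i) (on_obj T j) (on_arr T i j u) (p i) = p j"
      proof (rule mod_hom_ext[OF _ p])
        show "Comp (LMod R) ?I (on_obj T i) (on_obj T j) (on_arr T i j u) (p i) \<in> mod_hom R ?I (ob j)"
          using compose_mod_hom[OF lI p T_hom[OF u]] by simp
        fix x assume x: "x \<in> carrier ?I"
        have "p i x \<in> carrier (ob i)" by (rule mod_homD(1)[OF p x])
        then show "Comp (LMod R) ?I (on_obj T i) (on_obj T j) (on_arr T i j u) (p i) x = p j x"
          using x u ab qI IR by (auto simp: compose_def T_def p_def parallel_category_def split: if_splits)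
      qed
    qed
    fix Y y assume cone: "is_cone ?J (LMod R) T Y y"
    then have Y: "Y \<in> modules R" and y: "y a \<in> mod_hom R Y ?R" "y b \<in> mod_hom R Y Q"
      using ab by (auto simp: is_cone_def T_def ob_def parallel_category_def)
    note lY = modulesD(1)[OF Y]
    have "compose (carrier Y) (on_arr T a b a) (y a) = y b" "compose (carrier Y) (on_arr T a b b) (y a) = y b"
      using cone ab by (auto simp: is_cone_def parallel_category_def)
    then have q_ya: "compose (carrier Y) q (y a) = y b" and z_ya: "compose (carrier Y) (\<lambda>x \<in> carrier ?R. \<zero>\<^bsub>Q\<^esub>) (y a) = y b"
      using ab by (auto simp: T_def)
    have yb: "y b x = \<zero>\<^bsub>Q\<^esub>" if "x \<in> carrier Y" for x
      using fun_cong[OF z_ya, of x] that mod_homD(1)[OF y(1) that] by (simp add: compose_def)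
    have ya: "y a x \<in> I" if "x \<in> carrier Y" for x
    proof -
      have "q (y a x) = \<zero>\<^bsub>Q\<^esub>" using fun_cong[OF q_ya, of x] that yb by (simp add: compose_def)
      then show ?thesis using ker mod_homD(1)[OF y(1) that] by (auto simp: mod_kernel_def)
    qed
    have h: "y a \<in> mod_hom R Y ?I" by (rule mod_hom_into_submodule[OF y(1) ya])
    show "\<exists>!h. h \<in> Hom (LMod R) Y ?I \<and> (\<forall>i \<in> Obj ?J. Comp (LMod R) Y ?I (on_obj T i) (p i) h = y i)"
    proof (rule ex1I[of _ "y a"], intro conjI ballI)
      show "y a \<in> Hom (LMod R) Y ?I" using h by simp
      fix i assume "i \<in> Obj ?J"
      then consider "i = a" | "i = b" by (auto simp: parallel_category_def)
      then show "Comp (LMod R) Y ?I (on_obj T i) (p i) (y a) = y i"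
      proof cases
        case 1
        have "compose (carrier Y) (p a) (y a) = y a"
          by (rule mod_hom_ext[OF compose_mod_hom[OF lY h p] y(1)]) (use ya in \<open>simp add: compose_def p_def\<close>)
        then show ?thesis using 1 by simp
      next
        case 2
        have "compose (carrier Y) (p b) (y a) = y b"
          by (rule mod_hom_ext[OF compose_mod_hom[OF lY h p] y(2)])
            (use ya yb ab in \<open>simp add: compose_def p_def\<close>)
        then show ?thesis using 2 by simp
      qed
    next
      fix h' assume "h' \<in> Hom (LMod R) Y ?I \<and> (\<forall>i \<in> Obj ?J. Comp (LMod R) Y ?I (on_obj T i) (p i) h' = y i)"
      then have h': "h' \<in> mod_hom R Y ?I" "compose (carrier Y) (p a) h' = y a" by (auto simp: parallel_category_def)
      show "h' = y a"
      proof (rule mod_hom_ext[OF h'(1) h])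
        fix x assume x: "x \<in> carrier Y"
        show "h' x = y a x"
          using fun_cong[OF h'(2), of x] x mod_homD(1)[OF h'(1) x] by (simp add: compose_def p_def)
      qed
    qed
  qed
  have "is_limit ?J (LMod_stable R) (comp_functor (Q_functor R) T) (on_obj (Q_functor R) ?I)
      (\<lambda>i. on_arr (Q_functor R) ?I (on_obj T i) (p i))"
    using pres_J T lim unfolding preserves_limits_of_shape_def by blast
  then have lim': "is_limit ?J (LMod_stable R) (comp_functor (Q_functor R) T) ?I
      (\<lambda>i. stable_class R ?I (on_obj T i) (p i))" by simp
  have "(p i, (\<lambda>x \<in> carrier ?I. \<zero>\<^bsub>ob i\<^esub>)) \<in> stable_rel R ?I (ob i)" for i
  proof (cases "i = a")
    case True
    have "?R \<in> projectives R" using regular_projective regular_in_modules by (simp add: projectives_def)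
    then show ?thesis using projective_target_stable_zero[OF MI, of ?R "p a"] p[of a] True by (simp add: ob_def)
  next
    case False
    then have "p i = (\<lambda>x \<in> carrier ?I. \<zero>\<^bsub>ob i\<^esub>)" by (simp add: p_def ob_def)
    then show ?thesis using equivE[OF stable_rel_equiv[OF MI ob[of i]]] p[of i] by (metis refl_onD)
  qed
  then show "projective R ?I"
    by (intro stable_limit_projective[OF _ MI _ _ lim']) (use ob p in \<open>auto simp: T_def\<close>)
qed

end

section \<open>The stable category over a left hereditary ring\<close>

lemma isomorphic_objects_commute:
  "isomorphic_objects C a b \<Longrightarrow> isomorphic_objects C b a"
  unfolding isomorphic_objects_def iso_arrow_def by blast

context small_ring
begin

lemma LMod_St_simps [simp]:
  "Obj (LMod_St R) = stable_modules R" "Hom (LMod_St R) = mod_hom R"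
  "Id (LMod_St R) M = (\<lambda>x \<in> carrier M. x)" "Comp (LMod_St R) L M N g f = compose (carrier L) g f"
  by (auto simp: LMod_St_def stable_modules_def)

lemma LMod_St_category: "category (LMod_St R)"
  unfolding LMod_St_def by (rule full_subcategory_category[OF LMod_category])

context
  assumes her: "left_hereditary R"
begin

lemma R_incl_mod_hom: "M \<in> modules R \<Longrightarrow> R_incl R M \<in> mod_hom R (R_part R M) M"
  using incl_mod_hom[OF modulesD(1) R_part_carrier_submodule[OF her]]
  by (simp add: R_incl_def R_part_eq[OF her, symmetric])

lemma R_incl_app: "x \<in> carrier (R_part R M) \<Longrightarrow> R_incl R M x = x"
  by (simp add: R_incl_def)

text \<open>The difference factors through a projective module, and homomorphisms to projectives
  vanish on \<open>R(M)\<close>.\<close>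

lemma stable_rel_R_part:
  assumes M: "M \<in> modules R" and N: "N \<in> modules R" and rel: "(f, g) \<in> stable_rel R M N"
    and x: "x \<in> carrier (R_part R M)"
  shows "f x = g x"
proof -
  obtain P u v where *: "g \<in> mod_hom R M N" "P \<in> projectives R" "u \<in> mod_hom R M P" "v \<in> mod_hom R P N"
    "\<And>x. x \<in> carrier M \<Longrightarrow> f x = g x \<oplus>\<^bsub>N\<^esub> v (u x)"
    by (rule stable_relE[OF M N rel]) (rule that)
  note P = projectives_small[OF *(2)]
  interpret v: mod_homs R P N v by (rule mod_homsI[OF _ modulesD(1)[OF N] *(4)]) (use P in simp)
  have xM: "x \<in> carrier M" using x R_part_subset[OF her M] by blast
  have "u x = \<zero>\<^bsub>P\<^esub>" using R_part_hom_zero'[OF her M _ _ *(3) x] P by simp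
  then show ?thesis using *(5)[OF xM] mod_homD(1)[OF *(1) xM] by simp
qed

text \<open>The projection onto \<open>R(M)\<close> along a projective complement differs from the
  identity by the projection onto the complement, which factors through it.\<close>

lemma stable_retraction:
  assumes M: "M \<in> modules R" and splits: "R_part_splits R M"
  obtains \<pi> where "\<pi> \<in> mod_hom R M (R_part R M)" "\<And>x. x \<in> carrier (R_part R M) \<Longrightarrow> \<pi> x = x"
    "((\<lambda>x \<in> carrier M. x), compose (carrier M) (R_incl R M) \<pi>) \<in> stable_rel R M M"
proof -
  let ?K = "carrier (R_part R M)"
  note lM = modulesD(1)[OF M]
  interpret M: left_module R M by (rule lM)
  obtain P where ds: "internal_direct_sum R M ?K P" and P: "projective R (M\<lparr>carrier := P\<rparr>)"
    using splits by (auto simp: R_part_splits_def)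
  note D = internal_direct_sumD[OF ds]
  obtain \<pi> where \<pi>: "\<pi> \<in> mod_hom R M (M\<lparr>carrier := ?K\<rparr>)" "\<And>x. x \<in> ?K \<Longrightarrow> \<pi> x = x"
    "\<And>x. x \<in> carrier M \<Longrightarrow> x \<ominus>\<^bsub>M\<^esub> \<pi> x \<in> P"
    by (rule direct_sum_projection[OF lM internal_direct_sum_commute[OF lM ds]]) (rule that)
  have \<pi>R: "\<pi> \<in> mod_hom R M (R_part R M)" using \<pi>(1) by (simp add: R_part_eq[OF her, symmetric])
  note \<pi>K = mod_homD(1)[OF \<pi>R]
  have \<pi>M: "\<pi> x \<in> carrier M" if "x \<in> carrier M" for x using \<pi>K[OF that] R_part_subset[OF her M] by blast
  have c: "compose (carrier M) (R_incl R M) \<pi> \<in> mod_hom R M M"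
    by (rule compose_mod_hom[OF lM \<pi>R R_incl_mod_hom[OF M]])
  have c_app: "compose (carrier M) (R_incl R M) \<pi> x = \<pi> x" if "x \<in> carrier M" for x
    using that \<pi>K[OF that] by (simp add: compose_def R_incl_app)
  let ?q = "\<lambda>x \<in> carrier M. (\<lambda>x \<in> carrier M. x) x \<ominus>\<^bsub>M\<^esub> compose (carrier M) (R_incl R M) \<pi> x"
  have q: "?q \<in> mod_hom R M (M\<lparr>carrier := P\<rparr>)"
    by (rule mod_hom_into_submodule[OF diff_mod_hom[OF lM lM id_mod_hom[OF lM] c]]) (simp add: c_app \<pi>(3))
  have "((\<lambda>x \<in> carrier M. x), compose (carrier M) (R_incl R M) \<pi>) \<in> stable_rel R M M"
  proof (rule stable_relI[OF M M id_mod_hom[OF lM] c P summand_small[OF modulesD[OF M] D(2)] q incl_mod_hom[OF lM D(2)]])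
    fix x assume x: "x \<in> carrier M"
    have "(x \<ominus>\<^bsub>M\<^esub> \<pi> x) \<oplus>\<^bsub>M\<^esub> \<pi> x = x" by (rule M.diff_add_cancel[OF x \<pi>M[OF x]])
    then show "(\<lambda>x \<in> carrier M. x) x = compose (carrier M) (R_incl R M) \<pi> x \<oplus>\<^bsub>M\<^esub> (\<lambda>x \<in> P. x) (?q x)"
      using x c_app[OF x] \<pi>(3)[OF x] \<pi>M[OF x] M.M.a_comm[of "x \<ominus>\<^bsub>M\<^esub> \<pi> x" "\<pi> x"] by simp
  qed
  then show ?thesis using that \<pi>R \<pi>(2) by blast
qed

text \<open>The inverse is the class of the retraction: it is a strict left inverse of the
  inclusion, and a right inverse up to a map through a projective module.\<close>

lemma R_part_splits_iso:
  assumes M: "M \<in> modules R" and splits: "R_part_splits R M"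
  shows "iso_arrow (LMod_stable R) (R_part R M) M (stable_class R (R_part R M) M (R_incl R M))"
proof -
  let ?N = "R_part R M"
  note N = R_part_modules[OF her M] and lM = modulesD(1)[OF M]
  note lN = modulesD(1)[OF N] and \<iota> = R_incl_mod_hom[OF M]
  obtain \<pi> where \<pi>: "\<pi> \<in> mod_hom R M ?N" "\<And>x. x \<in> carrier ?N \<Longrightarrow> \<pi> x = x"
    "((\<lambda>x \<in> carrier M. x), compose (carrier M) (R_incl R M) \<pi>) \<in> stable_rel R M M"
    by (rule stable_retraction[OF M splits]) (rule that)
  have "compose (carrier ?N) \<pi> (R_incl R M) = (\<lambda>x \<in> carrier ?N. x)"
    by (auto simp: compose_def R_incl_app \<pi>(2) intro!: restrict_ext)
  then have 1: "Comp (LMod_stable R) ?N M ?N (stable_class R M ?N \<pi>) (stable_class R ?N M (R_incl R M)) = Id (LMod_stable R) ?N"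
    using stable_Comp[OF N M N \<iota> \<pi>(1)] by simp
  have "stable_class R M M (compose (carrier M) (R_incl R M) \<pi>) = stable_class R M M (\<lambda>x \<in> carrier M. x)"
    using stable_class_eq_iff[OF M M id_mod_hom[OF lM] compose_mod_hom[OF lM \<pi>(1) \<iota>]] \<pi>(3) by simp
  then have 2: "Comp (LMod_stable R) M ?N M (stable_class R ?N M (R_incl R M)) (stable_class R M ?N \<pi>) = Id (LMod_stable R) M"
    using stable_Comp[OF M N M \<pi>(1) \<iota>] by simp
  show ?thesis
    unfolding iso_arrow_def
    using stable_class_in_Hom[OF \<iota>] stable_class_in_Hom[OF \<pi>(1)] 1 2 by blast
qed

text \<open>The identity of \<open>M\<close> is \<open>g f\<close> plus a map \<open>v u\<close>
  through a projective module. Where \<open>u\<close> vanishes, \<open>x = g (f x)\<close>, and a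
  homomorphism to the ring composed with \<open>g\<close> vanishes on the stable module
  \<open>N\<close>. Hence \<open>u\<close> meets the splitting criterion.\<close>

lemma stable_isomorphic_imp_R_part_splits:
  assumes M: "M \<in> modules R" and N: "N \<in> stable_modules R" and iso: "isomorphic_objects (LMod_stable R) M N"
  shows "R_part_splits R M"
proof -
  have N': "N \<in> modules R" using N by (simp add: stable_modules_def)
  note lM = modulesD(1)[OF M] and lN = modulesD(1)[OF N']
  interpret M: left_module R M by (rule lM)
  obtain f g where f: "f \<in> mod_hom R M N" and g: "g \<in> mod_hom R N M"
    and gf: "Comp (LMod_stable R) M N M (stable_class R N M g) (stable_class R M N f) = Id (LMod_stable R) M"
    using iso unfolding isomorphic_objects_def iso_arrow_def by (metis stable_HomE)
  have "stable_class R M M (\<lambda>x \<in> carrier M. x) = stable_class R M M (compose (carrier M) g f)"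
    using gf stable_Comp[OF M N' M f g] by simp
  then have "((\<lambda>x \<in> carrier M. x), compose (carrier M) g f) \<in> stable_rel R M M"
    using stable_class_eq_iff[OF M M id_mod_hom[OF lM] compose_mod_hom[OF lM f g]] by simp
  then obtain P u v where *: "P \<in> projectives R" "u \<in> mod_hom R M P" "v \<in> mod_hom R P M"
    "\<And>x. x \<in> carrier M \<Longrightarrow> (\<lambda>x \<in> carrier M. x) x = compose (carrier M) g f x \<oplus>\<^bsub>M\<^esub> v (u x)"
    by (rule stable_relE[OF M M]) (rule that)
  note P = projectives_small[OF *(1)]
  interpret v: mod_homs R P M v by (rule mod_homsI[OF _ lM *(3)]) (use P in simp)
  show ?thesis
  proof (rule R_part_splitsI[OF her M _ _ *(2)])
    fix \<phi> x assume \<phi>: "\<phi> \<in> mod_hom R M (regular_module R)" and "x \<in> mod_kernel M P u"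
    then have x: "x \<in> carrier M" "u x = \<zero>\<^bsub>P\<^esub>" by (auto simp: mod_kernel_def)
    have fx: "f x \<in> carrier N" by (rule mod_homD(1)[OF f x(1)])
    have "x = g (f x)" using *(4)[OF x(1)] x mod_homD(1)[OF g fx] by (simp add: compose_def)
    moreover have "compose (carrier N) \<phi> g (f x) = \<zero>\<^bsub>regular_module R\<^esub>"
      by (rule stable_hom_zero[OF her lN modulesD(2)[OF N'] _ regular_projective _ compose_mod_hom[OF lN g \<phi>] fx])
        (use N regular_small in \<open>auto simp: stable_modules_def\<close>)
    ultimately show "\<phi> x = \<zero>" using fx by (simp add: compose_def)
  qed (use P in auto)
qed

text \<open>\<open>R_St\<close> extracts the element of a set of restrictions, so its value on a
  class is meaningful only once all representatives are known to restrict to the same map.\<close>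

lemma R_St_simps:
  "on_obj (R_St R) M = R_part R M"
  "\<lbrakk>M \<in> modules R; N \<in> modules R; f \<in> mod_hom R M N\<rbrakk> \<Longrightarrow>
    on_arr (R_St R) M N (stable_class R M N f) = restrict f (carrier (R_part R M))"
proof -
  show "on_obj (R_St R) M = R_part R M" by (simp add: R_St_def)
  assume M: "M \<in> modules R" and N: "N \<in> modules R" and f: "f \<in> mod_hom R M N"
  have "f \<in> stable_class R M N f"
    unfolding stable_class_def by (rule equiv_class_self[OF stable_rel_equiv[OF M N] f])
  moreover have "restrict g (carrier (R_part R M)) = restrict f (carrier (R_part R M))"
    if g: "g \<in> stable_class R M N f" for g
  proof (rule restrict_ext)
    fix x assume "x \<in> carrier (R_part R M)"
    moreover have "(f, g) \<in> stable_rel R M N" using g by (simp add: stable_class_def)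
    ultimately show "g x = f x" using stable_rel_R_part[OF M N] by metis
  qed
  ultimately have "(\<lambda>g. restrict g (carrier (R_part R M))) ` stable_class R M N f =
    {restrict f (carrier (R_part R M))}" by blast
  then show "on_arr (R_St R) M N (stable_class R M N f) = restrict f (carrier (R_part R M))"
    by (simp add: R_St_def R_functor_def)
qed

lemma R_part_restrict:
  assumes M: "M \<in> modules R" and N: "N \<in> modules R" and f: "f \<in> mod_hom R M N"
  shows "restrict f (carrier (R_part R M)) \<in> mod_hom R (R_part R M) (R_part R N)"
proof -
  have "restrict f (carrier (R_part R M)) \<in> mod_hom R (R_part R M) (N\<lparr>carrier := carrier (R_part R N)\<rparr>)"
    by (rule mod_hom_into_submodule[OF hom_restrict_R_part[OF her M modulesD(1)[OF N] f]])
      (simp add: hom_R_part[OF her M N f])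
  then show ?thesis by (simp add: R_part_eq[OF her, symmetric])
qed

lemma Q_St_functor: "is_functor (LMod_St R) (LMod_stable R) (Q_functor R)"
  unfolding is_functor_def
  using LMod_St_category LMod_stable_category stable_class_in_Hom stable_Comp
  by (simp add: stable_modules_def)

lemma R_St_functor: "is_functor (LMod_stable R) (LMod_St R) (R_St R)"
  unfolding is_functor_def
proof (intro conjI ballI LMod_St_category LMod_stable_category)
  fix L assume "L \<in> Obj (LMod_stable R)"
  then have L: "L \<in> modules R" by simp
  note lL = modulesD(1)[OF L]
  show "on_obj (R_St R) L \<in> Obj (LMod_St R)" using R_part_stable[OF her L] by (simp add: R_St_simps)
  have "restrict (\<lambda>x \<in> carrier L. x) (carrier (R_part R L)) = (\<lambda>x \<in> carrier (R_part R L). x)"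
    using R_part_subset[OF her L] by (auto simp: fun_eq_iff restrict_def)
  then show "on_arr (R_St R) L L (Id (LMod_stable R) L) = Id (LMod_St R) (on_obj (R_St R) L)"
    using R_St_simps(2)[OF L L id_mod_hom[OF lL]] by (simp add: R_St_simps(1))
  fix M assume "M \<in> Obj (LMod_stable R)"
  then have M: "M \<in> modules R" by simp
  show "on_arr (R_St R) L M u \<in> Hom (LMod_St R) (on_obj (R_St R) L) (on_obj (R_St R) M)"
    if u: "u \<in> Hom (LMod_stable R) L M" for u
  proof -
    obtain f where f: "f \<in> mod_hom R L M" "u = stable_class R L M f" using stable_HomE[OF u] by blast
    then show ?thesis using R_part_restrict[OF L M f(1)] R_St_simps(2)[OF L M f(1)] by (simp add: R_St_simps(1))
  qed
  fix N u v assume "N \<in> Obj (LMod_stable R)" and u: "u \<in> Hom (LMod_stable R) L M" and v: "v \<in> Hom (LMod_stable R) M N"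
  then have N: "N \<in> modules R" by simp
  obtain f where f: "f \<in> mod_hom R L M" "u = stable_class R L M f" using stable_HomE[OF u] by blast
  obtain g where g: "g \<in> mod_hom R M N" "v = stable_class R M N g" using stable_HomE[OF v] by blast
  have "restrict (compose (carrier L) g f) (carrier (R_part R L)) =
    compose (carrier (R_part R L)) (restrict g (carrier (R_part R M))) (restrict f (carrier (R_part R L)))"
    using R_part_subset[OF her L] hom_R_part[OF her L M f(1)] by (auto simp: compose_def fun_eq_iff)
  then show "on_arr (R_St R) L N (Comp (LMod_stable R) L M N v u) =
    Comp (LMod_St R) (on_obj (R_St R) L) (on_obj (R_St R) M) (on_obj (R_St R) N) (on_arr (R_St R) M N v) (on_arr (R_St R) L M u)"
    unfolding f(2) g(2) stable_Comp[OF L M N f(1) g(1)]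
    using R_St_simps(2)[OF L N compose_mod_hom[OF lL f(1) g(1)]] R_St_simps(2)[OF L M f(1)] R_St_simps(2)[OF M N g(1)]
    by (simp add: R_St_simps(1))
qed

text \<open>On stable modules \<open>R(M) = M\<close>, so the composite is the identity functor on
  the nose. Both directions are recorded: one equivalence needs the isomorphism as unit, the other
  as counit.\<close>

lemma R_St_Q_identity:
  shows "natural_isomorphism (LMod_St R) (LMod_St R) id_functor (comp_functor (R_St R) (Q_functor R)) (\<lambda>M. \<lambda>x \<in> carrier M. x)"
    and "natural_isomorphism (LMod_St R) (LMod_St R) (comp_functor (R_St R) (Q_functor R)) id_functor (\<lambda>M. \<lambda>x \<in> carrier M. x)"
proof -
  let ?F = "comp_functor (R_St R) (Q_functor R)"
  have F: "is_functor (LMod_St R) (LMod_St R) ?F" by (rule comp_functor_functor[OF Q_St_functor R_St_functor])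
  have obj: "on_obj ?F M = M" if "M \<in> stable_modules R" for M
    using stable_R_part[OF her that] by (simp add: R_St_simps(1))
  have arr: "on_arr ?F M N f = f" if "M \<in> stable_modules R" "N \<in> stable_modules R" "f \<in> mod_hom R M N" for M N f
  proof -
    have MN: "M \<in> modules R" "N \<in> modules R" using that by (auto simp: stable_modules_def)
    have "restrict f (carrier M) = f" using mod_homD(2)[OF that(3)] by (auto simp: fun_eq_iff)
    then show ?thesis using R_St_simps(2)[OF MN that(3)] stable_R_part[OF her that(1)] by simp
  qed
  have iso: "iso_arrow (LMod_St R) M M (\<lambda>x \<in> carrier M. x)" if "M \<in> stable_modules R" for M
  proof -
    have "left_module R M" using that by (simp add: stable_modules_def modules_def)
    then have "(\<lambda>x \<in> carrier M. x) \<in> mod_hom R M M" by (rule id_mod_hom)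
    moreover have "compose (carrier M) (\<lambda>x \<in> carrier M. x) (\<lambda>x \<in> carrier M. x) = (\<lambda>x \<in> carrier M. x)"
      by (auto simp: compose_def)
    ultimately show ?thesis unfolding iso_arrow_def by auto
  qed
  note idl = category.Comp_Id_left[OF LMod_St_category, simplified]
    and idr = category.Comp_Id_right[OF LMod_St_category, simplified]
  show "natural_isomorphism (LMod_St R) (LMod_St R) id_functor ?F (\<lambda>M. \<lambda>x \<in> carrier M. x)"
    unfolding natural_isomorphism_def natural_transformation_def
    using F id_functor_functor[OF LMod_St_category] obj arr iso idl idr
    by (simp add: iso_arrow_def del: comp_functor_simps)
  show "natural_isomorphism (LMod_St R) (LMod_St R) ?F id_functor (\<lambda>M. \<lambda>x \<in> carrier M. x)"
    unfolding natural_isomorphism_def natural_transformation_def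
    using F id_functor_functor[OF LMod_St_category] obj arr iso idl idr
    by (simp add: iso_arrow_def del: comp_functor_simps)
qed

section \<open>Adjoint, equivalences and reflection when every R(M) splits off\<close>

context
  assumes splits: "\<And>M. M \<in> modules R \<Longrightarrow> R_part_splits R M"
begin

text \<open>The map depends on the choice of a complement, but its stable class does not, being
  inverse to the class of the inclusion.\<close>

definition stable_projection :: "('v, 'v) module \<Rightarrow> 'v \<Rightarrow> 'v" where
  "stable_projection M = (SOME \<pi>. \<pi> \<in> mod_hom R M (R_part R M) \<and> (\<forall>x \<in> carrier (R_part R M). \<pi> x = x) \<and>
    ((\<lambda>x \<in> carrier M. x), compose (carrier M) (R_incl R M) \<pi>) \<in> stable_rel R M M)"

lemma stable_projection:
  assumes M: "M \<in> modules R"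
  shows "stable_projection M \<in> mod_hom R M (R_part R M)"
    and "\<And>x. x \<in> carrier (R_part R M) \<Longrightarrow> stable_projection M x = x"
    and "((\<lambda>x \<in> carrier M. x), compose (carrier M) (R_incl R M) (stable_projection M)) \<in> stable_rel R M M"
proof -
  have "\<exists>\<pi>. \<pi> \<in> mod_hom R M (R_part R M) \<and> (\<forall>x \<in> carrier (R_part R M). \<pi> x = x) \<and>
    ((\<lambda>x \<in> carrier M. x), compose (carrier M) (R_incl R M) \<pi>) \<in> stable_rel R M M"
    by (rule stable_retraction[OF M splits[OF M]]) blast
  from someI_ex[OF this]
  show "stable_projection M \<in> mod_hom R M (R_part R M)"
    and "\<And>x. x \<in> carrier (R_part R M) \<Longrightarrow> stable_projection M x = x"
    and "((\<lambda>x \<in> carrier M. x), compose (carrier M) (R_incl R M) (stable_projection M)) \<in> stable_rel R M M"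
    unfolding stable_projection_def by blast+
qed

text \<open>In the stable category the identity of \<open>M\<close> may be replaced by projection
  followed by inclusion, so the class of \<open>f\<close> is determined by the restriction of
  \<open>f\<close> to \<open>R(M)\<close>.\<close>

lemma stable_rel_restriction:
  assumes M: "M \<in> modules R" and N: "N \<in> modules R" and f: "f \<in> mod_hom R M N"
  shows "(f, compose (carrier M) (restrict f (carrier (R_part R M))) (stable_projection M)) \<in> stable_rel R M N"
proof -
  note lM = modulesD(1)[OF M] and \<pi> = stable_projection[OF M]
  have ff: "(f, f) \<in> stable_rel R M N"
    using equivE[OF stable_rel_equiv[OF M N]] f by (metis refl_onD)
  have "(compose (carrier M) f (\<lambda>x \<in> carrier M. x), compose (carrier M) f (compose (carrier M) (R_incl R M) (stable_projection M)))
    \<in> stable_rel R M N" by (rule stable_rel_compose[OF M M N \<pi>(3) ff])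
  moreover have "compose (carrier M) f (\<lambda>x \<in> carrier M. x) = f"
    using category.Comp_Id_right[OF LMod_category, of M R N f] M N f by simp
  moreover have "compose (carrier M) f (compose (carrier M) (R_incl R M) (stable_projection M)) =
    compose (carrier M) (restrict f (carrier (R_part R M))) (stable_projection M)"
    using mod_homD(1)[OF \<pi>(1)] by (auto simp: compose_def R_incl_app intro!: restrict_ext)
  ultimately show ?thesis by simp
qed

text \<open>The chosen projections give the natural isomorphism. For naturality \<open>f\<close> is
  replaced, up to stable equivalence, by its restriction after the projection of \<open>M\<close>;
  the restriction has values in \<open>R(L)\<close>, which the projection of \<open>L\<close>
  fixes.\<close>

lemma R_St_equivalence: "equivalence_of_categories (LMod_stable R) (LMod_St R) (R_St R)"
  unfolding equivalence_of_categories_def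
proof (intro conjI exI)
  show "is_functor (LMod_stable R) (LMod_St R) (R_St R)" by (rule R_St_functor)
  show "is_functor (LMod_St R) (LMod_stable R) (Q_functor R)" by (rule Q_St_functor)
  show "natural_isomorphism (LMod_St R) (LMod_St R) (comp_functor (R_St R) (Q_functor R)) id_functor (\<lambda>M. \<lambda>x \<in> carrier M. x)"
    by (rule R_St_Q_identity)
  show "natural_isomorphism (LMod_stable R) (LMod_stable R) id_functor (comp_functor (Q_functor R) (R_St R))
    (\<lambda>M. stable_class R M (R_part R M) (stable_projection M))"
    unfolding natural_isomorphism_def natural_transformation_def
  proof (intro conjI ballI id_functor_functor[OF LMod_stable_category] comp_functor_functor[OF R_St_functor Q_St_functor])
    fix M assume "M \<in> Obj (LMod_stable R)"
    then have M: "M \<in> modules R" by simp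
    let ?N = "R_part R M"
    note N = R_part_modules[OF her M] and lM = modulesD(1)[OF M] and \<pi> = stable_projection[OF M] and \<iota> = R_incl_mod_hom[OF M]
    have "compose (carrier ?N) (stable_projection M) (R_incl R M) = (\<lambda>x \<in> carrier ?N. x)"
      by (auto simp: compose_def R_incl_app \<pi>(2) intro!: restrict_ext)
    then have 1: "Comp (LMod_stable R) ?N M ?N (stable_class R M ?N (stable_projection M)) (stable_class R ?N M (R_incl R M)) = Id (LMod_stable R) ?N"
      using stable_Comp[OF N M N \<iota> \<pi>(1)] by simp
    have "stable_class R M M (compose (carrier M) (R_incl R M) (stable_projection M)) = stable_class R M M (\<lambda>x \<in> carrier M. x)"
      using stable_class_eq_iff[OF M M id_mod_hom[OF lM] compose_mod_hom[OF lM \<pi>(1) \<iota>]] \<pi>(3) by simp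
    then have 2: "Comp (LMod_stable R) M ?N M (stable_class R ?N M (R_incl R M)) (stable_class R M ?N (stable_projection M)) = Id (LMod_stable R) M"
      using stable_Comp[OF M N M \<pi>(1) \<iota>] by simp
    have iso: "iso_arrow (LMod_stable R) M ?N (stable_class R M ?N (stable_projection M))"
      unfolding iso_arrow_def
      using stable_class_in_Hom[OF \<iota>] stable_class_in_Hom[OF \<pi>(1)] 1 2 by blast
    then show "iso_arrow (LMod_stable R) (on_obj id_functor M) (on_obj (comp_functor (Q_functor R) (R_St R)) M) (stable_class R M (R_part R M) (stable_projection M))"
      by (simp add: R_St_simps(1))
    then show "stable_class R M (R_part R M) (stable_projection M) \<in> Hom (LMod_stable R) (on_obj id_functor M) (on_obj (comp_functor (Q_functor R) (R_St R)) M)"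
      by (simp add: iso_arrow_def)
    fix L u assume "L \<in> Obj (LMod_stable R)" and u: "u \<in> Hom (LMod_stable R) M L"
    then have L: "L \<in> modules R" by simp
    note RL = R_part_modules[OF her L] and \<pi>L = stable_projection[OF L]
    obtain f where f: "f \<in> mod_hom R M L" "u = stable_class R M L f" using stable_HomE[OF u] by blast
    note fr = R_part_restrict[OF M L f(1)]
    have \<pi>\<pi>: "(stable_projection L, stable_projection L) \<in> stable_rel R L (R_part R L)"
      using equivE[OF stable_rel_equiv[OF L RL]] \<pi>L(1) by (metis refl_onD)
    have "(compose (carrier M) (stable_projection L) f, compose (carrier M) (stable_projection L)
        (compose (carrier M) (restrict f (carrier ?N)) (stable_projection M))) \<in> stable_rel R M (R_part R L)"
      by (rule stable_rel_compose[OF M L RL stable_rel_restriction[OF M L f(1)] \<pi>\<pi>])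
    moreover have "compose (carrier M) (stable_projection L) (compose (carrier M) (restrict f (carrier ?N)) (stable_projection M))
      = compose (carrier M) (restrict f (carrier ?N)) (stable_projection M)"
    proof -
      have "stable_projection L (f (stable_projection M x)) = f (stable_projection M x)" if "x \<in> carrier M" for x
        by (rule \<pi>L(2)[OF hom_R_part[OF her M L f(1) mod_homD(1)[OF \<pi>(1) that]]])
      then show ?thesis using mod_homD(1)[OF \<pi>(1)] by (auto simp: compose_def intro!: restrict_ext)
    qed
    ultimately have "stable_class R M (R_part R L) (compose (carrier M) (stable_projection L) f) =
      stable_class R M (R_part R L) (compose (carrier M) (restrict f (carrier ?N)) (stable_projection M))"
      using stable_class_eq_iff[OF M RL compose_mod_hom[OF lM f(1) \<pi>L(1)] compose_mod_hom[OF lM \<pi>(1) fr]] by simp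
    then show "Comp (LMod_stable R) (on_obj id_functor M) (on_obj id_functor L) (on_obj (comp_functor (Q_functor R) (R_St R)) L)
        (stable_class R L (R_part R L) (stable_projection L)) (on_arr id_functor M L u) =
      Comp (LMod_stable R) (on_obj id_functor M) (on_obj (comp_functor (Q_functor R) (R_St R)) M) (on_obj (comp_functor (Q_functor R) (R_St R)) L)
        (on_arr (comp_functor (Q_functor R) (R_St R)) M L u) (stable_class R M (R_part R M) (stable_projection M))"
      using stable_Comp[OF M L RL f(1) \<pi>L(1)] stable_Comp[OF M N RL \<pi>(1) fr] R_St_simps(2)[OF M L f(1)]
      by (simp add: f(2) R_St_simps(1))
  qed
qed

text \<open>Here the inclusions give the natural isomorphism. The naturality square commutes already
  for homomorphisms, since \<open>f\<close> maps \<open>R(M)\<close> into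
  \<open>R(L)\<close>.\<close>

lemma Q_St_equivalence: "equivalence_of_categories (LMod_St R) (LMod_stable R) (Q_functor R)"
  unfolding equivalence_of_categories_def
proof (intro conjI exI)
  show "is_functor (LMod_stable R) (LMod_St R) (R_St R)" by (rule R_St_functor)
  show "is_functor (LMod_St R) (LMod_stable R) (Q_functor R)" by (rule Q_St_functor)
  show "natural_isomorphism (LMod_St R) (LMod_St R) id_functor (comp_functor (R_St R) (Q_functor R)) (\<lambda>M. \<lambda>x \<in> carrier M. x)"
    by (rule R_St_Q_identity)
  show "natural_isomorphism (LMod_stable R) (LMod_stable R) (comp_functor (Q_functor R) (R_St R)) id_functor
    (\<lambda>M. stable_class R (R_part R M) M (R_incl R M))"
    unfolding natural_isomorphism_def natural_transformation_def
  proof (intro conjI ballI id_functor_functor[OF LMod_stable_category] comp_functor_functor[OF R_St_functor Q_St_functor])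
    fix M assume "M \<in> Obj (LMod_stable R)"
    then have M: "M \<in> modules R" by simp
    show "iso_arrow (LMod_stable R) (on_obj (comp_functor (Q_functor R) (R_St R)) M) (on_obj id_functor M) (stable_class R (R_part R M) M (R_incl R M))"
      using R_part_splits_iso[OF M splits[OF M]] by (simp add: R_St_simps(1))
    then show "stable_class R (R_part R M) M (R_incl R M) \<in> Hom (LMod_stable R) (on_obj (comp_functor (Q_functor R) (R_St R)) M) (on_obj id_functor M)"
      by (simp add: iso_arrow_def)
    fix L u assume "L \<in> Obj (LMod_stable R)" and u: "u \<in> Hom (LMod_stable R) M L"
    then have L: "L \<in> modules R" by simp
    note RM = R_part_modules[OF her M] and RL = R_part_modules[OF her L]
    obtain f where f: "f \<in> mod_hom R M L" "u = stable_class R M L f" using stable_HomE[OF u] by blast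
    note fr = R_part_restrict[OF M L f(1)]
    have "compose (carrier (R_part R M)) (R_incl R L) (restrict f (carrier (R_part R M))) =
      compose (carrier (R_part R M)) f (R_incl R M)"
      using hom_R_part[OF her M L f(1)] by (auto simp: compose_def R_incl_app intro!: restrict_ext)
    then show "Comp (LMod_stable R) (on_obj (comp_functor (Q_functor R) (R_St R)) M) (on_obj (comp_functor (Q_functor R) (R_St R)) L) (on_obj id_functor L)
        (stable_class R (R_part R L) L (R_incl R L)) (on_arr (comp_functor (Q_functor R) (R_St R)) M L u) =
      Comp (LMod_stable R) (on_obj (comp_functor (Q_functor R) (R_St R)) M) (on_obj id_functor M) (on_obj id_functor L)
        (on_arr id_functor M L u) (stable_class R (R_part R M) M (R_incl R M))"
      using stable_Comp[OF RM RL L fr R_incl_mod_hom[OF L]] stable_Comp[OF RM M L R_incl_mod_hom[OF M] f(1)]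
        R_St_simps(2)[OF M L f(1)]
      by (simp add: f(2) R_St_simps(1))
  qed
qed

text \<open>The universal arrow from \<open>M\<close> is the class of the projection onto
  \<open>R(M)\<close>, and a class represented by \<open>f\<close> factors through the restriction
  of \<open>f\<close>. The factorisation is unique as a homomorphism and not merely stably, because
  equivalent maps agree on \<open>R(M)\<close>, where the projection is the identity.\<close>

lemma Q_has_left_adjoint: "has_left_adjoint (LMod R) (LMod_stable R) (Q_functor R)"
proof -
  let ?\<eta> = "\<lambda>M. stable_class R M (R_part R M) (stable_projection M)"
  obtain F \<epsilon> where "adjunction (LMod_stable R) (LMod R) F (Q_functor R) ?\<eta> \<epsilon>"
  proof (rule universal_arrows_adjunction[OF Q_functor_functor, where r = "R_part R" and \<eta> = ?\<eta>])
    fix M assume "M \<in> Obj (LMod_stable R)"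
    then have M: "M \<in> modules R" by simp
    note RM = R_part_modules[OF her M] and \<pi> = stable_projection[OF M] and lM = modulesD(1)[OF M]
    show "R_part R M \<in> Obj (LMod R)" using RM by simp
    show "?\<eta> M \<in> Hom (LMod_stable R) M (on_obj (Q_functor R) (R_part R M))"
      using stable_class_in_Hom[OF \<pi>(1)] by simp
    fix N u assume "N \<in> Obj (LMod R)" and u: "u \<in> Hom (LMod_stable R) M (on_obj (Q_functor R) N)"
    then have N: "N \<in> modules R" by simp
    obtain f where f: "f \<in> mod_hom R M N" "u = stable_class R M N f" using stable_HomE[of u M N] u by auto
    let ?r = "restrict f (carrier (R_part R M))"
    have r: "?r \<in> mod_hom R (R_part R M) N" by (rule hom_restrict_R_part[OF her M modulesD(1)[OF N] f(1)])
    have Comp: "Comp (LMod_stable R) M (R_part R M) N (stable_class R (R_part R M) N h) (?\<eta> M) =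
      stable_class R M N (compose (carrier M) h (stable_projection M))" if "h \<in> mod_hom R (R_part R M) N" for h
      by (rule stable_Comp[OF M RM N \<pi>(1) that])
    show "\<exists>!h. h \<in> Hom (LMod R) (R_part R M) N \<and>
      Comp (LMod_stable R) M (on_obj (Q_functor R) (R_part R M)) (on_obj (Q_functor R) N)
        (on_arr (Q_functor R) (R_part R M) N h) (?\<eta> M) = u"
    proof (rule ex1I[of _ ?r])
      show "?r \<in> Hom (LMod R) (R_part R M) N \<and>
        Comp (LMod_stable R) M (on_obj (Q_functor R) (R_part R M)) (on_obj (Q_functor R) N)
          (on_arr (Q_functor R) (R_part R M) N ?r) (?\<eta> M) = u"
        using r Comp[OF r] stable_rel_restriction[OF M N f(1)] f(2)
          stable_class_eq_iff[OF M N f(1) compose_mod_hom[OF lM \<pi>(1) r]] by simp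
      fix h assume "h \<in> Hom (LMod R) (R_part R M) N \<and>
        Comp (LMod_stable R) M (on_obj (Q_functor R) (R_part R M)) (on_obj (Q_functor R) N)
          (on_arr (Q_functor R) (R_part R M) N h) (?\<eta> M) = u"
      then have h: "h \<in> mod_hom R (R_part R M) N"
        and "stable_class R M N (compose (carrier M) h (stable_projection M)) = stable_class R M N f"
        using Comp f(2) by auto
      then have rel: "(compose (carrier M) h (stable_projection M), f) \<in> stable_rel R M N"
        using stable_class_eq_iff[OF M N compose_mod_hom[OF lM \<pi>(1) h] f(1)] by simp
      show "h = ?r"
      proof (rule mod_hom_ext[OF h r])
        fix x assume x: "x \<in> carrier (R_part R M)"
        then have "x \<in> carrier M" using R_part_subset[OF her M] by blast
        then show "h x = ?r x" using stable_rel_R_part[OF M N rel x] x \<pi>(2)[OF x] by (simp add: compose_def)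
      qed
    qed
  qed (rule that)
  then show ?thesis unfolding has_left_adjoint_def by blast
qed

text \<open>A homomorphism from \<open>M\<close> to a projective module kills \<open>R(M)\<close>,
  so it is determined by its values on the complement and factors uniquely through the projection
  along \<open>R(M)\<close>. This projection is onto.\<close>

lemma projectives_epireflective: "epireflective (LMod R) (projectives R)"
proof -
  \<comment> \<open>Complement and projection are chosen together, so that the objects of the
    reflection and its unit belong to the same decomposition of \<open>M\<close>.\<close>
  define T where "T M p \<longleftrightarrow> (case p of (P, \<pi>) \<Rightarrow>
    internal_direct_sum R M (carrier (R_part R M)) P \<and> projective R (M\<lparr>carrier := P\<rparr>) \<and>
    \<pi> \<in> mod_hom R M (M\<lparr>carrier := P\<rparr>) \<and> (\<forall>x \<in> P. \<pi> x = x) \<and>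
    (\<forall>x \<in> carrier M. \<pi> x = \<zero>\<^bsub>M\<^esub> \<longleftrightarrow> x \<in> carrier (R_part R M)))" for M p
  have "\<exists>p. T M p" if M: "M \<in> modules R" for M
  proof -
    obtain P where P: "internal_direct_sum R M (carrier (R_part R M)) P" "projective R (M\<lparr>carrier := P\<rparr>)"
      using splits[OF M] by (auto simp: R_part_splits_def)
    obtain \<pi> where "\<pi> \<in> mod_hom R M (M\<lparr>carrier := P\<rparr>)" "\<And>x. x \<in> P \<Longrightarrow> \<pi> x = x"
      "\<And>x. x \<in> carrier M \<Longrightarrow> \<pi> x = \<zero>\<^bsub>M\<^esub> \<longleftrightarrow> x \<in> carrier (R_part R M)"
      by (rule direct_sum_projection[OF modulesD(1)[OF M] P(1)]) (rule that)
    then have "T M (P, \<pi>)" using P by (simp add: T_def)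
    then show ?thesis by blast
  qed
  then have "T M (SOME p. T M p)" if "M \<in> modules R" for M using that by (simp add: someI_ex)
  moreover define P \<pi> where "P M = fst (SOME p. T M p)" and "\<pi> M = snd (SOME p. T M p)" for M
  ultimately have "T M (P M, \<pi> M)" if "M \<in> modules R" for M using that by simp
  then have ds: "\<And>M. M \<in> modules R \<Longrightarrow> internal_direct_sum R M (carrier (R_part R M)) (P M)"
    and P: "\<And>M. M \<in> modules R \<Longrightarrow> projective R (M\<lparr>carrier := P M\<rparr>)"
    and \<pi>: "\<And>M. M \<in> modules R \<Longrightarrow> \<pi> M \<in> mod_hom R M (M\<lparr>carrier := P M\<rparr>)"
    and \<pi>_id: "\<And>M x. \<lbrakk>M \<in> modules R; x \<in> P M\<rbrakk> \<Longrightarrow> \<pi> M x = x"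
    and \<pi>_ker: "\<And>M x. \<lbrakk>M \<in> modules R; x \<in> carrier M\<rbrakk> \<Longrightarrow> \<pi> M x = \<zero>\<^bsub>M\<^esub> \<longleftrightarrow> x \<in> carrier (R_part R M)"
    unfolding T_def by blast+
  let ?r = "\<lambda>M. M\<lparr>carrier := P M\<rparr>"
  have sub: "submodule (P M) R M" if "M \<in> modules R" for M by (rule internal_direct_sumD(2)[OF ds[OF that]])
  have rM: "?r M \<in> modules R" if "M \<in> modules R" for M by (rule submodule_in_modules[OF that sub[OF that]])
  have PM: "x \<in> carrier M" if "M \<in> modules R" "x \<in> P M" for M x
    using left_module.submoduleD(1)[OF modulesD(1)[OF that(1)] sub[OF that(1)]] that(2) by blast
  obtain F \<epsilon> where F: "on_obj F = ?r"
    and adj: "adjunction (LMod R) (full_subcategory (LMod R) (projectives R)) F id_functor \<pi> \<epsilon>"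
  proof (rule universal_arrows_adjunction[OF inclusion_functor[OF LMod_category], where r = ?r and \<eta> = \<pi>])
    fix M assume "M \<in> Obj (LMod R)"
    then have M: "M \<in> modules R" by simp
    note lM = modulesD(1)[OF M]
    interpret M: left_module R M by (rule lM)
    show "?r M \<in> Obj (full_subcategory (LMod R) (projectives R))"
      using rM[OF M] P[OF M] by (simp add: projectives_def)
    show "\<pi> M \<in> Hom (LMod R) M (on_obj id_functor (?r M))" using \<pi>[OF M] by simp
    fix N f assume "N \<in> Obj (full_subcategory (LMod R) (projectives R))" and "f \<in> Hom (LMod R) M (on_obj id_functor N)"
    then have N: "N \<in> projectives R" and f: "f \<in> mod_hom R M N" by auto
    note N' = projectives_small[OF N]
    interpret f: mod_homs R M N f by (rule mod_homsI[OF lM _ f]) (use N' in simp)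
    have f\<pi>: "f (\<pi> M x) = f x" if x: "x \<in> carrier M" for x
    proof -
      have \<pi>x: "\<pi> M x \<in> P M" using mod_homD(1)[OF \<pi>[OF M] x] by simp
      interpret \<pi>: mod_homs R M "?r M" "\<pi> M" by (rule mod_homsI[OF lM modulesD(1)[OF rM[OF M]] \<pi>[OF M]])
      have "\<pi> M (x \<ominus>\<^bsub>M\<^esub> \<pi> M x) = \<pi> M x \<ominus>\<^bsub>?r M\<^esub> \<pi> M x"
        using \<pi>.f_diff[OF x PM[OF M \<pi>x]] \<pi>_id[OF M \<pi>x] by simp
      also have "\<dots> = \<zero>\<^bsub>?r M\<^esub>"
        using \<pi>.N.diff_eq_zero_iff[OF \<pi>.f_closed[OF x] \<pi>.f_closed[OF x]] by blast
      finally have "x \<ominus>\<^bsub>M\<^esub> \<pi> M x \<in> carrier (R_part R M)"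
        using \<pi>_ker[OF M, of "x \<ominus>\<^bsub>M\<^esub> \<pi> M x"] x PM[OF M \<pi>x] by simp
      then have "f (x \<ominus>\<^bsub>M\<^esub> \<pi> M x) = \<zero>\<^bsub>N\<^esub>" using R_part_hom_zero'[OF her M _ _ f] N' by simp
      then show ?thesis using x PM[OF M \<pi>x] by (simp add: f.f_diff f.N.diff_eq_zero_iff)
    qed
    have r: "restrict f (P M) \<in> mod_hom R (?r M) N" by (rule f.restrict_mod_hom[OF sub[OF M]])
    show "\<exists>!h. h \<in> Hom (full_subcategory (LMod R) (projectives R)) (?r M) N \<and>
      Comp (LMod R) M (on_obj id_functor (?r M)) (on_obj id_functor N) (on_arr id_functor (?r M) N h) (\<pi> M) = f"
    proof (rule ex1I[of _ "restrict f (P M)"])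
      have "compose (carrier M) (restrict f (P M)) (\<pi> M) = f"
        by (rule mod_hom_ext[OF compose_mod_hom[OF lM \<pi>[OF M] r] f])
          (use mod_homD(1)[OF \<pi>[OF M]] f\<pi> in \<open>auto simp: compose_def\<close>)
      then show "restrict f (P M) \<in> Hom (full_subcategory (LMod R) (projectives R)) (?r M) N \<and>
        Comp (LMod R) M (on_obj id_functor (?r M)) (on_obj id_functor N) (on_arr id_functor (?r M) N (restrict f (P M))) (\<pi> M) = f"
        using r by simp
      fix h assume "h \<in> Hom (full_subcategory (LMod R) (projectives R)) (?r M) N \<and>
        Comp (LMod R) M (on_obj id_functor (?r M)) (on_obj id_functor N) (on_arr id_functor (?r M) N h) (\<pi> M) = f"
      then have h: "h \<in> mod_hom R (?r M) N" "compose (carrier M) h (\<pi> M) = f" by auto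
      show "h = restrict f (P M)"
      proof (rule mod_hom_ext[OF h(1) r])
        fix x assume "x \<in> carrier (?r M)"
        then have x: "x \<in> P M" by simp
        then show "h x = restrict f (P M) x"
          using fun_cong[OF h(2), of x] PM[OF M x] \<pi>_id[OF M x] by (simp add: compose_def)
      qed
    qed
  qed (rule that)
  have "epi_arrow (LMod R) M (on_obj F M) (\<pi> M)" if "M \<in> Obj (LMod R)" for M
  proof -
    have M: "M \<in> modules R" using that by simp
    have "\<pi> M ` carrier M = P M"
    proof
      show "\<pi> M ` carrier M \<subseteq> P M" using mod_homD(1)[OF \<pi>[OF M]] by auto
      show "P M \<subseteq> \<pi> M ` carrier M"
        using \<pi>_id[OF M] PM[OF M] by (metis imageI subsetI)
    qed
    then show ?thesis using epi_arrow_LMod_iff[OF M rM[OF M]] \<pi>[OF M] F by simp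
  qed
  then show ?thesis unfolding epireflective_def using adj by blast
qed

end

end

end

section \<open>Assembling the equivalences\<close>

lemma all_equivalentI:
  assumes "list_all (\<lambda>p. p \<longleftrightarrow> q) ps"
  shows "all_equivalent ps"
  using assms by (auto simp: all_equivalent_def list_all_iff)

text \<open>Essential surjectivity: the counit at \<open>M\<close> is an isomorphism whose source is
  a stable module.\<close>

lemma (in small_ring) Q_St_equivalence_imp_stable_isomorphic:
  assumes "equivalence_of_categories (LMod_St R) (LMod_stable R) (Q_functor R)" and M: "M \<in> modules R"
  obtains N where "N \<in> stable_modules R" "isomorphic_objects (LMod_stable R) M N"
proof -
  obtain G \<epsilon> where G: "is_functor (LMod_stable R) (LMod_St R) G"
    and \<epsilon>: "natural_isomorphism (LMod_stable R) (LMod_stable R) (comp_functor (Q_functor R) G) id_functor \<epsilon>"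
    using assms(1) by (auto simp: equivalence_of_categories_def)
  have "on_obj G M \<in> stable_modules R" using G M by (simp add: is_functor_def)
  moreover have "iso_arrow (LMod_stable R) (on_obj G M) M (\<epsilon> M)"
    using \<epsilon> M by (simp add: natural_isomorphism_def comp_functor_def id_functor_def Q_functor_def)
  ultimately show ?thesis using that isomorphic_objects_commute unfolding isomorphic_objects_def by metis
qed

theorem theorem5p2:
  fixes \<Lambda> :: "'v ring"
  assumes "strongly_inaccessible TYPE('v)"
    and "ring \<Lambda>" and "small (carrier \<Lambda>)"
  shows "all_equivalent
   [\<comment> \<open>(i)\<close>
    left_hereditary \<Lambda> \<and> left_perfect \<Lambda> \<and> right_coherent \<Lambda>,
    \<comment> \<open>(ii)\<close>
    left_hereditary \<Lambda> \<and>
      (\<forall>(I :: 'v set) (M :: 'v \<Rightarrow> ('v, 'v) module).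
         small I \<and> (\<forall>i \<in> I. M i \<in> projectives \<Lambda>) \<longrightarrow> projective \<Lambda> (direct_product I M)),
    \<comment> \<open>(iii)\<close>
    \<forall>J :: ('v, 'v) category. small_category J \<longrightarrow>
      preserves_limits_of_shape J (LMod \<Lambda>) (LMod_stable \<Lambda>) (Q_functor \<Lambda>),
    \<comment> \<open>(iv)\<close>
    has_left_adjoint (LMod \<Lambda>) (LMod_stable \<Lambda>) (Q_functor \<Lambda>),
    \<comment> \<open>(v)\<close>
    epireflective (LMod \<Lambda>) (projectives \<Lambda>),
    \<comment> \<open>(vi)\<close>
    left_hereditary \<Lambda> \<and> reflective (LMod \<Lambda>) (projectives \<Lambda>),
    \<comment> \<open>(vii)\<close>
    left_hereditary \<Lambda> \<and>
      (\<forall>M \<in> modules \<Lambda>. \<exists>K P. internal_direct_sum \<Lambda> M K P \<and> projective \<Lambda> (M\<lparr>carrier := P\<rparr>) \<and>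
         (\<forall>K' P'. internal_direct_sum \<Lambda> M K' P' \<and> projective \<Lambda> (M\<lparr>carrier := P'\<rparr>) \<longrightarrow>
            K \<subseteq> K' \<and>
            (\<exists>P''. submodule P'' \<Lambda> (M\<lparr>carrier := P\<rparr>) \<and> projective \<Lambda> (M\<lparr>carrier := P''\<rparr>) \<and>
               (\<exists>P1. mod_iso \<Lambda> (M\<lparr>carrier := P'\<rparr>) (M\<lparr>carrier := P1\<rparr>) \<noteq> {} \<and>
                  internal_direct_sum \<Lambda> (M\<lparr>carrier := P\<rparr>) P1 P'') \<and>
               internal_direct_sum \<Lambda> (M\<lparr>carrier := K'\<rparr>) K P''))),
    \<comment> \<open>(viii)\<close>
    left_hereditary \<Lambda> \<and>
      (\<forall>M \<in> modules \<Lambda>. \<exists>K P. internal_direct_sum \<Lambda> M K P \<and> projective \<Lambda> (M\<lparr>carrier := P\<rparr>) \<and>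
         (\<forall>K' P'. internal_direct_sum \<Lambda> M K' P' \<and> projective \<Lambda> (M\<lparr>carrier := P'\<rparr>) \<longrightarrow> K \<subseteq> K')),
    \<comment> \<open>(ix)\<close>
    left_hereditary \<Lambda> \<and>
      (\<forall>M \<in> modules \<Lambda>. \<exists>N \<in> stable_modules \<Lambda>. isomorphic_objects (LMod_stable \<Lambda>) M N),
    \<comment> \<open>(x)\<close>
    left_hereditary \<Lambda> \<and>
      equivalence_of_categories (LMod_stable \<Lambda>) (LMod_St \<Lambda>) (R_St \<Lambda>) \<and>
      equivalence_of_categories (LMod_St \<Lambda>) (LMod_stable \<Lambda>) (Q_functor \<Lambda>),
    \<comment> \<open>(xi)\<close>
    left_hereditary \<Lambda> \<and>
      (\<forall>M \<in> modules \<Lambda>. iso_arrow (LMod_stable \<Lambda>) (R_part \<Lambda> M) M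
         (stable_class \<Lambda> (R_part \<Lambda> M) M (R_incl \<Lambda> M))),
    \<comment> \<open>(xii)\<close>
    left_hereditary \<Lambda> \<and>
      (\<forall>M \<in> modules \<Lambda>. \<exists>N P. internal_direct_sum \<Lambda> M N P \<and>
         projective \<Lambda> (M\<lparr>carrier := P\<rparr>) \<and> submodule N \<Lambda> (R_part \<Lambda> M)),
    \<comment> \<open>(xiii)\<close>
    left_hereditary \<Lambda> \<and>
      (\<forall>M \<in> modules \<Lambda>. \<exists>P \<in> projectives \<Lambda>. \<exists>P' \<in> projectives \<Lambda>.
         \<exists>\<delta> \<in> mod_iso \<Lambda> (direct_sum (R_part \<Lambda> M) P) (direct_sum M P').
           \<forall>x \<in> carrier (R_part \<Lambda> M). R_incl \<Lambda> M x = fst (\<delta> (x, \<zero>\<^bsub>P\<^esub>)))]"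
    (is "all_equivalent [?i, ?ii, ?iii, ?iv, ?v, ?vi, ?vii, ?viii, ?ix, ?x, ?xi, ?xii, ?xiii]")
proof (rule all_equivalentI)
  interpret small_ring "TYPE('v)" \<Lambda>
    using assms by (simp add: small_ring_def small_ring_axioms_def universe_def)
  \<comment> \<open>The meeting point of the implications. The way from it to (ii), and from there
    to (i), leads through the left adjoint of \<open>Q\<close> and preservation of limits.\<close>
  let ?S = "left_hereditary \<Lambda> \<and> (\<forall>M \<in> modules \<Lambda>. R_part_splits \<Lambda> M)"
  have ii_i: "?ii \<Longrightarrow> ?i"
    using products_imp_dcc hereditary_dcc_imp_left_perfect products_imp_right_coherent by blast
  have i_ii: "?i \<Longrightarrow> ?ii"
    using perfect_coherent_imp_product_projective unfolding small_def by blast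
  have ii_S: "?ii \<Longrightarrow> ?S"
    using products_imp_R_part_splits by blast
  have S_iv: "?S \<Longrightarrow> ?iv"
    using Q_has_left_adjoint by blast
  have iv_iii: "?iv \<Longrightarrow> ?iii"
    using right_adjoint_preserves_limits by blast
  have iii_ii: "?iii \<Longrightarrow> ?ii"
    using preserves_limits_imp_hereditary preserves_limits_imp_products by blast
  have S_v: "?S \<Longrightarrow> ?v"
    using projectives_epireflective by blast
  have v_vi: "?v \<Longrightarrow> ?vi"
    using epireflective_imp_hereditary epireflective_imp_reflective by blast
  have vi_S: "?vi \<Longrightarrow> ?S"
    using reflective_imp_R_part_splits by blast
  have S_vii: "?S \<Longrightarrow> ?vii"
    using R_part_splits_imp_vii by blast
  have vii_viii: "?vii \<Longrightarrow> ?viii"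
    by (elim conjE, intro conjI) (assumption, meson)
  have viii_S: "?viii \<Longrightarrow> ?S"
    using R_part_splits_iff_viii by blast
  have S_xi: "?S \<Longrightarrow> ?xi"
    using R_part_splits_iso by blast
  have xi_ix: "?xi \<Longrightarrow> ?ix"
    using R_part_stable isomorphic_objects_commute unfolding isomorphic_objects_def by metis
  have ix_S: "?ix \<Longrightarrow> ?S"
    using stable_isomorphic_imp_R_part_splits by blast
  have S_x: "?S \<Longrightarrow> ?x"
    using R_St_equivalence Q_St_equivalence by blast
  have x_ix: "?x \<Longrightarrow> ?ix"
    using Q_St_equivalence_imp_stable_isomorphic by metis
  have i: "?i \<longleftrightarrow> ?S" by (rule iffI[OF ii_S[OF i_ii] ii_i[OF iii_ii[OF iv_iii[OF S_iv]]]])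
  have ii: "?ii \<longleftrightarrow> ?S" by (rule iffI[OF ii_S iii_ii[OF iv_iii[OF S_iv]]])
  have iii: "?iii \<longleftrightarrow> ?S" by (rule iffI[OF ii_S[OF iii_ii] iv_iii[OF S_iv]])
  have iv: "?iv \<longleftrightarrow> ?S" by (rule iffI[OF ii_S[OF iii_ii[OF iv_iii]] S_iv])
  have v: "?v \<longleftrightarrow> ?S" by (rule iffI[OF vi_S[OF v_vi] S_v])
  have vi: "?vi \<longleftrightarrow> ?S" by (rule iffI[OF vi_S v_vi[OF S_v]])
  have vii: "?vii \<longleftrightarrow> ?S" by (rule iffI[OF viii_S[OF vii_viii] S_vii])
  have viii: "?viii \<longleftrightarrow> ?S" by (rule iffI[OF viii_S vii_viii[OF S_vii]])
  have ix: "?ix \<longleftrightarrow> ?S" by (rule iffI[OF ix_S xi_ix[OF S_xi]])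
  have x: "?x \<longleftrightarrow> ?S" by (rule iffI[OF ix_S[OF x_ix] S_x])
  have xi: "?xi \<longleftrightarrow> ?S" by (rule iffI[OF ix_S[OF xi_ix] S_xi])
  have xii: "?xii \<longleftrightarrow> ?S" using R_part_splits_iff_xii by blast
  have xiii: "?xiii \<longleftrightarrow> ?S" using R_part_splits_iff_xiii by blast
  show "list_all (\<lambda>p. p \<longleftrightarrow> ?S) [?i, ?ii, ?iii, ?iv, ?v, ?vi, ?vii, ?viii, ?ix, ?x, ?xi, ?xii, ?xiii]"
    unfolding list.pred_inject(2) by (intro conjI list.pred_inject(1) i ii iii iv v vi vii viii ix x xi xii xiii)
qed

end
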